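(* Let $2<p<\infty$ and $k\ge 1$. Let $\Gamma_{\mathrm{ext}}=\Gamma\cup\Gamma'$, where $\Gamma$ and $\Gamma_{\mathrm{ext}}$ are complete contours in $\mathbb C$, $\Gamma_{\mathrm{ext}}$ carries one of its natural orientations and $\Gamma$ the induced one (again a natural orientation of the complete contour $\Gamma$), and $\operatorname{dist}(\Gamma,\Gamma')>0$. Let $R$ and $R^{-1}$ be analytic and bounded $k\times k$ matrix-valued functions in $\mathbb C\setminus\Gamma_{\mathrm{ext}}$, with non-tangential boundary values $R_\pm, R_\pm^{-1}$ on $\Gamma_{\mathrm{ext}}$ from $\Omega_\pm$ (where $\mathbb C\setminus\Gamma_{\mathrm{ext}}=\Omega_+\sqcup\Omega_-$). Let $v,\breve v:\Gamma\to GL(k,\mathbb C)$ be jump matrices related by $$v=R_-^{-1}\,\breve v\,R_+\quad\text{on }\Gamma ,$$ and assume $v-I,\ \breve v-I\in L^2(\Gamma)$. Suppose that $(1-C_{\breve v})^{-1}$ exists in $L^2(\Gamma)$ and also in $L^p(\Gamma)$, and that $(1-C_v)^{-1}$ exists in $L^2(\Gamma)$. Then $(1-C_v)^{-1}$ exists in $L^p(\Gamma)$ and $$\|(1-C_v)^{-1}\|_{L^p(\Gamma)\to L^p(\Gamma)}\le c_v^{\#},$$ where $$\begin{aligned}c_v^{\#}=\ & c\,\|R\|_{L^\infty(\mathbb C\setminus\Gamma_{\mathrm{ext}})}\|R^{-1}\|_{L^\infty(\mathbb C\setminus\Gamma_{\mathrm{ext}})}\|(1-C_{\breve v})^{-1}\|_{L^p(\Gamma)\to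 L^p(\Gamma)}\|(1-C_{\breve v})^{-1}\|_{L^2(\Gamma)\to L^2(\Gamma)}\\ &\times\|(1-C_v)^{-1}\|^2_{L^2(\Gamma)\to L^2(\Gamma)}\,\langle v\rangle_\infty^3\,\langle\breve v\rangle_\infty^2\,(1+\|\breve v-I\|_{L^2(\Gamma)})^2(1+\|v-I\|_{L^2(\Gamma)})^2,\end{aligned}$$ and $c$ is a constant depending only on $p$, $k$, $\Gamma$, $\Gamma'$ (not on $v,\breve v,R$).
   Context: Contours: all contours are oriented and are finite unions of smooth curves in $\overline{\mathbb C}$ whose complement in $\overline{\mathbb C}$ has finitely many components, of a class for which the standard Cauchy-operator facts hold. Namely, with $$Ch(z)=\int_\Sigma\frac{h(s)}{s-z}\frac{ds}{2\pi i},\qquad z\in\mathbb C\setminus\Sigma,$$ the non-tangential limits $C^\pm h(z)$ of $Ch(z')$ as $z'\to z\in\Sigma$ from the $(\pm)$-side exist a.e. for $h\in L^p(\Sigma,|dz|)$, $1\le p<\infty$; $C^\pm$ are bounded in $L^p(\Sigma)$ for $1<p<\infty$; $C^+-C^-=1$; bounded analytic functions in $\mathbb C\setminus\Sigma$ have non-tangential boundary values a.e. on $\Sigma$; and Cauchy integrals over one of two such contours at positive distance from each other are bounded from $L^q$ of it to $L^q\cap L^\infty$ of the other, $1<q<\infty$. (Typical examples: $\Gamma=\mathbb R$ or $\Gamma=\mathbb R\cup i\mathbb R$, with $\Gamma'$ consisting of parallel lines, respectively of right-angled corners inside each quadrant.) The $(+)$-side (resp. $(-)$-side) lies to the left (resp.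 right) when moving along the contour in the direction of its orientation. Complete contour: $\Gamma\subset\mathbb C$ is complete if $\mathbb C\setminus\Gamma$ is a disjoint union of two, possibly disconnected, open regions $\Omega_+$ and $\Omega_-$, and $\Gamma$ may be viewed as the positively oriented boundary of $\Omega_+$ and also as the negatively oriented boundary of $\Omega_-$. This gives its natural orientation (two choices, by relabelling $\Omega_\pm$). Jump matrix: a measurable map $v:\Gamma\to GL(k,\mathbb C)$ with $v,v^{-1}\in L^\infty(\Gamma)$. The operator $C_v$ acts on matrix-valued $h\in L^p(\Gamma)$ by $C_vh=C^-(h(v-I))$. "$(1-C_v)^{-1}$ exists in $L^p(\Gamma)$" means that $1-C_v$ is a bijection of $L^p(\Gamma)$ (so its inverse is bounded). Norms: $|A|=(\operatorname{tr}A^*A)^{1/2}$ for matrices, $\|A\|_{L^p}=\|\,|A|\,\|_{L^p}$, and $\langle v\rangle_\infty=\max(\|v\|_{L^\infty},\|v^{-1}\|_{L^\infty})$. *)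

theory Defs
  imports "HOL-Analysis.Analysis" "HOL-Probability.Essential_Supremum"
begin

section \<open>\<open>L\<^sup>p\<close> spaces\<close>

text \<open>
  Elements of \<open>L\<^sup>p\<close> are represented by functions; identities between them are meant almost
  everywhere.  On \<open>complex^'k^'k\<close> the library norm is the Frobenius norm
  \<open>(tr A\<^sup>* A)\<^sup>1\<^sup>/\<^sup>2\<close>.
\<close>

definition Lp :: "'a measure \<Rightarrow> real \<Rightarrow> ('a \<Rightarrow> 'b::real_normed_vector) set" where
  "Lp M p = {f. f \<in> borel_measurable M \<and> integrable M (\<lambda>x. norm (f x) powr p)}"

definition Lp_norm :: "'a measure \<Rightarrow> real \<Rightarrow> ('a \<Rightarrow> 'b::real_normed_vector) \<Rightarrow> real" where
  "Lp_norm M p f = (\<integral>x. norm (f x) powr p \<partial>M) powr (1 / p)"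

definition Linf :: "'a measure \<Rightarrow> ('a \<Rightarrow> 'b::real_normed_vector) set" where
  "Linf M = {f. f \<in> borel_measurable M \<and> (\<exists>B. AE x in M. norm (f x) \<le> B)}"

definition Linf_norm :: "'a measure \<Rightarrow> ('a \<Rightarrow> 'b::real_normed_vector) \<Rightarrow> real" where
  "Linf_norm M f = real_of_ereal (esssup M (\<lambda>x. ereal (norm (f x))))"

definition Lp_bijective ::
  "'a measure \<Rightarrow> real \<Rightarrow> (('a \<Rightarrow> 'b::real_normed_vector) \<Rightarrow> 'a \<Rightarrow> 'b) \<Rightarrow> bool" where
  "Lp_bijective M p T \<longleftrightarrow>
     (\<forall>h\<in>Lp M p. T h \<in> Lp M p) \<and>
     (\<forall>h\<in>Lp M p. \<forall>h'\<in>Lp M p. (AE x in M. T h x = T h' x) \<longrightarrow> (AE x in M. h x = h' x)) \<and>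
     (\<forall>f\<in>Lp M p. \<exists>h\<in>Lp M p. AE x in M. T h x = f x)"

definition Lp_inverse ::
  "'a measure \<Rightarrow> real \<Rightarrow> (('a \<Rightarrow> 'b::real_normed_vector) \<Rightarrow> 'a \<Rightarrow> 'b) \<Rightarrow> ('a \<Rightarrow> 'b) \<Rightarrow> 'a \<Rightarrow> 'b"
  where
  "Lp_inverse M p T f = (SOME h. h \<in> Lp M p \<and> (AE x in M. T h x = f x))"

text \<open>The operator norm takes values in \<open>[0, \<infinity>]\<close>, so that an upper bound for it really
  asserts boundedness.\<close>

definition Lp_opnorm ::
  "'a measure \<Rightarrow> real \<Rightarrow> (('a \<Rightarrow> 'b::real_normed_vector) \<Rightarrow> 'a \<Rightarrow> 'b) \<Rightarrow> ennreal" where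
  "Lp_opnorm M p T = (SUP f\<in>{f \<in> Lp M p. Lp_norm M p f \<le> 1}. ennreal (Lp_norm M p (T f)))"


section \<open>Oriented contours\<close>

text \<open>
  An oriented contour is a finite list of parametrised arcs.  An arc in the Riemann sphere is
  given by its restriction to the open interval \<open>(0,1)\<close>, which takes finite values.  At either
  end it extends to a regular \<open>C\<^sup>1\<close> curve in one of the two charts \<open>z\<close> and \<open>1/z\<close> of the
  sphere; in the second case the end point is \<open>\<infinity>\<close>.  Other values of the functions in the list
  are irrelevant.
\<close>

type_synonym contour = "(real \<Rightarrow> complex) list"

definition regular_end :: "(real \<Rightarrow> complex) \<Rightarrow> real \<Rightarrow> bool" where
  "regular_end \<gamma> a \<longleftrightarrow>
     (\<exists>e>0. \<exists>g. g C1_differentiable_on {a-e..a+e} \<and> vector_derivative g (at a) \<noteq> 0 \<and>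
        ((\<forall>t\<in>{0<..<1} \<inter> {a-e..a+e}. \<gamma> t = g t) \<and> g a \<notin> \<gamma> ` {0<..<1} \<or>
         (\<forall>t\<in>{0<..<1} \<inter> {a-e..a+e}. g t \<noteq> 0 \<and> \<gamma> t = 1 / g t) \<and> g a = 0))"

definition smooth_arc :: "(real \<Rightarrow> complex) \<Rightarrow> bool" where
  "smooth_arc \<gamma> \<longleftrightarrow>
     inj_on \<gamma> {0<..<1} \<and> \<gamma> C1_differentiable_on {0<..<1} \<and>
     (\<forall>t\<in>{0<..<1}. vector_derivative \<gamma> (at t) \<noteq> 0) \<and>
     regular_end \<gamma> 0 \<and> regular_end \<gamma> 1"

text \<open>The closure in \<open>\<complex>\<close> adds the finite end points.\<close>

definition contour_set :: "contour \<Rightarrow> complex set" where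
  "contour_set \<Sigma> = closure (\<Union>\<gamma>\<in>set \<Sigma>. \<gamma> ` {0<..<1})"

text \<open>
  Distinct arcs may meet only at end points, so that every point of an open arc has a left and
  a right side.  The components of the complement are the same, up to the point \<open>\<infinity>\<close>, in
  \<open>\<complex>\<close> and in the Riemann sphere.
\<close>

definition is_contour :: "contour \<Rightarrow> bool" where
  "is_contour \<Sigma> \<longleftrightarrow>
     (\<forall>\<gamma>\<in>set \<Sigma>. smooth_arc \<gamma>) \<and>
     (\<forall>i<length \<Sigma>. \<forall>j<length \<Sigma>. i \<noteq> j \<longrightarrow>
        (\<Sigma>!i) ` {0<..<1} \<inter> closure ((\<Sigma>!j) ` {0<..<1}) = {}) \<and>
     finite (components (- contour_set \<Sigma>))"

text \<open>The measure \<open>|dz|\<close>; it is completed, so that measurability is Lebesgue measurability.\<close>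

definition arclength :: "contour \<Rightarrow> complex measure" where
  "arclength \<Sigma> = completion
     (distr
       (density (count_space {..<length \<Sigma>} \<Otimes>\<^sub>M restrict_space lborel {0<..<1})
          (\<lambda>(j, t). ennreal (cmod (vector_derivative (\<Sigma>!j) (at t)))))
       borel
       (\<lambda>(j, t). (\<Sigma>!j) t))"

definition complete_contour :: "contour \<Rightarrow> bool" where
  "complete_contour \<Sigma> \<longleftrightarrow>
     (\<exists>\<Omega>p \<Omega>m. open \<Omega>p \<and> open \<Omega>m \<and> \<Omega>p \<inter> \<Omega>m = {} \<and> \<Omega>p \<union> \<Omega>m = - contour_set \<Sigma> \<and>
        frontier \<Omega>p = contour_set \<Sigma> \<and> frontier \<Omega>m = contour_set \<Sigma> \<and>
        (\<forall>\<gamma>\<in>set \<Sigma>. \<forall>t\<in>{0<..<1}.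
           (\<forall>\<^sub>F \<epsilon> in at_right 0. \<gamma> t + of_real \<epsilon> * \<i> * vector_derivative \<gamma> (at t) \<in> \<Omega>p) \<and>
           (\<forall>\<^sub>F \<epsilon> in at_right 0. \<gamma> t - of_real \<epsilon> * \<i> * vector_derivative \<gamma> (at t) \<in> \<Omega>m)))"


section \<open>Non-tangential boundary values and Cauchy operators\<close>

text \<open>
  \<open>\<sigma> = 1\<close> stands for the (+)-side (left) and \<open>\<sigma> = -1\<close> for the (-)-side (right).  The sector has
  vertex \<open>z\<close> and is symmetric about the normal \<open>\<sigma> i \<tau>\<close>; its opening tends to \<open>\<pi>\<close> as \<open>a\<close> tends
  to \<open>0\<close>.
\<close>

definition sector :: "real \<Rightarrow> real \<Rightarrow> complex \<Rightarrow> complex \<Rightarrow> complex set" where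
  "sector \<sigma> a z \<tau> = {w. a * cmod \<tau> * cmod (w - z) < \<sigma> * Im (cnj \<tau> * (w - z))}"

definition has_nt_limit ::
  "contour \<Rightarrow> real \<Rightarrow> (complex \<Rightarrow> 'a::t2_space) \<Rightarrow> complex \<Rightarrow> 'a \<Rightarrow> bool" where
  "has_nt_limit \<Sigma> \<sigma> f z l \<longleftrightarrow>
     (\<exists>\<gamma>\<in>set \<Sigma>. \<exists>t\<in>{0<..<1}. \<gamma> t = z \<and>
        (\<forall>a>0. (f \<longlongrightarrow> l) (at z within sector \<sigma> a z (vector_derivative \<gamma> (at t)))))"

definition nt_value :: "contour \<Rightarrow> real \<Rightarrow> (complex \<Rightarrow> 'a::t2_space) \<Rightarrow> complex \<Rightarrow> 'a" where
  "nt_value \<Sigma> \<sigma> f z = (THE l. has_nt_limit \<Sigma> \<sigma> f z l)"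

definition cauchy_integral :: "contour \<Rightarrow> (complex \<Rightarrow> complex) \<Rightarrow> complex \<Rightarrow> complex" where
  "cauchy_integral \<Sigma> h z =
     (\<Sum>\<gamma>\<leftarrow>\<Sigma>. LINT t:{0<..<1}|lebesgue. h (\<gamma> t) / (\<gamma> t - z) * vector_derivative \<gamma> (at t))
       / (2 * of_real pi * \<i>)"

definition cauchy_mat ::
  "contour \<Rightarrow> (complex \<Rightarrow> complex^'k^'k) \<Rightarrow> complex \<Rightarrow> complex^'k^'k" where
  "cauchy_mat \<Sigma> h z = (\<chi> i j. cauchy_integral \<Sigma> (\<lambda>s. h s $ i $ j) z)"

text \<open>The standing assumptions on a single contour, and on two contours at positive distance.\<close>

definition cauchy_contour :: "contour \<Rightarrow> bool" where
  "cauchy_contour \<Sigma> \<longleftrightarrow>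
     is_contour \<Sigma> \<and>
     (\<forall>p\<ge>1. \<forall>h\<in>Lp (arclength \<Sigma>) p. \<forall>\<sigma>\<in>{1, -1}.
        AE z in arclength \<Sigma>. \<exists>l. has_nt_limit \<Sigma> \<sigma> (cauchy_integral \<Sigma> h) z l) \<and>
     (\<forall>p>1. \<forall>\<sigma>\<in>{1, -1}. \<exists>K. \<forall>h\<in>Lp (arclength \<Sigma>) p.
        nt_value \<Sigma> \<sigma> (cauchy_integral \<Sigma> h) \<in> Lp (arclength \<Sigma>) p \<and>
        Lp_norm (arclength \<Sigma>) p (nt_value \<Sigma> \<sigma> (cauchy_integral \<Sigma> h)) \<le> K * Lp_norm (arclength \<Sigma>) p h) \<and>
     (\<forall>p\<ge>1. \<forall>h\<in>Lp (arclength \<Sigma>) p. AE z in arclength \<Sigma>.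
        nt_value \<Sigma> 1 (cauchy_integral \<Sigma> h) z - nt_value \<Sigma> (-1) (cauchy_integral \<Sigma> h) z = h z) \<and>
     (\<forall>f. f holomorphic_on - contour_set \<Sigma> \<and> bounded (f ` (- contour_set \<Sigma>)) \<longrightarrow>
        (\<forall>\<sigma>\<in>{1, -1}. AE z in arclength \<Sigma>. \<exists>l. has_nt_limit \<Sigma> \<sigma> f z l))"

definition cauchy_bounded_across :: "contour \<Rightarrow> contour \<Rightarrow> bool" where
  "cauchy_bounded_across \<Sigma> \<Sigma>' \<longleftrightarrow>
     (\<forall>q>1. \<exists>K. \<forall>h\<in>Lp (arclength \<Sigma>) q.
        cauchy_integral \<Sigma> h \<in> Lp (arclength \<Sigma>') q \<and> cauchy_integral \<Sigma> h \<in> Linf (arclength \<Sigma>') \<and>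
        Lp_norm (arclength \<Sigma>') q (cauchy_integral \<Sigma> h) \<le> K * Lp_norm (arclength \<Sigma>) q h \<and>
        Linf_norm (arclength \<Sigma>') (cauchy_integral \<Sigma> h) \<le> K * Lp_norm (arclength \<Sigma>) q h)"


section \<open>Jump matrices\<close>

definition jump_matrix :: "contour \<Rightarrow> (complex \<Rightarrow> complex^'k^'k) \<Rightarrow> bool" where
  "jump_matrix \<Gamma> v \<longleftrightarrow>
     (AE z in arclength \<Gamma>. invertible (v z)) \<and>
     v \<in> Linf (arclength \<Gamma>) \<and> (\<lambda>z. matrix_inv (v z)) \<in> Linf (arclength \<Gamma>)"

definition jump_size :: "contour \<Rightarrow> (complex \<Rightarrow> complex^'k^'k) \<Rightarrow> real" where
  "jump_size \<Gamma> v =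
     max (Linf_norm (arclength \<Gamma>) v) (Linf_norm (arclength \<Gamma>) (\<lambda>z. matrix_inv (v z)))"

definition C_op ::
  "contour \<Rightarrow> (complex \<Rightarrow> complex^'k^'k) \<Rightarrow> (complex \<Rightarrow> complex^'k^'k) \<Rightarrow> complex \<Rightarrow> complex^'k^'k"
  where
  "C_op \<Gamma> v h = nt_value \<Gamma> (-1) (cauchy_mat \<Gamma> (\<lambda>s. h s ** (v s - mat 1)))"

definition resolvent_exists :: "contour \<Rightarrow> (complex \<Rightarrow> complex^'k^'k) \<Rightarrow> real \<Rightarrow> bool" where
  "resolvent_exists \<Gamma> v p \<longleftrightarrow> Lp_bijective (arclength \<Gamma>) p (\<lambda>h z. h z - C_op \<Gamma> v h z)"

definition resolvent_norm :: "contour \<Rightarrow> (complex \<Rightarrow> complex^'k^'k) \<Rightarrow> real \<Rightarrow> ennreal" where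
  "resolvent_norm \<Gamma> v p =
     Lp_opnorm (arclength \<Gamma>) p (Lp_inverse (arclength \<Gamma>) p (\<lambda>h z. h z - C_op \<Gamma> v h z))"

definition bounded_analytic_on :: "(complex \<Rightarrow> complex^'k^'k) \<Rightarrow> complex set \<Rightarrow> bool" where
  "bounded_analytic_on R D \<longleftrightarrow>
     (\<forall>i j. (\<lambda>z. R z $ i $ j) holomorphic_on D) \<and> bounded (R ` D)"

end

theory Submission
  imports Defs "HOL-Complex_Analysis.Complex_Analysis"
begin


text \<open>
  The scalar core is the identity \<open>m r = C J\<close> off the union of the two contours, where \<open>m\<close> is the
  Cauchy integral over \<open>\<Gamma>\<close> of an \<open>L\<^sup>2\<close> function \<open>h\<close>, \<open>r\<close> is bounded and analytic off the union,
  \<open>J = m\<^sub>+ r\<^sub>+ - m\<^sub>- r\<^sub>-\<close>, and \<open>C J\<close> is the Cauchy integral of \<open>J\<close> over the union.  If \<open>h\<close> is the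
  indicator of a compact subarc, then \<open>m\<close> is bounded near all but two points of the contour, so
  \<open>m r - C J\<close> extends analytically across the open arcs, by Cauchy's formula on rectangles that
  straddle an arc.  A mean value estimate removes the remaining finitely many points, and the same
  estimate on large squares shows that the resulting entire function is \<open>0\<close>.  Both sides are
  bounded linear functionals of \<open>h\<close>, hence the identity holds on all of \<open>L\<^sup>2\<close>.

  Given \<open>f\<close> in \<open>L\<^sup>p\<close>, the function \<open>f (v - 1)\<close> lies in \<open>L\<^sup>2\<close>, because \<open>v - 1\<close> is bounded and in \<open>L\<^sup>2\<close>.
  Let \<open>g\<close> in \<open>L\<^sup>2\<close> solve \<open>(1 - C\<^sub>v) g = C\<^sub>v f\<close> and let \<open>m\<close> be the Cauchy integral of \<open>(f + g) (v - 1)\<close>, so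
  that \<open>m\<^sub>- = g\<close>.  The identity for the entries of \<open>m\<close> and of the inverse \<open>S\<close> of \<open>R\<close> shows that
  \<open>N = g S\<^sub>-\<close> satisfies \<open>(1 - C\<^sub>w) N = C\<^sup>-(f (v - 1) S\<^sub>+) + k\<close>, where \<open>k\<close> is a Cauchy integral over \<open>\<Gamma>'\<close>
  and so is bounded and in \<open>L\<^sup>2\<close>.  The right-hand side lies in \<open>L\<^sup>p\<close>; the solution in \<open>L\<^sup>p\<close> also lies in
  \<open>L\<^sup>2\<close> and therefore equals \<open>N\<close>.  Hence \<open>g = N R\<^sub>-\<close> is in \<open>L\<^sup>p\<close>, and \<open>f + g\<close> solves \<open>(1 - C\<^sub>v) h = f\<close>.
\<close>

text \<open>The obstacle is Cauchy's theorem up to the contour: boundary values exist only almost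
  everywhere, so passing to the limit needs dominated convergence and hence a local bound on m r,
  while m is in general unbounded. For the indicator of a subarc, m is a difference of logarithms,
  bounded away from two points. End points of arcs and the point at infinity offer no regularity;
  the only global information is that |m r - C J| is dominated by a potential whose densities are
  integrable against 1/(1+|s|). Means over squares turn this into pointwise decay. The condition p >
  2 enters because an Lp function times a function that is bounded and in L2 lies again in L2, so
  that data from Lp are accessible to the L2 resolvent. The construction gives a sum with fewer
  factors than the stated product. The product majorises it because, on a contour of positive
  length, a jump size is at least 1 and a resolvent norm times the corresponding jump size is
  bounded below by a constant. In the code \<open>w\<close> is the second jump matrix, the one whose
  resolvent is known in Lp.\<close>

abbreviation L2 :: "contour => (complex => 'b::real_normed_vector) set" where
  "L2 Sg == Lp (arclength Sg) 2"

abbreviation N2 :: "contour => (complex => 'b::real_normed_vector) => real" where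
  "N2 Sg == Lp_norm (arclength Sg) 2"

abbreviation bmeas :: "'a measure => ('a => 'b::topological_space) set" where
  "bmeas M == borel_measurable M"

abbreviation vel :: "(real => complex) => real => complex" where
  "vel gm t == vector_derivative gm (at t)"

abbreviation CI :: "contour => (complex => complex) => complex => complex" where
  "CI == cauchy_integral"

section \<open>Cauchy integrals over rectangles\<close>

lemma contour_integral_linepath_same_Im:
 assumes "Im z = c" "Im z' = c" "Re z = a" "Re z' = b" "a < b"
 shows "contour_integral (linepath z z') f = integral {a..b} (%x. f (Complex x c))"
proof -
 have zz': "z = Complex a c" "z' = Complex b c"
  using assms by (auto simp: complex_eq_iff)
 have "contour_integral (linepath z z') f =
  (z' - z) * integral {0..1} (%x. f (linepath z z' x))"
  by (simp add: contour_integral_integral)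
 also have "z' - z = of_real (b - a)"
  by (simp add: zz' Complex_eq algebra_simps)
 also have "integral {0..1} (%x. f (linepath z z' x)) =
  integral {0..1} (%x. f (Complex (linepath a b x) c))"
  by (simp add: linepath_def Complex_eq scaleR_conv_of_real algebra_simps zz')
 also have "... = integral {0..(b - a) / (b - a)} (%x. f (Complex (a + (b - a) * x) c))"
  using \<open>a < b\<close> by (simp add: algebra_simps linepath_def)
 also have "{0..(b - a) / (b - a)} = (%x. x / (b - a)) ` {0..b - a}"
  using \<open>a < b\<close> by simp
 also have "integral ... (%x. f (Complex (a + (b - a) * x) c)) =
  integral {a-a..b-a} (%x. f (Complex (x + a) c)) / of_real (b - a)"
  using \<open>a < b\<close> by (subst integral_stretch_real) (auto simp: scaleR_conv_of_real add_ac)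
 also have "... = integral {a..b} (%x. f (Complex x c)) / of_real (b - a)"
  by (subst integral_shift_real_ivl) (rule refl)
 finally show ?thesis
  using \<open>a < b\<close> by simp
qed

text \<open>Cauchy's formula on a counterclockwise rectangle, hence the minus signs at the top and
  left sides. With the sides written as integrals over real intervals, they can be averaged over
  concentric squares by Fubini, and can be compared with Lebesgue integrals along an arc.\<close>

lemma cauchy_rectangle:
 assumes "convex S" "open S" "f holomorphic_on S" "cbox p q <= S" "z : box p q"
 defines "k \<equiv> %w. f w / (w - z)"
 shows "2 * pi * \<i> * f z =
  integral {Re p..Re q} (%x. k (Complex x (Im p))) + \<i> * integral {Im p..Im q} (%y. k (Complex (Re q) y))
  - integral {Re p..Re q} (%x. k (Complex x (Im q))) - \<i> * integral {Im p..Im q} (%y. k (Complex (Re p) y))"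
proof -
 have less: "Re p < Re q" "Im p < Im q"
  using assms(5) by (auto simp: in_box_complex_iff)
 have zS: "z : S" using assms(4,5) box_subset_cbox by blast
 define a2 a4 where "a2 = Complex (Re q) (Im p)" and "a4 = Complex (Re p) (Im q)"
 have img: "path_image (rectpath p q) <= S - {z}"
  using path_image_rectpath_cbox_minus_box[of p q] less assms(4,5) by auto
 have hk: "k holomorphic_on S - {z}" unfolding k_def
  by (intro holomorphic_intros holomorphic_on_subset[OF assms(3)]) auto
 have ck: "continuous_on (path_image (rectpath p q)) k"
  by (rule continuous_on_subset[OF holomorphic_on_imp_continuous_on[OF hk] img])
 have "((%w. f w / (w-z)) has_contour_integral (2*pi * \<i> * winding_number (rectpath p q) z * f z)) (rectpath p q)"
  by (rule Cauchy_integral_formula_convex_simple[OF assms(1,3)])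
  (use assms(2) zS img in \<open>auto simp: interior_open\<close>)
 then have 1: "(k has_contour_integral (2*pi * \<i> * f z)) (rectpath p q)"
  using assms(5) by (simp add: winding_number_rectpath k_def)
 have ims: "path_image (linepath p a2) <= path_image (rectpath p q)"
  "path_image (linepath a2 q) <= path_image (rectpath p q)"
  "path_image (linepath q a4) <= path_image (rectpath p q)"
  "path_image (linepath a4 p) <= path_image (rectpath p q)"
  by (auto simp: rectpath_def Let_def a2_def a4_def path_image_join)
 have ci: "k contour_integrable_on linepath p a2" "k contour_integrable_on linepath a2 q"
  "k contour_integrable_on linepath q a4" "k contour_integrable_on linepath a4 p"
  by (intro contour_integrable_continuous_linepath continuous_on_subset[OF ck] ims[unfolded path_image_linepath])+
 have "contour_integral (rectpath p q) k = contour_integral (linepath p a2) k +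
  contour_integral (linepath a2 q) k + contour_integral (linepath q a4) k + contour_integral (linepath a4 p) k"
  unfolding rectpath_def Let_def a2_def[symmetric] a4_def[symmetric]
  using ci by (simp add: contour_integrable_join)
 also have "contour_integral (linepath q a4) k = - contour_integral (linepath a4 q) k"
  by (intro contour_integral_reverse_linepath continuous_on_subset[OF ck])
  (use ims in \<open>auto simp: closed_segment_commute\<close>)
 also have "contour_integral (linepath a4 p) k = - contour_integral (linepath p a4) k"
  by (intro contour_integral_reverse_linepath continuous_on_subset[OF ck])
  (use ims in \<open>auto simp: closed_segment_commute\<close>)
 also have "contour_integral (linepath p a2) k = integral {Re p..Re q} (%x. k (Complex x (Im p)))"
  by (rule contour_integral_linepath_same_Im) (use less in \<open>auto simp: a2_def\<close>)
 also have "contour_integral (linepath a4 q) k = integral {Re p..Re q} (%x. k (Complex x (Im q)))"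
  by (rule contour_integral_linepath_same_Im) (use less in \<open>auto simp: a4_def\<close>)
 also have "contour_integral (linepath a2 q) k = \<i> * integral {Im p..Im q} (%y. k (Complex (Re q) y))"
  by (rule contour_integral_linepath_same_Re) (use less in \<open>auto simp: a2_def\<close>)
 also have "contour_integral (linepath p a4) k = \<i> * integral {Im p..Im q} (%y. k (Complex (Re p) y))"
  by (rule contour_integral_linepath_same_Re) (use less in \<open>auto simp: a4_def\<close>)
 finally show ?thesis using contour_integral_unique[OF 1] by simp
qed

lemma norm_integral_le_nn_integral:
 fixes k :: "real => complex"
 assumes "continuous_on {a..b} k"
 shows "ennreal (norm (integral {a..b} k)) <= (\<integral>\<^sup>+x. ennreal (norm (k x)) * indicator {a..b} x \<partial>lborel)"
proof -
 have "set_integrable lborel {a..b} k"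
  using assms by (rule borel_integrable_atLeastAtMost')
 then have "integral {a..b} k = (LINT x:{a..b}|lborel. k x)" "integrable lborel (%x. indicator {a..b} x *\<^sub>R k x)"
  by (auto simp: set_borel_integral_eq_integral(2) set_integrable_def)
 then have "ennreal (norm (integral {a..b} k)) <= (\<integral>\<^sup>+x. norm (indicator {a..b} x *\<^sub>R k x) \<partial>lborel)"
  unfolding set_lebesgue_integral_def by (metis integral_norm_bound_ennreal)
 also have "... = (\<integral>\<^sup>+x. ennreal (norm (k x)) * indicator {a..b} x \<partial>lborel)"
  by (intro nn_integral_cong) (auto split: split_indicator)
 finally show ?thesis .
qed

lemma continuous_on_Complex [continuous_intros]:
 "continuous_on A f ==> continuous_on A g ==> continuous_on A (%x. Complex (f x) (g x))"
 unfolding Complex_eq by (intro continuous_intros)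

text \<open>Cauchy's formula is averaged over the squares of half side r between rh/2 and rh. On
  such a square the kernel 1/|w| is at most 2/rh, and as r varies each side sweeps out a part of the
  large square. Using an area integral instead of a sup norm is what allows functions that are only
  bounded by a potential.\<close>

lemma mean_value_square_0:
 fixes rh :: real
 assumes "convex S" "open S" "G holomorphic_on S" "cbox (Complex (-rh) (-rh)) (Complex rh rh) <= S" "rh > 0"
 shows "ennreal (norm (G 0)) <= ennreal (3 / rh^2) *
  (\<integral>\<^sup>+y. \<integral>\<^sup>+x. ennreal (norm (G (Complex x y))) * indicator {-rh..rh} x * indicator {-rh..rh} y \<partial>lborel \<partial>lborel)"
proof -
 define h where "h = (%x y. ennreal (norm (G (Complex x y))) * indicator {-rh..rh} x * indicator {-rh..rh} y)"
 have contG: "continuous_on (cbox (Complex (-rh) (-rh)) (Complex rh rh)) G"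
  using holomorphic_on_imp_continuous_on[OF assms(3)] assms(4) by (rule continuous_on_subset)
 let ?C = "{-rh..rh} \<times> {-rh..rh}"
 have "continuous_on ?C (%z. norm (G (Complex (fst z) (snd z))))"
  by (intro continuous_intros continuous_on_compose2[OF contG]) (auto simp: in_cbox_complex_iff)
 then have "(%z. indicator ?C z *\<^sub>R norm (G (Complex (fst z) (snd z)))) : bmeas borel"
  by (rule borel_measurable_continuous_on_indicator[rotated]) (intro borel_closed closed_Times closed_atLeastAtMost)
 then have hm0: "(%z. ennreal (indicator ?C z *\<^sub>R norm (G (Complex (fst z) (snd z))))) : bmeas (lborel \<Otimes>\<^sub>M lborel)"
  unfolding lborel_prod by simp
 have eq: "(%(x,y). h x y) = (%z. ennreal (indicator ?C z *\<^sub>R norm (G (Complex (fst z) (snd z)))))"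
  by (auto simp: fun_eq_iff h_def split: split_indicator)
 have hm[measurable]: "(%(x,y). h x y) : bmeas (lborel \<Otimes>\<^sub>M lborel)" unfolding eq by (rule hm0)
 have hm'[measurable]: "(%(x,y). h y x) : bmeas (lborel \<Otimes>\<^sub>M lborel)" by measurable
 define T where "T = (%y. \<integral>\<^sup>+x. h x y \<partial>lborel)"
 define V where "V = (%x. \<integral>\<^sup>+y. h x y \<partial>lborel)"
 have Tm[measurable]: "T : bmeas borel" unfolding T_def by measurable
 have Vm[measurable]: "V : bmeas borel" unfolding V_def by measurable
 define I where "I = (\<integral>\<^sup>+y. T y \<partial>lborel)"
 have IV: "(\<integral>\<^sup>+x. V x \<partial>lborel) = I"
  unfolding I_def T_def V_def
  using lborel_pair.Fubini'[of h] by simp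
 have refl: "(\<integral>\<^sup>+y. f (-y) \<partial>lborel) = (\<integral>\<^sup>+y. f y \<partial>lborel)" if [measurable]: "f : bmeas borel"
  for f :: "real => ennreal"
  using nn_integral_real_affine[of f "-1" 0] that by simp
 have main: "ennreal (2 * pi * norm (G 0)) <= ennreal (2/rh) * (T (-r) + V r + T r + V (-r))"
  if r: "r : {rh/2..rh}" for r
 proof -
  have r0: "r > 0" using r assms(5) by simp
  define k where "k = (%w. G w / (w - 0))"
  have sub: "cbox (Complex (-r) (-r)) (Complex r r) <= cbox (Complex (-rh) (-rh)) (Complex rh rh)"
  using r by (auto simp: in_cbox_complex_iff)
  have "2 * pi * \<i> * G 0 =
  integral {-r..r} (%x. k (Complex x (-r))) + \<i> * integral {-r..r} (%y. k (Complex r y))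
  - integral {-r..r} (%x. k (Complex x r)) - \<i> * integral {-r..r} (%y. k (Complex (-r) y))"
  using cauchy_rectangle[OF assms(1-3) order.trans[OF sub assms(4)], of 0] r0
  by (simp add: k_def in_box_complex_iff)
  then have "norm (2 * pi * \<i> * G 0) <= norm (integral {-r..r} (%x. k (Complex x (-r))))
  + norm (integral {-r..r} (%y. k (Complex r y)))
  + norm (integral {-r..r} (%x. k (Complex x r))) + norm (integral {-r..r} (%y. k (Complex (-r) y)))"
  by (auto simp: norm_mult intro!: norm_triangle_le norm_triangle_le_diff)
  then have "ennreal (2 * pi * norm (G 0)) <= ennreal (norm (integral {-r..r} (%x. k (Complex x (-r))))
  + norm (integral {-r..r} (%y. k (Complex r y)))
  + norm (integral {-r..r} (%x. k (Complex x r))) + norm (integral {-r..r} (%y. k (Complex (-r) y))))"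
  by (intro ennreal_leI) (simp add: norm_mult)
  also have "... = ennreal (norm (integral {-r..r} (%x. k (Complex x (-r)))))
  + ennreal (norm (integral {-r..r} (%y. k (Complex r y))))
  + ennreal (norm (integral {-r..r} (%x. k (Complex x r)))) + ennreal (norm (integral {-r..r} (%y. k (Complex (-r) y))))"
  by simp
  also have "... <= ennreal (2/rh) * T (-r) + ennreal (2/rh) * V r + ennreal (2/rh) * T r + ennreal (2/rh) * V (-r)"
  proof -
  have bd: "ennreal (norm (integral {-r..r} (%x. k (P x)))) <= ennreal (2/rh) * (\<integral>\<^sup>+x. H x \<partial>lborel)"
  if P: "continuous_on {-r..r} P" "!!x. x : {-r..r} ==> cmod (P x) >= r & P x : cbox (Complex (-r) (-r)) (Complex r r)"
  and H: "!!x. x : {-r..r} ==> ennreal (norm (G (P x))) <= H x" and [measurable]: "H : bmeas borel" for P H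
  proof -
  have "continuous_on {-r..r} (%x. k (P x))" unfolding k_def diff_0_right
  by (intro continuous_intros continuous_on_compose2[OF contG] P(1))
  (use P(2) r0 sub in \<open>fastforce\<close>)+
  then have "ennreal (norm (integral {-r..r} (%x. k (P x)))) <= (\<integral>\<^sup>+x. ennreal (norm (k (P x))) * indicator {-r..r} x \<partial>lborel)"
  by (rule norm_integral_le_nn_integral)
  also have "... <= (\<integral>\<^sup>+x. ennreal (2/rh) * H x \<partial>lborel)"
  proof (intro nn_integral_mono)
  fix x
  show "ennreal (norm (k (P x))) * indicator {-r..r} x <= ennreal (2/rh) * H x"
  proof (cases "x : {-r..r}")
  case True
  have "norm (k (P x)) <= (2/rh) * norm (G (P x))"
  proof -
  have "norm (k (P x)) = norm (G (P x)) / cmod (P x)" by (simp add: k_def norm_divide)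
  also have "... <= norm (G (P x)) / (rh/2)"
  using P(2)[OF True] r r0 assms(5) by (intro divide_left_mono mult_pos_pos) auto
  finally show ?thesis by (simp add: field_simps)
  qed
  then have "ennreal (norm (k (P x))) <= ennreal (2/rh) * ennreal (norm (G (P x)))"
  using assms(5) by (subst ennreal_mult[symmetric]) (auto intro!: ennreal_leI)
  also have "... <= ennreal (2/rh) * H x" by (intro mult_left_mono H True) auto
  finally show ?thesis using True by simp
  qed simp
  qed
  also have "... = ennreal (2/rh) * (\<integral>\<^sup>+x. H x \<partial>lborel)" by (rule nn_integral_cmult) simp
  finally show ?thesis .
  qed
  have le: "r <= cmod (Complex x y)" if "\<bar>x\<bar> = r \<or> \<bar>y\<bar> = r" for x y
  using that abs_Re_le_cmod[of "Complex x y"] abs_Im_le_cmod[of "Complex x y"] by auto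
  have mh: "(%x. h x c) : bmeas borel" "(%y. h c y) : bmeas borel" for c
  using measurable_compose[OF measurable_Pair1'[of c lborel lborel] hm]
  measurable_compose[OF measurable_Pair2'[of c lborel lborel] hm] by auto
  have b1: "ennreal (norm (integral {-r..r} (%x. k ((%x. Complex x (-r)) x)))) <= ennreal (2/rh) * (\<integral>\<^sup>+x. (%x. h x (-r)) x \<partial>lborel)"
  proof (rule bd)
  show "continuous_on {-r..r} (%x. Complex x (-r))" by (intro continuous_intros)
  show "r <= cmod ((%x. Complex x (-r)) x) & (%x. Complex x (-r)) x : cbox (Complex (-r) (-r)) (Complex r r)" if "x : {-r..r}" for x
  using that r0 le by (simp add: in_cbox_complex_iff)
  show "ennreal (norm (G ((%x. Complex x (-r)) x))) <= (%x. h x (-r)) x" if "x : {-r..r}" for x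
  using that r r0 by (simp add: h_def)
  qed (rule mh)
  have b2: "ennreal (norm (integral {-r..r} (%x. k ((%y. Complex r y) x)))) <= ennreal (2/rh) * (\<integral>\<^sup>+x. (%y. h r y) x \<partial>lborel)"
  proof (rule bd)
  show "continuous_on {-r..r} (%y. Complex r y)" by (intro continuous_intros)
  show "r <= cmod ((%y. Complex r y) x) & (%y. Complex r y) x : cbox (Complex (-r) (-r)) (Complex r r)" if "x : {-r..r}" for x
  using that r0 le by (simp add: in_cbox_complex_iff)
  show "ennreal (norm (G ((%y. Complex r y) x))) <= (%y. h r y) x" if "x : {-r..r}" for x
  using that r r0 by (simp add: h_def)
  qed (rule mh)
  have b3: "ennreal (norm (integral {-r..r} (%x. k ((%x. Complex x r) x)))) <= ennreal (2/rh) * (\<integral>\<^sup>+x. (%x. h x r) x \<partial>lborel)"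
  proof (rule bd)
  show "continuous_on {-r..r} (%x. Complex x r)" by (intro continuous_intros)
  show "r <= cmod ((%x. Complex x r) x) & (%x. Complex x r) x : cbox (Complex (-r) (-r)) (Complex r r)" if "x : {-r..r}" for x
  using that r0 le by (simp add: in_cbox_complex_iff)
  show "ennreal (norm (G ((%x. Complex x r) x))) <= (%x. h x r) x" if "x : {-r..r}" for x
  using that r r0 by (simp add: h_def)
  qed (rule mh)
  have b4: "ennreal (norm (integral {-r..r} (%x. k ((%y. Complex (-r) y) x)))) <= ennreal (2/rh) * (\<integral>\<^sup>+x. (%y. h (-r) y) x \<partial>lborel)"
  proof (rule bd)
  show "continuous_on {-r..r} (%y. Complex (-r) y)" by (intro continuous_intros)
  show "r <= cmod ((%y. Complex (-r) y) x) & (%y. Complex (-r) y) x : cbox (Complex (-r) (-r)) (Complex r r)" if "x : {-r..r}" for x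
  using that r0 le by (simp add: in_cbox_complex_iff)
  show "ennreal (norm (G ((%y. Complex (-r) y) x))) <= (%y. h (-r) y) x" if "x : {-r..r}" for x
  using that r r0 by (simp add: h_def)
  qed (rule mh)
  show ?thesis unfolding T_def V_def
  using add_mono[OF add_mono[OF add_mono[OF b1 b2] b3] b4] by simp
  qed
  finally show ?thesis by (simp add: distrib_left)
 qed
 \<comment> \<open>The half sides r fill an interval of length rh/2, which turns 2 pi into pi rh.
   The four swept sides cost at most the full integral I each, so the resulting constant is 8/pi,
   rounded up to 3.\<close>
 have "ennreal (pi * rh * norm (G 0)) = (\<integral>\<^sup>+r. ennreal (2 * pi * norm (G 0)) * indicator {rh/2..rh} r \<partial>lborel)"
  using assms(5) by (subst nn_integral_cmult_indicator) (auto simp: ennreal_mult'[symmetric])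
 also have "... <= (\<integral>\<^sup>+r. ennreal (2/rh) * (T (-r) + V r + T r + V (-r)) \<partial>lborel)"
  by (intro nn_integral_mono) (use main in \<open>auto split: split_indicator\<close>)
 also have "... = ennreal (2/rh) * ((\<integral>\<^sup>+r. T (-r) \<partial>lborel) + (\<integral>\<^sup>+r. V r \<partial>lborel) + (\<integral>\<^sup>+r. T r \<partial>lborel) + (\<integral>\<^sup>+r. V (-r) \<partial>lborel))"
  by (simp add: nn_integral_cmult nn_integral_add)
 also have "... = ennreal (2/rh) * (4 * I)"
 proof -
  have "4 * I = (2 + 2) * I" by simp
  also have "... = I + I + I + I" by (simp only: distrib_right mult_2 add.assoc)
  finally show ?thesis by (simp only: refl[OF Tm] refl[OF Vm] IV I_def[symmetric])
 qed
 finally have A: "ennreal (pi * rh * norm (G 0)) <= ennreal (2/rh) * (4 * I)" .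
 have "ennreal (norm (G 0)) = ennreal (1 / (pi * rh)) * ennreal (pi * rh * norm (G 0))"
  using assms(5) by (subst ennreal_mult[symmetric]) auto
 also have "... <= ennreal (1 / (pi * rh)) * (ennreal (2/rh) * (4 * I))"
  by (intro mult_left_mono A) auto
 also have "... = ennreal (8 / (pi * rh^2)) * I"
 proof -
  have "ennreal (8 / (pi * rh^2)) = ennreal (1 / (pi * rh)) * (ennreal (2/rh) * ennreal 4)"
  using assms(5) by (simp add: ennreal_mult[symmetric] power2_eq_square field_simps del: ennreal_numeral)
  then show ?thesis by (simp add: mult.assoc)
 qed
 also have "... <= ennreal (3 / rh^2) * I"
  using assms(5) pi_gt3 by (intro mult_right_mono ennreal_leI) (auto simp: field_simps)
 finally show ?thesis unfolding I_def T_def h_def .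
qed

text \<open>Uniform in the translation a: within distance rh of the singularity the two halves give
  2 sqrt rh each, and farther away the integrand is at most 1/sqrt rh on an interval of length 2 rh.
  The value \<open>top\<close> at 0 replaces the default \<open>0 powr (-1/2) = 0\<close>, which
  would not be an upper bound for a singular kernel.\<close>

lemma nn_integral_inverse_sqrt_le:
 fixes a rh :: real
 assumes "rh > 0"
 defines "kq \<equiv> %u::real. if u = 0 then top else ennreal (\<bar>u\<bar> powr (-1/2))"
 shows "(\<integral>\<^sup>+x. kq (x - a) * indicator {-rh..rh} x \<partial>lborel) <= ennreal (6 * sqrt rh)"
proof -
 have [measurable]: "kq : bmeas borel" unfolding kq_def by measurable
 have half: "(\<integral>\<^sup>+x. kq x * indicator {0..rh} x \<partial>lborel) = ennreal (2 * sqrt rh)"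
 proof -
  have "((%x. x powr (-1/2)) has_integral (rh powr (-1/2 + 1) / (-1/2+1))) {0..rh}"
  using assms(1) by (intro has_integral_powr_from_0) auto
  then have hi: "((%x. x powr (-1/2)) has_integral (2 * sqrt rh)) {0..rh}"
  using assms(1) by (simp add: powr_half_sqrt mult.commute[of 2])
  have "(\<integral>\<^sup>+x. kq x * indicator {0..rh} x \<partial>lborel) = (\<integral>\<^sup>+x. ennreal (x powr (-1/2)) * indicator {0..rh} x \<partial>lborel)"
  proof (intro nn_integral_cong_AE)
  have "AE x in lborel. x ~= (0::real)" by (rule AE_lborel_singleton)
  then show "AE x in lborel. kq x * indicator {0..rh} x = ennreal (x powr (-1/2)) * indicator {0..rh} x"
  by eventually_elim (auto simp: kq_def split: split_indicator)
  qed
  also have "... = (\<integral>\<^sup>+x. ennreal (x powr (-1/2) * indicator {0..rh} x) \<partial>lborel)"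
  by (intro nn_integral_cong) (auto split: split_indicator)
  also have "... = ennreal (2 * sqrt rh)"
  proof (rule nn_integral_has_integral_lborel)
  have "((%x. if x : {0..rh} then x powr (-1/2) else 0) has_integral (2 * sqrt rh)) UNIV"
  using hi by (simp only: has_integral_restrict_UNIV)
  moreover have "(%x. if x : {0..rh} then x powr (-1/2) else 0) = (%x. x powr (-1/2) * indicator {0..rh} x)"
  by (rule ext) simp
  ultimately show "((%x. x powr (-1/2) * indicator {0..rh} x) has_integral (2 * sqrt rh)) UNIV" by metis
  qed (auto split: split_indicator)
  finally show ?thesis .
 qed
 have half': "(\<integral>\<^sup>+x. kq x * indicator {-rh..0} x \<partial>lborel) = ennreal (2 * sqrt rh)"
  unfolding half[symmetric]
  using nn_integral_real_affine[of "%x. kq x * indicator {-rh..0} x" "-1" 0]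
  by (auto simp: kq_def intro!: nn_integral_cong split: split_indicator)
 have "(\<integral>\<^sup>+x. kq (x - a) * indicator {-rh..rh} x \<partial>lborel) <=
  (\<integral>\<^sup>+x. (kq (x-a) * indicator {0..rh} (x-a) + kq (x-a) * indicator {-rh..0} (x-a)) + ennreal (1 / sqrt rh) * indicator {-rh..rh} x \<partial>lborel)"
 proof (intro nn_integral_mono)
  fix x
  show "kq (x - a) * indicator {-rh..rh} x <= (kq (x-a) * indicator {0..rh} (x-a) + kq (x-a) * indicator {-rh..0} (x-a)) + ennreal (1 / sqrt rh) * indicator {-rh..rh} x"
  proof (cases "\<bar>x - a\<bar> <= rh")
  case True
  then show ?thesis by (cases "x - a >= 0") (auto split: split_indicator simp: add_increasing add_increasing2)
  next
  case False
  then have "kq (x-a) <= ennreal (1 / sqrt rh)"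
  using assms(1) by (auto simp: kq_def powr_minus powr_half_sqrt inverse_eq_divide intro!: ennreal_leI divide_left_mono)
  then show ?thesis by (auto split: split_indicator simp: add_increasing)
  qed
 qed
 also have "... = ((\<integral>\<^sup>+x. kq (x-a) * indicator {0..rh} (x-a) \<partial>lborel) + (\<integral>\<^sup>+x. kq (x-a) * indicator {-rh..0} (x-a) \<partial>lborel))
  + (\<integral>\<^sup>+x. ennreal (1 / sqrt rh) * indicator {-rh..rh} x \<partial>lborel)"
  by (simp add: nn_integral_add)
 also have "(\<integral>\<^sup>+x. kq (x-a) * indicator {0..rh} (x-a) \<partial>lborel) = ennreal (2 * sqrt rh)"
  unfolding half[symmetric]
  using nn_integral_real_affine[of "%x. kq x * indicator {0..rh} x" 1 "-a"] by simp
 also have "(\<integral>\<^sup>+x. kq (x-a) * indicator {-rh..0} (x-a) \<partial>lborel) = ennreal (2 * sqrt rh)"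
  unfolding half'[symmetric]
  using nn_integral_real_affine[of "%x. kq x * indicator {-rh..0} x" 1 "-a"] by simp
 also have "(\<integral>\<^sup>+x. ennreal (1 / sqrt rh) * indicator {-rh..rh} x \<partial>lborel) = ennreal (2 * sqrt rh)"
  using assms(1) by (subst nn_integral_cmult_indicator) (auto simp: ennreal_mult'[symmetric] field_simps)
 also have "ennreal (2 * sqrt rh) + ennreal (2 * sqrt rh) + ennreal (2 * sqrt rh) = ennreal (6 * sqrt rh)"
  using assms(1) by (simp add: ennreal_plus[symmetric] del: ennreal_plus)
 finally show ?thesis .
qed

text \<open>If s is at distance at least 4 rh, the kernel is at most 2/|s - z| on a square of area 4
  rh^2. Otherwise |w| >= sqrt(|Re w| |Im w|) splits the kernel into two one-dimensional factors with
  integrals at most 6 sqrt rh; then 36 rh times max(rh, |s - z|) <= 4 rh gives 144 rh^2.\<close>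

lemma kernel_square_bound:
 fixes s z :: complex and rh :: real
 assumes "rh > 0"
 shows "(\<integral>\<^sup>+y. \<integral>\<^sup>+x. ennreal (1 / cmod (s - (z + Complex x y))) * indicator {-rh..rh} x * indicator {-rh..rh} y \<partial>lborel \<partial>lborel)
  <= ennreal (144 * rh^2 / max rh (cmod (s - z)))"
proof (cases "cmod (s - z) >= 4 * rh")
 case True
 have pt: "ennreal (1 / cmod (s - (z + Complex x y))) * indicator {-rh..rh} x * indicator {-rh..rh} y
  <= ennreal (2 / cmod (s - z)) * indicator {-rh..rh} x * indicator {-rh..rh} y" for x y
 proof (cases "x : {-rh..rh} & y : {-rh..rh}")
  case t: True
  have "cmod (Complex x y) <= \<bar>x\<bar> + \<bar>y\<bar>" using cmod_le[of "Complex x y"] by simp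
  also have "... <= 2 * rh" using t by auto
  finally have "cmod (s - (z + Complex x y)) >= cmod (s - z) / 2"
  using norm_triangle_ineq2[of "s - z" "Complex x y"] True by (simp add: algebra_simps)
  moreover have "0 < cmod (s - z)" using True assms by linarith
  moreover from calculation have "0 < cmod (s - (z + Complex x y))" by linarith
  ultimately have "1 / cmod (s - (z + Complex x y)) <= 1 / (cmod (s - z) / 2)"
  by (intro divide_left_mono mult_pos_pos) auto
  then show ?thesis using t by (simp add: ennreal_leI)
 qed auto
 have "(\<integral>\<^sup>+y. \<integral>\<^sup>+x. ennreal (1 / cmod (s - (z + Complex x y))) * indicator {-rh..rh} x * indicator {-rh..rh} y \<partial>lborel \<partial>lborel)
  <= (\<integral>\<^sup>+y. \<integral>\<^sup>+x. ennreal (2 / cmod (s - z)) * indicator {-rh..rh} x * indicator {-rh..rh} y \<partial>lborel \<partial>lborel)"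
  by (intro nn_integral_mono pt)
 also have "... = ennreal (2 / cmod (s - z)) * ennreal (2 * rh) * ennreal (2 * rh)"
  using assms by (simp add: nn_integral_multc nn_integral_cmult)
 also have "... = ennreal (8 * rh^2 / cmod (s - z))"
  using assms by (simp add: ennreal_mult[symmetric] power2_eq_square)
 also have "... <= ennreal (144 * rh^2 / max rh (cmod (s - z)))"
  using assms True by (auto simp: max_def intro!: ennreal_leI divide_right_mono)
 finally show ?thesis .
next
 case False
 define kq where "kq = (%u::real. if u = 0 then top else ennreal (\<bar>u\<bar> powr (-1/2)))"
 define a b where "a = Re (s - z)" and "b = Im (s - z)"
 have [measurable]: "kq : bmeas borel" unfolding kq_def by measurable
 have pt: "ennreal (1 / cmod (s - (z + Complex x y))) <= kq (x - a) * kq (y - b)" for x y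
 proof (cases "x = a \<or> y = b")
  case True
  then show ?thesis by (auto simp: kq_def ennreal_mult_eq_top_iff ennreal_top_mult ennreal_mult_top)
 next
  case False
  have "\<bar>x - a\<bar> * \<bar>y - b\<bar> <= cmod (s - (z + Complex x y)) * cmod (s - (z + Complex x y))"
  using abs_Re_le_cmod[of "s - (z + Complex x y)"] abs_Im_le_cmod[of "s - (z + Complex x y)"]
  by (intro mult_mono) (auto simp: a_def b_def abs_minus_commute algebra_simps)
  then have le: "sqrt \<bar>x - a\<bar> * sqrt \<bar>y - b\<bar> <= cmod (s - (z + Complex x y))"
  by (simp add: real_sqrt_mult[symmetric] real_le_lsqrt power2_eq_square)
  have pos: "0 < sqrt \<bar>x - a\<bar> * sqrt \<bar>y - b\<bar>" using False by simp
  have "1 / cmod (s - (z + Complex x y)) <= 1 / (sqrt \<bar>x - a\<bar> * sqrt \<bar>y - b\<bar>)"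
  using pos le order.strict_trans2[OF pos le] by (intro divide_left_mono mult_pos_pos[of "cmod (s - (z + Complex x y))"]) simp_all
  also have "... = \<bar>x-a\<bar> powr (-1/2) * \<bar>y-b\<bar> powr (-1/2)"
  using False by (simp add: powr_minus powr_half_sqrt field_simps)
  finally show ?thesis using False by (simp add: kq_def ennreal_mult[symmetric] ennreal_leI)
 qed
 have "(\<integral>\<^sup>+y. \<integral>\<^sup>+x. ennreal (1 / cmod (s - (z + Complex x y))) * indicator {-rh..rh} x * indicator {-rh..rh} y \<partial>lborel \<partial>lborel)
  <= (\<integral>\<^sup>+y. \<integral>\<^sup>+x. (kq (y - b) * indicator {-rh..rh} y) * (kq (x - a) * indicator {-rh..rh} x) \<partial>lborel \<partial>lborel)"
 proof (intro nn_integral_mono)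
  fix x y
  show "ennreal (1 / cmod (s - (z + Complex x y))) * indicator {-rh..rh} x * indicator {-rh..rh} y
  <= (kq (y - b) * indicator {-rh..rh} y) * (kq (x - a) * indicator {-rh..rh} x)"
  using pt[of x y] by (auto split: split_indicator simp: mult.commute)
 qed
 also have "... = (\<integral>\<^sup>+x. kq (x - a) * indicator {-rh..rh} x \<partial>lborel) * (\<integral>\<^sup>+y. kq (y - b) * indicator {-rh..rh} y \<partial>lborel)"
  by (simp add: nn_integral_cmult nn_integral_multc mult.commute)
 also have "... <= ennreal (6 * sqrt rh) * ennreal (6 * sqrt rh)"
  unfolding kq_def by (intro mult_mono nn_integral_inverse_sqrt_le assms) auto
 also have "... = ennreal (36 * rh)"
  using assms by (simp add: ennreal_mult[symmetric])
 also have "... <= ennreal (144 * rh^2 / max rh (cmod (s - z)))"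
 proof (intro ennreal_leI)
  have "max rh (cmod (s - z)) <= 4 * rh" using False assms by simp
  then have "36 * rh * max rh (cmod (s - z)) <= 36 * rh * (4 * rh)" using assms by (intro mult_left_mono) auto
  then show "36 * rh <= 144 * rh^2 / max rh (cmod (s - z))"
  using assms by (subst pos_le_divide_eq) (auto simp: power2_eq_square)
 qed
 finally show ?thesis .
qed

section \<open>Mean values of analytic functions that are dominated by potentials\<close>

lemma negligible_AE_lborel: "negligible N ==> AE x in lborel. x ~: N"
 using AE_not_in[of N lebesgue] by (simp add: negligible_iff_null_sets AE_completion_iff)

text \<open>The mean value over the square is inserted into the bound by a potential and Tonelli
  moves the mean onto the kernel, which it regularises to 1/max(rh, distance); 432 is 3 times 144.
  Only a bound off a null set is required, so the potential may be used for an extension of a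
  function known off the contour. The null set is written with pairs (y,x) because y is the outer
  variable of the iterated integral.\<close>

lemma mean_value_potential:
 fixes Ph :: "complex => complex" and z :: complex and rh :: real and g :: "'i => real => ennreal"
 assumes "convex S" "open S" "Ph holomorphic_on S"
  and sub: "!!x y. \<bar>x\<bar> <= rh ==> \<bar>y\<bar> <= rh ==> z + Complex x y : S" and "rh > 0"
  and A: "finite A" and [measurable]: "!!j. j : A ==> p j : bmeas borel" "!!j. j : A ==> g j : bmeas borel"
  and N: "negligible {(y,x). Complex x y : N}"
  and le: "!!w. w : S - N ==> ennreal (norm (Ph w)) <= (\<Sum>j\<in>A. \<integral>\<^sup>+t. g j t * ennreal (1 / cmod (p j t - w)) \<partial>lborel)"
 shows "ennreal (norm (Ph z)) <= (\<Sum>j\<in>A. \<integral>\<^sup>+t. g j t * ennreal (432 / max rh (cmod (p j t - z))) \<partial>lborel)"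
proof -
 have [measurable]: "(%q. Complex (fst q) (snd q)) : bmeas borel"
  "(fst :: real \<times> real => real) : bmeas borel" "(snd :: real \<times> real => real) : bmeas borel"
  by (intro borel_measurable_continuous_onI continuous_intros)+
 define k where "k = (%j t q. g j t * ennreal (1 / cmod (p j t - (z + Complex (fst q) (snd q)))) * indicator {-rh..rh} (fst q) * indicator {-rh..rh} (snd q))"
 have km: "(%(q,t). k j t q) : bmeas (lborel \<Otimes>\<^sub>M lborel)" if [simp]: "j : A" for j
  unfolding k_def by measurable
 let ?S = "(+) (-z) ` S"
 define G where "G = (%w. Ph (z + w))"
 have Gh: "G holomorphic_on ?S" unfolding G_def
  by (rule holomorphic_on_compose_gen[OF _ assms(3), unfolded o_def]) (auto intro!: holomorphic_intros)
 let ?h = "%x y. ennreal (norm (G (Complex x y))) * indicator {-rh..rh} x * indicator {-rh..rh} y"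
 have "ennreal (norm (G 0)) <= ennreal (3 / rh^2) * (\<integral>\<^sup>+y. \<integral>\<^sup>+x. ?h x y \<partial>lborel \<partial>lborel)"
 proof (rule mean_value_square_0[OF _ _ Gh _ assms(5)])
  show "cbox (Complex (- rh) (- rh)) (Complex rh rh) <= ?S"
  proof
  fix w assume "w : cbox (Complex (- rh) (- rh)) (Complex rh rh)"
  then have "z + Complex (Re w) (Im w) : S" by (intro sub) (auto simp: in_cbox_complex_iff)
  then show "w : ?S" by (force simp: image_iff algebra_simps)
  qed
 qed (use assms(1,2) in \<open>auto simp: convex_translation open_translation_subtract\<close>)
 also have "(\<integral>\<^sup>+y. \<integral>\<^sup>+x. ?h x y \<partial>lborel \<partial>lborel) <= (\<integral>\<^sup>+y. \<integral>\<^sup>+x. (\<Sum>j\<in>A. \<integral>\<^sup>+t. k j t (x,y) \<partial>lborel) \<partial>lborel \<partial>lborel)"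
 proof -
  have "negligible ((+) (-Im z, -Re z) ` {(y,x). Complex x y : N})" using N by (rule negligible_translation)
  then have "AE q in lborel. q ~: ((+) (-Im z, -Re z) ` {(y,x). Complex x y : N})"
  by (rule negligible_AE_lborel)
  then have "AE q in lborel. z + Complex (snd q) (fst q) ~: N"
  proof eventually_elim
  case (elim q)
  have "q = (-Im z, -Re z) + (Im z + fst q, Re z + snd q)" by (cases q) simp
  moreover have "z + Complex (snd q) (fst q) = Complex (Re z + snd q) (Im z + fst q)" by (simp add: complex_eq_iff)
  ultimately show ?case using elim by (metis (mono_tags, lifting) case_prodI image_eqI mem_Collect_eq)
  qed
  then have "AE q in lborel \<Otimes>\<^sub>M lborel. z + Complex (snd q) (fst q) ~: N" unfolding lborel_prod .
  then have "AE y in lborel. AE x in lborel. z + Complex x y ~: N"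
  by (drule_tac lborel_pair.AE_pair) simp
  then show ?thesis
  proof (intro nn_integral_mono_AE, eventually_elim)
  case (elim y)
  then show ?case
  proof (intro nn_integral_mono_AE, eventually_elim)
  case (elim x)
  show ?case
  proof (cases "x : {-rh..rh} & y : {-rh..rh}")
  case True
  then have "ennreal (norm (Ph (z + Complex x y))) <= (\<Sum>j\<in>A. \<integral>\<^sup>+t. g j t * ennreal (1 / cmod (p j t - (z + Complex x y))) \<partial>lborel)"
  using elim by (intro le) (auto intro!: sub)
  then show ?thesis using True by (simp add: G_def k_def)
  qed auto
  qed
  qed
 qed
 also have "(\<integral>\<^sup>+y. \<integral>\<^sup>+x. (\<Sum>j\<in>A. \<integral>\<^sup>+t. k j t (x,y) \<partial>lborel) \<partial>lborel \<partial>lborel) =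
  (\<integral>\<^sup>+q. (\<Sum>j\<in>A. \<integral>\<^sup>+t. k j t q \<partial>lborel) \<partial>(lborel \<Otimes>\<^sub>M lborel))"
  by (subst lborel_pair.nn_integral_snd[symmetric])
  (auto simp: k_def lborel_prod intro!: borel_measurable_sum lborel.borel_measurable_nn_integral)
 also have "... = (\<integral>\<^sup>+q. (\<Sum>j\<in>A. \<integral>\<^sup>+t. k j t q \<partial>lborel) \<partial>lborel)" by (simp add: lborel_prod)
 also have "... = (\<Sum>j\<in>A. \<integral>\<^sup>+q. (\<integral>\<^sup>+t. k j t q \<partial>lborel) \<partial>lborel)"
  by (rule nn_integral_sum) (auto simp: k_def intro!: lborel.borel_measurable_nn_integral)
 also have "... = (\<Sum>j\<in>A. \<integral>\<^sup>+t. (\<integral>\<^sup>+q. k j t q \<partial>lborel) \<partial>lborel)"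
  using lborel_pair.Fubini'[OF km] by (intro sum.cong) auto
 also have "... <= (\<Sum>j\<in>A. \<integral>\<^sup>+t. g j t * ennreal (144 * rh^2 / max rh (cmod (p j t - z))) \<partial>lborel)"
 proof (intro sum_mono nn_integral_mono)
  fix j t assume [simp]: "j : A"
  have "(\<integral>\<^sup>+q. k j t q \<partial>lborel) = (\<integral>\<^sup>+q. k j t q \<partial>(lborel \<Otimes>\<^sub>M lborel))" by (simp add: lborel_prod)
  also have "... = (\<integral>\<^sup>+y. \<integral>\<^sup>+x. k j t (x,y) \<partial>lborel \<partial>lborel)"
  by (subst lborel_pair.nn_integral_snd[symmetric]) (auto simp: k_def lborel_prod)
  also have "... = g j t * (\<integral>\<^sup>+y. \<integral>\<^sup>+x. ennreal (1 / cmod (p j t - (z + Complex x y))) * indicator {-rh..rh} x * indicator {-rh..rh} y \<partial>lborel \<partial>lborel)"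
  proof -
  have [measurable]: "(%q. Complex (snd q) (fst q)) : bmeas (borel :: (real\<times>real) measure)"
  "(%x. Complex x y) : bmeas borel" for y
  by (intro borel_measurable_continuous_onI continuous_intros)+
  have "(%q. ennreal (1 / cmod (p j t - (z + Complex (snd q) (fst q)))) * indicator {-rh..rh} (snd q) * indicator {-rh..rh} (fst q)) : bmeas (lborel \<Otimes>\<^sub>M lborel)"
  unfolding lborel_prod by measurable
  from lborel.borel_measurable_nn_integral_fst[OF this]
  have "(%y. \<integral>\<^sup>+x. ennreal (1 / cmod (p j t - (z + Complex x y))) * indicator {-rh..rh} x * indicator {-rh..rh} y \<partial>lborel) : bmeas lborel"
  by simp
  then show ?thesis by (simp add: k_def mult.assoc nn_integral_cmult)
  qed
  also have "... <= g j t * ennreal (144 * rh^2 / max rh (cmod (p j t - z)))"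
  by (intro mult_left_mono kernel_square_bound assms) auto
  finally show "(\<integral>\<^sup>+q. k j t q \<partial>lborel) <= g j t * ennreal (144 * rh^2 / max rh (cmod (p j t - z)))" .
 qed
 finally have "ennreal (norm (Ph z)) <= ennreal (3 / rh^2) * (\<Sum>j\<in>A. \<integral>\<^sup>+t. g j t * ennreal (144 * rh^2 / max rh (cmod (p j t - z))) \<partial>lborel)"
  by (simp add: G_def mult_left_mono)
 also have "... = (\<Sum>j\<in>A. \<integral>\<^sup>+t. ennreal (3 / rh^2) * (g j t * ennreal (144 * rh^2 / max rh (cmod (p j t - z)))) \<partial>lborel)"
  unfolding sum_distrib_left by (intro sum.cong refl nn_integral_cmult[symmetric]) auto
 also have "... = (\<Sum>j\<in>A. \<integral>\<^sup>+t. g j t * ennreal (432 / max rh (cmod (p j t - z))) \<partial>lborel)"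
 proof (intro sum.cong refl nn_integral_cong)
  fix j t
  have "ennreal (3 / rh^2) * ennreal (144 * rh^2 / max rh (cmod (p j t - z))) = ennreal (432 / max rh (cmod (p j t - z)))"
  using assms(5) by (subst ennreal_mult[symmetric]) auto
  then show "ennreal (3 / rh^2) * (g j t * ennreal (144 * rh^2 / max rh (cmod (p j t - z)))) = g j t * ennreal (432 / max rh (cmod (p j t - z)))"
  by (metis mult.left_commute)
 qed
 finally show ?thesis .
qed

section \<open>Flat arcs\<close>

lemma inverse_dist_le:
 fixes q z :: complex
 assumes "0 < dl" "dl <= cmod (q - z)"
 shows "1 / cmod (q - z) <= (1 + (1 + cmod z) / dl) / (1 + cmod q)"
proof -
 have "1 + cmod q <= 1 + cmod z + cmod (q - z)"
  using norm_triangle_ineq[of "q - z" z] by simp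
 also have "1 + cmod z = (1 + cmod z) / dl * dl" using assms by simp
 also have "... <= (1 + cmod z) / dl * cmod (q - z)"
  using assms by (intro mult_left_mono) (auto intro: add_nonneg_nonneg)
 finally have "1 + cmod q <= (1 + (1 + cmod z) / dl) * cmod (q - z)" by (simp add: algebra_simps)
 moreover have "0 < cmod (q - z)" using assms by linarith
 ultimately show ?thesis by (simp add: field_simps add_pos_nonneg)
qed

text \<open>A curve through infinity leaves only integrability against 1/(1+|q|); at distance at
  least dl from z the Cauchy kernel is comparable with this weight. The alternative
  \<open>ph x = 0\<close> covers parameters outside the curve, where q is a default value that may
  be close to z.\<close>

lemma integrable_cauchy_kernel:
 fixes q ph :: "'a => complex"
 assumes [measurable]: "q : bmeas M" "ph : bmeas M"
  and int: "integrable M (%x. norm (ph x) / (1 + cmod (q x)))"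
  and dl: "0 < dl" "AE x in M. ph x = 0 \<or> dl <= cmod (q x - z)"
 shows "integrable M (%x. ph x / (q x - z))"
proof (rule Bochner_Integration.integrable_bound)
 show "integrable M (%x. (1 + (1 + cmod z) / dl) * (norm (ph x) / (1 + cmod (q x))))"
  by (intro integrable_mult_right int)
 show "AE x in M. norm (ph x / (q x - z)) <= norm ((1 + (1 + cmod z) / dl) * (norm (ph x) / (1 + cmod (q x))))"
  using dl(2)
 proof eventually_elim
  case (elim x)
  show ?case
  proof (cases "ph x = 0")
  case False
  with elim have "1 / cmod (q x - z) <= (1 + (1 + cmod z) / dl) / (1 + cmod (q x))"
  using inverse_dist_le dl(1) by blast
  then have "norm (ph x) * (1 / cmod (q x - z)) <= norm (ph x) * ((1 + (1 + cmod z) / dl) / (1 + cmod (q x)))"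
  by (rule mult_left_mono) simp
  also have "... = (1 + (1 + cmod z) / dl) * (norm (ph x) / (1 + cmod (q x)))" by simp
  finally have "norm (ph x / (q x - z)) <= (1 + (1 + cmod z) / dl) * (norm (ph x) / (1 + cmod (q x)))"
  by (simp add: norm_divide)
  then show ?thesis unfolding real_norm_def by (rule order.trans[OF _ abs_ge_self])
  qed simp
 qed
qed measurable

text \<open>The difference quotient of the kernel is 1/((q - w)(q - z)). For |w - z| < dl/2 it is
  dominated by 2/dl times |1/(q - z)|, so differentiation under the integral follows by dominated
  convergence along sequences.\<close>

lemma cauchy_transform_holomorphic:
 fixes q ph :: "'a => complex"
 assumes "open D" and [measurable]: "q : bmeas M" "ph : bmeas M"
  and int: "integrable M (%x. norm (ph x) / (1 + cmod (q x)))"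
  and sep: "!!z. z : D ==> EX dl>0. AE x in M. ph x = 0 \<or> dl <= cmod (q x - z)"
 shows "(%z. \<integral>x. ph x / (q x - z) \<partial>M) holomorphic_on D"
proof (rule holomorphic_onI)
 fix z assume z: "z : D"
 then obtain dl where dl: "dl > 0" "AE x in M. ph x = 0 \<or> dl <= cmod (q x - z)" using sep by blast
 define F where "F = (%z. \<integral>x. ph x / (q x - z) \<partial>M)"
 define F' where "F' = (\<integral>x. ph x / (q x - z)^2 \<partial>M)"
 have near: "AE x in M. ph x = 0 \<or> dl/2 <= cmod (q x - w)" if "cmod (w - z) < dl/2" for w
  using dl(2)
 proof eventually_elim
  case (elim x)
  then show ?case using that norm_triangle_ineq2[of "q x - z" "w - z"] by (auto simp: algebra_simps)
 qed
 have intz: "integrable M (%x. ph x / (q x - w))" if "cmod (w - z) < dl/2" for w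
  by (rule integrable_cauchy_kernel[OF _ _ int _ near[OF that]]) (use dl in auto)
 have "((%w. (F w - F z) / (w - z)) \<longlongrightarrow> F') (at z)"
  unfolding tendsto_at_iff_sequentially o_def
 proof (intro allI impI)
  fix w :: "nat => complex" assume w: "ALL i. w i : UNIV - {z}" "w \<longlonglongrightarrow> z"
  have "eventually (%i. cmod (w i - z) < dl/2) sequentially"
  using tendstoD[OF w(2), of "dl/2"] dl(1) by (simp add: dist_norm)
  then obtain N where N: "!!i. i >= N ==> cmod (w i - z) < dl/2" by (auto simp: eventually_sequentially)
  have "(%i. \<integral>x. ph x / ((q x - w (i + N)) * (q x - z)) \<partial>M) \<longlonglongrightarrow> F'"
  unfolding F'_def
  proof (rule integral_dominated_convergence[where w = "%x. (1/(dl/2)) * norm (ph x / (q x - z))"])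
  show "integrable M (%x. 1 / (dl/2) * norm (ph x / (q x - z)))"
  using intz[of z] dl(1) by simp
  show "AE x in M. (%i. ph x / ((q x - w (i + N)) * (q x - z))) \<longlonglongrightarrow> ph x / (q x - z)^2"
  using dl(2)
  proof eventually_elim
  case (elim x)
  show ?case
  proof (cases "ph x = 0")
  case False
  then have ne: "q x - z ~= 0" using elim dl(1) by auto
  have "(%i. w (i + N)) \<longlonglongrightarrow> z" using w(2) by (rule LIMSEQ_ignore_initial_segment)
  then show ?thesis unfolding power2_eq_square using ne by (intro tendsto_intros) auto
  qed simp
  qed
  show "AE x in M. norm (ph x / ((q x - w (i + N)) * (q x - z))) <= 1 / (dl/2) * norm (ph x / (q x - z))" for i
  using near[OF N[OF le_add2], of i]
  proof eventually_elim
  case (elim x)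
  show ?case
  proof (cases "ph x = 0")
  case False
  then have d: "dl/2 <= cmod (q x - w (i + N))" using elim by auto
  have "norm (ph x / ((q x - w (i + N)) * (q x - z))) = 1 / cmod (q x - w (i+N)) * norm (ph x / (q x - z))"
  by (simp add: norm_divide norm_mult)
  also have "... <= 1 / (dl/2) * norm (ph x / (q x - z))"
  by (intro mult_right_mono divide_left_mono mult_pos_pos) (use dl(1) d order.strict_trans2[OF _ d] in auto)
  finally show ?thesis .
  qed simp
  qed
  qed auto
  moreover have "(F (w (i + N)) - F z) / (w (i + N) - z) = (\<integral>x. ph x / ((q x - w (i + N)) * (q x - z)) \<partial>M)" for i
  proof -
  have ne: "w (i + N) - z ~= 0" using w(1) by auto
  have "F (w (i + N)) - F z = (\<integral>x. ph x / (q x - w (i+N)) - ph x / (q x - z) \<partial>M)"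
  unfolding F_def using intz[of z] intz[OF N[OF le_add2]] dl(1) by simp
  also have "... = (\<integral>x. (w (i+N) - z) * (ph x / ((q x - w (i + N)) * (q x - z))) \<partial>M)"
  proof (rule integral_cong_AE)
  show "AE x in M. ph x / (q x - w (i+N)) - ph x / (q x - z) = (w (i+N) - z) * (ph x / ((q x - w (i + N)) * (q x - z)))"
  using near[OF N[OF le_add2], of i] dl(2)
  proof eventually_elim
  case (elim x)
  show ?case
  proof (cases "ph x = 0")
  case False
  then have "q x - w (i+N) ~= 0" "q x - z ~= 0" using elim dl(1) by auto
  then show ?thesis by (simp add: field_simps)
  qed simp
  qed
  qed measurable
  also have "... = (w (i+N) - z) * (\<integral>x. ph x / ((q x - w (i + N)) * (q x - z)) \<partial>M)"
  by (rule integral_mult_right_zero)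
  finally show ?thesis using ne by simp
  qed
  ultimately have "(%i. (F (w (i + N)) - F z) / (w (i + N) - z)) \<longlonglongrightarrow> F'" by simp
  then show "(%i. (F (w i) - F z) / (w i - z)) \<longlonglongrightarrow> F'" by (rule LIMSEQ_offset)
 qed
 then have "(F has_field_derivative F') (at z)" by (simp add: has_field_derivative_iff)
 then show "F field_differentiable at z within D"
  using field_differentiable_at_within field_differentiable_def by blast
qed

section \<open>Cauchy's theorem on the two sides of an almost straight arc\<close>

lemma set_lebesgue_FTC:
 fixes F f :: "real => complex"
 assumes "a <= b" "!!t. t : {a..b} ==> (F has_vector_derivative f t) (at t)" "continuous_on {a..b} f"
 shows "set_integrable lebesgue {a..b} f & (LINT t:{a..b}|lebesgue. f t) = F b - F a"
proof
 show i: "set_integrable lebesgue {a..b} f"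
  using absolutely_integrable_continuous_real[OF assms(3)] .
 have "(f has_integral (F b - F a)) {a..b}"
  using assms(1,2) by (intro fundamental_theorem_of_calculus) (auto intro: has_vector_derivative_at_within)
 then show "(LINT t:{a..b}|lebesgue. f t) = F b - F a"
  using set_lebesgue_integral_eq_integral(2)[OF i] by (simp add: integral_unique)
qed

lemma integrable_indicator_Icc:
 fixes x y c :: real shows "integrable lebesgue (%t. indicat_real {x..y} t *\<^sub>R c)"
 by (intro integrable_scaleR_left integrable_real_indicator) (auto simp: emeasure_lborel_Icc_eq)

text \<open>An arc in normal position: base parameter and base point moved to 0, image divided by
  the tangent. The constant 1/4 makes real parts grow at rate at least 3/4 and imaginary parts vary
  at rate at most 1/4, so the arc is a graph over the real axis with slope at most 1/3.\<close>

locale flat_arc =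
 fixes bt bt' :: "real => complex" and d :: real
 assumes d: "0 < d" and beta0: "bt 0 = 0"
  and flat: "!!s t. s : {-d..d} ==> t : {-d..d} ==> cmod (bt s - bt t - of_real (s - t)) <= \<bar>s - t\<bar> / 4"
  and deriv: "!!t. t : {-d<..<d} ==> (bt has_vector_derivative bt' t) (at t)"
  and cont: "continuous_on {-d<..<d} bt'"
begin

text \<open>The real parts of the arc cover |x| <= 3d/4, so every vertical line of the strip meets
  the arc in exactly one point and the quantifier over t fixes a single lower bound. The height 2d
  leaves room above the horizontal line at height d used for integration.\<close>

definition above :: "complex set" where
 "above = {w. \<bar>Re w\<bar> < 3*d/4 & Im w < 2*d & (ALL t:{-d..d}. Re w = Re (bt t) --> Im (bt t) < Im w)}"

lemma Re_diff: "s : {-d..d} ==> t : {-d..d} ==> \<bar>Re (bt s) - Re (bt t) - (s - t)\<bar> <= \<bar>s - t\<bar> / 4"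
 using flat[of s t] abs_Re_le_cmod[of "bt s - bt t - of_real (s - t)"] by simp

lemma Im_diff: "s : {-d..d} ==> t : {-d..d} ==> \<bar>Im (bt s) - Im (bt t)\<bar> <= \<bar>s - t\<bar> / 4"
 using flat[of s t] abs_Im_le_cmod[of "bt s - bt t - of_real (s - t)"] by simp

lemma Im_diff_Re:
 assumes "s : {-d..d}" "t : {-d..d}" shows "\<bar>Im (bt s) - Im (bt t)\<bar> <= \<bar>Re (bt s) - Re (bt t)\<bar> / 3"
 using Re_diff[OF assms] Im_diff[OF assms] by (simp add: abs_if split: if_splits)

lemma Re_inj:
 assumes "s : {-d..d}" "t : {-d..d}" "Re (bt s) = Re (bt t)" shows "s = t"
 using Re_diff[OF assms(1,2)] assms(3) by (simp add: abs_if split: if_splits)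

lemma abs_Re_le: "t : {-d..d} ==> \<bar>Re (bt t)\<bar> <= 5/4 * \<bar>t\<bar>" and abs_Re_ge: "t : {-d..d} ==> \<bar>Re (bt t)\<bar> >= 3/4 * \<bar>t\<bar>"
 and abs_Im_le: "t : {-d..d} ==> \<bar>Im (bt t)\<bar> <= \<bar>t\<bar> / 4"
 using Re_diff[of t 0] Im_diff[of t 0] d beta0 by (simp_all add: abs_if split: if_splits)

lemma continuous_beta: "continuous_on {-d..d} bt"
proof (rule continuous_on_iff[THEN iffD2], intro ballI allI impI)
 fix t e :: real assume te: "t : {-d..d}" "e > 0"
 show "EX dl>0. ALL s:{-d..d}. dist s t < dl --> dist (bt s) (bt t) < e"
 proof (intro exI[of _ "e/2"] conjI ballI impI)
  fix s assume s: "s : {-d..d}" "dist s t < e/2"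
  have "cmod (bt s - bt t) <= cmod (bt s - bt t - of_real (s - t)) + \<bar>s - t\<bar>"
  using norm_triangle_ineq[of "bt s - bt t - of_real (s - t)" "of_real (s - t)"]
  by (simp del: of_real_diff)
  also have "... <= 5/4 * \<bar>s - t\<bar>" using flat[OF s(1) te(1)] by simp
  also have "... < e" using s(2) te(2) by (simp add: dist_real_def)
  finally show "dist (bt s) (bt t) < e" by (simp add: dist_norm)
 qed (use te in auto)
qed

lemma Re_surj: assumes "\<bar>x\<bar> <= 3*d/4" shows "EX t:{-d..d}. Re (bt t) = x"
proof -
 have "Re (bt (-d)) <= x" "x <= Re (bt d)"
  using Re_diff[of "-d" 0] Re_diff[of d 0] d beta0 assms by (simp_all add: abs_if split: if_splits)
 then have "EX t>=-d. t <= d & Re (bt t) = x"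
  using d continuous_on_Re[OF continuous_beta] by (intro IVT') auto
 then show ?thesis by auto
qed

lemma open_above: "open above"
proof (rule openI)
 fix w assume w: "w : above"
 then obtain t0 where t0: "t0 : {-d..d}" "Re (bt t0) = Re w" using Re_surj[of "Re w"] unfolding above_def by force
 \<comment> \<open>Half of the vertical gap suffices: the point drops by less than r while the arc
   rises by less than r/3.\<close>
 define r where "r = min (3*d/4 - \<bar>Re w\<bar>) (min (2*d - Im w) ((Im w - Im (bt t0))/2))"
 have gap: "Im (bt t0) < Im w" using w t0 by (auto simp: above_def)
 have r0: "r > 0" using w gap by (auto simp: above_def r_def)
 have r1: "r <= 3*d/4 - \<bar>Re w\<bar>" "r <= 2*d - Im w" "r <= (Im w - Im (bt t0))/2" by (auto simp: r_def min_def)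
 show "EX e>0. ball w e <= above"
 proof (intro exI conjI subsetI)
  fix w' assume "w' : ball w r"
  then have dd: "cmod (w' - w) < r" by (simp add: dist_norm norm_minus_commute)
  have 1: "\<bar>Re w' - Re w\<bar> < r" "\<bar>Im w' - Im w\<bar> < r"
  using dd abs_Re_le_cmod[of "w' - w"] abs_Im_le_cmod[of "w' - w"] by auto
  have "Im (bt t) < Im w'" if "t : {-d..d}" "Re w' = Re (bt t)" for t
  proof -
  have "Im (bt t) - Im (bt t0) <= \<bar>Re w' - Re w\<bar> / 3"
  using abs_le_D1[OF Im_diff_Re[OF that(1) t0(1)]] that(2) t0(2) by simp
  moreover have "Im w - Im w' < r" using 1(2) by (simp add: abs_if split: if_splits)
  ultimately show ?thesis using 1(1) r1(3) gap by (simp add: field_simps)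
  qed
  then show "w' : above" unfolding above_def using 1 r1 by auto
 qed (rule r0)
qed

text \<open>The region need not be convex, but it is star-shaped about i d, which is enough for a
  primitive. On the segment from w to i d, a low w (height at most 3d/4) gains height (1-s)(d - Im
  w) >= (1-s) d/4, while the arc, having slope at most 1/3 over a horizontal shift of at most (1-s)
  3d/4, rises by at most (1-s) d/4. From a higher w the segment stays above 3d/4, whereas the arc
  stays below d/4.\<close>

lemma starlike_above: "starlike above"
 unfolding starlike_def
proof (intro bexI ballI subsetI)
 have "Im (bt t) < d" if "t : {-d..d}" for t using abs_Im_le[OF that] that d by auto
 then show c: "Complex 0 d : above" unfolding above_def using d by auto
 fix w p assume w: "w : above" and p: "p : closed_segment (Complex 0 d) w"
 then obtain s where s: "0 <= s" "s <= 1" "p = (1 - s) *\<^sub>R Complex 0 d + s *\<^sub>R w"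
  by (auto simp: closed_segment_def)
 have p1: "Re p = s * Re w" "Im p = (1 - s) * d + s * Im w" using s by auto
 obtain tw where tw: "tw : {-d..d}" "Re (bt tw) = Re w" using Re_surj[of "Re w"] w unfolding above_def by force
 have w1: "\<bar>Re w\<bar> < 3*d/4" "Im w < 2*d" "Im (bt tw) < Im w" using w tw by (auto simp: above_def)
 have "s * \<bar>Re w\<bar> <= 1 * \<bar>Re w\<bar>" using s by (intro mult_right_mono) auto
 then have a: "\<bar>Re p\<bar> < 3*d/4" using w1 s by (simp add: p1 abs_mult)
 have b: "Im p < 2*d"
 proof -
  have "s * Im w <= s * (2*d)" using s w1 by (intro mult_left_mono) auto
  moreover have "(1 - s) * d <= (1-s) * (2*d)" using s d by (intro mult_left_mono) auto
  ultimately have "Im p <= 2 * d" by (simp add: p1 algebra_simps)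
  moreover have "Im p ~= 2*d"
  proof
  assume e: "Im p = 2*d"
  show False
  proof (cases "s = 0")
  case True then show False using e p1 d by simp
  next
  case False
  then have "s * Im w < s * (2*d)" using s w1 by (intro mult_strict_left_mono) auto
  with \<open>(1 - s) * d <= (1-s) * (2*d)\<close> e p1 show False by (simp add: algebra_simps)
  qed
  qed
  ultimately show ?thesis by simp
 qed
 have c: "Im (bt t) < Im p" if t: "t : {-d..d}" "Re p = Re (bt t)" for t
 proof (cases "Im w <= 3*d/4")
  case True
  have "Re (bt t) - Re (bt tw) = - ((1-s) * Re w)"
  using t tw p1 by (simp add: algebra_simps)
  then have "\<bar>Re (bt t) - Re (bt tw)\<bar> = (1-s) * \<bar>Re w\<bar>"
  using s by (simp only: abs_minus_cancel abs_mult)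
  also have "... <= (1-s) * (3*d/4)" using s w1 by (intro mult_left_mono) auto
  finally have "\<bar>Re (bt t) - Re (bt tw)\<bar> / 3 <= (1-s) * (3*d/4) / 3" by (rule divide_right_mono) simp
  from order.trans[OF abs_le_D1[OF Im_diff_Re[OF t(1) tw(1)]] this]
  have "Im (bt t) <= Im (bt tw) + (1-s) * (3*d/4) / 3" by (simp only: diff_le_eq add.commute)
  also have "... < Im w + (1-s) * (3*d/4) / 3" using w1 by simp
  also have "... <= Im p"
  proof -
  have "(1-s) * (d/4) <= (1-s) * (d - Im w)" using True s by (intro mult_left_mono) auto
  then have "(1-s) * (d/4) <= (1-s) * d - (1-s) * Im w" by (simp only: right_diff_distrib)
  moreover have "(1-s) * Im w = Im w - s * Im w" by (simp add: left_diff_distrib)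
  moreover have "(1-s) * (3*d/4) / 3 = (1-s) * (d/4)" by simp
  ultimately show ?thesis unfolding p1(2) by linarith
  qed
  finally show ?thesis .
 next
  case False
  have "s * Im w >= s * (3*d/4)" using s False by (intro mult_left_mono) auto
  moreover have "(1-s) * d >= (1-s) * (3*d/4)" using s d by (intro mult_left_mono) auto
  moreover have "(1-s) * (3*d/4) + s * (3*d/4) = 3*d/4" by (simp only: distrib_right[symmetric] diff_add_cancel mult_1_left)
  ultimately have "Im p >= 3*d/4" unfolding p1(2) by linarith
  then show ?thesis using abs_Im_le[OF t(1)] t(1) d by auto
 qed
 show "p : above" unfolding above_def using a b c by auto
qed

lemma vertical_shift_in_above:
 assumes "t : {-d/2..d/2}" "0 < ep" "ep < d" shows "bt t + \<i> * of_real ep : above"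
proof -
 have t: "t : {-d..d}" using assms(1) d by auto
 have "\<bar>Re (bt t)\<bar> <= 5/4 * (d/2)" using abs_Re_le[OF t] assms(1) by auto
 moreover have "\<bar>Im (bt t)\<bar> <= d/4" using abs_Im_le[OF t] assms(1) by auto
 moreover have "Im (bt s) < Im (bt t) + ep" if "s : {-d..d}" "Re (bt t) = Re (bt s)" for s
  using Re_inj[OF that(1) t] that assms(2) by auto
 ultimately show ?thesis using assms d by (auto simp: above_def)
qed

text \<open>A primitive K of k exists on the star-shaped region. The fundamental theorem along the
  arc lifted by ep, the top side and the two vertical sides gives four differences of K that cancel.
  As ep tends to 0, boundedness of k is the domination, which is why boundary values along almost
  every vertical suffice. The parameter range is halved so that the lifted arc stays inside the
  strip.\<close>

lemma integral_above:
 fixes k :: "complex => complex"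
 defines "a \<equiv> d/2"
 assumes hol: "k holomorphic_on above" and bd0: "ALL w:above. norm (k w) <= N"
  and [measurable]: "kp : bmeas lebesgue"
  and lim: "AE t in lebesgue. t : {-a..a} --> ((%ep. k (bt t + \<i> * of_real ep)) \<longlongrightarrow> kp t) (at_right 0)"
 shows "(LINT t:{-a..a}|lebesgue. kp t * bt' t) =
  (LINT x:{Re (bt (-a))..Re (bt a)}|lebesgue. k (Complex x d))
  - \<i> * (LINT y:{Im (bt a)<..d}|lebesgue. k (Complex (Re (bt a)) y))
  + \<i> * (LINT y:{Im (bt (-a))<..d}|lebesgue. k (Complex (Re (bt (-a))) y))"
  and "set_integrable lebesgue {-a..a} (%t. kp t * bt' t)"
  and "set_integrable lebesgue {Re (bt (-a))..Re (bt a)} (%x. k (Complex x d))"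
  and "t : {-a, a} ==> set_integrable lebesgue {Im (bt t)<..d} (%y. k (Complex (Re (bt t)) y))"
proof -
 note bd = bd0[rule_format]
 have a: "0 < a" "a < d" "-a < a" using d by (auto simp: a_def)
 obtain K where K: "!!w. w : above ==> (K has_field_derivative k w) (at w)"
  using holomorphic_starlike_primitive[OF holomorphic_on_imp_continuous_on[OF hol] starlike_above open_above finite.emptyI]
  hol open_above by (auto simp: holomorphic_on_open field_differentiable_def)
 have contk: "continuous_on above k" by (rule holomorphic_on_imp_continuous_on[OF hol])
 have shift: "bt t + \<i> * of_real ep : above" if "t : {-a..a}" "0 < ep" "ep < d" for t ep
  using vertical_shift_in_above[of t ep] that by (simp add: a_def)
 have top: "Complex x d : above" if "x : {Re (bt (-a))..Re (bt a)}" for x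
 proof -
  have "\<bar>Re (bt a)\<bar> <= 5/8*d" "\<bar>Re (bt (-a))\<bar> <= 5/8*d" using abs_Re_le[of a] abs_Re_le[of "-a"] a by (auto simp: a_def)
  then have "\<bar>x\<bar> < 3*d/4" using that d by auto
  moreover have "Im (bt t) < d" if "t : {-d..d}" for t using abs_Im_le[OF that] that d by auto
  ultimately show ?thesis using d by (auto simp: above_def)
 qed
 have ver: "Complex (Re (bt t)) y : above" if "t : {-a, a}" "Im (bt t) < y" "y <= d" for t y
 proof -
  have t: "t : {-a..a}" using that a by auto
  have "\<bar>Im (bt t)\<bar> <= d/8" using abs_Im_le[of t] that(1) a by (auto simp: a_def)
  then have "y - Im (bt t) < 2 * d" using that(3) d by auto
  show ?thesis
  proof (cases "y - Im (bt t) < d")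
  case True
  have "bt t + \<i> * of_real (y - Im (bt t)) = Complex (Re (bt t)) y" by (simp add: complex_eq_iff)
  then show ?thesis using shift[OF t, of "y - Im (bt t)"] that True by simp
  next
  case False
  have "\<bar>Re (bt t)\<bar> <= 5/8*d" using abs_Re_le[of t] that(1) a by (auto simp: a_def)
  moreover have "Im (bt s) < y" if "s : {-d..d}" "Re (bt t) = Re (bt s)" for s
  using Re_inj[OF that(1) _ that(2)[symmetric]] t a \<open>Im (bt t) < y\<close> by auto
  ultimately show ?thesis using that d by (auto simp: above_def)
  qed
 qed
 \<comment> \<open>Dominated convergence works along sequences; the offset 4 keeps every term at
   most d/4, so that the lifted arc lies in the region from n = 0 on.\<close>
 define ep where "ep = (%n::nat. d / (real n + 4))"
 have ep4: "0 < ep n & ep n <= d/4" for n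
  unfolding ep_def using d by (intro conjI divide_pos_pos divide_left_mono) auto
 then have ep0: "0 < ep n" "ep n <= d/4" "ep n < d" for n
  using d order.strict_trans1[of "ep n" "d/4" d] by auto
 have eplim: "ep \<longlonglongrightarrow> 0" unfolding ep_def
  using LIMSEQ_ignore_initial_segment[OF lim_const_over_n[of d], of 4] by simp
 have epr: "filterlim ep (at_right 0) sequentially"
  unfolding filterlim_at using eplim ep0(1) less_imp_neq[OF ep0(1)] by auto
 have contb: "continuous_on {-a..a} bt'" by (rule continuous_on_subset[OF cont]) (use a in auto)
 have contbeta: "continuous_on {-a..a} bt" by (rule continuous_on_subset[OF continuous_beta]) (use a in auto)
 obtain L where "ALL w:bt' ` {-a..a}. norm w <= L"
  using compact_imp_bounded[OF compact_continuous_image[OF contb compact_Icc]] unfolding bounded_iff by blast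
 then have L: "!!t. t : {-a..a} ==> norm (bt' t) <= L" by blast
 have L0: "0 <= L" using order.trans[OF norm_ge_zero L[of a]] a by simp
 have N0: "0 <= N" using order.trans[OF norm_ge_zero bd[OF shift[of 0 "ep 0"]]] a ep0[of 0] by simp
 have G: "set_integrable lebesgue {-a..a} (%t. k (bt t + \<i> * of_real (ep n)) * bt' t) &
  (LINT t:{-a..a}|lebesgue. k (bt t + \<i> * of_real (ep n)) * bt' t) = K (bt a + \<i> * of_real (ep n)) - K (bt (-a) + \<i> * of_real (ep n))" for n
 proof (rule set_lebesgue_FTC)
  fix t assume t: "t : {-a..a}"
  have "((K \<circ> (%t. bt t + \<i> * of_real (ep n))) has_vector_derivative (bt' t * k (bt t + \<i> * of_real (ep n)))) (at t)"
  by (rule field_vector_diff_chain_at[OF _ K])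
  (use t a ep0 in \<open>auto intro!: derivative_eq_intros deriv shift\<close>)
  then show "((%t. K (bt t + \<i> * of_real (ep n))) has_vector_derivative (k (bt t + \<i> * of_real (ep n)) * bt' t)) (at t)"
  by (simp add: o_def mult.commute)
 next
  show "continuous_on {-a..a} (%t. k (bt t + \<i> * of_real (ep n)) * bt' t)"
  by (intro continuous_intros continuous_on_compose2[OF contk] contb contbeta) (use ep0 in \<open>auto intro!: shift\<close>)
 qed (use a in auto)
 have T: "set_integrable lebesgue {Re (bt (-a))..Re (bt a)} (%x. k (Complex x d)) &
  (LINT x:{Re (bt (-a))..Re (bt a)}|lebesgue. k (Complex x d)) = K (Complex (Re (bt a)) d) - K (Complex (Re (bt (-a))) d)"
 proof (rule set_lebesgue_FTC)
  show "Re (bt (-a)) <= Re (bt a)" using Re_diff[of a "-a"] a by (simp add: abs_if split: if_splits)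
  show "continuous_on {Re (bt (-a))..Re (bt a)} (%x. k (Complex x d))"
  by (intro continuous_on_compose2[OF contk] continuous_intros) (use top in auto)
  fix x assume x: "x : {Re (bt (-a))..Re (bt a)}"
  have "((K \<circ> (%x. of_real x + \<i> * of_real d)) has_vector_derivative (1 * k (of_real x + \<i> * of_real d))) (at x)"
  by (rule field_vector_diff_chain_at[OF _ K])
  (use top[OF x] in \<open>auto intro!: derivative_eq_intros simp: Complex_eq\<close>)
  then show "((%x. K (Complex x d)) has_vector_derivative k (Complex x d)) (at x)"
  by (simp add: o_def Complex_eq)
 qed
 have V: "set_integrable lebesgue {Im (bt t) + ep n..d} (%y. \<i> * k (Complex (Re (bt t)) y)) &
  (LINT y:{Im (bt t) + ep n..d}|lebesgue. \<i> * k (Complex (Re (bt t)) y)) = K (Complex (Re (bt t)) d) - K (bt t + \<i> * of_real (ep n))"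
  if t: "t : {-a,a}" for t n
 proof -
  have eq: "bt t + \<i> * of_real (ep n) = Complex (Re (bt t)) (Im (bt t) + ep n)" by (simp add: complex_eq_iff)
  show ?thesis unfolding eq
  proof (rule set_lebesgue_FTC)
  show "Im (bt t) + ep n <= d" using abs_Im_le[of t] t a ep0(2)[of n] by (auto simp: a_def)
  show "continuous_on {Im (bt t) + ep n..d} (%y. \<i> * k (Complex (Re (bt t)) y))"
  by (intro continuous_on_compose2[OF contk] continuous_intros)
  (use ver[OF t] ep0[of n] in \<open>force\<close>)
  fix y assume y: "y : {Im (bt t) + ep n..d}"
  have "((K \<circ> (%y. of_real (Re (bt t)) + \<i> * of_real y)) has_vector_derivative (\<i> * k (of_real (Re (bt t)) + \<i> * of_real y))) (at y)"
  by (rule field_vector_diff_chain_at[OF _ K])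
  (use ver[OF t, of y] y ep0[of n] in \<open>auto intro!: derivative_eq_intros simp: Complex_eq\<close>)
  then show "((%y. K (Complex (Re (bt t)) y)) has_vector_derivative \<i> * k (Complex (Re (bt t)) y)) (at y)"
  by (simp add: o_def Complex_eq)
  qed
 qed
 have eq: "(LINT t:{-a..a}|lebesgue. k (bt t + \<i> * of_real (ep n)) * bt' t) =
  (LINT x:{Re (bt (-a))..Re (bt a)}|lebesgue. k (Complex x d))
  - (LINT y:{Im (bt a) + ep n..d}|lebesgue. \<i> * k (Complex (Re (bt a)) y))
  + (LINT y:{Im (bt (-a)) + ep n..d}|lebesgue. \<i> * k (Complex (Re (bt (-a))) y))" for n
  using G[of n] T V[of a n] V[of "-a" n] by simp
 have [measurable]: "(%t. indicator {-a..a} t *\<^sub>R bt' t) : bmeas lebesgue"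
  by (intro measurable_completion) (simp add: borel_measurable_continuous_on_indicator[OF _ contb])
 have meq: "(%t. indicator {-a..a} t *\<^sub>R (kp t * bt' t)) = (%t. kp t * (indicator {-a..a} t *\<^sub>R bt' t))" by auto
 have m1: "(%t. indicator {-a..a} t *\<^sub>R (kp t * bt' t)) : bmeas lebesgue"
  unfolding meq by measurable
 note fin = integrable_indicator_Icc
 have aeG: "AE t in lebesgue. (%n. indicator {-a..a} t *\<^sub>R (k (bt t + \<i> * of_real (ep n)) * bt' t)) \<longlonglongrightarrow> indicator {-a..a} t *\<^sub>R (kp t * bt' t)"
  using lim
 proof eventually_elim
  case (elim t)
  show ?case
  proof (cases "t : {-a..a}")
  case True
  then have "(%n. k (bt t + \<i> * of_real (ep n))) \<longlonglongrightarrow> kp t"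
  using filterlim_compose[OF _ epr] elim by blast
  then show ?thesis by (intro tendsto_intros)
  qed simp
 qed
 have bdG: "AE t in lebesgue. norm (indicator {-a..a} t *\<^sub>R (k (bt t + \<i> * of_real (ep n)) * bt' t)) <= indicator {-a..a} t *\<^sub>R (N * L)" for n
  by (rule AE_I2) (auto split: split_indicator simp: norm_mult intro!: mult_mono bd shift ep0 L N0)
 have mG: "(%t. indicator {-a..a} t *\<^sub>R (k (bt t + \<i> * of_real (ep n)) * bt' t)) : bmeas lebesgue" for n
  using G[of n] unfolding set_integrable_def by (blast intro: borel_measurable_integrable)
 note dcG = integrable_dominated_convergence[OF m1 mG fin aeG bdG] integral_dominated_convergence[OF m1 mG fin aeG bdG]
 have V': "set_integrable lebesgue {Im (bt t)<..d} (%y. \<i> * k (Complex (Re (bt t)) y)) &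
  (%n. LINT y:{Im (bt t) + ep n..d}|lebesgue. \<i> * k (Complex (Re (bt t)) y)) \<longlonglongrightarrow> (LINT y:{Im (bt t)<..d}|lebesgue. \<i> * k (Complex (Re (bt t)) y))"
  if t: "t : {-a,a}" for t
 proof -
  let ?f = "%y. \<i> * k (Complex (Re (bt t)) y)"
  have mV: "(%y. indicator {Im (bt t) + ep n..d} y *\<^sub>R ?f y) : bmeas lebesgue" for n
  using V[OF t, of n] unfolding set_integrable_def by (blast intro: borel_measurable_integrable)
  have lV: "(%n. indicator {Im (bt t) + ep n..d} y *\<^sub>R ?f y) \<longlonglongrightarrow> indicator {Im (bt t)<..d} y *\<^sub>R ?f y" for y
  proof (cases "Im (bt t) < y")
  case True
  have "eventually (%n. ep n < y - Im (bt t)) sequentially"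
  using order_tendstoD(2)[OF eplim] True by simp
  then have "eventually (%n. indicator {Im (bt t) + ep n..d} y *\<^sub>R ?f y = indicator {Im (bt t)<..d} y *\<^sub>R ?f y) sequentially"
  by eventually_elim (use True in \<open>auto split: split_indicator\<close>)
  then show ?thesis by (rule tendsto_eventually)
  next
  case False
  have "indicat_real {Im (bt t) + ep n..d} y = 0" "indicat_real {Im (bt t)<..d} y = 0" for n
  using False ep0(1)[of n] by (auto split: split_indicator)
  then show ?thesis by simp
  qed
  have m2: "(%y. indicator {Im (bt t)<..d} y *\<^sub>R ?f y) : bmeas lebesgue"
  by (rule borel_measurable_LIMSEQ_metric[OF mV lV])
  have bV: "AE y in lebesgue. norm (indicator {Im (bt t) + ep n..d} y *\<^sub>R ?f y) <= indicator {Im (bt t)..d} y *\<^sub>R N" for n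
  proof (rule AE_I2)
  fix y
  show "norm (indicator {Im (bt t) + ep n..d} y *\<^sub>R ?f y) <= indicator {Im (bt t)..d} y *\<^sub>R N"
  using bd[OF ver[OF t, of y]] ep0(1)[of n] N0 by (auto split: split_indicator simp: norm_mult)
  qed
  have lV': "AE y in lebesgue. (%n. indicator {Im (bt t) + ep n..d} y *\<^sub>R ?f y) \<longlonglongrightarrow> indicator {Im (bt t)<..d} y *\<^sub>R ?f y"
  using lV by simp
  show ?thesis unfolding set_integrable_def set_lebesgue_integral_def
  using integrable_dominated_convergence[OF m2 mV fin lV' bV] integral_dominated_convergence[OF m2 mV fin lV' bV] by simp
 qed
 show "set_integrable lebesgue {-a..a} (%t. kp t * bt' t)" using dcG(1) unfolding set_integrable_def .
 show "set_integrable lebesgue {Re (bt (-a))..Re (bt a)} (%x. k (Complex x d))" using T by simp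
 show "set_integrable lebesgue {Im (bt t)<..d} (%y. k (Complex (Re (bt t)) y))" if "t : {-a, a}"
  using V'[OF that] set_integrable_mult_right[of "\<i>" lebesgue "{Im (bt t)<..d}" "%y. k (Complex (Re (bt t)) y)"]
  set_integrable_mult_right[of "-\<i>" lebesgue "{Im (bt t)<..d}" "%y. \<i> * k (Complex (Re (bt t)) y)"] by simp
 have "(%n. LINT t:{-a..a}|lebesgue. k (bt t + \<i> * of_real (ep n)) * bt' t) \<longlonglongrightarrow> (LINT t:{-a..a}|lebesgue. kp t * bt' t)"
  using dcG(2) unfolding set_lebesgue_integral_def .
 moreover have "(%n. LINT t:{-a..a}|lebesgue. k (bt t + \<i> * of_real (ep n)) * bt' t) \<longlonglongrightarrow>
  (LINT x:{Re (bt (-a))..Re (bt a)}|lebesgue. k (Complex x d))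
  - (LINT y:{Im (bt a)<..d}|lebesgue. \<i> * k (Complex (Re (bt a)) y))
  + (LINT y:{Im (bt (-a))<..d}|lebesgue. \<i> * k (Complex (Re (bt (-a))) y))"
  unfolding eq using V'[of a] V'[of "-a"] by (intro tendsto_intros) auto
 ultimately have "(LINT t:{-a..a}|lebesgue. kp t * bt' t) = (LINT x:{Re (bt (-a))..Re (bt a)}|lebesgue. k (Complex x d))
  - (LINT y:{Im (bt a)<..d}|lebesgue. \<i> * k (Complex (Re (bt a)) y))
  + (LINT y:{Im (bt (-a))<..d}|lebesgue. \<i> * k (Complex (Re (bt (-a))) y))"
  by (rule LIMSEQ_unique)
 then show "(LINT t:{-a..a}|lebesgue. kp t * bt' t) =
  (LINT x:{Re (bt (-a))..Re (bt a)}|lebesgue. k (Complex x d))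
  - \<i> * (LINT y:{Im (bt a)<..d}|lebesgue. k (Complex (Re (bt a)) y))
  + \<i> * (LINT y:{Im (bt (-a))<..d}|lebesgue. k (Complex (Re (bt (-a))) y))"
  by simp
qed

definition below :: "complex set" where
 "below = {w. \<bar>Re w\<bar> < 3*d/4 & -2*d < Im w & (ALL t:{-d..d}. Re w = Re (bt t) --> Im w < Im (bt t))}"

text \<open>Complex conjugation exchanges the two sides of the arc, so everything about the lower
  side is obtained by reflection.\<close>

lemma flat_arc_cnj: "flat_arc (%t. cnj (bt t)) (%t. cnj (bt' t)) d"
proof
 fix t assume t: "t : {-d<..<d}"
 show "((%t. cnj (bt t)) has_vector_derivative cnj (bt' t)) (at t)"
  by (rule bounded_linear.has_vector_derivative[OF bounded_linear_cnj deriv[OF t]])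
next
 fix s t assume st: "s : {-d..d}" "t : {-d..d}"
 have "cnj (bt s) - cnj (bt t) - of_real (s - t) = cnj (bt s - bt t - of_real (s - t))" by simp
 then show "cmod (cnj (bt s) - cnj (bt t) - of_real (s - t)) <= \<bar>s - t\<bar> / 4"
  using flat[OF st] by (simp only: complex_mod_cnj)
qed (use d beta0 cont in \<open>auto intro!: continuous_intros\<close>)

lemma above_cnj: "flat_arc.above (%t. cnj (bt t)) d = cnj ` below"
proof -
 have "w : flat_arc.above (%t. cnj (bt t)) d \<longleftrightarrow> cnj w : below" for w
  unfolding flat_arc.above_def[OF flat_arc_cnj] below_def by (auto simp: minus_less_iff less_minus_iff)
 then show ?thesis by (force simp: image_iff)
qed

end

lemma LINT_reflect:
 fixes f :: "real => complex"
 shows "(LINT x:{-b..<-a}|lebesgue. f x) = (LINT x:{a<..b}|lebesgue. f (-x))"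
  and "set_integrable lebesgue {-b..<-a} f \<longleftrightarrow> set_integrable lebesgue {a<..b} (%x. f (-x))"
proof -
 have ind: "indicator {-b..<-a} (-x) = (indicator {a<..b} x :: real)" for x :: real
  by (auto simp: indicator_def)
 show "(LINT x:{-b..<-a}|lebesgue. f x) = (LINT x:{a<..b}|lebesgue. f (-x))"
  unfolding set_lebesgue_integral_def
  using lebesgue_integral_real_affine[of "-1" "%x. indicator {-b..<-a} x *\<^sub>R f x" 0] by (simp add: ind)
 show "set_integrable lebesgue {-b..<-a} f \<longleftrightarrow> set_integrable lebesgue {a<..b} (%x. f (-x))"
  unfolding set_integrable_def
  using lebesgue_integrable_real_affine_iff[of "-1" "%x. indicator {-b..<-a} x *\<^sub>R f x" 0] by (simp add: ind)
qed

context flat_arc begin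

text \<open>The upper formula for w -> cnj(k(cnj w)) along the conjugate arc, conjugated back.
  Conjugation turns i into -i, which reverses the signs of the vertical sides, and reflects their
  intervals.\<close>

lemma integral_below:
 fixes k :: "complex => complex"
 defines "a \<equiv> d/2"
 assumes hol: "k holomorphic_on below" and bd: "ALL w:below. norm (k w) <= N"
  and km[measurable]: "km : bmeas lebesgue"
  and lim: "AE t in lebesgue. t : {-a..a} --> ((%ep. k (bt t - \<i> * of_real ep)) \<longlongrightarrow> km t) (at_right 0)"
 shows "(LINT t:{-a..a}|lebesgue. km t * bt' t) =
  (LINT x:{Re (bt (-a))..Re (bt a)}|lebesgue. k (Complex x (-d)))
  + \<i> * (LINT y:{-d..<Im (bt a)}|lebesgue. k (Complex (Re (bt a)) y))
  - \<i> * (LINT y:{-d..<Im (bt (-a))}|lebesgue. k (Complex (Re (bt (-a))) y))"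
  and "set_integrable lebesgue {-a..a} (%t. km t * bt' t)"
  and "set_integrable lebesgue {Re (bt (-a))..Re (bt a)} (%x. k (Complex x (-d)))"
  and "t : {-a, a} ==> set_integrable lebesgue {-d..<Im (bt t)} (%y. k (Complex (Re (bt t)) y))"
proof -
 interpret R: flat_arc "%t. cnj (bt t)" "%t. cnj (bt' t)" d by (rule flat_arc_cnj)
 have ob: "open (cnj ` below)" using R.open_above by (simp add: above_cnj)
 define k' where "k' = (%w. cnj (k (cnj w)))"
 have 1: "k' holomorphic_on R.above" unfolding k'_def above_cnj
  using holomorphic_on_compose_cnj_cnj[OF _ ob, of k] hol by (simp add: o_def image_image)
 have 2: "ALL w:R.above. norm (k' w) <= N"
  using bd by (auto simp: above_cnj k'_def)
 have 3: "(%t. cnj (km t)) : bmeas lebesgue"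
  by (rule measurable_compose[OF km]) (intro borel_measurable_continuous_onI continuous_intros)
 have 4: "AE t in lebesgue. t : {-(d/2)..d/2} --> ((%ep. k' (cnj (bt t) + \<i> * of_real ep)) \<longlongrightarrow> cnj (km t)) (at_right 0)"
  using lim unfolding k'_def a_def by eventually_elim (auto intro!: tendsto_cnj)
 note R = R.integral_above[OF 1 2 3 4, folded a_def]
 have icnj: "set_integrable lebesgue S (%x. cnj (g x)) \<longleftrightarrow> set_integrable lebesgue S g" for S and g :: "real => complex"
  unfolding set_integrable_def
  using integrable_bounded_linear[OF bounded_linear_cnj, of lebesgue "%x. indicat_real S x *\<^sub>R g x"]
  integrable_bounded_linear[OF bounded_linear_cnj, of lebesgue "%x. indicat_real S x *\<^sub>R cnj (g x)"] by auto
 have Icnj: "(LINT x:S|lebesgue. cnj (g x)) = cnj (LINT x:S|lebesgue. g x)" for S and g :: "real => complex"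
  unfolding set_lebesgue_integral_def using Bochner_Integration.integral_cnj[of lebesgue "%x. indicat_real S x *\<^sub>R g x"] by simp
 have c: "cnj (Complex x y) = Complex x (-y)" for x y by (simp add: complex_eq_iff)
 show "set_integrable lebesgue {-a..a} (%t. km t * bt' t)"
  using R(2) icnj[of _ "%t. km t * bt' t"] by simp
 show "set_integrable lebesgue {Re (bt (-a))..Re (bt a)} (%x. k (Complex x (-d)))"
  using R(3) icnj[of _ "%x. k (Complex x (-d))"] by (simp add: k'_def c)
 show "set_integrable lebesgue {-d..<Im (bt t)} (%y. k (Complex (Re (bt t)) y))" if "t : {-a, a}"
  using R(4)[OF that] icnj[of _ "%y. k (Complex (Re (bt t)) (-y))"]
  LINT_reflect(2)[of d "- Im (bt t)" "%y. k (Complex (Re (bt t)) y)"] by (simp add: k'_def c)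
 have "cnj (LINT t:{-a..a}|lebesgue. km t * bt' t) =
  cnj (LINT x:{Re (bt (-a))..Re (bt a)}|lebesgue. k (Complex x (-d)))
  - \<i> * cnj (LINT y:{-d..<Im (bt a)}|lebesgue. k (Complex (Re (bt a)) y))
  + \<i> * cnj (LINT y:{-d..<Im (bt (-a))}|lebesgue. k (Complex (Re (bt (-a))) y))"
  using R(1) LINT_reflect(1)[of d "- Im (bt a)" "%y. k (Complex (Re (bt a)) y)"]
  LINT_reflect(1)[of d "- Im (bt (-a))" "%y. k (Complex (Re (bt (-a))) y)"]
  by (simp add: k'_def c Icnj flip: complex_cnj_mult)
 then have "cnj (cnj (LINT t:{-a..a}|lebesgue. km t * bt' t)) = cnj (
  cnj (LINT x:{Re (bt (-a))..Re (bt a)}|lebesgue. k (Complex x (-d)))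
  - \<i> * cnj (LINT y:{-d..<Im (bt a)}|lebesgue. k (Complex (Re (bt a)) y))
  + \<i> * cnj (LINT y:{-d..<Im (bt (-a))}|lebesgue. k (Complex (Re (bt (-a))) y)))"
  by (rule arg_cong)
 then show "(LINT t:{-a..a}|lebesgue. km t * bt' t) =
  (LINT x:{Re (bt (-a))..Re (bt a)}|lebesgue. k (Complex x (-d)))
  + \<i> * (LINT y:{-d..<Im (bt a)}|lebesgue. k (Complex (Re (bt a)) y))
  - \<i> * (LINT y:{-d..<Im (bt (-a))}|lebesgue. k (Complex (Re (bt (-a))) y))"
  by simp
qed

text \<open>Over the strip the arc is a graph, so a point of the box off the arc is strictly on one
  side of the unique arc point with the same real part. The bound 2d on the other side is automatic,
  since the arc has heights between -d/4 and d/4.\<close>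

lemma above_Un_below: "{w. \<bar>Re w\<bar> < 3*d/4 & \<bar>Im w\<bar> < 2*d} - bt ` {-d..d} = above Un below"
proof (intro equalityI subsetI)
 fix w assume w: "w : {w. \<bar>Re w\<bar> < 3*d/4 & \<bar>Im w\<bar> < 2*d} - bt ` {-d..d}"
 then obtain t where t: "t : {-d..d}" "Re (bt t) = Re w" using Re_surj[of "Re w"] by force
 have u: "s = t" if "s : {-d..d}" "Re w = Re (bt s)" for s using Re_inj[OF that(1) t(1)] that t by auto
 have "Im w ~= Im (bt t)" using w t by (metis (no_types, lifting) DiffD2 complex_eqI image_eqI)
 then consider "Im (bt t) < Im w" | "Im w < Im (bt t)" by linarith
 then show "w : above Un below"
 proof cases
  case 1 then have "w : above" using w u by (auto simp: above_def)
  then show ?thesis ..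
 next
  case 2 then have "w : below" using w u by (auto simp: below_def)
  then show ?thesis ..
 qed
next
 fix w assume "w : above Un below"
 then have w: "\<bar>Re w\<bar> < 3*d/4" "w ~: bt ` {-d..d}" by (auto simp: above_def below_def)
 obtain t where t: "t : {-d..d}" "Re (bt t) = Re w" using Re_surj[of "Re w"] w by force
 have "\<bar>Im (bt t)\<bar> <= d/4" using abs_Im_le[OF t(1)] t(1) d by auto
 then have b: "- (d/4) <= Im (bt t)" "Im (bt t) <= d/4" by (simp_all add: abs_le_iff)
 from \<open>w : above Un below\<close> have "- (2*d) < Im w & Im w < 2*d"
 proof
  assume "w : above"
  then have "Im w < 2*d" "Im (bt t) < Im w" using t by (auto simp: above_def)
  then show ?thesis using b d by auto
 next
  assume "w : below"
  then have "-2*d < Im w" "Im w < Im (bt t)" using t by (auto simp: below_def)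
  then show ?thesis using b d by auto
 qed
 then have "\<bar>Im w\<bar> < 2*d" by (simp add: abs_less_iff)
 then show "w : {w. \<bar>Re w\<bar> < 3*d/4 & \<bar>Im w\<bar> < 2*d} - bt ` {-d..d}" using w by auto
qed

text \<open>Cauchy's formula for the parts of a rectangle above and below the arc, added up.\<close>

proposition local_cauchy_representation:
 fixes f :: "complex => complex"
 assumes hol: "f holomorphic_on above Un below" and bd: "!!w. w : above Un below ==> norm (f w) <= M"
  and [measurable]: "fp : bmeas lebesgue" "fm : bmeas lebesgue"
  and limp: "AE t in lebesgue. t : {-d/2..d/2} --> ((%ep. f (bt t + \<i> * of_real ep)) \<longlongrightarrow> fp t) (at_right 0)"
  and limm: "AE t in lebesgue. t : {-d/2..d/2} --> ((%ep. f (bt t - \<i> * of_real ep)) \<longlongrightarrow> fm t) (at_right 0)"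
 shows "EX Ps. Ps holomorphic_on ball 0 (d/4) & (ALL z:ball 0 (d/4) - bt ` {-d..d}.
  2 * pi * \<i> * f z = Ps z + (LINT t:{-d/2..d/2}|lebesgue. (fp t - fm t) / (bt t - z) * bt' t))"
proof -
 define a where "a = d/2"
 have a: "0 < a" "a < d" using d by (auto simp: a_def)
 define D where "D = above Un below"
 have "below = cnj -` (cnj ` below)" by (auto simp: image_iff)
 then have ob: "open below"
  using open_vimage[OF flat_arc.open_above[OF flat_arc_cnj], of cnj]
  by (simp add: above_cnj continuous_on_cnj)
 have oD: "open D" unfolding D_def using open_above ob by auto
 define x0 x1 where "x0 = Re (bt (-a))" and "x1 = Re (bt a)"
 have x: "x0 <= -3/8*d" "3/8*d <= x1" "\<bar>x0\<bar> <= 5/8*d" "\<bar>x1\<bar> <= 5/8*d"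
  using Re_diff[of a 0] Re_diff[of "-a" 0] a beta0 by (auto simp: x0_def x1_def a_def abs_if split: if_splits)
 have Im_le: "\<bar>Im (bt t)\<bar> <= d/8" if "t : {-a,a}" for t using abs_Im_le[of t] that a by (auto simp: a_def)
 \<comment> \<open>Extension by 0 makes f a bounded Borel function on the plane, so the vertical
   sides can be integrated as whole intervals although they cross the arc.\<close>
 define f0 where "f0 = (%w. if w : D then f w else 0)"
 have f0m[measurable]: "f0 : bmeas borel"
 proof -
  have "(%w. indicator D w *\<^sub>R f w) : bmeas borel"
  using holomorphic_on_imp_continuous_on[OF hol] oD by (intro borel_measurable_continuous_on_indicator) (auto simp: D_def)
  also have "(%w. indicator D w *\<^sub>R f w) = f0" by (auto simp: f0_def)
  finally show ?thesis .
 qed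
 have "bt 0 + \<i> * of_real (d/2) : above" using d by (intro vertical_shift_in_above) auto
 then have M0: "0 <= M" using order.trans[OF norm_ge_zero bd] by blast
 have f0b: "norm (f0 w) <= M" for w using bd M0 by (auto simp: f0_def D_def)
 define h where "h = (%z w. f0 w / (w - z))"
 define B where "B = (%z. LINT x:{x0..x1}|lebesgue. h z (Complex x (-d)))"
 define T where "T = (%z. LINT x:{x0..x1}|lebesgue. h z (Complex x d))"
 define R where "R = (%z. LINT y:{-d..d}|lebesgue. h z (Complex x1 y))"
 define L where "L = (%z. LINT y:{-d..d}|lebesgue. h z (Complex x0 y))"
 have Cm: "(%x. Complex x c) : bmeas borel" "(%y. Complex c y) : bmeas borel" for c
  by (intro borel_measurable_continuous_onI continuous_intros)+
 have bnd: "\<bar>Re z\<bar> < d/4" "\<bar>Im z\<bar> < d/4" if "z : ball 0 (d/4)" for z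
  using that abs_Re_le_cmod[of z] abs_Im_le_cmod[of z] by auto
 have side: "(%z. LINT x:{u..v}|lebesgue. h z (P x)) holomorphic_on ball 0 (d/4)
  & (ALL z:ball 0 (d/4). set_integrable lebesgue {u..v} (%x. h z (P x)) & set_integrable lebesgue {u..v} (%x. 1 / (P x - z)))"
  if P: "P : bmeas borel" and sep: "!!z x. z : ball 0 (d/4) ==> x : {u..v} ==> d/8 <= cmod (P x - z)" for P and u v :: real
 proof -
  have Pm[measurable]: "P : bmeas lebesgue" using P by (simp add: measurable_completion)
  have f0P[measurable]: "(%x. f0 (P x)) : bmeas lebesgue" by (rule measurable_compose[OF Pm f0m])
  have ind[measurable]: "(indicator {u..v} :: real => real) : bmeas lebesgue" by (intro borel_measurable_indicator) auto
  define ph where "ph = (%x. indicat_real {u..v} x *\<^sub>R f0 (P x))"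
  define ps where "ps = (%x. indicat_real {u..v} x *\<^sub>R (1::complex))"
  have m[measurable]: "ph : bmeas lebesgue" "ps : bmeas lebesgue" unfolding ph_def ps_def by measurable
  have int: "integrable lebesgue (%x. norm (ph x) / (1 + cmod (P x)))" "integrable lebesgue (%x. norm (ps x) / (1 + cmod (P x)))"
  proof -
  show "integrable lebesgue (%x. norm (ph x) / (1 + cmod (P x)))"
  proof (rule Bochner_Integration.integrable_bound[OF integrable_indicator_Icc[of u v M]])
  have "norm (f0 (P x)) / (1 + cmod (P x)) <= M / 1" for x by (intro frac_le f0b M0) auto
  then show "AE x in lebesgue. norm (norm (ph x) / (1 + cmod (P x))) <= norm (indicator {u..v} x *\<^sub>R M)"
  by (intro AE_I2) (auto simp: ph_def M0 abs_of_nonneg split: split_indicator)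
  qed measurable
  show "integrable lebesgue (%x. norm (ps x) / (1 + cmod (P x)))"
  proof (rule Bochner_Integration.integrable_bound[OF integrable_indicator_Icc[of u v 1]])
  have "1 / (1 + cmod (P x)) <= 1 / 1" for x by (intro frac_le) auto
  then show "AE x in lebesgue. norm (norm (ps x) / (1 + cmod (P x))) <= norm (indicator {u..v} x *\<^sub>R (1::real))"
  by (intro AE_I2) (auto simp: ps_def abs_of_nonneg split: split_indicator)
  qed measurable
  qed
  have sep': "AE x in lebesgue. ph x = 0 \<or> d/8 <= cmod (P x - z)" "AE x in lebesgue. ps x = 0 \<or> d/8 <= cmod (P x - z)"
  if "z : ball 0 (d/4)" for z
  using sep[OF that] by (intro AE_I2; auto simp: ph_def ps_def split: split_indicator)+
  have "(%z. \<integral>x. ph x / (P x - z) \<partial>lebesgue) holomorphic_on ball 0 (d/4)"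
  by (rule cauchy_transform_holomorphic[OF open_ball Pm m(1) int(1)]) (use sep'(1) d in \<open>auto intro!: exI[of _ "d/8"]\<close>)
  moreover have "(\<integral>x. ph x / (P x - z) \<partial>lebesgue) = (LINT x:{u..v}|lebesgue. h z (P x))" for z
  unfolding set_lebesgue_integral_def by (intro Bochner_Integration.integral_cong) (auto simp: ph_def h_def scaleR_conv_of_real)
  moreover have "set_integrable lebesgue {u..v} (%x. h z (P x))" "set_integrable lebesgue {u..v} (%x. 1 / (P x - z))" if "z : ball 0 (d/4)" for z
  using integrable_cauchy_kernel[OF Pm m(1) int(1) _ sep'(1)[OF that]] integrable_cauchy_kernel[OF Pm m(2) int(2) _ sep'(2)[OF that]] d
  unfolding set_integrable_def ph_def ps_def h_def by (simp_all add: scaleR_conv_of_real)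
  ultimately show ?thesis by simp
 qed
 have leRe: "d/8 <= cmod w" if "d/8 <= \<bar>Re w\<bar>" for w using that abs_Re_le_cmod[of w] by linarith
 have leIm: "d/8 <= cmod w" if "d/8 <= \<bar>Im w\<bar>" for w using that abs_Im_le_cmod[of w] by linarith
 \<comment> \<open>The sides lie at real parts beyond 3d/8 or at imaginary parts d and -d, and z has
   modulus below d/4. The resulting distance makes the side integrals analytic in z.\<close>
 have sB: "d/8 <= cmod (Complex x (-d) - z)" "d/8 <= cmod (Complex x d - z)"
  "d/8 <= cmod (Complex x0 y - z)" "d/8 <= cmod (Complex x1 y - z)" if "z : ball 0 (d/4)" for x y z
  using bnd[OF that] x d by (intro leIm leRe; auto simp: abs_if split: if_splits)+
 note sides = side[OF Cm(1)[of "-d"] sB(1), of x0 x1, folded B_def] side[OF Cm(1)[of d] sB(2), of x0 x1, folded T_def]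
  side[OF Cm(2)[of x0] sB(3), of "-d" d, folded L_def] side[OF Cm(2)[of x1] sB(4), of "-d" d, folded R_def]
 define Ps where "Ps = (%z. B z - T z + \<i> * R z - \<i> * L z)"
 have "Ps holomorphic_on ball 0 (d/4)" unfolding Ps_def using sides by (intro holomorphic_intros) auto
 moreover have "2 * pi * \<i> * f z = Ps z + (LINT t:{-d/2..d/2}|lebesgue. (fp t - fm t) / (bt t - z) * bt' t)"
  if z: "z : ball 0 (d/4) - bt ` {-d..d}" for z
 proof -
  have zb: "z : ball 0 (d/4)" using z by auto
  have zD: "z : D" unfolding D_def above_Un_below[symmetric] using z bnd[OF zb] d by auto
  \<comment> \<open>The difference quotient of f at z is analytic also at z and bounded, so the
    formulas for both sides of the arc apply without a small circle around z. The subtracted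
    multiple of 1/(w - z) brings back the term 2 pi i f(z).\<close>
  define k where "k = (%w. if w = z then deriv f z else (f w - f z) / (w - z))"
  have kh: "k holomorphic_on D" unfolding k_def by (rule pole_lemma_open[OF _ oD]) (use hol in \<open>simp add: D_def\<close>)
  obtain dl where dl: "dl > 0" "cball z dl <= D" using oD zD open_contains_cball by blast
  obtain N1 where N1: "!!w. w : cball z dl ==> norm (k w) <= N1"
  proof -
  have "bounded (k ` cball z dl)"
  by (intro compact_imp_bounded compact_continuous_image continuous_on_subset[OF holomorphic_on_imp_continuous_on[OF kh] dl(2)] compact_cball)
  then show ?thesis using that unfolding bounded_iff by blast
  qed
  define N where "N = max N1 (2 * M / dl)"
  have kb: "norm (k w) <= N" if "w : D" for w
  proof (cases "w : cball z dl")
  case True then show ?thesis using N1 by (auto simp: N_def max.coboundedI1)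
  next
  case False
  then have wz: "dl <= cmod (w - z)" "w ~= z" using dl(1) by (auto simp: dist_norm norm_minus_commute)
  have "norm (k w) = cmod (f w - f z) / cmod (w - z)" using wz by (simp add: k_def norm_divide)
  also have "... <= (M + M) / dl"
  using bd[of w] bd[of z] that zD wz dl(1) M0 norm_triangle_ineq4[of "f w" "f z"] by (intro frac_le) (auto simp: D_def)
  finally show ?thesis by (simp add: N_def max.coboundedI2)
  qed
  define kp km where "kp = (%t. if t : {-a..a} then (fp t - f z) / (bt t - z) else 0)" and "km = (%t. if t : {-a..a} then (fm t - f z) / (bt t - z) else 0)"
  have ib: "(%t. indicat_real {-a..a} t *\<^sub>R (1 / (bt t - z))) : bmeas lebesgue"
  proof -
  have "(%t. indicat_real {-a..a} t *\<^sub>R (1 / (bt t - z))) : bmeas borel"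
  by (rule borel_measurable_continuous_on_indicator)
  (use z a in \<open>auto intro!: continuous_intros continuous_on_subset[OF continuous_beta]\<close>)
  then show ?thesis by (intro measurable_completion) simp
  qed
  have kpe: "kp = (%t. (fp t - f z) * (indicat_real {-a..a} t *\<^sub>R (1 / (bt t - z))))" "km = (%t. (fm t - f z) * (indicat_real {-a..a} t *\<^sub>R (1 / (bt t - z))))"
  by (auto simp: kp_def km_def fun_eq_iff)
  have kpm: "kp : bmeas lebesgue" "km : bmeas lebesgue"
  unfolding kpe using ib by measurable
  have lim: "AE t in lebesgue. t : {-a..a} --> ((%ep. k (bt t + s * of_real ep)) \<longlongrightarrow> g' t) (at_right 0)"
  if l: "AE t in lebesgue. t : {-d/2..d/2} --> ((%ep. f (bt t + s * of_real ep)) \<longlongrightarrow> g t) (at_right 0)"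
  and g': "g' = (%t. if t : {-a..a} then (g t - f z) / (bt t - z) else 0)" for s g g'
  using l
  proof eventually_elim
  case (elim t)
  show ?case
  proof
  assume t: "t : {-a..a}"
  then have nz: "bt t - z ~= 0" using z a by auto
  have c: "((%ep. bt t + s * of_real ep) \<longlongrightarrow> bt t) (at_right 0)"
  by (auto intro!: tendsto_eq_intros)
  have ev: "\<forall>\<^sub>F ep in at_right 0. bt t + s * of_real ep ~= z"
  using tendsto_imp_eventually_ne[OF c] nz by simp
  have "((%ep. (f (bt t + s * of_real ep) - f z) / (bt t + s * of_real ep - z)) \<longlongrightarrow> (g t - f z) / (bt t - z)) (at_right 0)"
  using elim t nz a_def by (intro tendsto_intros c) auto
  then show "((%ep. k (bt t + s * of_real ep)) \<longlongrightarrow> g' t) (at_right 0)"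
  unfolding g' using t by (auto elim!: Lim_transform_eventually intro!: eventually_mono[OF ev] simp: k_def)
  qed
  qed
  have lp: "AE t in lebesgue. t : {-(d/2)..d/2} --> ((%ep. k (bt t + \<i> * of_real ep)) \<longlongrightarrow> kp t) (at_right 0)"
  using lim[OF limp kp_def] by (simp add: a_def)
  have lm: "AE t in lebesgue. t : {-(d/2)..d/2} --> ((%ep. k (bt t - \<i> * of_real ep)) \<longlongrightarrow> km t) (at_right 0)"
  using lim[of "-\<i>" fm, OF _ km_def] limm by (simp add: a_def)
  have ka: "k holomorphic_on above" "ALL w:above. norm (k w) <= N" and kbe: "k holomorphic_on below" "ALL w:below. norm (k w) <= N"
  using kh kb by (auto simp: D_def elim: holomorphic_on_subset)
  note A = integral_above[OF ka kpm(1) lp, folded a_def x0_def x1_def]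
  note Be = integral_below[OF kbe kpm(2) lm, folded a_def x0_def x1_def]
  define k0 where "k0 = (%w. h z w - f z * (1 / (w - z)))"
  have k0: "k w = k0 w" if "w : D" "w ~= z" for w using that by (simp add: k0_def h_def f0_def k_def diff_divide_distrib)
  \<comment> \<open>The lower and upper half-open parts of a vertical side are joined; the crossing
    point with the arc is a null set.\<close>
  have vert: "(LINT y:{-d..<Im (bt t)}|lebesgue. k (Complex (Re (bt t)) y)) + (LINT y:{Im (bt t)<..d}|lebesgue. k (Complex (Re (bt t)) y))
  = (LINT y:{-d..d}|lebesgue. k0 (Complex (Re (bt t)) y))" if t: "t : {-a, a}" for t
  proof -
  have tr: "Re (bt t) = x0 \<or> Re (bt t) = x1" using t by (auto simp: x0_def x1_def)
  have "(LINT y:{-d..<Im (bt t)}|lebesgue. k (Complex (Re (bt t)) y)) + (LINT y:{Im (bt t)<..d}|lebesgue. k (Complex (Re (bt t)) y))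
  = (LINT y:{-d..<Im (bt t)} Un {Im (bt t)<..d}|lebesgue. k (Complex (Re (bt t)) y))"
  by (rule set_integral_Un[symmetric]) (use A(4)[OF t] Be(4)[OF t] t in \<open>auto\<close>)
  also have "... = (LINT y:{-d..d}|lebesgue. k0 (Complex (Re (bt t)) y))"
  unfolding set_lebesgue_integral_def
  proof (rule integral_cong_AE)
  have i1: "set_integrable lebesgue ({-d..<Im (bt t)} Un {Im (bt t)<..d}) (%y. k (Complex (Re (bt t)) y))"
  by (rule set_integrable_Un) (use A(4)[OF t] Be(4)[OF t] in auto)
  then show "(%y. indicat_real ({-d..<Im (bt t)} Un {Im (bt t)<..d}) y *\<^sub>R k (Complex (Re (bt t)) y)) : bmeas lebesgue"
  unfolding set_integrable_def by (rule borel_measurable_integrable)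
  have "set_integrable lebesgue {-d..d} (%y. k0 (Complex (Re (bt t)) y))"
  unfolding k0_def using sides zb tr by (intro set_integral_diff(1) set_integrable_mult_right) auto
  then show "(%y. indicat_real {-d..d} y *\<^sub>R k0 (Complex (Re (bt t)) y)) : bmeas lebesgue"
  unfolding set_integrable_def by (rule borel_measurable_integrable)
  have "AE y in lborel. y ~= Im (bt t)" by (rule AE_lborel_singleton)
  then have "AE y in lebesgue. y ~= Im (bt t)" by (rule AE_completion)
  then show "AE y in lebesgue. indicat_real ({-d..<Im (bt t)} Un {Im (bt t)<..d}) y *\<^sub>R k (Complex (Re (bt t)) y) = indicat_real {-d..d} y *\<^sub>R k0 (Complex (Re (bt t)) y)"
  proof eventually_elim
  case (elim y)
  show ?case
  proof (cases "y : {-d..d}")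
  case True
  have "Complex (Re (bt t)) y ~= bt s" if "s : {-d..d}" for s
  using Re_inj[OF that, of t] t a elim by (auto simp: complex_eq_iff)
  then have nb: "Complex (Re (bt t)) y ~: bt ` {-d..d}" by blast
  have "\<bar>Re (bt t)\<bar> <= 5/8*d" using tr x by auto
  then have "Complex (Re (bt t)) y : D"
  unfolding D_def above_Un_below[symmetric] by (intro DiffI nb) (use True d in \<open>auto simp: abs_le_iff\<close>)
  moreover have "Complex (Re (bt t)) y ~= z" using sB(3,4)[OF zb, of y] tr d by auto
  ultimately show ?thesis using k0 elim True by (auto split: split_indicator)
  next
  case False
  then show ?thesis using Im_le[of t] t d by (auto split: split_indicator simp: abs_if split: if_splits)
  qed
  qed
  qed
  finally show ?thesis .
  qed
  have horD: "Complex x (-d) : D" "Complex x d : D" if "x : {x0..x1}" for x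
  proof -
  have "\<bar>Im (bt s)\<bar> <= d/4" if "s : {-d..d}" for s using abs_Im_le[OF that] that by auto
  have ne: "Complex x c ~= bt s" if "s : {-d..d}" "\<bar>c\<bar> = d" for s c
  proof
  assume "Complex x c = bt s"
  then have "Im (bt s) = c" by (metis complex.sel(2))
  moreover have "\<bar>Im (bt s)\<bar> <= d/4" using abs_Im_le[OF that(1)] that(1) by auto
  ultimately show False using that(2) d by simp
  qed
  have "Complex x (-d) ~= bt s" "Complex x d ~= bt s" if "s : {-d..d}" for s
  using ne[OF that] d by auto
  then have nb: "Complex x (-d) ~: bt ` {-d..d}" "Complex x d ~: bt ` {-d..d}" by blast+
  have "x <= 5/8*d" "- (5/8*d) <= x" using x that by (auto simp: abs_le_iff)
  then have "\<bar>x\<bar> < 3*d/4" using d by (simp add: abs_less_iff)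
  then show "Complex x (-d) : D" "Complex x d : D"
  unfolding D_def above_Un_below[symmetric] by (intro DiffI nb; use d in simp)+
  qed
  have hor: "(LINT x:{x0..x1}|lebesgue. k (Complex x (-d))) = (LINT x:{x0..x1}|lebesgue. k0 (Complex x (-d)))"
  "(LINT x:{x0..x1}|lebesgue. k (Complex x d)) = (LINT x:{x0..x1}|lebesgue. k0 (Complex x d))"
  proof -
  have nz: "Complex x (-d) ~= z" "Complex x d ~= z" for x using sB(1,2)[OF zb, of x] d by auto
  have e: "k (Complex x (-d)) = k0 (Complex x (-d))" "k (Complex x d) = k0 (Complex x d)" if "x : {x0..x1}" for x
  using k0[OF horD(1)[OF that] nz(1)] k0[OF horD(2)[OF that] nz(2)] .
  show "(LINT x:{x0..x1}|lebesgue. k (Complex x (-d))) = (LINT x:{x0..x1}|lebesgue. k0 (Complex x (-d)))"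
  "(LINT x:{x0..x1}|lebesgue. k (Complex x d)) = (LINT x:{x0..x1}|lebesgue. k0 (Complex x d))"
  by (rule set_lebesgue_integral_cong; use e in simp)+
  qed
  have split: "(LINT x:{u..v}|lebesgue. k0 (P x)) = (LINT x:{u..v}|lebesgue. h z (P x)) - f z * (LINT x:{u..v}|lebesgue. 1 / (P x - z))"
  if "set_integrable lebesgue {u..v} (%x. h z (P x))" "set_integrable lebesgue {u..v} (%x. 1 / (P x - z))" for u v and P :: "real => complex"
  proof -
  have "(LINT x:{u..v}|lebesgue. k0 (P x)) = (LINT x:{u..v}|lebesgue. h z (P x)) - (LINT x:{u..v}|lebesgue. f z * (1 / (P x - z)))"
  unfolding k0_def by (rule set_integral_diff(2)[OF that(1) set_integrable_mult_right]) (rule that(2))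
  then show ?thesis by (simp only: set_integral_mult_right)
  qed
  define rect where "rect = (%g :: complex => complex. (LINT x:{x0..x1}|lebesgue. g (Complex x (-d))) - (LINT x:{x0..x1}|lebesgue. g (Complex x d))
  + \<i> * (LINT y:{-d..d}|lebesgue. g (Complex x1 y)) - \<i> * (LINT y:{-d..d}|lebesgue. g (Complex x0 y)))"
  have 1: "rect (%w. 1 / (w - z)) = 2 * pi * \<i>"
  proof -
  have "z : box (Complex x0 (-d)) (Complex x1 d)" using bnd[OF zb] x d by (auto simp: in_box_complex_iff)
  from cauchy_rectangle[OF convex_UNIV open_UNIV _ subset_UNIV this, of "%_. 1"]
  show ?thesis unfolding rect_def using sides zb by (simp add: set_lebesgue_integral_eq_integral(2))
  qed
  have 2: "rect k0 = Ps z - f z * rect (%w. 1 / (w - z))"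
  unfolding rect_def Ps_def B_def T_def R_def L_def using sides zb
  by (simp add: split algebra_simps)
  \<comment> \<open>Subtracting the lower formula from the upper one puts the four sides together
    with clockwise orientation, hence the minus sign. Below, f(z) cancels in the difference of the
    two boundary densities, leaving only the jump of f.\<close>
  have 3: "(LINT t:{-a..a}|lebesgue. kp t * bt' t) - (LINT t:{-a..a}|lebesgue. km t * bt' t) = - rect k0"
  unfolding A(1) Be(1) rect_def hor using vert[of a] vert[of "-a"]
  by (simp add: x0_def[symmetric] x1_def[symmetric] algebra_simps flip: distrib_left)
  have "(LINT t:{-a..a}|lebesgue. kp t * bt' t) - (LINT t:{-a..a}|lebesgue. km t * bt' t) = (LINT t:{-a..a}|lebesgue. kp t * bt' t - km t * bt' t)"
  using A(2) Be(2) by (simp add: set_integral_diff(2))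
  also have "... = (LINT t:{-a..a}|lebesgue. (fp t - fm t) / (bt t - z) * bt' t)"
  by (intro set_lebesgue_integral_cong) (auto simp: kp_def km_def diff_divide_distrib algebra_simps)
  finally have "2 * pi * \<i> * f z = Ps z + (LINT t:{-a..a}|lebesgue. (fp t - fm t) / (bt t - z) * bt' t)"
  using 1 2 3 by (simp add: algebra_simps)
  then show ?thesis by (simp add: a_def)
 qed
 ultimately show ?thesis by blast
qed

text \<open>The integrand has the primitive Ln(bt t - z) on a suitable branch, so the integral is a
  difference of two logarithms at the ends. These are at distance between d/8 and 2d from z, and the
  argument is at most pi in absolute value, uniformly on both sides of the arc.\<close>

lemma bounded_log_integral:
 "EX C. ALL z:ball 0 (d/4) - bt ` {-d..d}. cmod (LINT t:{-d/2..d/2}|lebesgue. bt' t / (bt t - z)) <= C"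
proof -
 define m where "m = \<bar>ln (d/8)\<bar> + \<bar>ln (2*d)\<bar> + pi"
 have "cmod (LINT t:{-d/2..d/2}|lebesgue. bt' t / (bt t - z)) <= 2 * m" if z: "z : ball 0 (d/4) - bt ` {-d..d}" for z
 proof -
 have zb: "\<bar>Re z\<bar> < d/4" "\<bar>Im z\<bar> < d/4" "cmod z < d/4" using z abs_Re_le_cmod[of z] abs_Im_le_cmod[of z] by auto
 have "z : above Un below" unfolding above_Un_below[symmetric] using z zb d by auto
 \<comment> \<open>For z above the arc, bt t - z never lies on the ray of i y with y >= 0;
   multiplication by i moves this ray to the cut of the principal logarithm. Below the arc, -i plays
   this role.\<close>
 then obtain s where s: "s = \<i> \<or> s = -\<i>" and "!!t. t : {-d..d} ==> s * (bt t - z) ~: \<real>\<^sub>\<le>\<^sub>0"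
 proof
  assume "z : above"
  then have "\<i> * (bt t - z) ~: \<real>\<^sub>\<le>\<^sub>0" if "t : {-d..d}" for t
  using that by (force simp: above_def complex_nonpos_Reals_iff)
  then show ?thesis using that by blast
 next
  assume "z : below"
  then have "-\<i> * (bt t - z) ~: \<real>\<^sub>\<le>\<^sub>0" if "t : {-d..d}" for t
  using that by (force simp: below_def complex_nonpos_Reals_iff)
  then show ?thesis using that by blast
 qed
 note sb = this(2)
 have nz: "bt t ~= z" if "t : {-d..d}" for t using z that by auto
 have 1: "(LINT t:{-d/2..d/2}|lebesgue. bt' t / (bt t - z)) = Ln (s * (bt (d/2) - z)) - Ln (s * (bt (-d/2) - z))"
 proof (rule conjunct2[OF set_lebesgue_FTC])
  show "continuous_on {-d/2..d/2} (%t. bt' t / (bt t - z))"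
  by (intro continuous_intros continuous_on_subset[OF cont] continuous_on_subset[OF continuous_beta]) (use d nz in auto)
  fix t assume t: "t : {-d/2..d/2}"
  then have td: "t : {-d..d}" using d by auto
  have "((Ln \<circ> (%t. s * (bt t - z))) has_vector_derivative ((s * bt' t) * inverse (s * (bt t - z)))) (at t)"
  proof (rule field_vector_diff_chain_at)
  have "(bt has_vector_derivative bt' t) (at t)" using t d by (intro deriv) auto
  then show "((%t. s * (bt t - z)) has_vector_derivative s * bt' t) (at t)"
  by (auto intro!: derivative_eq_intros)
  show "(Ln has_field_derivative inverse (s * (bt t - z))) (at (s * (bt t - z)))"
  by (rule has_field_derivative_Ln[OF sb[OF td]])
  qed
  moreover have "(s * bt' t) * inverse (s * (bt t - z)) = bt' t / (bt t - z)"
  using s nz[OF td] by (auto simp: divide_inverse)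
  ultimately show "((%t. Ln (s * (bt t - z))) has_vector_derivative bt' t / (bt t - z)) (at t)"
  by (simp only: o_def)
 qed (use d in auto)
 have 2: "cmod (Ln (s * (bt t - z))) <= m" if t: "t = d/2 \<or> t = -d/2" for t
 proof -
  have td: "t : {-d..d}" using t d by auto
  have w: "cmod (s * (bt t - z)) = cmod (bt t - z)" using s by (auto simp: norm_mult)
  have "d/8 <= \<bar>Re (bt t - z)\<bar>" using abs_Re_ge[OF td] t zb d by (auto simp: abs_if split: if_splits)
  then have lo: "d/8 <= cmod (bt t - z)" using abs_Re_le_cmod[of "bt t - z"] by linarith
  have "cmod (bt t) <= \<bar>Re (bt t)\<bar> + \<bar>Im (bt t)\<bar>" by (rule cmod_le)
  also have "... <= 5/4*(d/2) + (d/2)/4" using abs_Re_le[OF td] abs_Im_le[OF td] t d by auto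
  finally have up: "cmod (bt t - z) <= 2*d" using norm_triangle_ineq4[of "bt t" z] zb d by simp
  have "ln (d/8) <= ln (cmod (bt t - z))" "ln (cmod (bt t - z)) <= ln (2*d)" using lo up d by (auto intro!: ln_mono)
  then have "\<bar>ln (cmod (bt t - z))\<bar> <= \<bar>ln (d/8)\<bar> + \<bar>ln (2*d)\<bar>" by linarith
  moreover have "s * (bt t - z) ~= 0" using sb[OF td] by auto
  then have "Re (Ln (s * (bt t - z))) = ln (cmod (bt t - z))" "\<bar>Im (Ln (s * (bt t - z)))\<bar> <= pi"
  using mpi_less_Im_Ln[of "s * (bt t - z)"] Im_Ln_le_pi[of "s * (bt t - z)"] w by (auto simp: abs_le_iff)
  ultimately show ?thesis using cmod_le[of "Ln (s * (bt t - z))"] by (simp add: m_def)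
 qed
 show ?thesis
  unfolding 1 using norm_triangle_ineq4[of "Ln (s * (bt (d/2) - z))" "Ln (s * (bt (-d/2) - z))"] 2[of "d/2"] 2[of "-d/2"] by simp
qed
 then show ?thesis by blast
qed

end

section \<open>Local geometry of contours\<close>

text \<open>At a finite end the closure adds at most the point \<open>g a\<close>. At an end at
  infinity it adds nothing: a limit w of points 1/g(s) with s tending to l satisfies g(l) w = 1,
  which excludes l = a because g a = 0.\<close>

lemma closure_arc_tail:
 fixes gm g :: "real => complex"
 assumes "compact K" "a : K" "K - {a} <= {0<..<1}" "continuous_on K g"
  and "(ALL t:K-{a}. gm t = g t) & g a ~: gm ` {0<..<1} \<or> (ALL t:K-{a}. g t ~= 0 & gm t = 1 / g t) & g a = 0"
 shows "EX F. finite F & F Int gm ` {0<..<1} = {} & F <= {g a} & closure (gm ` (K - {a})) <= gm ` (K - {a}) Un F"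
 using assms(5)
proof
 assume *: "(ALL t:K-{a}. gm t = g t) & g a ~: gm ` {0<..<1}"
 have "closure (gm ` (K - {a})) <= g ` K"
  by (rule closure_minimal) (use * in \<open>auto intro!: compact_imp_closed compact_continuous_image assms\<close>)
 also have "... <= gm ` (K - {a}) Un {g a}" using * by force
 finally show ?thesis using * by (intro exI[of _ "{g a}"]) auto
next
 assume *: "(ALL t:K-{a}. g t ~= 0 & gm t = 1 / g t) & g a = 0"
 have "closure (gm ` (K - {a})) <= gm ` (K - {a})"
 proof
  fix w assume "w : closure (gm ` (K - {a}))"
  then obtain u where u: "!!n. u n : gm ` (K - {a})" "u \<longlonglongrightarrow> w" by (auto simp: closure_sequential)
  then have "ALL n. EX s. s : K - {a} & u n = gm s" by blast
  then obtain s where s: "!!n::nat. s n : K - {a}" "!!n. u n = gm (s n)" by (auto dest!: choice)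
  obtain l r where l: "l : K" "strict_mono r" "(s \<circ> r) \<longlonglongrightarrow> l"
  using assms(1)[unfolded compact_def, rule_format, of s] s(1) by blast
  have "(%n. g ((s \<circ> r) n)) \<longlonglongrightarrow> g l"
  by (rule continuous_on_tendsto_compose[OF assms(4) l(3) l(1)]) (use s(1) in auto)
  moreover have "(%n. (u \<circ> r) n) \<longlonglongrightarrow> w" using LIMSEQ_subseq_LIMSEQ[OF u(2) l(2)] by (simp add: o_def)
  ultimately have "(%n. g ((s \<circ> r) n) * (u \<circ> r) n) \<longlonglongrightarrow> g l * w" by (rule tendsto_mult)
  moreover have "g ((s \<circ> r) n) * (u \<circ> r) n = 1" for n using * s(1)[of "r n"] by (simp add: s(2))
  ultimately have 1: "g l * w = 1" by (simp add: LIMSEQ_const_iff)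
  then have "l ~= a" using * by auto
  then have "gm l = 1 / g l" "g l ~= 0" using * l(1) by auto
  with 1 have "w * g l = gm l * g l" by (simp add: mult.commute)
  then have "w = gm l" using \<open>g l ~= 0\<close> by (metis mult_cancel_right)
  then show "w : gm ` (K - {a})" using l(1) \<open>l ~= a\<close> by auto
 qed
 then show ?thesis by (intro exI[of _ "{}"]) auto
qed

text \<open>That \<open>F\<close> misses the open arc means that an end never returns to an interior
  point of its own arc. The set \<open>F\<close> serves all small tails at once, so the tails can be
  shortened away from a given parameter without changing it.\<close>

lemma smooth_arc_closure:
 assumes "smooth_arc gm"
 shows "EX F dl0. finite F & F Int gm ` {0<..<1} = {} & 0 < dl0 & dl0 < 1/2 &
  (ALL dl>0. dl <= dl0 --> closure (gm ` {0<..dl}) <= gm ` {0<..dl} Un F & closure (gm ` {1-dl..<1}) <= gm ` {1-dl..<1} Un F)"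
proof -
 have "regular_end gm 0" "regular_end gm 1" using assms by (auto simp: smooth_arc_def)
 then obtain e0 g0 e1 g1 where e: "e0 > 0" "e1 > 0"
  and c: "g0 C1_differentiable_on {0-e0..0+e0}" "g1 C1_differentiable_on {1-e1..1+e1}"
  and g0: "(ALL t:{0<..<1} Int {0-e0..0+e0}. gm t = g0 t) & g0 0 ~: gm ` {0<..<1} \<or>
  (ALL t:{0<..<1} Int {0-e0..0+e0}. g0 t ~= 0 & gm t = 1 / g0 t) & g0 0 = 0"
  and g1: "(ALL t:{0<..<1} Int {1-e1..1+e1}. gm t = g1 t) & g1 1 ~: gm ` {0<..<1} \<or>
  (ALL t:{0<..<1} Int {1-e1..1+e1}. g1 t ~= 0 & gm t = 1 / g1 t) & g1 1 = 0"
  unfolding regular_end_def by blast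
 define dl0 where "dl0 = min (1/4) (min e0 e1)"
 have dl0: "0 < dl0" "dl0 < 1/2" "dl0 <= e0" "dl0 <= e1" using e by (auto simp: dl0_def)
 have K0: "{0..dl} - {0} = {0<..dl}" and K1: "{1-dl..1} - {1} = {1-dl..<1}" for dl :: real by auto
 have A: "EX F. finite F & F Int gm ` {0<..<1} = {} & F <= {g0 0} & closure (gm ` ({0..dl} - {0})) <= gm ` ({0..dl} - {0}) Un F"
  if "0 < dl" "dl <= dl0" for dl
  by (rule closure_arc_tail[OF _ _ _ continuous_on_subset[OF C1_differentiable_imp_continuous_on[OF c(1)]]])
  (use that dl0 g0 in auto)
 have B: "EX F. finite F & F Int gm ` {0<..<1} = {} & F <= {g1 1} & closure (gm ` ({1-dl..1} - {1})) <= gm ` ({1-dl..1} - {1}) Un F"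
  if "0 < dl" "dl <= dl0" for dl
  by (rule closure_arc_tail[OF _ _ _ continuous_on_subset[OF C1_differentiable_imp_continuous_on[OF c(2)]]])
  (use that dl0 g1 in auto)
 have "closure (gm ` {0<..dl}) <= gm ` {0<..dl} Un ({g0 0, g1 1} - gm ` {0<..<1}) &
  closure (gm ` {1-dl..<1}) <= gm ` {1-dl..<1} Un ({g0 0, g1 1} - gm ` {0<..<1})" if "0 < dl" "dl <= dl0" for dl
  using A[OF that] B[OF that] unfolding K0 K1 by blast
 then show ?thesis using dl0(1,2) by (intro exI[of _ "{g0 0, g1 1} - gm ` {0<..<1}"] exI[of _ dl0]) auto
qed

lemma smooth_arc_deriv:
 assumes "smooth_arc gm" "t : {0<..<1}"
 shows "(gm has_vector_derivative vel gm t) (at t)" "vel gm t ~= 0"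
 using assms by (auto simp: smooth_arc_def C1_differentiable_on_eq vector_derivative_works)

lemma smooth_arc_continuous:
 assumes "smooth_arc gm"
 shows "continuous_on {0<..<1} gm" "continuous_on {0<..<1} (%t. vel gm t)" "inj_on gm {0<..<1}"
 using assms by (auto simp: smooth_arc_def C1_differentiable_on_eq C1_differentiable_imp_continuous_on)

text \<open>By continuity of the velocity, the rescaled derivative is within 1/4 of 1 near t0; the
  mean value inequality for bt s - s gives the flatness. All d up to d0 are allowed because d is
  later reduced further to fit given radii.\<close>

lemma smooth_arc_flat:
 assumes gm: "smooth_arc gm" and t0: "t0 : {0<..<1}"
 defines "tu \<equiv> vel gm t0"
 obtains d0 where "0 < d0" "!!d. 0 < d ==> d <= d0 ==> {t0-d..t0+d} <= {0<..<1} &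
  (ALL s:{-d..d}. cmod (vel gm (t0 + s) / tu - 1) <= 1/4) &
  flat_arc (%s. (gm (t0 + s) - gm t0) / tu) (%s. vel gm (t0 + s) / tu) d"
proof -
 have tu: "tu ~= 0" using smooth_arc_deriv[OF assms(1,2)] by (simp add: tu_def)
 have "continuous_on {0<..<1} (%t. vel gm t / tu)"
  by (rule continuous_on_divide[OF smooth_arc_continuous(2)[OF gm] continuous_on_const]) (use tu in auto)
 then have "isCont (%t. vel gm t / tu) t0"
  using t0 by (simp add: continuous_on_eq_continuous_at)
 then obtain e where e: "e > 0" "!!t. dist t t0 < e ==> dist (vel gm t / tu) (vel gm t0 / tu) < 1/4"
  unfolding continuous_at_eps_delta by (metis zero_less_divide_1_iff zero_less_numeral)
 define d0 where "d0 = min (e/2) (min (t0/2) ((1-t0)/2))"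
 have d0: "0 < d0" "d0 < e" "d0 < t0" "d0 < 1 - t0" using e(1) t0 by (auto simp: d0_def min_def)
 show ?thesis
 proof (rule that[OF d0(1)])
  fix d assume d: "0 < d" "d <= d0"
  have sub: "{t0-d..t0+d} <= {0<..<1}" using d d0 t0 by auto
  define bt bt' where "bt = (%s. (gm (t0 + s) - gm t0) / tu)" and "bt' = (%s. vel gm (t0 + s) / tu)"
  have der: "(bt has_vector_derivative bt' s) (at s)" if "s : {-d..d}" for s
  proof -
  have "t0 + s : {0<..<1}" by (rule subsetD[OF sub]) (use that in auto)
  then have "(gm has_vector_derivative vel gm (t0 + s)) (at (t0 + s))"
  by (rule smooth_arc_deriv[OF gm])
  then have "((gm \<circ> (%s. t0 + s)) has_vector_derivative (1 *\<^sub>R vel gm (t0 + s))) (at s)"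
  by (intro vector_diff_chain_at) (auto intro!: derivative_eq_intros)
  then show ?thesis unfolding bt_def bt'_def o_def
  by (auto intro!: derivative_eq_intros)
  qed
  have bd: "cmod (bt' s - 1) <= 1/4" if "s : {-d..d}" for s
  using e(2)[of "t0 + s"] that d d0 tu by (auto simp: bt'_def dist_norm tu_def[symmetric] less_imp_le abs_if)
  have "flat_arc bt bt' d"
  proof
  show "0 < d" by fact
  show "bt 0 = 0" by (simp add: bt_def)
  show "(bt has_vector_derivative bt' t) (at t)" if "t : {-d<..<d}" for t using der that by simp
  show "continuous_on {-d<..<d} bt'" unfolding bt'_def
  by (intro continuous_intros continuous_on_compose2[OF smooth_arc_continuous(2)[OF gm]]) (use sub tu in auto)
  fix s t assume st: "s : {-d..d}" "t : {-d..d}"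
  have "cmod ((bt s - of_real s) - (bt t - of_real t)) <= 1/4 * norm (s - t)"
  proof (rule differentiable_bound[of "{-d..d}" _ "%s h. h *\<^sub>R (bt' s - 1)"])
  show "((%s. bt s - of_real s) has_derivative (%h. h *\<^sub>R (bt' x - 1))) (at x within {-d..d})" if "x : {-d..d}" for x
  proof -
  have "((%s. bt s - of_real s) has_vector_derivative (bt' x - 1)) (at x)"
  using der[OF that] by (auto intro!: derivative_eq_intros)
  then show ?thesis by (auto simp: has_vector_derivative_def intro: has_derivative_at_withinI)
  qed
  show "onorm (%h. h *\<^sub>R (bt' x - 1)) <= 1/4" if "x : {-d..d}" for x
  proof (rule onorm_le)
  fix h :: real
  have "\<bar>h\<bar> * cmod (bt' x - 1) <= \<bar>h\<bar> * (1/4)" by (rule mult_left_mono[OF bd[OF that]]) simp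
  then show "norm (h *\<^sub>R (bt' x - 1)) <= 1/4 * norm h" by simp
  qed
  qed (use st in auto)
  then show "cmod (bt s - bt t - of_real (s - t)) <= \<bar>s - t\<bar> / 4" by (simp add: algebra_simps)
  qed
  then show "{t0-d..t0+d} <= {0<..<1} &
  (ALL s:{-d..d}. cmod (vel gm (t0 + s) / tu - 1) <= 1/4) &
  flat_arc (%s. (gm (t0 + s) - gm t0) / tu) (%s. vel gm (t0 + s) / tu) d"
  using sub bd by (simp add: bt_def bt'_def)
 qed
qed

lemma contour_set_eq_UN: "contour_set Sg = (\<Union>gm\<in>set Sg. closure (gm ` {0<..<1}))"
proof
 have "closed (\<Union>gm\<in>set Sg. closure (gm ` {0<..<1}))" by (intro closed_UN) auto
 then show "contour_set Sg <= (\<Union>gm\<in>set Sg. closure (gm ` {0<..<1}))"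
  unfolding contour_set_def by (rule closure_minimal[rotated]) (intro UN_mono order.refl closure_subset)
 show "(\<Union>gm\<in>set Sg. closure (gm ` {0<..<1})) <= contour_set Sg"
  unfolding contour_set_def by (intro UN_least closure_mono) blast
qed

lemma contour_arc_subset: "gm : set Sg ==> t : {0<..<1} ==> gm t : contour_set Sg"
 unfolding contour_set_def by (rule subsetD[OF closure_subset]) blast

lemma closed_contour_set: "closed (contour_set Sg)"
 by (simp add: contour_set_def)

lemma closure_smooth_arc_subset:
 assumes "smooth_arc gm" shows "EX F. finite F & closure (gm ` {0<..<1}) <= gm ` {0<..<1} Un F"
proof -
 obtain F dl where F: "finite F" "0 < dl" "dl < 1/2" and cl:
  "ALL et>0. et <= dl --> closure (gm ` {0<..et}) <= gm ` {0<..et} Un F & closure (gm ` {1-et..<1}) <= gm ` {1-et..<1} Un F"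
  using smooth_arc_closure[OF assms] by blast
 note F = F conjunct1[OF cl[rule_format]] conjunct2[OF cl[rule_format]]
 have c: "closed (gm ` {dl..1-dl})"
  by (intro compact_imp_closed compact_continuous_image continuous_on_subset[OF smooth_arc_continuous(1)[OF assms]]) (use F in auto)
 have "{0<..<1} = {0<..dl} Un {dl..1-dl} Un {1-dl..<1}" using F(2,3) by auto
 then have "closure (gm ` {0<..<1}) = closure (gm ` {0<..dl}) Un closure (gm ` {dl..1-dl}) Un closure (gm ` {1-dl..<1})"
  by (simp only: image_Un closure_Un)
 also have "... <= (gm ` {0<..dl} Un F) Un gm ` {dl..1-dl} Un (gm ` {1-dl..<1} Un F)"
  unfolding closure_closed[OF c] using F(4)[OF F(2) order.refl] F(5)[OF F(2) order.refl] by (intro Un_mono order.refl)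
 also have "... <= gm ` {0<..<1} Un F" using F(2,3) by auto
 finally show ?thesis using F(1) by blast
qed

lemma contour_set_subset_finite:
 assumes "is_contour Sg" shows "EX F. finite F & contour_set Sg <= (\<Union>gm\<in>set Sg. gm ` {0<..<1}) Un F"
proof -
 have "ALL gm:set Sg. EX F. finite F & closure (gm ` {0<..<1}) <= gm ` {0<..<1} Un F"
  using assms closure_smooth_arc_subset by (auto simp: is_contour_def)
 then obtain F where F: "ALL gm:set Sg. finite (F gm) & closure (gm ` {0<..<1}) <= gm ` {0<..<1} Un F gm"
  by (auto dest!: bchoice)
 show ?thesis unfolding contour_set_eq_UN
 proof (intro exI conjI UN_least)
  show "finite (\<Union>gm\<in>set Sg. F gm)" using F by auto
  fix gm assume g: "gm : set Sg"
  then have "closure (gm ` {0<..<1}) <= gm ` {0<..<1} Un F gm" using F by auto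
  also have "... <= (\<Union>gm\<in>set Sg. gm ` {0<..<1}) Un (\<Union>gm\<in>set Sg. F gm)" using g by (intro Un_mono UN_upper)
  finally show "closure (gm ` {0<..<1}) <= (\<Union>gm\<in>set Sg. gm ` {0<..<1}) Un (\<Union>gm\<in>set Sg. F gm)" .
 qed
qed

text \<open>Differentiable images of intervals are null in the plane, and end points contribute
  finitely many points. The coordinates are ordered as in
  \<open>mean_value_potential\<close>.\<close>

lemma negligible_contour_set:
 assumes "is_contour Sg" shows "negligible {(y,x). Complex x y : contour_set Sg}"
proof -
 obtain F where F: "finite F" "contour_set Sg <= (\<Union>gm\<in>set Sg. gm ` {0<..<1}) Un F"
  using contour_set_subset_finite[OF assms] by blast
 let ?p = "%w. (Im w, Re w)"
 have "negligible ((%t. ?p (gm t)) ` {0<..<1})" if "gm : set Sg" for gm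
 proof (rule negligible_differentiable_image_lowdim)
  have "gm differentiable_on {0<..<1}"
  using that assms
  by (auto simp: is_contour_def smooth_arc_def C1_differentiable_on_eq intro!: differentiable_at_imp_differentiable_on)
  moreover have "bounded_linear ?p" by (intro bounded_linear_Pair bounded_linear_Im bounded_linear_Re)
  ultimately show "(%t. ?p (gm t)) differentiable_on {0<..<1}"
  unfolding differentiable_on_def differentiable_def
  using bounded_linear.has_derivative by blast
 qed auto
 moreover have "negligible (?p ` F)" using F by (intro negligible_finite) auto
 ultimately have "negligible ((\<Union>gm\<in>set Sg. (%t. ?p (gm t)) ` {0<..<1}) Un ?p ` F)"
  by (intro negligible_Un negligible_Union) auto
 moreover have "{(y,x). Complex x y : contour_set Sg} <= (\<Union>gm\<in>set Sg. (%t. ?p (gm t)) ` {0<..<1}) Un ?p ` F"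
 proof
  fix q assume "q : {(y,x). Complex x y : contour_set Sg}"
  then obtain y x where q: "q = (y,x)" and c: "Complex x y : contour_set Sg" by auto
  show "q : (\<Union>gm\<in>set Sg. (%t. ?p (gm t)) ` {0<..<1}) Un ?p ` F"
  proof (cases "Complex x y : F")
  case True
  then have "?p (Complex x y) : ?p ` F" by (rule imageI)
  then show ?thesis using q by simp
  next
  case False
  then obtain gm t where gt: "gm : set Sg" "t : {0<..<1}" "Complex x y = gm t" using F(2) c by blast
  have "?p (gm t) = q" by (simp add: q flip: gt(3))
  then show ?thesis using gt(1,2) by blast
  qed
 qed
 ultimately show ?thesis by (rule negligible_subset)
qed

text \<open>All of the contour outside the given parameter neighbourhood lies in a closed set that
  misses \<open>gm t0\<close>: by injectivity for the same arc, by \<open>smooth_arc_closure\<close>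
  for its tails, and by the definition of a contour for the closures of the other arcs.\<close>

lemma contour_locally_arc:
 assumes Sg: "is_contour Sg" and gm: "gm : set Sg" and d: "0 < d" "{t0-d..t0+d} <= {0<..<1}"
 obtains rh where "0 < rh" "contour_set Sg Int ball (gm t0) rh <= gm ` {t0-d..t0+d}"
proof -
 obtain i where i: "i < length Sg" "gm = Sg ! i" using gm by (auto simp: in_set_conv_nth)
 have sm: "smooth_arc gm" using Sg gm by (simp add: is_contour_def)
 have inj: "inj_on gm {0<..<1}" and cont: "continuous_on {0<..<1} gm" using smooth_arc_continuous[OF sm] by auto
 have "t0 : {t0-d..t0+d}" "t0 - d : {t0-d..t0+d}" "t0 + d : {t0-d..t0+d}" using d(1) by auto
 then have "t0 : {0<..<1}" "t0 - d : {0<..<1}" "t0 + d : {0<..<1}" using d(2) by blast+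
 then have t0: "t0 : {0<..<1}" and td: "0 < t0 - d" "t0 + d < 1" by auto
 obtain F dl0 where F: "F Int gm ` {0<..<1} = {}" "0 < dl0" "dl0 < 1/2" and cl:
  "ALL dl>0. dl <= dl0 --> closure (gm ` {0<..dl}) <= gm ` {0<..dl} Un F & closure (gm ` {1-dl..<1}) <= gm ` {1-dl..<1} Un F"
  using smooth_arc_closure[OF sm] by blast
 note F = F conjunct1[OF cl[rule_format]] conjunct2[OF cl[rule_format]]
 define dl where "dl = min dl0 (min (t0 - d) (1 - (t0 + d)))"
 have dl: "0 < dl" "dl <= dl0" "dl <= t0 - d" "dl <= 1 - (t0 + d)" using F(2) td by (auto simp: dl_def)
 have dl': "t0 + d <= 1 - dl" "t0 <= 1 - dl" "dl < t0" "dl < 1" using dl d t0 by auto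
 define C where "C = closure (gm ` {0<..dl}) Un gm ` {dl..t0-d} Un gm ` {t0+d..1-dl} Un closure (gm ` {1-dl..<1})
  Un (\<Union>j\<in>{..<length Sg} - {i}. closure ((Sg!j) ` {0<..<1}))"
 have "closed C" unfolding C_def
  by (intro closed_Un closed_UN compact_imp_closed compact_continuous_image continuous_on_subset[OF cont] closed_closure)
  (use dl dl' d in auto)
 moreover have "gm t0 ~: C"
 proof -
  have ne: "gm t0 ~= gm s" if "s : {0<..<1}" "s ~= t0" for s using inj_onD[OF inj _ t0 that(1)] that by auto
  have nim: "gm t0 ~: gm ` S" if "S <= {0<..<1}" "t0 ~: S" for S using ne that by blast
  have nF: "gm t0 ~: F" using F(1) t0 by blast
  have "gm t0 ~: gm ` {0<..dl}" by (rule nim) (use dl' in auto)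
  then have "gm t0 ~: closure (gm ` {0<..dl})" using F(4)[OF dl(1,2)] nF by blast
  moreover have "gm t0 ~: closure (gm ` {1-dl..<1})"
  proof -
  have "gm t0 ~: gm ` {1-dl..<1}" by (rule nim) (use dl' d(1) in auto)
  then show ?thesis using F(5)[OF dl(1,2)] nF by blast
  qed
  moreover have "gm t0 ~: gm ` {dl..t0-d}" by (rule nim) (use dl dl' d(1) td in auto)
  moreover have "gm t0 ~: gm ` {t0+d..1-dl}" by (rule nim) (use dl dl' d(1) td t0 in auto)
  moreover have "gm t0 ~: closure ((Sg!j) ` {0<..<1})" if "j : {..<length Sg} - {i}" for j
  using Sg i that t0 unfolding is_contour_def by blast
  ultimately show ?thesis unfolding C_def by blast
 qed
 ultimately obtain rh where rh: "rh > 0" "ball (gm t0) rh <= - C" using open_contains_ball[of "-C"] by (auto simp: open_Compl)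
 have "contour_set Sg <= C Un gm ` {t0-d..t0+d}"
 proof
  fix w assume "w : contour_set Sg"
  then obtain j where j: "j < length Sg" "w : closure ((Sg!j) ` {0<..<1})" unfolding contour_set_eq_UN by (auto simp: in_set_conv_nth)
  show "w : C Un gm ` {t0-d..t0+d}"
  proof (cases "j = i")
  case True
  have "{0<..<1} = {0<..dl} Un {dl..t0-d} Un {t0+d..1-dl} Un {1-dl..<1} Un {t0-d..t0+d}" using dl dl' d by auto
  then have "closure (gm ` {0<..<1}) = closure (gm ` {0<..dl}) Un closure (gm ` {dl..t0-d}) Un closure (gm ` {t0+d..1-dl}) Un closure (gm ` {1-dl..<1}) Un closure (gm ` {t0-d..t0+d})"
  by (simp only: image_Un closure_Un)
  moreover have "closed (gm ` {dl..t0-d})" "closed (gm ` {t0+d..1-dl})" "closed (gm ` {t0-d..t0+d})"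
  by (intro compact_imp_closed compact_continuous_image continuous_on_subset[OF cont]; use dl dl' d in auto)+
  ultimately show ?thesis using j True i unfolding C_def by (auto simp: closure_closed)
  next
  case False
  then show ?thesis using j unfolding C_def by auto
  qed
 qed
 then show ?thesis using that[OF rh(1)] rh(2) by blast
qed

section \<open>Spaces of integrable functions\<close>

lemma Lp_iff:
 fixes f :: "'a => 'b::{real_normed_vector, second_countable_topology}"
 shows "f : Lp M p \<longleftrightarrow> f : bmeas M & (\<integral>\<^sup>+x. ennreal (norm (f x) powr p) \<partial>M) < \<infinity>"
 unfolding Lp_def by (auto simp: integrable_iff_bounded)

lemma Lp_measurable: "f : Lp M p ==> f : bmeas M"
 by (simp add: Lp_def)

lemma Lp_norm_nonneg [simp]: "0 <= Lp_norm M p f"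
 by (simp add: Lp_norm_def)

lemma Lp_norm_powr:
 assumes "f : Lp M p" "p > 0"
 shows "ennreal (Lp_norm M p f powr p) = (\<integral>\<^sup>+x. ennreal (norm (f x) powr p) \<partial>M)"
proof -
 have "integrable M (%x. norm (f x) powr p)" using assms by (simp add: Lp_def)
 then have "(\<integral>\<^sup>+x. ennreal (norm (f x) powr p) \<partial>M) = ennreal (\<integral>x. norm (f x) powr p \<partial>M)"
  by (rule nn_integral_eq_integral) auto
 then show ?thesis using assms(2) by (simp add: Lp_norm_def powr_powr)
qed

lemma Lp_norm_leI:
 fixes f :: "'a => 'b::{real_normed_vector, second_countable_topology}"
 assumes "f : bmeas M" "p > 0" "0 <= C" "(\<integral>\<^sup>+x. ennreal (norm (f x) powr p) \<partial>M) <= ennreal (C powr p)"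
 shows "f : Lp M p" "Lp_norm M p f <= C"
proof -
 show f: "f : Lp M p" using assms by (auto simp: Lp_iff intro: order.strict_trans1)
 have "ennreal (Lp_norm M p f powr p) <= ennreal (C powr p)" using Lp_norm_powr[OF f assms(2)] assms(4) by simp
 then have "Lp_norm M p f powr p <= C powr p" by simp
 then show "Lp_norm M p f <= C" using assms(2,3)
  by (meson Lp_norm_nonneg not_less powr_less_mono2)
qed

lemma Lp_mono:
 fixes f :: "'a => 'b::{real_normed_vector, second_countable_topology}" and g :: "'a => 'c::{real_normed_vector, second_countable_topology}"
 assumes f: "f : Lp M p" and g: "g : bmeas M" and p: "p > 0" and c: "0 <= c" and le: "AE x in M. norm (g x) <= c * norm (f x)"
 shows "g : Lp M p" "Lp_norm M p g <= c * Lp_norm M p f"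
proof -
 have "(\<integral>\<^sup>+x. ennreal (norm (g x) powr p) \<partial>M) <= (\<integral>\<^sup>+x. ennreal (c powr p) * ennreal (norm (f x) powr p) \<partial>M)"
 proof (rule nn_integral_mono_AE)
  show "AE x in M. ennreal (norm (g x) powr p) <= ennreal (c powr p) * ennreal (norm (f x) powr p)"
  using le
  proof eventually_elim
  case (elim x)
  have "norm (g x) powr p <= (c * norm (f x)) powr p" using elim p by (intro powr_mono2) auto
  also have "... = c powr p * norm (f x) powr p" using c by (simp add: powr_mult)
  finally show ?case by (simp add: ennreal_mult[symmetric])
  qed
 qed
 also have "... = ennreal (c powr p) * (\<integral>\<^sup>+x. ennreal (norm (f x) powr p) \<partial>M)"
  by (rule nn_integral_cmult) (use Lp_measurable[OF f] in measurable)
 also have "... = ennreal ((c * Lp_norm M p f) powr p)"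
  using Lp_norm_powr[OF f p] c by (simp add: powr_mult ennreal_mult)
 finally show "g : Lp M p" "Lp_norm M p g <= c * Lp_norm M p f"
  using Lp_norm_leI[OF g p, of "c * Lp_norm M p f"] c by simp_all
qed

lemma Lp_cong_AE:
 fixes f :: "'a => 'b::{real_normed_vector, second_countable_topology}"
 assumes "f : Lp M p" "g : bmeas M" "p > 0" "AE x in M. f x = g x"
 shows "g : Lp M p" "Lp_norm M p g <= Lp_norm M p f"
proof -
 have "AE x in M. norm (g x) <= 1 * norm (f x)" using assms(4) by eventually_elim simp
 then show "g : Lp M p" "Lp_norm M p g <= Lp_norm M p f" using Lp_mono[OF assms(1-3), of 1] by auto
qed

text \<open>Instead of the sharp constant 1 of Minkowski's inequality, the factor 2 comes from
  (a+b)^p <= 2^p (a^p + b^p) and A^p + B^p <= (A+B)^p. The final estimate is only up to a constant,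
  so this is enough.\<close>

lemma Lp_add:
 fixes f g :: "'a => 'b::{real_normed_vector, second_countable_topology}"
 assumes f: "f : Lp M p" and g: "g : Lp M p" and p: "p >= 1"
 shows "(%x. f x + g x) : Lp M p" "Lp_norm M p (%x. f x + g x) <= 2 * (Lp_norm M p f + Lp_norm M p g)"
proof -
 note [measurable] = Lp_measurable[OF f] Lp_measurable[OF g]
 have p0: "p > 0" using p by simp
 define A B where "A = Lp_norm M p f" and "B = Lp_norm M p g"
 have AB: "0 <= A" "0 <= B" by (simp_all add: A_def B_def)
 have pt: "(a + b) powr p <= 2 powr p * (a powr p + b powr p)" if "0 <= a" "0 <= b" for a b :: real
 proof -
  have "(a + b) powr p <= (2 * max a b) powr p" using that p0 by (intro powr_mono2) auto
  also have "... = 2 powr p * max a b powr p" using that by (simp add: powr_mult)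
  also have "... <= 2 powr p * (a powr p + b powr p)" by (intro mult_left_mono) (auto simp: max_def)
  finally show ?thesis .
 qed
 have sup: "A powr p + B powr p <= (A + B) powr p"
 proof (cases "A + B = 0")
  case False
  then have s: "A + B > 0" using AB by auto
  have "(A / (A + B)) powr p <= (A / (A + B)) powr 1" "(B / (A + B)) powr p <= (B / (A + B)) powr 1"
  using AB s p by (intro powr_mono'; simp)+
  then have "(A / (A + B)) powr p + (B / (A + B)) powr p <= A / (A + B) + B / (A + B)" using AB s by simp
  also have "... = 1" using s by (simp add: add_divide_distrib[symmetric])
  finally have "(A powr p + B powr p) / (A + B) powr p <= 1" using AB s by (simp add: powr_divide add_divide_distrib)
  then show ?thesis using s by (simp add: divide_le_eq)
 next
  case True
  then have "A = 0" "B = 0" using AB by linarith+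
  then show ?thesis by simp
 qed
 have "(\<integral>\<^sup>+x. ennreal (norm (f x + g x) powr p) \<partial>M) <= (\<integral>\<^sup>+x. ennreal (2 powr p) * (ennreal (norm (f x) powr p) + ennreal (norm (g x) powr p)) \<partial>M)"
 proof (rule nn_integral_mono)
  fix x
  have "norm (f x + g x) powr p <= (norm (f x) + norm (g x)) powr p" using p0 by (intro powr_mono2 norm_triangle_ineq) auto
  also have "... <= 2 powr p * (norm (f x) powr p + norm (g x) powr p)" by (rule pt) auto
  finally show "ennreal (norm (f x + g x) powr p) <= ennreal (2 powr p) * (ennreal (norm (f x) powr p) + ennreal (norm (g x) powr p))"
  by (simp add: ennreal_plus[symmetric] ennreal_mult[symmetric] del: ennreal_plus)
 qed
 also have "... = ennreal (2 powr p) * ((\<integral>\<^sup>+x. ennreal (norm (f x) powr p) \<partial>M) + (\<integral>\<^sup>+x. ennreal (norm (g x) powr p) \<partial>M))"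
  by (simp add: nn_integral_cmult nn_integral_add)
 also have "... = ennreal (2 powr p * (A powr p + B powr p))"
  unfolding Lp_norm_powr[OF f p0, symmetric] Lp_norm_powr[OF g p0, symmetric] A_def B_def
  by (simp add: ennreal_mult ennreal_plus)
 also have "... <= ennreal (2 powr p * (A + B) powr p)"
  by (intro ennreal_leI mult_left_mono sup) auto
 also have "... = ennreal ((2 * (A + B)) powr p)" using AB powr_mult[of 2 "A + B" p] by (simp del: distrib_left_numeral)
 finally show "(%x. f x + g x) : Lp M p" "Lp_norm M p (%x. f x + g x) <= 2 * (Lp_norm M p f + Lp_norm M p g)"
  using Lp_norm_leI[of "%x. f x + g x" M p "2 * (A + B)"] p0 AB by (auto simp: A_def B_def)
qed

lemma Lp_scale:
 fixes f :: "'a => complex"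
 assumes "f : Lp M p" "p > 0"
 shows "(%x. c * f x) : Lp M p" "Lp_norm M p (%x. c * f x) <= cmod c * Lp_norm M p f"
proof -
 have [measurable]: "f : bmeas M" by (rule Lp_measurable[OF assms(1)])
 have m: "(%x. c * f x) : bmeas M" by measurable
 show "(%x. c * f x) : Lp M p" "Lp_norm M p (%x. c * f x) <= cmod c * Lp_norm M p f"
  using Lp_mono[OF assms(1) m assms(2), of "cmod c"] by (auto simp: norm_mult)
qed

lemma Lp_uminus:
 fixes f :: "'a => 'b::{real_normed_vector, second_countable_topology}"
 assumes "f : Lp M p" "p > 0"
 shows "(%x. - f x) : Lp M p" "Lp_norm M p (%x. - f x) <= Lp_norm M p f"
proof -
 have m: "(%x. - f x) : bmeas M" using Lp_measurable[OF assms(1)] by measurable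
 show "(%x. - f x) : Lp M p" "Lp_norm M p (%x. - f x) <= Lp_norm M p f"
  using Lp_mono[OF assms(1) m assms(2), of 1] by auto
qed

lemma Lp_diff:
 fixes f g :: "'a => 'b::{real_normed_vector, second_countable_topology}"
 assumes f: "f : Lp M p" and g: "g : Lp M p" and p: "p >= 1"
 shows "(%x. f x - g x) : Lp M p" "Lp_norm M p (%x. f x - g x) <= 2 * (Lp_norm M p f + Lp_norm M p g)"
proof -
 have p0: "p > 0" using p by simp
 note u = Lp_uminus[OF g p0]
 show "(%x. f x - g x) : Lp M p" "Lp_norm M p (%x. f x - g x) <= 2 * (Lp_norm M p f + Lp_norm M p g)"
  using Lp_add[OF f u(1) p] u(2) by simp_all
qed

lemma Lp_norm_eq_0:
 fixes f :: "'a => 'b::{real_normed_vector, second_countable_topology}"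
 assumes "f : Lp M p" "p > 0" "Lp_norm M p f = 0"
 shows "AE x in M. f x = 0"
proof -
 have [measurable]: "f : bmeas M" by (rule Lp_measurable[OF assms(1)])
 have "(\<integral>\<^sup>+x. ennreal (norm (f x) powr p) \<partial>M) = 0" using Lp_norm_powr[OF assms(1,2)] assms(2,3) by simp
 then have "AE x in M. ennreal (norm (f x) powr p) = 0" by (subst (asm) nn_integral_0_iff_AE) auto
 then show ?thesis by eventually_elim (auto simp: ennreal_eq_0_iff)
qed

lemma Lp_zero:
 assumes "p > 0" shows "(%_. 0 :: 'b::{real_normed_vector, second_countable_topology}) : Lp M p" "Lp_norm M p (%_. 0 :: 'b) = 0"
 using assms by (auto simp: Lp_def Lp_norm_def)

text \<open>\<open>real_of_ereal\<close> maps infinite values to 0, so the essential supremum must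
  be shown finite. It is bounded above by assumption and nonnegative unless the whole space is null;
  in that case every statement holds almost everywhere.\<close>

lemma Linf_bound:
 fixes f :: "'a => 'b::{real_normed_vector, second_countable_topology}"
 assumes "f : Linf M"
 shows "AE x in M. norm (f x) <= Linf_norm M f"
proof -
 have [measurable]: "f : bmeas M" using assms by (simp add: Linf_def)
 obtain B where B: "AE x in M. norm (f x) <= B" using assms by (auto simp: Linf_def)
 show ?thesis
 proof (cases "emeasure M (space M) = 0")
  case True
  then have e: "ae_filter M = bot" by (simp add: ae_filter_eq_bot_iff)
  show ?thesis unfolding e by simp
 next
  case False
  let ?e = "esssup M (%x. ereal (norm (f x)))"
  have up: "?e <= ereal B" using B by (intro esssup_I) auto
  have "AE x in M. 0 <= ereal (norm (f x))" by simp
  then have "esssup M (%_. 0 :: ereal) <= ?e" by (intro esssup_AE_mono) auto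
  then have "0 <= ?e" using False by (simp add: esssup_const)
  then obtain r where r: "?e = ereal r" using up by (cases ?e) auto
  have "AE x in M. ereal (norm (f x)) <= ?e" by (rule esssup_AE)
  then show ?thesis unfolding Linf_norm_def r by simp
 qed
qed

lemma Linf_norm_nonneg:
 fixes f :: "'a => 'b::{real_normed_vector, second_countable_topology}"
 assumes "f : bmeas M" shows "0 <= Linf_norm M f"
proof (cases "emeasure M (space M) = 0")
 case True
 then show ?thesis using assms by (simp add: Linf_norm_def esssup_zero_space)
next
 case False
 have "esssup M (%_. 0 :: ereal) <= esssup M (%x. ereal (norm (f x)))" using assms by (intro esssup_AE_mono) auto
 then show ?thesis using False by (simp add: esssup_const Linf_norm_def real_of_ereal_pos)
qed

text \<open>Interpolation in the form |f|^p = |f|^(p-2) |f|^2, with one number B bounding both the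
  sup norm and the L2 norm. It brings Cauchy integrals over the second contour, which are bounded
  and in L2 on the first, into Lp.\<close>

lemma Lp_Int_Linf:
 fixes f :: "'a => 'b::{real_normed_vector, second_countable_topology}"
 assumes f: "f : Lp M 2" and bd: "AE x in M. norm (f x) <= B" and le: "Lp_norm M 2 f <= B" and B: "0 <= B" and p: "p > 2"
 shows "f : Lp M p" "Lp_norm M p f <= B"
proof -
 have [measurable]: "f : bmeas M" by (rule Lp_measurable[OF f])
 have "(\<integral>\<^sup>+x. ennreal (norm (f x) powr p) \<partial>M) <= (\<integral>\<^sup>+x. ennreal (B powr (p - 2)) * ennreal (norm (f x) powr 2) \<partial>M)"
 proof (rule nn_integral_mono_AE)
  show "AE x in M. ennreal (norm (f x) powr p) <= ennreal (B powr (p - 2)) * ennreal (norm (f x) powr 2)"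
  using bd
  proof eventually_elim
  case (elim x)
  have "norm (f x) powr p = norm (f x) powr (p - 2) * norm (f x) powr 2" by (simp flip: powr_add del: powr_numeral)
  also have "... <= B powr (p - 2) * norm (f x) powr 2" using elim p by (intro mult_right_mono powr_mono2) auto
  finally show ?case by (simp add: ennreal_mult[symmetric] del: powr_numeral)
  qed
 qed
 also have "... = ennreal (B powr (p - 2)) * ennreal (Lp_norm M 2 f powr 2)"
  by (subst nn_integral_cmult) (auto simp: Lp_norm_powr[OF f] simp del: powr_numeral)
 also have "... <= ennreal (B powr (p - 2)) * ennreal (B powr 2)"
  using le by (intro mult_left_mono ennreal_leI powr_mono2) auto
 also have "... = ennreal (B powr p)" by (simp add: ennreal_mult[symmetric] flip: powr_add del: powr_numeral)
 finally show "f : Lp M p" "Lp_norm M p f <= B" using Lp_norm_leI[of f M p B] p B by auto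
qed

text \<open>On \<open>norm (f x) <= 1\<close> the product is dominated by \<open>b\<close>, elsewhere by \<open>norm (f x) powr p\<close>;
 this replaces Hoelder's inequality.\<close>

lemma L2_product:
 fixes f :: "'a => 'b::{real_normed_vector, second_countable_topology}" and b :: "'a => 'c::{real_normed_vector, second_countable_topology}"
  and g :: "'a => 'd::{real_normed_vector, second_countable_topology}"
 assumes f: "f : Lp M p" and p: "2 < p" and f1: "Lp_norm M p f <= 1" and b: "b : Lp M 2" and bB: "AE x in M. norm (b x) <= B" and B: "0 <= B"
  and g: "g : bmeas M" and le: "AE x in M. norm (g x) <= norm (f x) * norm (b x)"
 shows "g : Lp M 2" "Lp_norm M 2 g <= Lp_norm M 2 b + B"
proof -
 note [measurable] = Lp_measurable[OF f] Lp_measurable[OF b]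
 have "(\<integral>\<^sup>+x. ennreal (norm (g x) powr 2) \<partial>M) <= (\<integral>\<^sup>+x. ennreal (norm (b x) powr 2) + ennreal (B powr 2) * ennreal (norm (f x) powr p) \<partial>M)"
 proof (rule nn_integral_mono_AE)
  show "AE x in M. ennreal (norm (g x) powr 2) <= ennreal (norm (b x) powr 2) + ennreal (B powr 2) * ennreal (norm (f x) powr p)"
  using le bB
  proof eventually_elim
  case (elim x)
  have "norm (g x) powr 2 <= (norm (f x) * norm (b x)) powr 2" using elim by (intro powr_mono2) auto
  also have "... = norm (f x) powr 2 * norm (b x) powr 2" by (simp add: powr_mult del: powr_numeral)
  also have "... <= norm (b x) powr 2 + B powr 2 * norm (f x) powr p"
  proof (cases "norm (f x) <= 1")
  case True
  have "norm (f x) powr 2 * norm (b x) powr 2 <= 1 * norm (b x) powr 2"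
  using True by (intro mult_right_mono) (auto simp: abs_square_le_1 power_le_one)
  then show ?thesis by (simp add: add_increasing2 del: powr_numeral)
  next
  case False
  have "norm (f x) powr 2 <= norm (f x) powr p" using False p by (intro powr_mono) auto
  moreover have "norm (b x) powr 2 <= B powr 2" using elim by (intro powr_mono2) auto
  ultimately have "norm (f x) powr 2 * norm (b x) powr 2 <= norm (f x) powr p * B powr 2" by (intro mult_mono) auto
  then show ?thesis by (simp add: add_increasing mult.commute del: powr_numeral)
  qed
  finally show ?case by (simp add: ennreal_plus[symmetric] ennreal_mult[symmetric] del: ennreal_plus powr_numeral)
  qed
 qed
 also have "... = (\<integral>\<^sup>+x. ennreal (norm (b x) powr 2) \<partial>M) + ennreal (B powr 2) * (\<integral>\<^sup>+x. ennreal (norm (f x) powr p) \<partial>M)"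
  by (simp add: nn_integral_cmult nn_integral_add del: powr_numeral)
 also have "... = ennreal (Lp_norm M 2 b powr 2) + ennreal (B powr 2) * ennreal (Lp_norm M p f powr p)"
  using p by (simp add: Lp_norm_powr[OF b] Lp_norm_powr[OF f] del: powr_numeral)
 also have "... <= ennreal (Lp_norm M 2 b powr 2) + ennreal (B powr 2) * ennreal 1"
  using f1 p powr_mono2[of p "Lp_norm M p f" 1] by (intro add_left_mono mult_left_mono ennreal_leI) auto
 also have "... <= ennreal ((Lp_norm M 2 b + B) powr 2)"
  using B by (simp add: ennreal_plus[symmetric] power2_sum del: ennreal_plus)
 finally show "g : Lp M 2" "Lp_norm M 2 g <= Lp_norm M 2 b + B"
  using Lp_norm_leI[OF g, of 2 "Lp_norm M 2 b + B"] B by auto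
qed

section \<open>Arc length and Cauchy integrals\<close>

abbreviation open_unit :: "real set" where "open_unit \<equiv> {0<..<1}"

abbreviation arc_speed :: "(real => complex) => real => real" where
 "arc_speed gm t \<equiv> cmod (vel gm t)"

text \<open>Open arcs are injective and pairwise disjoint, so a point on one of them determines the
  arc and the parameter. Non-tangential limits therefore refer to one tangent only, and sums over
  the list become sums over a set.\<close>

lemma is_contour_arcs:
 assumes "is_contour Sg"
 shows "!!gm. gm : set Sg ==> smooth_arc gm"
  and "!!gm dl s t. gm : set Sg ==> dl : set Sg ==> s : open_unit ==> t : open_unit ==> gm s = dl t ==> gm = dl & s = t"
  and "distinct Sg"
proof -
 show 1: "smooth_arc gm" if "gm : set Sg" for gm using assms that by (simp add: is_contour_def)
 have dis: "i = j" if "i < length Sg" "j < length Sg" "s : open_unit" "t : open_unit" "(Sg!i) s = (Sg!j) t" for i j s t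
 proof (rule ccontr)
  assume "i ~= j"
  then have "(Sg!i) ` open_unit Int closure ((Sg!j) ` open_unit) = {}" using assms that by (simp add: is_contour_def)
  moreover have "(Sg!j) t : closure ((Sg!j) ` open_unit)" using that by (intro subsetD[OF closure_subset]) auto
  ultimately show False using that by (metis IntI emptyE imageI)
 qed
 show "gm = dl & s = t" if gd: "gm : set Sg" "dl : set Sg" "s : open_unit" "t : open_unit" "gm s = dl t" for gm dl s t
 proof -
  obtain i j where "i < length Sg" "gm = Sg!i" "j < length Sg" "dl = Sg!j" using gd(1,2) unfolding in_set_conv_nth by blast
  then have eq: "gm = dl" using dis gd by metis
  then have "s = t" using smooth_arc_continuous(3)[OF 1[OF gd(1)]] gd by (auto dest: inj_onD)
  then show ?thesis using eq by simp
 qed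
 show "distinct Sg"
 proof (unfold distinct_conv_nth, intro allI impI)
  fix i j assume "i < length Sg" "j < length Sg" "i ~= j"
  then show "Sg!i ~= Sg!j" using dis[of i j "1/2" "1/2"] by force
 qed
qed

lemma smooth_arc_measurable:
 assumes "smooth_arc gm"
 shows "gm : bmeas (restrict_space lborel open_unit)"
  and "(%t. vel gm t) : bmeas (restrict_space lborel open_unit)"
  and "(%t. if t : open_unit then gm t else 0) : bmeas borel"
  and "(%t. if t : open_unit then vel gm t else 0) : bmeas borel"
proof -
 have 1: "f : bmeas (restrict_space lborel open_unit)" if "continuous_on open_unit f" for f :: "real => complex"
  using borel_measurable_continuous_on_restrict[OF that] by (simp cong: measurable_cong_sets restrict_space_sets_cong)
 have 2: "(%t. if t : open_unit then f t else 0) : bmeas borel" if "continuous_on open_unit f" for f :: "real => complex"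
  using borel_measurable_continuous_on_if[of open_unit f "%_. 0"] that by simp
 show "gm : bmeas (restrict_space lborel open_unit)"
  "(%t. vel gm t) : bmeas (restrict_space lborel open_unit)"
  "(%t. if t : open_unit then gm t else 0) : bmeas borel"
  "(%t. if t : open_unit then vel gm t else 0) : bmeas borel"
  using 1 2 smooth_arc_continuous[OF assms] by blast+
qed

section \<open>Arc length in terms of the parameter interval\<close>

definition arclength_borel :: "contour => complex measure" where
 "arclength_borel Sg = distr
  (density (count_space {..<length Sg} \<Otimes>\<^sub>M restrict_space lborel {0<..<1})
  (%(j, t). ennreal (cmod (vector_derivative (Sg!j) (at t)))))
  borel (%(j, t). (Sg!j) t)"

lemma arclength_eq: "arclength Sg = completion (arclength_borel Sg)"
 by (simp add: arclength_def arclength_borel_def)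

lemma sets_arclength_borel [simp]: "sets (arclength_borel Sg) = sets borel" "space (arclength_borel Sg) = UNIV"
 by (simp_all add: arclength_borel_def)

lemma space_arclength [simp]: "space (arclength Sg) = UNIV"
 by (simp add: arclength_eq)

lemma nn_integral_arclength_borel:
 assumes Sg: "is_contour Sg" and f[measurable]: "f : bmeas borel"
 shows "(\<integral>\<^sup>+z. f z \<partial>arclength_borel Sg) = (\<Sum>gm\<in>set Sg. \<integral>\<^sup>+t. f (gm t) * ennreal (arc_speed gm t) * indicator open_unit t \<partial>lborel)"
proof -
 let ?R = "restrict_space lborel open_unit" and ?C = "count_space {..<length Sg}"
 interpret R: sigma_finite_measure ?R
  by (rule sigma_finite_measure_restrict_space) (auto intro: lborel.sigma_finite_measure_axioms)
 have arc: "smooth_arc (Sg!j)" if "j < length Sg" for j using is_contour_arcs(1)[OF Sg] that by simp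
 note m = smooth_arc_measurable[OF arc]
 have P[measurable]: "(%(j, t). (Sg!j) t) : bmeas (?C \<Otimes>\<^sub>M ?R)"
  by (rule measurable_pair_measure_countable1) (auto intro: m)
 have w[measurable]: "(%(j, t). ennreal (arc_speed (Sg!j) t)) : bmeas (?C \<Otimes>\<^sub>M ?R)"
  by (rule measurable_pair_measure_countable1) (auto intro!: measurable_compose[OF m(2)])
 have P': "(%(j, t). (Sg!j) t) : bmeas (density (?C \<Otimes>\<^sub>M ?R) (%(j, t). ennreal (arc_speed (Sg!j) t)))"
  using P by simp
 have fP: "(%x. f (case x of (j, t) => (Sg!j) t)) : bmeas (?C \<Otimes>\<^sub>M ?R)"
  by (rule measurable_compose[OF P f])
 have "(\<integral>\<^sup>+z. f z \<partial>arclength_borel Sg) = (\<integral>\<^sup>+x. f (case x of (j, t) => (Sg!j) t) \<partial>density (?C \<Otimes>\<^sub>M ?R) (%(j, t). ennreal (arc_speed (Sg!j) t)))"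
  unfolding arclength_borel_def by (rule nn_integral_distr[OF P']) simp
 also have "... = (\<integral>\<^sup>+x. (case x of (j, t) => ennreal (arc_speed (Sg!j) t)) * f (case x of (j, t) => (Sg!j) t) \<partial>(?C \<Otimes>\<^sub>M ?R))"
  by (rule nn_integral_density[OF w fP])
 also have "... = (\<integral>\<^sup>+j. \<integral>\<^sup>+t. ennreal (arc_speed (Sg!j) t) * f ((Sg!j) t) \<partial>?R \<partial>?C)"
  using R.nn_integral_fst[OF borel_measurable_times_ennreal[OF w fP]] by simp
 also have "... = (\<Sum>j<length Sg. \<integral>\<^sup>+t. ennreal (arc_speed (Sg!j) t) * f ((Sg!j) t) \<partial>?R)"
  by (simp add: nn_integral_count_space_finite)
 also have "... = (\<Sum>j<length Sg. \<integral>\<^sup>+t. f ((Sg!j) t) * ennreal (arc_speed (Sg!j) t) * indicator open_unit t \<partial>lborel)"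
  by (intro sum.cong refl, subst nn_integral_restrict_space) (auto simp: mult.commute)
 also have "... = (\<Sum>gm\<in>set Sg. \<integral>\<^sup>+t. f (gm t) * ennreal (arc_speed gm t) * indicator open_unit t \<partial>lborel)"
  by (rule sum.reindex_bij_betw[OF bij_betw_nth[OF is_contour_arcs(3)[OF Sg] refl refl]])
 finally show ?thesis .
qed

lemma smooth_arc_image_borel:
 assumes "smooth_arc gm" shows "gm ` (open_unit Int {..a}) : sets borel"
proof -
 define K where "K = (%n::nat. {1 / (real n + 3)..min a (1 - 1 / (real n + 3))})"
 have "open_unit Int {..a} = (\<Union>n. K n)"
 proof (intro equalityI subsetI)
  fix t assume t: "t : open_unit Int {..a}"
  then have "0 < min t (1 - t)" by auto
  then obtain n where n: "inverse (real (Suc n)) < min t (1 - t)" using reals_Archimedean by blast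
  have "1 / (real n + 3) <= inverse (real (Suc n))" by (simp add: inverse_eq_divide frac_le)
  then show "t : (\<Union>n. K n)" using n t by (intro UN_I[of n]) (auto simp: K_def)
 next
  fix t assume "t : (\<Union>n. K n)"
  then obtain n where t: "t : K n" by auto
  have "0 < 1 / (real n + 3)" by simp
  moreover have "1 / (real n + 3) <= t" "t <= a" "t <= 1 - 1 / (real n + 3)" using t by (auto simp: K_def)
  ultimately have "0 < t" "t < 1" "t <= a" by linarith+
  then show "t : open_unit Int {..a}" by simp
 qed
 then have "gm ` (open_unit Int {..a}) = (\<Union>n. gm ` K n)" by (simp add: image_UN)
 moreover have "gm ` K n : sets borel" for n
 proof -
  have "0 < 1 / (real n + 3)" by simp
  then have "0 < t & t < 1" if "1 / (real n + 3) <= t" "t <= 1 - 1 / (real n + 3)" for t using that by linarith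
  then have "K n <= open_unit" unfolding K_def by auto
  then have "compact (gm ` K n)" unfolding K_def
  by (intro compact_continuous_image continuous_on_subset[OF smooth_arc_continuous(1)[OF assms]]) auto
  then show ?thesis by (intro borel_compact)
 qed
 ultimately show ?thesis by auto
qed

text \<open>The inverse of the parametrisation is Borel, because its sublevel sets are images of
  \<open>open_unit Int {..a}\<close> and these are countable unions of compact sets. Off the arc it
  takes the value 2, which lies outside the unit interval.\<close>

lemma smooth_arc_image_borel_set:
 assumes "smooth_arc gm" "B : sets borel" shows "gm ` (open_unit Int B) : sets borel"
proof -
 define s where "s = (%z. if z : gm ` open_unit then inv_into open_unit gm z else 2)"
 have inj: "inj_on gm open_unit" using smooth_arc_continuous[OF assms(1)] by auto
 have s: "s (gm t) = t" if "t : open_unit" for t using inj that by (simp add: s_def inv_into_f_f)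
 have img: "gm ` open_unit : sets borel" using smooth_arc_image_borel[OF assms(1), of 1] by (simp add: Int_absorb2 subset_eq)
 have "s : bmeas borel"
 proof (rule borel_measurable_iff_le[THEN iffD2], intro allI)
  fix a
  have eq: "{z : space borel. s z <= a} = gm ` (open_unit Int {..a}) Un (if 2 <= a then - gm ` open_unit else {})"
  proof (intro set_eqI)
  fix z
  show "z : {z : space borel. s z <= a} \<longleftrightarrow> z : gm ` (open_unit Int {..a}) Un (if 2 <= a then - gm ` open_unit else {})"
  proof (cases "z : gm ` open_unit")
  case True
  then obtain t where t: "t : open_unit" "z = gm t" by auto
  have "gm t : gm ` (open_unit Int {..a}) \<longleftrightarrow> t : open_unit Int {..a}"
  by (rule inj_on_image_mem_iff[OF inj t(1)]) auto
  then show ?thesis using t s[OF t(1)] by auto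
  next
  case False
  then show ?thesis by (auto simp: s_def)
  qed
  qed
  show "{z : space borel. s z <= a} : sets borel"
  unfolding eq using smooth_arc_image_borel[OF assms(1), of a] img by auto
 qed
 then have "s -` B Int space borel : sets borel" using assms(2) by (rule measurable_sets)
 then have "gm ` open_unit Int s -` B : sets borel" using img by auto
 also have "gm ` open_unit Int s -` B = gm ` (open_unit Int B)" using s by auto
 finally show ?thesis .
qed

text \<open>A null set of the contour has null preimages because the speed does not vanish on open
  arcs. Conversely, the images of the good parameters, cut down to Borel sets, have a complement of
  arc length 0. This reduces all almost-everywhere statements on contours to Lebesgue
  measure.\<close>

lemma AE_arclength_iff:
 assumes Sg: "is_contour Sg"
 shows "(AE z in arclength Sg. P z) \<longleftrightarrow> (ALL gm:set Sg. AE t in lebesgue. t : open_unit --> P (gm t))"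
proof
 assume "AE z in arclength Sg. P z"
 then have "AE z in arclength_borel Sg. P z" unfolding arclength_eq by (rule AE_completion_iff[THEN iffD1])
 then obtain N where N: "{z : space (arclength_borel Sg). \<not> P z} <= N" "N : sets (arclength_borel Sg)" "emeasure (arclength_borel Sg) N = 0"
  by (auto elim!: AE_E)
 then have NP: "!!z. \<not> P z ==> z : N" and [measurable]: "N : sets borel" by auto
 have "0 = (\<integral>\<^sup>+z. indicator N z \<partial>arclength_borel Sg)" using N by simp
 also have "... = (\<Sum>gm\<in>set Sg. \<integral>\<^sup>+t. indicator N (gm t) * ennreal (arc_speed gm t) * indicator open_unit t \<partial>lborel)"
  by (rule nn_integral_arclength_borel[OF Sg]) simp
 finally have z: "ALL gm:set Sg. (\<integral>\<^sup>+t. indicator N (gm t) * ennreal (arc_speed gm t) * indicator open_unit t \<partial>lborel) = 0"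
  by (simp add: sum_nonneg_eq_0_iff)
 show "ALL gm:set Sg. AE t in lebesgue. t : open_unit --> P (gm t)"
 proof
  fix gm assume g: "gm : set Sg"
  note sm = is_contour_arcs(1)[OF Sg g]
  define p p' where "p = (%t. if t : open_unit then gm t else 0)" and "p' = (%t. if t : open_unit then vel gm t else 0)"
  have [measurable]: "p : bmeas borel" "p' : bmeas borel" unfolding p_def p'_def by (rule smooth_arc_measurable[OF sm])+
  have e: "(%t. indicator N (gm t) * ennreal (arc_speed gm t) * indicator open_unit t) = (%t. indicator N (p t) * ennreal (cmod (p' t)) * indicator open_unit t)"
  by (auto simp: p_def p'_def fun_eq_iff split: split_indicator)
  have "AE t in lborel. indicator N (p t) * ennreal (cmod (p' t)) * indicator open_unit t = 0"
  proof (rule nn_integral_0_iff_AE[THEN iffD1])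
  show "(\<integral>\<^sup>+t. indicator N (p t) * ennreal (cmod (p' t)) * indicator open_unit t \<partial>lborel) = 0"
  using bspec[OF z g] unfolding e .
  qed measurable
  then have "AE t in lborel. t : open_unit --> P (gm t)"
  proof eventually_elim
  case (elim t)
  then show ?case using NP[of "gm t"] smooth_arc_deriv(2)[OF sm, of t] by (auto simp: p_def p'_def split: split_indicator_asm if_splits)
  qed
  then show "AE t in lebesgue. t : open_unit --> P (gm t)" by (rule AE_completion)
 qed
next
 assume *: "ALL gm:set Sg. AE t in lebesgue. t : open_unit --> P (gm t)"
 have "EX N. N : null_sets lborel & (ALL t:open_unit - N. P (gm t))" if "gm : set Sg" for gm
 proof -
  have "AE t in lborel. t : open_unit --> P (gm t)" using * that by (simp add: AE_completion_iff)
  then obtain N where "N : null_sets lborel" "{t : space lborel. \<not> (t : open_unit --> P (gm t))} <= N"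
  unfolding eventually_ae_filter by blast
  then show ?thesis by (intro exI[of _ N]) auto
 qed
 then have "ALL gm:set Sg. EX N. N : null_sets lborel & (ALL t:open_unit - N. P (gm t))" by blast
 from bchoice[OF this] obtain N where N0: "ALL gm:set Sg. N gm : null_sets lborel & (ALL t:open_unit - N gm. P (gm t))" by blast
 have N: "N gm : null_sets lborel" "!!t. t : open_unit - N gm ==> P (gm t)" if "gm : set Sg" for gm using N0 that by blast+
 define G where "G = (\<Union>gm\<in>set Sg. gm ` (open_unit Int - N gm))"
 have Gb: "G : sets borel" unfolding G_def
 proof (intro sets.finite_UN finite_set)
  fix gm assume g: "gm : set Sg"
  show "gm ` (open_unit Int - N gm) : sets borel"
  by (rule smooth_arc_image_borel_set[OF is_contour_arcs(1)[OF Sg g]]) (use N(1)[OF g] in auto)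
 qed
 have "emeasure (arclength_borel Sg) (- G) = (\<integral>\<^sup>+z. indicator (-G) z \<partial>arclength_borel Sg)" using Gb by simp
 also have "... = (\<Sum>gm\<in>set Sg. \<integral>\<^sup>+t. indicator (-G) (gm t) * ennreal (arc_speed gm t) * indicator open_unit t \<partial>lborel)"
  by (rule nn_integral_arclength_borel[OF Sg]) (use Gb in simp)
 also have "... = (\<Sum>gm\<in>set Sg. 0)"
 proof (intro sum.cong refl)
  fix gm assume g: "gm : set Sg"
  have "AE t in lborel. indicator (-G) (gm t) * ennreal (arc_speed gm t) * indicator open_unit t = 0"
  using AE_not_in[OF N(1)[OF g]] by eventually_elim (use g in \<open>auto simp: G_def split: split_indicator\<close>)
  then have "(\<integral>\<^sup>+t. indicator (-G) (gm t) * ennreal (arc_speed gm t) * indicator open_unit t \<partial>lborel) = (\<integral>\<^sup>+t. 0 \<partial>(lborel :: real measure))"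
  by (rule nn_integral_cong_AE)
  then show "(\<integral>\<^sup>+t. indicator (-G) (gm t) * ennreal (arc_speed gm t) * indicator open_unit t \<partial>lborel) = 0" by simp
 qed
 finally have "- G : null_sets (arclength_borel Sg)" using Gb by (auto simp: null_sets_def)
 then have "AE z in arclength_borel Sg. z ~: - G" by (rule AE_not_in)
 then have "AE z in arclength_borel Sg. P z" by eventually_elim (use N(2) in \<open>auto simp: G_def\<close>)
 then show "AE z in arclength Sg. P z" unfolding arclength_eq by (rule AE_completion)
qed

lemma arclength_null_iff: "(AE z in arclength Sg. z ~: N) \<longleftrightarrow> N : null_sets (arclength Sg)"
 unfolding arclength_eq using completion.null_sets_iff_AE[of N "arclength_borel Sg"] by simp

text \<open>The parametrisation is measurable even between the completed measures, since null sets
  pull back to null sets.\<close>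

lemma measurable_arc:
 assumes Sg: "is_contour Sg" and g: "gm : set Sg"
 shows "gm : lebesgue_on open_unit \<rightarrow>\<^sub>M arclength Sg"
proof (rule measurableI)
 note sm = is_contour_arcs(1)[OF Sg g]
 fix A assume "A : sets (arclength Sg)"
 then obtain S N N' where A: "A = S Un N" "N <= N'" "N' : null_sets (arclength_borel Sg)" "S : sets borel"
  unfolding arclength_eq by (auto elim: sets_completionE)
 have "AE z in arclength_borel Sg. z ~: N" using AE_not_in[OF A(3)] by eventually_elim (use A(2) in auto)
 then have "AE z in arclength Sg. z ~: N" unfolding arclength_eq by (rule AE_completion)
 then have "AE t in lebesgue. t : open_unit --> gm t ~: N" using g by (simp add: AE_arclength_iff[OF Sg])
 then have n: "{t. t : open_unit & gm t : N} : null_sets lebesgue"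
  by (simp add: completion.AE_iff_null_sets)
 have "gm -` S Int open_unit : sets (restrict_space lborel open_unit)"
  using measurable_sets[OF smooth_arc_measurable(1)[OF sm] A(4)] by (simp add: space_restrict_space)
 then have "gm -` S Int open_unit : sets lborel" by (simp add: sets_restrict_space_iff)
 then have "gm -` S Int open_unit : sets lebesgue" by (rule sets_completionI_sets)
 then have "(gm -` S Int open_unit) Un {t. t : open_unit & gm t : N} : sets lebesgue" using n by auto
 also have "(gm -` S Int open_unit) Un {t. t : open_unit & gm t : N} = gm -` A Int open_unit" using A by auto
 finally show "gm -` A Int space (lebesgue_on open_unit) : sets (lebesgue_on open_unit)"
  by (subst sets_restrict_space_iff) auto
qed simp

lemma arc_image_sets:
 assumes Sg: "is_contour Sg" and g: "gm : set Sg" and L: "L : sets lebesgue" "L <= open_unit"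
 shows "gm ` L : sets (arclength Sg)"
proof -
 note sm = is_contour_arcs(1)[OF Sg g]
 obtain S N N' where A: "L = S Un N" "N <= N'" "N' : null_sets lborel" "S : sets lborel"
  using L(1) by (auto elim: sets_completionE)
 have "AE t in lborel. t ~: N" using AE_not_in[OF A(3)] by eventually_elim (use A(2) in auto)
 then have nt: "AE t in lebesgue. t ~: N" by (rule AE_completion)
 have "AE z in arclength Sg. z ~: gm ` N"
  unfolding AE_arclength_iff[OF Sg]
 proof
  fix dl assume d: "dl : set Sg"
  show "AE t in lebesgue. t : open_unit --> dl t ~: gm ` N"
  using nt
  proof eventually_elim
  case (elim t)
  show ?case
  proof (intro impI notI)
  assume t: "t : open_unit" "dl t : gm ` N"
  then obtain s where s: "s : N" "dl t = gm s" by auto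
  then have "s : open_unit" using A(1) L(2) by auto
  then have "t = s" using is_contour_arcs(2)[OF Sg d g t(1)] s(2) by blast
  then show False using s elim by simp
  qed
  qed
 qed
 then have "gm ` N : null_sets (arclength Sg)" by (simp add: arclength_null_iff)
 moreover have "gm ` (open_unit Int S) : sets (arclength_borel Sg)" using smooth_arc_image_borel_set[OF sm] A(4) by simp
 then have "gm ` (open_unit Int S) : sets (arclength Sg)" unfolding arclength_eq by (rule sets_completionI_sets)
 moreover have "gm ` L = gm ` (open_unit Int S) Un gm ` N" using A(1) L(2) by auto
 ultimately show ?thesis by auto
qed

lemma AE_arclength_on_arcs:
 assumes "is_contour Sg" shows "AE z in arclength Sg. EX gm:set Sg. EX t:open_unit. z = gm t"
 unfolding AE_arclength_iff[OF assms] by (intro ballI AE_I2) blast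

text \<open>Points on no open arc form a null set, and in the completed measure each of its subsets
  is measurable; hence measurability along every arc suffices.\<close>

lemma borel_measurable_arclengthI:
 assumes Sg: "is_contour Sg" and f: "!!gm. gm : set Sg ==> (%t. f (gm t)) : bmeas (lebesgue_on open_unit)"
 shows "f : bmeas (arclength Sg)"
proof (rule measurableI)
 fix A :: "'a set" assume A: "A : sets borel"
 let ?U = "\<Union>gm\<in>set Sg. gm ` open_unit"
 have arc: "gm ` {t : open_unit. f (gm t) : A} : sets (arclength Sg)" if "gm : set Sg" for gm
 proof (rule arc_image_sets[OF Sg that])
  have "{t : open_unit. f (gm t) : A} : sets (lebesgue_on open_unit)"
  using measurable_sets[OF f[OF that] A] by (simp add: vimage_def Int_def conj_commute)
  then show "{t : open_unit. f (gm t) : A} : sets lebesgue" by (simp add: sets_restrict_space_iff)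
 qed auto
 have "AE z in arclength Sg. z ~: - ?U" using AE_arclength_on_arcs[OF Sg] by eventually_elim auto
 then have "AE z in arclength Sg. z ~: {z : - ?U. f z : A}" by eventually_elim auto
 then have "{z : - ?U. f z : A} : sets (arclength Sg)" unfolding arclength_null_iff by auto
 then have "(\<Union>gm\<in>set Sg. gm ` {t : open_unit. f (gm t) : A}) Un {z : - ?U. f z : A} : sets (arclength Sg)"
  using arc by (intro sets.Un sets.finite_UN) auto
 also have "(\<Union>gm\<in>set Sg. gm ` {t : open_unit. f (gm t) : A}) Un {z : - ?U. f z : A} = f -` A Int space (arclength Sg)" by auto
 finally show "f -` A Int space (arclength Sg) : sets (arclength Sg)" .
qed simp

lemma nn_integral_arclength:
 assumes Sg: "is_contour Sg" and f: "f : bmeas (arclength Sg)"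
 shows "(\<integral>\<^sup>+z. f z \<partial>arclength Sg) = (\<Sum>gm\<in>set Sg. \<integral>\<^sup>+t. f (gm t) * ennreal (arc_speed gm t) * indicator open_unit t \<partial>lebesgue)"
proof -
 obtain f' where f': "f' : bmeas (arclength_borel Sg)" "AE z in arclength_borel Sg. f z = f' z"
  using f unfolding arclength_eq by (auto dest: completion_ex_borel_measurable)
 have ae: "AE z in arclength Sg. f z = f' z" unfolding arclength_eq by (rule AE_completion[OF f'(2)])
 have "(\<integral>\<^sup>+z. f z \<partial>arclength Sg) = (\<integral>\<^sup>+z. f' z \<partial>arclength Sg)" by (rule nn_integral_cong_AE[OF ae])
 also have "... = (\<integral>\<^sup>+z. f' z \<partial>arclength_borel Sg)" unfolding arclength_eq by (rule nn_integral_completion)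
 also have "... = (\<Sum>gm\<in>set Sg. \<integral>\<^sup>+t. f' (gm t) * ennreal (arc_speed gm t) * indicator open_unit t \<partial>lborel)"
  by (rule nn_integral_arclength_borel[OF Sg]) (use f' in \<open>simp cong: measurable_cong_sets\<close>)
 also have "... = (\<Sum>gm\<in>set Sg. \<integral>\<^sup>+t. f' (gm t) * ennreal (arc_speed gm t) * indicator open_unit t \<partial>lebesgue)"
  by (simp add: nn_integral_completion)
 also have "... = (\<Sum>gm\<in>set Sg. \<integral>\<^sup>+t. f (gm t) * ennreal (arc_speed gm t) * indicator open_unit t \<partial>lebesgue)"
 proof (intro sum.cong refl nn_integral_cong_AE)
  fix gm assume "gm : set Sg"
  then have "AE t in lebesgue. t : open_unit --> f (gm t) = f' (gm t)" using ae by (simp add: AE_arclength_iff[OF Sg])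
  then show "AE t in lebesgue. f' (gm t) * ennreal (arc_speed gm t) * indicator open_unit t = f (gm t) * ennreal (arc_speed gm t) * indicator open_unit t"
  by eventually_elim (auto split: split_indicator)
 qed
 finally show ?thesis .
qed

section \<open>Densities of Cauchy integrals and their weight at infinity\<close>

lemma one_plus_norm_neq_0: "1 + norm x ~= 0" "norm x + 1 ~= 0"
 using norm_ge_zero[of x] by linarith+

text \<open>The quotient is, up to constants, the speed in the spherical metric, hence invariant in
  kind under z -> 1/z: with gm = 1/g it equals |g'|/(1+|g|)^2, which is bounded up to an end at
  infinity.\<close>

lemma regular_end_weight:
 assumes "regular_end gm a"
 shows "EX e>0. EX B. ALL t:open_unit Int {a-e<..<a+e}. arc_speed gm t / (1 + cmod (gm t))^2 <= B"
proof -
 obtain e g where e: "e > 0" and g: "g C1_differentiable_on {a-e..a+e}"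
  and gg: "(ALL t:{0<..<1} Int {a-e..a+e}. gm t = g t) & g a ~: gm ` {0<..<1} \<or>
  (ALL t:{0<..<1} Int {a-e..a+e}. g t ~= 0 & gm t = 1 / g t) & g a = 0"
  using assms unfolding regular_end_def by blast
 have cg: "continuous_on {a-e..a+e} (%t. vel g t)" and
  dg: "!!t. t : {a-e..a+e} ==> (g has_vector_derivative vel g t) (at t)"
  using g by (auto simp: C1_differentiable_on_eq vector_derivative_works)
 obtain B where "ALL w:(%t. vel g t) ` {a-e..a+e}. norm w <= B"
  using compact_imp_bounded[OF compact_continuous_image[OF cg compact_Icc]] unfolding bounded_iff by blast
 then have B: "cmod (vel g t) <= B" if "t : {a-e..a+e}" for t using that by blast
 have "arc_speed gm t / (1 + cmod (gm t))^2 <= B" if t: "t : open_unit Int {a-e<..<a+e}" for t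
 proof -
  have t': "t : {a-e..a+e}" using t by auto
  have op: "open (open_unit Int {a-e<..<a+e})" by auto
  have sub: "open_unit Int {a-e<..<a+e} <= open_unit Int {a-e..a+e}" by auto
  let ?g' = "vel g t"
  from gg show ?thesis
  proof
  assume *: "(ALL t:{0<..<1} Int {a-e..a+e}. gm t = g t) & g a ~: gm ` {0<..<1}"
  have "(gm has_vector_derivative ?g') (at t)"
  by (rule has_vector_derivative_transform_within_open[OF dg[OF t'] op t]) (use * sub in auto)
  then have "vel gm t = ?g'" by (rule vector_derivative_at)
  then have "arc_speed gm t / (1 + cmod (gm t))^2 = cmod ?g' / (1 + cmod (gm t))^2" by simp
  also have "... <= cmod ?g' / 1" by (intro divide_left_mono) (auto simp: one_plus_norm_neq_0)
  finally show ?thesis using B[OF t'] by simp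
  next
  assume *: "(ALL t:{0<..<1} Int {a-e..a+e}. g t ~= 0 & gm t = 1 / g t) & g a = 0"
  then have gt: "g t ~= 0" "gm t = 1 / g t" using t by auto
  have "((inverse \<circ> g) has_vector_derivative (?g' * - (inverse (g t) ^ Suc (Suc 0)))) (at t)"
  by (rule field_vector_diff_chain_at[OF dg[OF t'] DERIV_inverse[OF gt(1)]])
  then have "(gm has_vector_derivative (?g' * - (inverse (g t) ^ Suc (Suc 0)))) (at t)"
  by (rule has_vector_derivative_transform_within_open[OF _ op t]) (use * sub in \<open>auto simp: inverse_eq_divide\<close>)
  then have "vel gm t = ?g' * - (inverse (g t) ^ Suc (Suc 0))" by (rule vector_derivative_at)
  then have "arc_speed gm t = cmod ?g' / (cmod (g t))^2"
  by (simp add: norm_mult norm_inverse power2_eq_square divide_inverse)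
  moreover have "cmod (gm t) = 1 / cmod (g t)" using gt(2) by (simp add: norm_divide)
  then have "1 + cmod (gm t) = (cmod (g t) + 1) / cmod (g t)" using gt(1) by (simp add: add_divide_distrib)
  ultimately have "arc_speed gm t / (1 + cmod (gm t))^2 = cmod ?g' / (cmod (g t) + 1)^2"
  using gt by (simp add: power_divide)
  also have "... <= cmod ?g' / 1" by (intro divide_left_mono) (auto simp: one_plus_norm_neq_0)
  finally show ?thesis using B[OF t'] by simp
  qed
 qed
 then show ?thesis using e by blast
qed

lemma smooth_arc_weight:
 assumes sm: "smooth_arc gm" shows "EX B>=0. ALL t:open_unit. arc_speed gm t / (1 + cmod (gm t))^2 <= B"
proof -
 have "regular_end gm 0" "regular_end gm 1" using sm by (auto simp: smooth_arc_def)
 then obtain e0 B0 e1 B1 where e: "e0 > 0" "e1 > 0"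
  and B0: "!!t. t\<in>open_unit Int {0-e0<..<0+e0} ==> arc_speed gm t / (1 + cmod (gm t))^2 <= B0"
  and B1: "!!t. t\<in>open_unit Int {1-e1<..<1+e1} ==> arc_speed gm t / (1 + cmod (gm t))^2 <= B1"
  using regular_end_weight by metis
 define dl where "dl = min (1/2) (min (e0/2) (e1/2))"
 have dl: "0 < dl" "dl < e0" "dl < e1" "dl <= 1/2" using e by (auto simp: dl_def min_def)
 have sub: "{dl..1-dl} <= open_unit" using dl by auto
 have "continuous_on {dl..1-dl} (%t. arc_speed gm t / (1 + cmod (gm t))^2)"
  by (intro continuous_intros continuous_on_subset[OF smooth_arc_continuous(1)[OF sm] sub] continuous_on_subset[OF smooth_arc_continuous(2)[OF sm] sub])
  (simp add: one_plus_norm_neq_0)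
 from compact_imp_bounded[OF compact_continuous_image[OF this compact_Icc]]
 obtain B2 where "ALL w:(%t. arc_speed gm t / (1 + cmod (gm t))^2) ` {dl..1-dl}. norm w <= B2" unfolding bounded_iff by blast
 then have B2: "\<bar>arc_speed gm t / (1 + cmod (gm t))^2\<bar> <= B2" if "t : {dl..1-dl}" for t using that by auto
 have "arc_speed gm t / (1 + cmod (gm t))^2 <= max 0 (max B0 (max B1 B2))" if t: "t : open_unit" for t
 proof -
  consider "t < e0" | "1 - e1 < t" | "t : {dl..1-dl}" using dl by fastforce
  then show ?thesis
  proof cases
  case 1 then show ?thesis using B0[of t] t e by (simp add: le_max_iff_disj)
  next
  case 2 then show ?thesis using B1[of t] t e by (simp add: le_max_iff_disj)
  next
  case 3 then show ?thesis using abs_le_D1[OF B2[OF 3]] by (simp add: le_max_iff_disj)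
  qed
 qed
 then show ?thesis by (intro exI[of _ "max 0 (max B0 (max B1 B2))"]) auto
qed

text \<open>Together with \<open>arc_density\<close>, this rewrites integrals over an open arc as
  integrals over the real line. The default point 0 may lie near the evaluation point, but the
  density is 0 at those parameters.\<close>

definition arc_point :: "(real => complex) => real => complex" where
 "arc_point gm t = (if t : open_unit then gm t else 0)"

definition arc_density :: "(real => complex) => (complex => complex) => real => complex" where
 "arc_density gm h t = (if t : open_unit then h (gm t) * vel gm t else 0)"

lemma cauchy_integral_eq:
 assumes "is_contour Sg"
 shows "CI Sg h z = (\<Sum>gm\<in>set Sg. \<integral>t. arc_density gm h t / (arc_point gm t - z) \<partial>lebesgue) / (2 * of_real pi * \<i>)"
proof -
 have "(LINT t:{0<..<1}|lebesgue. h (gm t) / (gm t - z) * vel gm t) = (\<integral>t. arc_density gm h t / (arc_point gm t - z) \<partial>lebesgue)" for gm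
  unfolding set_lebesgue_integral_def
  by (intro Bochner_Integration.integral_cong) (auto simp: arc_density_def arc_point_def split: split_indicator)
 then show ?thesis unfolding cauchy_integral_def by (simp add: sum_list_distinct_conv_sum_set[OF is_contour_arcs(3)[OF assms]])
qed

lemma arc_point_measurable: "smooth_arc gm ==> arc_point gm : bmeas borel"
 using smooth_arc_measurable(3)[of gm] by (simp add: arc_point_def[abs_def])

lemma arc_density_measurable:
 assumes Sg: "is_contour Sg" and g: "gm : set Sg" and h: "h : bmeas (arclength Sg)"
 shows "arc_density gm h : bmeas lebesgue"
proof -
 have "(%t. h (gm t)) : bmeas (lebesgue_on open_unit)"
  by (rule measurable_compose[OF measurable_arc[OF Sg g] h])
 then have 1: "(%t. if t : open_unit then h (gm t) else 0) : bmeas lebesgue"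
  by (subst borel_measurable_if) auto
 have "(%t. if t : open_unit then vel gm t else 0) : bmeas lborel"
  using smooth_arc_measurable(4)[OF is_contour_arcs(1)[OF Sg g]] by simp
 then have 2: "(%t. if t : open_unit then vel gm t else 0) : bmeas lebesgue" by (rule measurable_completion)
 have "arc_density gm h = (%t. (if t : open_unit then h (gm t) else 0) * (if t : open_unit then vel gm t else 0))"
  by (auto simp: arc_density_def)
 then show ?thesis using borel_measurable_times[OF 1 2] by simp
qed

lemma ennreal_le_of_power2_le:
 fixes x :: ennreal
 assumes "x^2 <= (ennreal c)^2" "0 <= c" shows "x <= ennreal c"
proof (cases x)
 case (real r)
 then have "ennreal (r^2) <= ennreal (c^2)"
  using assms ennreal_power[of r 2] ennreal_power[of c 2] by metis
 then have "r^2 <= c^2" by (simp add: ennreal_le_iff)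
 then have "r <= c" using assms(2) by (rule power2_le_imp_le)
 then show ?thesis using real by (simp add: ennreal_leI)
next
 case top
 then have 1: "x * x = top" by (simp only: ennreal_mult_eq_top_iff) simp
 have 2: "x * x <= ennreal c * ennreal c" using assms(1) by (simp only: power2_eq_square)
 have "ennreal c * ennreal c < top" by (simp add: ennreal_mult_less_top)
 then show ?thesis using order.strict_trans1[OF 2] 1 by (metis less_irrefl)
qed

text \<open>Cauchy-Schwarz for the factors |h| sqrt|gm'| and sqrt|gm'|/(1+|gm|). The first has L2
  norm at most that of h on the contour; the square of the second is the bounded weight of
  \<open>smooth_arc_weight\<close> on an interval of length 1, whence the constant sqrt B.\<close>

lemma arc_density_bound:
 assumes Sg: "is_contour Sg" and g: "gm : set Sg"
 shows "EX C>=0. ALL h:L2 Sg. integrable lebesgue (%t. norm (arc_density gm h t) / (1 + cmod (arc_point gm t))) &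
  (\<integral>t. norm (arc_density gm h t) / (1 + cmod (arc_point gm t)) \<partial>lebesgue) <= C * N2 Sg h"
proof -
 note sm = is_contour_arcs(1)[OF Sg g]
 obtain B where B: "B >= 0" "!!t. t : open_unit ==> arc_speed gm t / (1 + cmod (gm t))^2 <= B" using smooth_arc_weight[OF sm] by blast
 show ?thesis
 proof (intro exI[of _ "sqrt B"] conjI ballI)
  fix h :: "complex => complex" assume h: "h : L2 Sg"
  define N where "N = N2 Sg h"
  have hm: "h : bmeas (arclength Sg)" by (rule Lp_measurable[OF h])
  define ph where "ph = arc_density gm h"
  define q where "q = arc_point gm"
  have m[measurable]: "ph : bmeas lebesgue" unfolding ph_def by (rule arc_density_measurable[OF Sg g hm])
  have [measurable]: "q : bmeas lebesgue" unfolding q_def using arc_point_measurable[OF sm] by (intro measurable_completion) simp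
  define D where "D = (%t. if t : open_unit then vel gm t else 0)"
  have [measurable]: "D : bmeas lebesgue" unfolding D_def using smooth_arc_measurable(4)[OF sm] by (intro measurable_completion) simp
  define u where "u = (%t. ennreal (norm (ph t) / sqrt (cmod (D t))))"
  define w where "w = (%t. ennreal (sqrt (cmod (D t)) / (1 + cmod (q t))))"
  have [measurable]: "u : bmeas lebesgue" "w : bmeas lebesgue" unfolding u_def w_def by measurable
  have "(\<integral>\<^sup>+t. ennreal (norm (ph t) / (1 + cmod (q t))) \<partial>lebesgue) <= (\<integral>\<^sup>+t. u t * w t \<partial>lebesgue)"
  proof (rule nn_integral_mono)
  fix t
  show "ennreal (norm (ph t) / (1 + cmod (q t))) <= u t * w t"
  using smooth_arc_deriv(2)[OF sm, of t]
  by (auto simp: u_def w_def ennreal_mult[symmetric] ph_def arc_density_def D_def q_def)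
  qed
  then have "(\<integral>\<^sup>+t. ennreal (norm (ph t) / (1 + cmod (q t))) \<partial>lebesgue)^2 <= (\<integral>\<^sup>+t. u t * w t \<partial>lebesgue)^2" by (intro power_mono) auto
  also have "... <= (\<integral>\<^sup>+t. (u t)^2 \<partial>lebesgue) * (\<integral>\<^sup>+t. (w t)^2 \<partial>lebesgue)" by (rule Cauchy_Schwarz_nn_integral) measurable
  also have "... <= ennreal (N^2) * ennreal B"
  proof (intro mult_mono)
  have "(\<integral>\<^sup>+t. (u t)^2 \<partial>lebesgue) = (\<integral>\<^sup>+t. ennreal (norm (h (gm t)) powr 2) * ennreal (arc_speed gm t) * indicator open_unit t \<partial>lebesgue)"
  proof (rule nn_integral_cong)
  fix t
  show "(u t)^2 = ennreal (norm (h (gm t)) powr 2) * ennreal (arc_speed gm t) * indicator open_unit t"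
  using smooth_arc_deriv(2)[OF sm, of t]
  by (auto simp: u_def ennreal_power ennreal_mult[symmetric] ph_def arc_density_def D_def power_divide norm_mult power_mult_distrib power2_eq_square)
  qed
  also have "... <= (\<Sum>gm\<in>set Sg. \<integral>\<^sup>+t. ennreal (norm (h (gm t)) powr 2) * ennreal (arc_speed gm t) * indicator open_unit t \<partial>lebesgue)"
  using g by (intro member_le_sum) auto
  also have "... = (\<integral>\<^sup>+z. ennreal (norm (h z) powr 2) \<partial>arclength Sg)"
  by (rule nn_integral_arclength[OF Sg, symmetric]) (use hm in measurable)
  also have "... = ennreal (N^2)" using Lp_norm_powr[OF h] by (simp add: N_def)
  finally show "(\<integral>\<^sup>+t. (u t)^2 \<partial>lebesgue) <= ennreal (N^2)" .
  have "(\<integral>\<^sup>+t. (w t)^2 \<partial>lebesgue) <= (\<integral>\<^sup>+t. ennreal B * indicator open_unit t \<partial>lebesgue)"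
  proof (rule nn_integral_mono)
  fix t
  show "(w t)^2 <= ennreal B * indicator open_unit t"
  using B(2)[of t] by (auto simp: w_def ennreal_power D_def power_divide q_def arc_point_def intro!: ennreal_leI)
  qed
  also have "... = ennreal B" by (subst nn_integral_cmult_indicator) auto
  finally show "(\<integral>\<^sup>+t. (w t)^2 \<partial>lebesgue) <= ennreal B" .
  qed auto
  also have "... = ennreal ((sqrt B * N)^2)" using B(1) by (simp add: ennreal_mult[symmetric] power_mult_distrib mult.commute)
  finally have sq: "(\<integral>\<^sup>+t. ennreal (norm (ph t) / (1 + cmod (q t))) \<partial>lebesgue)^2 <= (ennreal (sqrt B * N))^2"
  using B(1) by (simp add: ennreal_power N_def)
  have le: "(\<integral>\<^sup>+t. ennreal (norm (ph t) / (1 + cmod (q t))) \<partial>lebesgue) <= ennreal (sqrt B * N)"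
  by (rule ennreal_le_of_power2_le[OF sq]) (use B(1) in \<open>simp add: N_def\<close>)
  show int: "integrable lebesgue (%t. norm (arc_density gm h t) / (1 + cmod (arc_point gm t)))"
  unfolding ph_def[symmetric] q_def[symmetric]
  by (rule integrableI_bounded) (use le in \<open>auto intro: order.strict_trans1\<close>)
  have "ennreal (\<integral>t. norm (arc_density gm h t) / (1 + cmod (arc_point gm t)) \<partial>lebesgue) <= ennreal (sqrt B * N)"
  using le unfolding ph_def q_def by (subst nn_integral_eq_integral[OF int, symmetric]) auto
  then show "(\<integral>t. norm (arc_density gm h t) / (1 + cmod (arc_point gm t)) \<partial>lebesgue) <= sqrt B * N2 Sg h"
  using B(1) by (simp add: N_def)
 qed (use B in auto)
qed

section \<open>Analytic functions with a prescribed jump\<close>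

text \<open>Each point of C is a limit of points outside C, so two local extensions that agree with
  Ph off C agree by continuity. The extension at a point of C may therefore be defined by the local
  extension chosen for that very point. The finite set K collects the points where no local
  extension is known.\<close>

lemma holomorphic_glue:
 fixes Ph :: "complex => complex"
 assumes C: "closed C" "C <= closure (- C)" and K: "finite K" "K <= C" and hol: "Ph holomorphic_on - C"
  and loc: "!!w. w : C - K ==> EX rh>0. EX Tt. Tt holomorphic_on ball w rh & (ALL z:ball w rh - C. Tt z = Ph z)"
 shows "EX Ph'. Ph' holomorphic_on - K & (ALL z:-C. Ph' z = Ph z)"
proof -
 from loc have "ALL w:C-K. EX p. fst p > (0::real) & snd p holomorphic_on ball w (fst p) & (ALL z:ball w (fst p) - C. snd p z = Ph z)"
  by force
 from bchoice[OF this] obtain p where p: "!!w. w : C - K ==> fst (p w) > (0::real)"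
  "!!w. w : C - K ==> snd (p w) holomorphic_on ball w (fst (p w))"
  "!!w z. w : C - K ==> z : ball w (fst (p w)) - C ==> snd (p w) z = Ph z" by blast
 define rh Tt where "rh = (%w. fst (p w))" and "Tt = (%w. snd (p w))"
 define Ph' where "Ph' = (%z. if z : C then Tt z z else Ph z)"
 have same: "Tt w z = Ph' z" if w: "w : C - K" and z: "z : ball w (rh w) - K" for w z
 proof (cases "z : C")
  case False
  then show ?thesis using p(3)[OF w] z by (simp add: Ph'_def Tt_def rh_def)
 next
  case True
  then have zC: "z : C - K" using z by auto
  obtain u where u: "!!n. u n : - C" "u \<longlonglongrightarrow> z" using C(2) True closure_sequential[of z "-C"] by blast
  let ?U = "ball w (rh w) Int ball z (rh z)"
  have zU: "z : ?U" using z p(1)[OF zC] by (simp add: rh_def)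
  have ev: "eventually (%n. u n : ?U) sequentially"
  using topological_tendstoD[OF u(2) _ zU] by blast
  have lim: "(%n. Tt v (u n)) \<longlonglongrightarrow> Tt v z" if "v : C - K" "z : ball v (rh v)" for v
  proof -
  have "isCont (Tt v) z"
  using holomorphic_on_imp_continuous_on[OF p(2)[OF that(1)]] that(2)
  by (simp add: continuous_on_eq_continuous_at Tt_def rh_def)
  then show ?thesis using u(2) by (rule isCont_tendsto_compose)
  qed
  have ev': "eventually (%n. Tt z (u n) = Tt w (u n)) sequentially"
  using ev
  proof eventually_elim
  case (elim n)
  then have "u n : ball w (fst (p w)) - C" "u n : ball z (fst (p z)) - C" using u(1)[of n] by (auto simp: rh_def)
  then show ?case using p(3)[OF w] p(3)[OF zC] by (simp add: Tt_def)
  qed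
  have "(%n. Tt w (u n)) \<longlonglongrightarrow> Tt z z"
  by (rule Lim_transform_eventually[OF lim[OF zC] ev']) (use zU in auto)
  then have "Tt w z = Tt z z" using LIMSEQ_unique lim[OF w] z by blast
  then show ?thesis using True by (simp add: Ph'_def)
 qed
 have "Ph' holomorphic_on - K"
  unfolding holomorphic_on_def
 proof
  fix z assume z: "z : - K"
  show "Ph' field_differentiable at z within - K"
  proof (cases "z : C")
  case True
  then have zC: "z : C - K" using z by auto
  let ?U = "ball z (rh z) - K"
  have op: "open ?U" using K(1) by (simp add: open_Diff finite_imp_closed)
  have "z : ?U" using z p(1)[OF zC] by (simp add: rh_def)
  moreover have "Tt z holomorphic_on ?U" using p(2)[OF zC] by (auto simp: Tt_def rh_def elim: holomorphic_on_subset)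
  then have "Ph' holomorphic_on ?U" by (rule holomorphic_transform) (use same[OF zC] in auto)
  ultimately show ?thesis using op holomorphic_on_imp_differentiable_at field_differentiable_at_within by blast
  next
  case False
  have "Ph holomorphic_on - C" by (rule hol)
  then have "Ph' holomorphic_on - C" by (rule holomorphic_transform) (auto simp: Ph'_def)
  then show ?thesis using C(1) False holomorphic_on_imp_differentiable_at[of Ph' "-C" z] field_differentiable_at_within by (auto simp: open_Compl)
  qed
 qed
 then show ?thesis by (intro exI[of _ Ph']) (auto simp: Ph'_def)
qed

text \<open>The approach is along the normal of a nearby base point, whose tangent is tu. The ratio
  w of the two tangents satisfies |w - 1| <= 1/4, so Re w >= 3/4 > 5/8 >= |w|/2, and the ray stays
  in the sector with a = 1/2. One direction thus serves a whole neighbourhood on the arc, as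
  vertical lines do over a flat arc.\<close>

lemma has_nt_limit_vertical:
 assumes Sg: "is_contour Sg" and g: "gm : set Sg" and t: "t : open_unit" and nt: "has_nt_limit Sg sx F (gm t) l"
  and sx: "sx = 1 \<or> sx = -1" and tu: "tu ~= 0" "cmod (vel gm t / tu - 1) <= 1/4"
 shows "((%ep. F (gm t + tu * (of_real sx * \<i> * of_real ep))) \<longlongrightarrow> l) (at_right 0)"
proof -
 obtain dl s where ds: "dl : set Sg" "s : open_unit" "dl s = gm t"
  "!!a. a > 0 ==> (F \<longlongrightarrow> l) (at (gm t) within sector sx a (gm t) (vel dl s))"
  using nt unfolding has_nt_limit_def by blast
 have "dl = gm & s = t" by (rule is_contour_arcs(2)[OF Sg ds(1) g ds(2) t ds(3)])
 then have lim: "(F \<longlongrightarrow> l) (at (gm t) within sector sx (1/2) (gm t) (vel gm t))" using ds(4)[of "1/2"] by simp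
 define w where "w = vel gm t / tu"
 have d: "vel gm t = tu * w" using tu by (simp add: w_def)
 have w: "Re w >= 3/4" "cmod w <= 5/4"
  using tu(2) abs_Re_le_cmod[of "w - 1"] norm_triangle_ineq[of "w - 1" 1] by (auto simp: w_def[symmetric])
 have "filterlim (%ep. gm t + tu * (of_real sx * \<i> * of_real ep)) (at (gm t) within sector sx (1/2) (gm t) (vel gm t)) (at_right 0)"
  unfolding filterlim_at
 proof
  show "\<forall>\<^sub>F ep in at_right 0. gm t + tu * (of_real sx * \<i> * of_real ep) : sector sx (1/2) (gm t) (vel gm t) & gm t + tu * (of_real sx * \<i> * of_real ep) ~= gm t"
  unfolding eventually_at_right_field
  proof (intro exI[of _ 1] conjI allI impI)
  fix ep :: real assume e: "0 < ep"
  have im: "Im (complex_of_real r * (\<i> * cnj w)) = r * Re w" for r by simp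
  have "cnj (tu * w) * (tu * (of_real sx * \<i> * of_real ep)) = of_real ((cmod tu)^2 * sx * ep) * (\<i> * cnj w)"
  by (simp add: complex_norm_square[symmetric] algebra_simps)
  then have "sx * Im (cnj (tu * w) * (tu * (of_real sx * \<i> * of_real ep))) = sx * ((cmod tu)^2 * sx * ep * Re w)"
  by (simp only: im)
  also have "... = (cmod tu)^2 * ep * Re w" using sx by auto
  finally have 1: "sx * Im (cnj (tu * w) * (tu * (of_real sx * \<i> * of_real ep))) = (cmod tu)^2 * ep * Re w" .
  have "1/2 * cmod (tu * w) * cmod (tu * (of_real sx * \<i> * of_real ep)) = (cmod tu)^2 * ep * (1/2 * cmod w)"
  using sx e by (auto simp: norm_mult power2_eq_square)
  also have "... < (cmod tu)^2 * ep * Re w" using w tu(1) e by (intro mult_strict_left_mono) auto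
  finally show "gm t + tu * (of_real sx * \<i> * of_real ep) : sector sx (1/2) (gm t) (vel gm t)"
  unfolding sector_def d using 1 by simp
  show "gm t + tu * (of_real sx * \<i> * of_real ep) ~= gm t" using tu sx e by auto
  qed simp
  show "((%ep. gm t + tu * (of_real sx * \<i> * of_real ep)) \<longlongrightarrow> gm t) (at_right 0)"
  by (auto intro!: tendsto_eq_intros)
 qed
 from filterlim_compose[OF lim this] show ?thesis .
qed

text \<open>In flat coordinates \<open>local_cauchy_representation\<close> writes F near the arc as
  an analytic function plus the Cauchy integral of its jump over a short piece. The rest of C J
  comes from parts of the contour at positive distance and is analytic nearby, so F - C J extends
  across the arc.\<close>

lemma local_extension:
 fixes F J :: "complex => complex"
 assumes Sg: "is_contour Sg" and hol: "F holomorphic_on - contour_set Sg"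
  and g: "gm : set Sg" and t0: "t0 : open_unit"
  and bd: "0 < rh1" "!!z. z : ball (gm t0) rh1 - contour_set Sg ==> cmod (F z) <= M"
  and J: "J : L2 Sg"
  and nt: "AE s in arclength Sg. EX lp lm. has_nt_limit Sg 1 F s lp & has_nt_limit Sg (-1) F s lm & J s = lp - lm"
 shows "EX rh>0. EX Tt. Tt holomorphic_on ball (gm t0) rh & (ALL z:ball (gm t0) rh - contour_set Sg. Tt z = F z - CI Sg J z)"
proof -
 define C where "C = contour_set Sg"
 have oC: "open (- C)" by (simp add: C_def closed_contour_set open_Compl)
 note sm = is_contour_arcs(1)[OF Sg g]
 define tu where "tu = vel gm t0"
 have tu: "tu ~= 0" using smooth_arc_deriv(2)[OF sm t0] by (simp add: tu_def)
 define w where "w = gm t0"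
 define bt bt' where "bt = (%s. (gm (t0 + s) - w) / tu)" and "bt' = (%s. vel gm (t0 + s) / tu)"
 have gb: "gm (t0 + s) = w + tu * bt s" for s using tu by (simp add: bt_def)
 obtain d0 where d0: "0 < d0" and fl: "!!d. 0 < d ==> d <= d0 ==> {t0-d..t0+d} <= open_unit & (ALL s:{-d..d}. cmod (bt' s - 1) <= 1/4) & flat_arc bt bt' d"
  using smooth_arc_flat[OF sm t0] unfolding bt_def bt'_def w_def tu_def by blast
 obtain rh2 where rh2: "0 < rh2" "C Int ball w rh2 <= gm ` {t0-d0..t0+d0}"
  using contour_locally_arc[OF Sg g d0(1)] fl[OF d0 order.refl] unfolding C_def w_def by metis
 \<comment> \<open>The box with |Re u| < 3d/4 and |Im u| < 2d lies in the disc of radius 3d. After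
   scaling by |tu| it must stay where F is bounded and where the contour consists of this arc
   alone.\<close>
 define d where "d = min d0 (min (rh1 / (3 * cmod tu)) (rh2 / (3 * cmod tu)))"
 have d: "0 < d" "d <= d0" "3 * d * cmod tu <= rh1" "3 * d * cmod tu <= rh2"
 proof -
  show "0 < d" using d0 bd(1) rh2(1) tu by (simp add: d_def)
  show "d <= d0" by (simp add: d_def)
  have "d <= rh1 / (3 * cmod tu)" "d <= rh2 / (3 * cmod tu)" by (auto simp: d_def)
  then show "3 * d * cmod tu <= rh1" "3 * d * cmod tu <= rh2" using tu by (simp_all add: pos_le_divide_eq mult_ac)
 qed
 interpret A: flat_arc bt bt' d0 using fl[OF d0 order.refl] by blast
 interpret B: flat_arc bt bt' d using fl[OF d(1,2)] by blast
 have b1: "cmod (bt' s - 1) <= 1/4" if "s : {-d..d}" for s using fl[OF d(1,2)] that by blast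
 have sub: "{t0-d..t0+d} <= open_unit" using fl[OF d(1,2)] by blast
 have ou: "t0 + s : open_unit" if "s : {-d..d}" for s by (rule subsetD[OF sub]) (use that in auto)
 have box: "w + tu * u : ball w rh1 - C" "w + tu * u ~: C" if u: "u : B.above Un B.below" for u
 proof -
  have u': "\<bar>Re u\<bar> < 3*d/4" "\<bar>Im u\<bar> < 2*d" "u ~: bt ` {-d..d}" using u unfolding B.above_Un_below[symmetric] by auto
  have "cmod u <= \<bar>Re u\<bar> + \<bar>Im u\<bar>" by (rule cmod_le)
  then have "cmod u < 3 * d" using u' by linarith
  then have "cmod tu * cmod u < cmod tu * (3 * d)" using tu by simp
  then have l: "cmod (tu * u) < rh1" "cmod (tu * u) < rh2" using d(3,4) by (auto simp: norm_mult mult_ac)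
  show n: "w + tu * u ~: C"
  proof
  assume "w + tu * u : C"
  then obtain r where r: "r : {t0-d0..t0+d0}" "w + tu * u = gm r" using rh2(2) l(2) by (force simp: dist_norm)
  define s where "s = r - t0"
  have s: "s : {-d0..d0}" "u = bt s" using r gb[of s] tu by (auto simp: s_def)
  have "3/4 * \<bar>s\<bar> <= \<bar>Re u\<bar>" using A.abs_Re_ge[OF s(1)] s(2) by simp
  then have "\<bar>s\<bar> < d" using u' by linarith
  then have "s : {-d..d}" by (auto simp: abs_less_iff)
  then have "u : bt ` {-d..d}" using s(2) by blast
  then show False using u' by simp
  qed
  then show "w + tu * u : ball w rh1 - C" using l by (simp add: dist_norm)
 qed
 define f where "f = (%u. F (w + tu * u))"
 have fh: "f holomorphic_on B.above Un B.below" unfolding f_def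
  by (rule holomorphic_on_compose_gen[OF _ hol, unfolded o_def]) (use box in \<open>auto intro!: holomorphic_intros simp: C_def\<close>)
 have fb: "norm (f u) <= M" if "u : B.above Un B.below" for u
  unfolding f_def using box[OF that] bd(2) by (simp add: w_def C_def)
 have "AE t in lebesgue. t : open_unit --> (EX lp lm. has_nt_limit Sg 1 F (gm t) lp & has_nt_limit Sg (-1) F (gm t) lm & J (gm t) = lp - lm)"
  using nt g by (simp add: AE_arclength_iff[OF Sg])
 then have "{t. \<not> (t : open_unit --> (EX lp lm. has_nt_limit Sg 1 F (gm t) lp & has_nt_limit Sg (-1) F (gm t) lm & J (gm t) = lp - lm))} : null_sets lebesgue"
  by (simp add: completion.AE_iff_null_sets)
 then have "negligible ((+) (-t0) ` {t. \<not> (t : open_unit --> (EX lp lm. has_nt_limit Sg 1 F (gm t) lp & has_nt_limit Sg (-1) F (gm t) lm & J (gm t) = lp - lm))})"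
  by (intro negligible_translation) (simp add: negligible_iff_null_sets)
 then have "AE s in lborel. s ~: ((+) (-t0) ` {t. \<not> (t : open_unit --> (EX lp lm. has_nt_limit Sg 1 F (gm t) lp & has_nt_limit Sg (-1) F (gm t) lm & J (gm t) = lp - lm))})"
  by (rule negligible_AE_lborel)
 then have "AE s in lborel. t0 + s : open_unit --> (EX lp lm. has_nt_limit Sg 1 F (gm (t0 + s)) lp & has_nt_limit Sg (-1) F (gm (t0 + s)) lm & J (gm (t0 + s)) = lp - lm)"
 proof eventually_elim
  case (elim s)
  have "s = -t0 + (t0 + s)" by simp
  then show ?case using elim by blast
 qed
 then have ae: "AE s in lebesgue. s : {-d..d} --> (EX lp lm. ((%ep. f (bt s + \<i> * of_real ep)) \<longlongrightarrow> lp) (at_right 0) & ((%ep. f (bt s - \<i> * of_real ep)) \<longlongrightarrow> lm) (at_right 0) & J (gm (t0 + s)) = lp - lm)"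
 proof (intro AE_completion, eventually_elim)
  case (elim s)
  show ?case
  proof
  assume s: "s : {-d..d}"
  then obtain lp lm where l: "has_nt_limit Sg 1 F (gm (t0 + s)) lp" "has_nt_limit Sg (-1) F (gm (t0 + s)) lm" "J (gm (t0 + s)) = lp - lm"
  using elim ou by blast
  have q: "cmod (vector_derivative gm (at (t0+s)) / tu - 1) <= 1/4" using b1[OF s] by (simp add: bt'_def)
  have 1: "w + tu * (bt s + c) = gm (t0 + s) + tu * c" for c by (simp add: gb distrib_left)
  have "((%ep. f (bt s + \<i> * of_real ep)) \<longlongrightarrow> lp) (at_right 0)"
  using has_nt_limit_vertical[OF Sg g ou[OF s] l(1) _ tu q] by (simp add: f_def 1)
  moreover have "((%ep. f (bt s - \<i> * of_real ep)) \<longlongrightarrow> lm) (at_right 0)"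
  using has_nt_limit_vertical[OF Sg g ou[OF s] l(2) _ tu q] 1[of "- (\<i> * of_real ep)" for ep] by (simp add: f_def)
  ultimately show "EX lp lm. ((%ep. f (bt s + \<i> * of_real ep)) \<longlongrightarrow> lp) (at_right 0) & ((%ep. f (bt s - \<i> * of_real ep)) \<longlongrightarrow> lm) (at_right 0) & J (gm (t0 + s)) = lp - lm"
  using l(3) by blast
  qed
 qed
 define f0 where "f0 = (%u. if w + tu * u : - C then f u else 0)"
 have f0m: "f0 : bmeas borel"
 proof -
  have o: "open ((%u. w + tu * u) -` (- C))" by (intro open_vimage oC continuous_intros)
  have "continuous_on ((%u. w + tu * u) -` (- C)) f" unfolding f_def
  by (intro continuous_on_compose2[OF holomorphic_on_imp_continuous_on[OF hol]] continuous_intros) (auto simp: C_def)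
  then have "(%u. if u : (%u. w + tu * u) -` (- C) then f u else 0) : bmeas borel"
  using o by (intro borel_measurable_continuous_on_if) auto
  then show ?thesis by (simp add: f0_def)
 qed
 define ep where "ep = (%n::nat. d / (real n + 4))"
 have ep4: "0 < ep n & ep n <= d/4" for n
  unfolding ep_def using d by (intro conjI divide_pos_pos divide_left_mono) auto
 have "ep \<longlonglongrightarrow> 0" unfolding ep_def using LIMSEQ_ignore_initial_segment[OF lim_const_over_n[of d], of 4] by simp
 moreover have "ep n ~= 0" for n using ep4[of n] by auto
 ultimately have epr: "filterlim ep (at_right 0) sequentially" unfolding filterlim_at using ep4 by auto
 \<comment> \<open>One-sided boundary values as limits along one fixed sequence: this makes them
   measurable everywhere, and they equal the non-tangential limits wherever these exist.\<close>
 define L where "L = (%(c::complex) s. lim (%n. if s : {-d/2..d/2} then f0 (bt s + c * of_real (ep n)) else 0))"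
 have Lm: "L c : bmeas lebesgue" for c
 proof -
  have "continuous_on {-d/2..d/2} bt" by (rule continuous_on_subset[OF B.continuous_beta]) (use d in auto)
  then have bm: "(%s. if s : {-d/2..d/2} then bt s else 0) : bmeas borel"
  by (intro borel_measurable_continuous_on_if) auto
  have "(%s. f0 ((if s : {-d/2..d/2} then bt s else 0) + c * of_real (ep n))) : bmeas borel" for n
  by (rule measurable_compose[OF borel_measurable_add[OF bm borel_measurable_const] f0m])
  then have "(%s. if s : {-d/2..d/2} then f0 ((if s : {-d/2..d/2} then bt s else 0) + c * of_real (ep n)) else 0) : bmeas borel" for n
  by (intro measurable_If_set) auto
  then have "(%s. if s : {-d/2..d/2} then f0 (bt s + c * of_real (ep n)) else 0) : bmeas borel" for n
  by (rule measurable_cong[THEN iffD1, rotated]) auto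
  then have "L c : bmeas borel" unfolding L_def by (rule borel_measurable_lim_metric)
  then show ?thesis by (intro measurable_completion) simp
 qed
 have Leq: "L c s = l" if s: "s : {-d/2..d/2}" and l: "((%ep. f (bt s + c * of_real ep)) \<longlongrightarrow> l) (at_right 0)" and c: "c = \<i> \<or> c = -\<i>" for c s l
 proof -
  have "bt s + c * of_real (ep n) : B.above Un B.below" for n
  unfolding B.above_Un_below[symmetric]
  proof -
  have sd: "s : {-d..d}" using s d by auto
  have "\<bar>Re (bt s)\<bar> <= 5/4*(d/2)" "\<bar>Im (bt s)\<bar> <= (d/2)/4" using B.abs_Re_le[OF sd] B.abs_Im_le[OF sd] s by auto
  moreover have "bt s + c * of_real (ep n) ~= bt r" if "r : {-d..d}" for r
  proof
  assume e: "bt s + c * of_real (ep n) = bt r"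
  then have "Re (bt s) = Re (bt r)" using c by (auto dest: arg_cong[of _ _ Re])
  then have "s = r" by (rule B.Re_inj[OF sd that])
  then show False using e c ep4[of n] by auto
  qed
  ultimately have nb: "bt s + c * of_real (ep n) ~: bt ` {-d..d}" and R: "\<bar>Re (bt s)\<bar> <= 5/4*(d/2)" "\<bar>Im (bt s)\<bar> <= (d/2)/4" by blast+
  have "\<bar>Im (c * of_real (ep n))\<bar> = ep n" "Re (c * of_real (ep n)) = 0" using c ep4[of n] by auto
  then have "\<bar>Re (bt s + c * of_real (ep n))\<bar> < 3*d/4" "\<bar>Im (bt s + c * of_real (ep n))\<bar> < 2*d"
  using R ep4[of n] d(1) abs_triangle_ineq[of "Im (bt s)" "Im (c * of_real (ep n))"]
  unfolding plus_complex.sel by linarith+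
  then show "bt s + c * of_real (ep n) : {w. \<bar>Re w\<bar> < 3*d/4 & \<bar>Im w\<bar> < 2*d} - bt ` {-d..d}"
  by (intro DiffI nb) simp
  qed
  then have "f0 (bt s + c * of_real (ep n)) = f (bt s + c * of_real (ep n))" for n
  using box(2) by (simp add: f0_def)
  moreover have "(%n. f (bt s + c * of_real (ep n))) \<longlonglongrightarrow> l" by (rule filterlim_compose[OF l epr])
  ultimately show ?thesis using s by (simp add: L_def limI)
 qed
 have dd: "s : {-d..d}" if "s : {-d/2..d/2}" for s using that d by auto
 have limp: "AE s in lebesgue. s : {-d/2..d/2} --> ((%ep. f (bt s + \<i> * of_real ep)) \<longlongrightarrow> L \<i> s) (at_right 0)"
  and limm: "AE s in lebesgue. s : {-d/2..d/2} --> ((%ep. f (bt s - \<i> * of_real ep)) \<longlongrightarrow> L (-\<i>) s) (at_right 0)"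
  and Jeq: "AE s in lebesgue. s : {-d/2..d/2} --> J (gm (t0 + s)) = L \<i> s - L (-\<i>) s"
 proof -
  have *: "((%ep. f (bt s + \<i> * of_real ep)) \<longlongrightarrow> L \<i> s) (at_right 0) & ((%ep. f (bt s - \<i> * of_real ep)) \<longlongrightarrow> L (-\<i>) s) (at_right 0) & J (gm (t0 + s)) = L \<i> s - L (-\<i>) s"
  if s: "s : {-d/2..d/2}" and ex: "s : {-d..d} --> (EX lp lm. ((%ep. f (bt s + \<i> * of_real ep)) \<longlongrightarrow> lp) (at_right 0) & ((%ep. f (bt s - \<i> * of_real ep)) \<longlongrightarrow> lm) (at_right 0) & J (gm (t0 + s)) = lp - lm)" for s
  proof -
  obtain lp lm where l: "((%ep. f (bt s + \<i> * of_real ep)) \<longlongrightarrow> lp) (at_right 0)" "((%ep. f (bt s - \<i> * of_real ep)) \<longlongrightarrow> lm) (at_right 0)" "J (gm (t0 + s)) = lp - lm"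
  using ex dd[OF s] by blast
  have "L \<i> s = lp" by (rule Leq[OF s l(1)]) simp
  moreover have "L (-\<i>) s = lm" by (rule Leq[OF s]) (use l(2) in simp_all)
  ultimately show ?thesis using l by simp
  qed
  show "AE s in lebesgue. s : {-d/2..d/2} --> ((%ep. f (bt s + \<i> * of_real ep)) \<longlongrightarrow> L \<i> s) (at_right 0)"
  using ae by eventually_elim (use * in blast)
  show "AE s in lebesgue. s : {-d/2..d/2} --> ((%ep. f (bt s - \<i> * of_real ep)) \<longlongrightarrow> L (-\<i>) s) (at_right 0)"
  using ae by eventually_elim (use * in blast)
  show "AE s in lebesgue. s : {-d/2..d/2} --> J (gm (t0 + s)) = L \<i> s - L (-\<i>) s"
  using ae by eventually_elim (use * in blast)
 qed
 obtain Ps where Ps: "Ps holomorphic_on ball 0 (d/4)" "!!u. u : ball 0 (d/4) - bt ` {-d..d} ==>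
  2 * pi * \<i> * f u = Ps u + (LINT s:{-d/2..d/2}|lebesgue. (L \<i> s - L (-\<i>) s) / (bt s - u) * bt' s)"
  using B.local_cauchy_representation[OF fh fb Lm Lm limp limm] by blast
 define S where "S = {t0-d/2..t0+d/2}"
 have Sou: "S <= open_unit" using sub d by (auto simp: S_def)
 \<comment> \<open>The density of J with the short piece S around the base point removed; what
   remains stays at distance rh3/2 from the small disc.\<close>
 define ph where "ph = (%dl t. if dl = gm & t : S then 0 else arc_density dl J t)"
 obtain rh3 where rh3: "0 < rh3" "C Int ball w rh3 <= gm ` S"
  using contour_locally_arc[OF Sg g, of "d/2" t0] Sou d(1) unfolding C_def w_def S_def by (metis half_gt_zero)
 define rh where "rh = min (rh3/2) (cmod tu * (d/4))"
 have rh: "0 < rh" "rh <= rh3/2" "rh <= cmod tu * (d/4)" using rh3 tu d by (auto simp: rh_def)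
 have sep: "ph dl t = 0 \<or> rh3/2 <= cmod (arc_point dl t - z)" if "dl : set Sg" "z : ball w rh" for dl t z
 proof (cases "t : open_unit")
  case True
  show ?thesis
  proof (cases "dl = gm & t : S")
  case False
  have "dl t ~: gm ` S"
  proof
  assume "dl t : gm ` S"
  then obtain s where s: "s : S" "dl t = gm s" by auto
  then have "dl = gm & t = s" using Sou by (intro is_contour_arcs(2)[OF Sg that(1) g True]) auto
  then show False using s False by auto
  qed
  moreover have "dl t : C" unfolding C_def by (rule contour_arc_subset[OF that(1) True])
  ultimately have "\<not> cmod (dl t - w) < rh3" using rh3(2) by (auto simp: dist_norm norm_minus_commute)
  moreover have "cmod (w - z) < rh3/2" using that(2) rh(2) by (auto simp: dist_norm)
  moreover have "cmod (dl t - w) <= cmod (dl t - z) + cmod (w - z)" using norm_triangle_ineq4[of "dl t - z" "w - z"] by simp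
  ultimately have "rh3/2 <= cmod (dl t - z)" by linarith
  then show ?thesis using True by (simp add: arc_point_def)
  qed (simp add: ph_def)
 qed (auto simp: ph_def arc_density_def)
 have dm[measurable]: "arc_density dl J : bmeas lebesgue" if "dl : set Sg" for dl
  by (rule arc_density_measurable[OF Sg that Lp_measurable[OF J]])
 have pm[measurable]: "arc_point dl : bmeas lebesgue" if "dl : set Sg" for dl
  using arc_point_measurable[OF is_contour_arcs(1)[OF Sg that]] by (intro measurable_completion) simp
 have phm: "ph dl : bmeas lebesgue" if "dl : set Sg" for dl
 proof (cases "dl = gm")
  case True
  have "(%t. if t : S then 0 else arc_density dl J t) : bmeas lebesgue"
  using dm[OF that] by (intro measurable_If_set) (auto simp: S_def)
  moreover have "ph dl = (%t. if t : S then 0 else arc_density dl J t)" using True by (auto simp: ph_def fun_eq_iff)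
  ultimately show ?thesis by simp
 qed (use dm[OF that] in \<open>simp add: ph_def\<close>)
 have dint: "integrable lebesgue (%t. norm (arc_density dl J t) / (1 + cmod (arc_point dl t)))" if "dl : set Sg" for dl
  using arc_density_bound[OF Sg that] J by blast
 have phint: "integrable lebesgue (%t. norm (ph dl t) / (1 + cmod (arc_point dl t)))" if "dl : set Sg" for dl
  by (rule Bochner_Integration.integrable_bound[OF dint[OF that]])
  (use phm[OF that] pm[OF that] in \<open>auto simp: ph_def\<close>)
 define Rest where "Rest = (%z. \<Sum>dl\<in>set Sg. \<integral>t. ph dl t / (arc_point dl t - z) \<partial>lebesgue)"
 have Rh: "Rest holomorphic_on ball w rh" unfolding Rest_def
 proof (intro holomorphic_on_sum)
  fix dl assume de: "dl : set Sg"
  show "(%z. \<integral>t. ph dl t / (arc_point dl t - z) \<partial>lebesgue) holomorphic_on ball w rh"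
  by (rule cauchy_transform_holomorphic[OF open_ball pm[OF de] phm[OF de] phint[OF de]])
  (use sep[OF de] rh3(1) in \<open>auto intro!: exI[of _ "rh3/2"]\<close>)
 qed
 define Tt where "Tt = (%z. (Ps ((z - w) / tu) - Rest z) / (2 * pi * \<i>))"
 have inb: "(z - w) / tu : ball 0 (d/4)" if "z : ball w rh" for z
 proof -
  have "cmod (z - w) < cmod tu * (d/4)" using that rh(3) by (auto simp: dist_norm norm_minus_commute)
  then show ?thesis using tu by (simp add: norm_divide pos_divide_less_eq mult.commute)
 qed
 have "(%z. Ps ((z - w) / tu)) holomorphic_on ball w rh"
  by (rule holomorphic_on_compose_gen[OF _ Ps(1), unfolded o_def]) (use inb in \<open>auto intro!: holomorphic_intros simp: tu\<close>)
 then have "Tt holomorphic_on ball w rh" unfolding Tt_def by (intro holomorphic_intros Rh) auto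
 moreover have "Tt z = F z - CI Sg J z" if z: "z : ball w rh - C" for z
 proof -
  define u where "u = (z - w) / tu"
  have zu: "z = w + tu * u" using tu by (simp add: u_def)
  have zb: "z : ball w rh" using z by simp
  have "u ~: bt ` {-d..d}"
  proof
  assume "u : bt ` {-d..d}"
  then obtain s where "s : {-d..d}" "u = bt s" by auto
  then have "z = gm (t0 + s)" "t0 + s : open_unit" using gb ou zu by auto
  then show False using z contour_arc_subset[OF g] by (simp add: C_def)
  qed
  then have rep: "2 * pi * \<i> * F z = Ps u + (LINT s:{-d/2..d/2}|lebesgue. (L \<i> s - L (-\<i>) s) / (bt s - u) * bt' s)"
  using Ps(2)[of u] inb[OF zb] by (simp add: u_def[symmetric] f_def zu[symmetric])
  have "(LINT s:{-d/2..d/2}|lebesgue. (L \<i> s - L (-\<i>) s) / (bt s - u) * bt' s) =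
  (\<integral>s. (if t0 + s : S then arc_density gm J (t0 + s) / (arc_point gm (t0 + s) - z) else 0) \<partial>lebesgue)"
  unfolding set_lebesgue_integral_def
  proof (rule integral_cong_AE)
  have e: "(%s. indicat_real {-d/2..d/2} s *\<^sub>R ((L \<i> s - L (-\<i>) s) / (bt s - u) * bt' s)) = (%s. (L \<i> s - L (-\<i>) s) * (if s : {-d/2..d/2} then bt' s / (bt s - u) else 0))"
  by (auto simp: fun_eq_iff)
  have "continuous_on {-d/2..d/2} (%s. bt' s / (bt s - u))"
  by (intro continuous_intros continuous_on_subset[OF B.cont] continuous_on_subset[OF B.continuous_beta]) (use d \<open>u ~: bt ` {-d..d}\<close> in auto)
  then have "(%s. if s : {-d/2..d/2} then bt' s / (bt s - u) else 0) : bmeas borel"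
  by (intro borel_measurable_continuous_on_if) auto
  then have "(%s. if s : {-d/2..d/2} then bt' s / (bt s - u) else 0) : bmeas lebesgue" by (intro measurable_completion) simp
  then show "(%s. indicat_real {-d/2..d/2} s *\<^sub>R ((L \<i> s - L (-\<i>) s) / (bt s - u) * bt' s)) : bmeas lebesgue"
  unfolding e using Lm by measurable
  have "(%t. if t : S then arc_density gm J t / (arc_point gm t - z) else 0) : bmeas lebesgue"
  using dm[OF g] pm[OF g] by (intro measurable_If_set) (auto simp: S_def)
  moreover have "(%s::real. t0 + 1 * s) : lebesgue \<rightarrow>\<^sub>M lebesgue" using lebesgue_affine_measurable[where c= "%x::real. 1" and t=t0] by simp
  ultimately show "(%s. if t0 + s : S then arc_density gm J (t0 + s) / (arc_point gm (t0 + s) - z) else 0) : bmeas lebesgue"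
  using measurable_compose[of "%s::real. t0 + 1 * s" lebesgue lebesgue] by simp
  show "AE s in lebesgue. indicat_real {-d/2..d/2} s *\<^sub>R ((L \<i> s - L (-\<i>) s) / (bt s - u) * bt' s) = (if t0 + s : S then arc_density gm J (t0 + s) / (arc_point gm (t0 + s) - z) else 0)"
  using Jeq
  proof eventually_elim
  case (elim s)
  show ?case
  proof (cases "s : {-d/2..d/2}")
  case True
  then have "t0 + s : S" by (auto simp: S_def)
  have "gm (t0 + s) - z = tu * (bt s - u)" by (simp only: gb zu) (simp add: algebra_simps)
  moreover have "vel gm (t0 + s) = tu * bt' s" using tu by (simp add: bt'_def)
  ultimately show ?thesis using True elim \<open>t0 + s : S\<close> ou[OF dd[OF True]] tu by (simp add: arc_density_def arc_point_def)
  qed (auto simp: S_def)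
  qed
  qed
  also have "... = (\<integral>t. (if t : S then arc_density gm J t / (arc_point gm t - z) else 0) \<partial>lebesgue)"
  using lebesgue_integral_real_affine[of 1 "%t. if t : S then arc_density gm J t / (arc_point gm t - z) else 0" t0] by (simp cong: if_cong)
  finally have loc: "(LINT s:{-d/2..d/2}|lebesgue. (L \<i> s - L (-\<i>) s) / (bt s - u) * bt' s) = (\<integral>t. (if t : S then arc_density gm J t / (arc_point gm t - z) else 0) \<partial>lebesgue)" .
  obtain et where et: "et > 0" "ball z et <= - C" using z by (auto intro: openE[OF oC])
  have sepz: "arc_density dl J t = 0 \<or> et <= cmod (arc_point dl t - z)" if "dl : set Sg" for dl t
  proof (cases "t : open_unit")
  case True
  then have "dl t ~: ball z et" using et(2) contour_arc_subset[OF that True] by (auto simp: C_def)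
  then show ?thesis using True by (auto simp: arc_point_def dist_norm norm_minus_commute)
  qed (auto simp: arc_density_def)
  have intz: "integrable lebesgue (%t. arc_density dl J t / (arc_point dl t - z))" if "dl : set Sg" for dl
  by (rule integrable_cauchy_kernel[OF pm[OF that] dm[OF that] dint[OF that] et(1)]) (use sepz[OF that] in auto)
  have intph: "integrable lebesgue (%t. ph dl t / (arc_point dl t - z))" if "dl : set Sg" for dl
  by (rule integrable_cauchy_kernel[OF pm[OF that] phm[OF that] phint[OF that] et(1)]) (use sepz[OF that] in \<open>auto simp: ph_def\<close>)
  have "(\<integral>t. arc_density dl J t / (arc_point dl t - z) \<partial>lebesgue) - (\<integral>t. ph dl t / (arc_point dl t - z) \<partial>lebesgue)
  = (if dl = gm then (\<integral>t. (if t : S then arc_density gm J t / (arc_point gm t - z) else 0) \<partial>lebesgue) else 0)" if "dl : set Sg" for dl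
  proof (cases "dl = gm")
  case True
  have "(\<integral>t. arc_density dl J t / (arc_point dl t - z) \<partial>lebesgue) - (\<integral>t. ph dl t / (arc_point dl t - z) \<partial>lebesgue)
  = (\<integral>t. arc_density dl J t / (arc_point dl t - z) - ph dl t / (arc_point dl t - z) \<partial>lebesgue)"
  using intz[OF that] intph[OF that] by simp
  also have "... = (\<integral>t. (if t : S then arc_density gm J t / (arc_point gm t - z) else 0) \<partial>lebesgue)"
  using True by (intro Bochner_Integration.integral_cong) (auto simp: ph_def)
  finally show ?thesis using True by simp
  qed (simp add: ph_def)
  then have "(\<Sum>dl\<in>set Sg. \<integral>t. arc_density dl J t / (arc_point dl t - z) \<partial>lebesgue) - Rest z = (\<integral>t. (if t : S then arc_density gm J t / (arc_point gm t - z) else 0) \<partial>lebesgue)"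
  unfolding Rest_def using g by (simp add: sum_subtractf[symmetric])
  then have "2 * pi * \<i> * F z = Ps u + (\<Sum>dl\<in>set Sg. \<integral>t. arc_density dl J t / (arc_point dl t - z) \<partial>lebesgue) - Rest z"
  using rep loc by (simp add: algebra_simps)
  moreover have "F z = (p - r) / T + x / T" if "T * F z = p + x - r" "T ~= 0" for p r x T
  proof -
  have "F z = (p + x - r) / T" using that by (simp add: eq_divide_eq mult.commute)
  then show ?thesis by (simp add: add_divide_distrib diff_divide_distrib)
  qed
  ultimately have "F z = (Ps u - Rest z) / (2 * pi * \<i>) + CI Sg J z"
  unfolding cauchy_integral_eq[OF Sg] by simp
  then show ?thesis by (simp add: Tt_def u_def)
 qed
 ultimately show ?thesis using rh(1) unfolding w_def C_def by blast
qed

text \<open>Serves both limits of mean values: squares shrinking to an exceptional point of the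
  contour, and squares growing to the whole plane.\<close>

lemma integral_kernel_tendsto_0:
 fixes G :: "real => real" and q :: "real => complex"
 assumes int: "integrable lebesgue (%t. G t / (1 + cmod (q t)))" and [measurable]: "G : bmeas lebesgue" "!!n. kq n : bmeas lebesgue"
  and G0: "!!t. 0 <= G t" and kq: "!!n t. 0 <= kq n t" "!!n t. kq n t <= C / (1 + cmod (q t))"
  and lim: "AE t in lebesgue. G t = 0 \<or> (%n. kq n t) \<longlonglongrightarrow> 0"
 shows "(%n. \<integral>t. G t * kq n t \<partial>lebesgue) \<longlonglongrightarrow> 0"
proof -
 have "(%n. \<integral>t. G t * kq n t \<partial>lebesgue) \<longlonglongrightarrow> (\<integral>t. 0 \<partial>(lebesgue :: real measure))"
 proof (rule integral_dominated_convergence[where w = "%t. C * (G t / (1 + cmod (q t)))"])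
  show "AE t in lebesgue. (%n. G t * kq n t) \<longlonglongrightarrow> 0"
  using lim
  proof eventually_elim
  case (elim t)
  then show ?case using tendsto_mult_right_zero by (cases "G t = 0") auto
  qed
  show "AE t in lebesgue. norm (G t * kq n t) <= C * (G t / (1 + cmod (q t)))" for n
  proof (rule AE_I2)
  fix t
  have "norm (G t * kq n t) = G t * kq n t" using G0[of t] kq(1)[of n t] by simp
  also have "... <= G t * (C / (1 + cmod (q t)))" by (intro mult_left_mono kq G0)
  finally show "norm (G t * kq n t) <= C * (G t / (1 + cmod (q t)))" by (simp add: mult_ac)
  qed
  show "integrable lebesgue (%t. C * (G t / (1 + cmod (q t))))" by (intro integrable_mult_right int)
 qed auto
 then show ?thesis by simp
qed

text \<open>Densities on arcs are only Lebesgue measurable, so Borel versions equal almost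
  everywhere are passed to \<open>mean_value_potential\<close>. The regularised kernel is integrable
  against the weighted density, which permits the return to real-valued integrals.\<close>

lemma mean_value_arcs:
 fixes Ph :: "complex => complex" and G :: "(real => complex) => real => real"
 assumes "convex S" "open S" "Ph holomorphic_on S" "!!x y. \<bar>x\<bar> <= rh ==> \<bar>y\<bar> <= rh ==> z + Complex x y : S" "rh > 0"
  and Sg: "is_contour Sg" and Gm: "!!gm. gm : set Sg ==> G gm : bmeas lebesgue" and G0: "!!gm t. 0 <= G gm t"
  and int: "!!gm. gm : set Sg ==> integrable lebesgue (%t. G gm t / (1 + cmod (arc_point gm t)))"
  and N: "negligible {(y,x). Complex x y : N}"
  and le: "!!w. w : S - N ==> ennreal (norm (Ph w)) <= (\<Sum>gm\<in>set Sg. \<integral>\<^sup>+t. ennreal (G gm t / cmod (arc_point gm t - w)) \<partial>lebesgue)"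
 shows "norm (Ph z) <= (\<Sum>gm\<in>set Sg. \<integral>t. G gm t * (432 / max rh (cmod (arc_point gm t - z))) \<partial>lebesgue)"
proof -
 have "ALL gm:set Sg. EX g. g : bmeas lborel & (AE t in lborel. ennreal (G gm t) = g t)"
 proof
  fix gm assume "gm : set Sg"
  then have "(%t. ennreal (G gm t)) : bmeas lebesgue" using Gm by measurable
  from completion_ex_borel_measurable[OF this] show "EX g. g : bmeas lborel & (AE t in lborel. ennreal (G gm t) = g t)" by blast
 qed
 from bchoice[OF this] obtain g where g: "!!gm. gm : set Sg ==> g gm : bmeas borel"
  and ge: "!!gm. gm : set Sg ==> AE t in lborel. ennreal (G gm t) = g gm t" by auto
 have conv: "(\<integral>\<^sup>+t. g gm t * ennreal (k t) \<partial>lborel) = (\<integral>\<^sup>+t. ennreal (G gm t * k t) \<partial>lebesgue)" if "gm : set Sg" "!!t. 0 <= k t" for gm k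
 proof -
  have "(\<integral>\<^sup>+t. ennreal (G gm t * k t) \<partial>lebesgue) = (\<integral>\<^sup>+t. ennreal (G gm t * k t) \<partial>lborel)" by (rule nn_integral_completion)
  also have "... = (\<integral>\<^sup>+t. g gm t * ennreal (k t) \<partial>lborel)"
  proof (rule nn_integral_cong_AE)
  show "AE t in lborel. ennreal (G gm t * k t) = g gm t * ennreal (k t)"
  using ge[OF that(1)] by eventually_elim (use G0 that(2) in \<open>simp add: ennreal_mult\<close>)
  qed
  finally show ?thesis by simp
 qed
 have fin: "integrable lebesgue (%t. G gm t * (432 / max rh (cmod (arc_point gm t - z))))" if ga: "gm : set Sg" for gm
 proof (rule Bochner_Integration.integrable_bound)
  let ?q = "arc_point gm"
  have [measurable]: "?q : bmeas lebesgue" using arc_point_measurable[OF is_contour_arcs(1)[OF Sg ga]] by (intro measurable_completion) simp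
  note [measurable] = Gm[OF ga]
  show "integrable lebesgue (%t. 432 * (1 + (1 + cmod z) / rh) * (G gm t / (1 + cmod (?q t))))"
  by (intro integrable_mult_right int ga)
  show "(%t. G gm t * (432 / max rh (cmod (arc_point gm t - z)))) : bmeas lebesgue" by measurable
  show "AE t in lebesgue. norm (G gm t * (432 / max rh (cmod (?q t - z)))) <= norm (432 * (1 + (1 + cmod z) / rh) * (G gm t / (1 + cmod (?q t))))"
  proof (rule AE_I2)
  fix t
  let ?m = "max rh (cmod (?q t - z))"
  have m: "0 < ?m" "rh <= ?m" "cmod (?q t - z) <= ?m" using assms(5) by auto
  have "1 + cmod (?q t) <= (1 + cmod z) + cmod (?q t - z)" using norm_triangle_ineq[of "?q t - z" z] by simp
  also have "1 + cmod z = (1 + cmod z) / rh * rh" using assms(5) by simp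
  also have "... <= (1 + cmod z) / rh * ?m" using assms(5) m by (intro mult_left_mono) (auto intro!: add_nonneg_nonneg)
  finally have "1 + cmod (?q t) <= (1 + (1 + cmod z) / rh) * ?m" using m(3) by (simp add: algebra_simps)
  then have "1 / ?m <= (1 + (1 + cmod z) / rh) / (1 + cmod (?q t))"
  using m(1) by (simp add: field_simps add_pos_nonneg)
  then have "432 * G gm t * (1 / ?m) <= 432 * G gm t * ((1 + (1 + cmod z) / rh) / (1 + cmod (?q t)))"
  by (intro mult_left_mono) (use G0 in auto)
  then have l: "G gm t * (432 / ?m) <= 432 * (1 + (1 + cmod z) / rh) * (G gm t / (1 + cmod (?q t)))" by (simp add: mult_ac)
  moreover have "0 <= G gm t * (432 / ?m)" using G0 m(1) by (intro mult_nonneg_nonneg) auto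
  ultimately show "norm (G gm t * (432 / ?m)) <= norm (432 * (1 + (1 + cmod z) / rh) * (G gm t / (1 + cmod (?q t))))"
  unfolding real_norm_def by linarith
  qed
 qed
 have "ennreal (norm (Ph z)) <= (\<Sum>gm\<in>set Sg. \<integral>\<^sup>+t. g gm t * ennreal (432 / max rh (cmod (arc_point gm t - z))) \<partial>lborel)"
 proof (rule mean_value_potential[OF assms(1-5) finite_set _ g N])
  show "arc_point gm : bmeas borel" if "gm : set Sg" for gm by (rule arc_point_measurable[OF is_contour_arcs(1)[OF Sg that]])
  fix w assume w: "w : S - N"
  have "ennreal (norm (Ph w)) <= (\<Sum>gm\<in>set Sg. \<integral>\<^sup>+t. ennreal (G gm t / cmod (arc_point gm t - w)) \<partial>lebesgue)" by (rule le[OF w])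
  also have "... = (\<Sum>gm\<in>set Sg. \<integral>\<^sup>+t. g gm t * ennreal (1 / cmod (arc_point gm t - w)) \<partial>lborel)"
  using conv[of _ "%t. 1 / cmod (arc_point gm t - w)" for gm] by (intro sum.cong refl) simp
  finally show "ennreal (norm (Ph w)) <= (\<Sum>gm\<in>set Sg. \<integral>\<^sup>+t. g gm t * ennreal (1 / cmod (arc_point gm t - w)) \<partial>lborel)" .
 qed auto
 also have "... = (\<Sum>gm\<in>set Sg. \<integral>\<^sup>+t. ennreal (G gm t * (432 / max rh (cmod (arc_point gm t - z)))) \<partial>lebesgue)"
  using assms(5) by (intro sum.cong refl conv) (auto simp: le_max_iff_disj)
 also have "... = (\<Sum>gm\<in>set Sg. ennreal (\<integral>t. G gm t * (432 / max rh (cmod (arc_point gm t - z))) \<partial>lebesgue))"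
 proof (intro sum.cong refl nn_integral_eq_integral fin AE_I2)
  fix gm t
  have "0 < max rh (cmod (arc_point gm t - z))" using assms(5) by auto
  then show "0 <= G gm t * (432 / max rh (cmod (arc_point gm t - z)))" using G0 by (intro mult_nonneg_nonneg) auto
 qed
 also have "... = ennreal (\<Sum>gm\<in>set Sg. \<integral>t. G gm t * (432 / max rh (cmod (arc_point gm t - z))) \<partial>lebesgue)"
 proof (rule sum_ennreal)
  fix gm
  have "0 < max rh (cmod (arc_point gm t - z))" for t using assms(5) by auto
  then show "0 <= (\<integral>t. G gm t * (432 / max rh (cmod (arc_point gm t - z))) \<partial>lebesgue)" using G0
  by (intro Bochner_Integration.integral_nonneg mult_nonneg_nonneg divide_nonneg_pos) auto
 qed
 finally show ?thesis
  by (rule ennreal_le_iff[THEN iffD1, rotated])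
  (use G0 assms(5) in \<open>auto intro!: sum_nonneg Bochner_Integration.integral_nonneg mult_nonneg_nonneg divide_nonneg_nonneg simp: le_max_iff_disj\<close>)
qed

text \<open>A Painleve theorem: \<open>F\<close> and the Cauchy integral of its jump differ by a function that is
 analytic across the open arcs; its growth at the end points and at infinity is controlled in the mean,
 because it is dominated by a potential of arclength densities.\<close>

theorem cauchy_integral_of_jump:
 fixes F J h :: "complex => complex"
 assumes Sg: "is_contour Sg" and dense: "contour_set Sg <= closure (- contour_set Sg)"
  and hol: "F holomorphic_on - contour_set Sg" and E: "finite E"
  and bd: "!!w. w : contour_set Sg - E ==> EX rh>0. EX M. ALL z:ball w rh - contour_set Sg. cmod (F z) <= M"
  and J: "J : L2 Sg"
  and nt: "AE s in arclength Sg. EX lp lm. has_nt_limit Sg 1 F s lp & has_nt_limit Sg (-1) F s lm & J s = lp - lm"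
  and h: "h : L2 Sg"
  and Fh: "!!z. z ~: contour_set Sg ==> cmod (F z) <= (\<Sum>gm\<in>set Sg. \<integral>t. cmod (arc_density gm h t) / cmod (arc_point gm t - z) \<partial>lebesgue)"
  and z: "z ~: contour_set Sg"
 shows "F z = CI Sg J z"
proof -
 define C where "C = contour_set Sg"
 have cC: "closed C" by (simp add: C_def closed_contour_set)
 then have oC: "open (- C)" by (simp add: open_Compl)
 obtain K0 where K0: "finite K0" "C <= (\<Union>gm\<in>set Sg. gm ` open_unit) Un K0"
  using contour_set_subset_finite[OF Sg] unfolding C_def by blast
 \<comment> \<open>Exceptional points: those where F may be unbounded, and the finite end points of
   arcs, where the contour is not a single arc.\<close>
 define K where "K = (E Un K0) Int C"
 have K: "finite K" "K <= C" using E K0 by (auto simp: K_def)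
 define Ph where "Ph = (%z. F z - CI Sg J z)"
 have dm: "arc_density gm u : bmeas lebesgue" if "gm : set Sg" "u : L2 Sg" for gm u
  by (rule arc_density_measurable[OF Sg that(1) Lp_measurable[OF that(2)]])
 have pm: "arc_point gm : bmeas lebesgue" if "gm : set Sg" for gm
  using arc_point_measurable[OF is_contour_arcs(1)[OF Sg that]] by (intro measurable_completion) simp
 have dint: "integrable lebesgue (%t. norm (arc_density gm u t) / (1 + cmod (arc_point gm t)))" if "gm : set Sg" "u : L2 Sg" for gm u
  using arc_density_bound[OF Sg that(1)] that(2) by blast
 have sep: "EX et>0. ALL gm:set Sg. ALL t u. arc_density gm u t = 0 \<or> et <= cmod (arc_point gm t - w)" if wC: "w : - C" for w
 proof -
  obtain et where et: "et > 0" "ball w et <= - C" by (rule openE[OF oC wC])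
  have "arc_density gm u t = 0 \<or> et <= cmod (arc_point gm t - w)" if "gm : set Sg" for gm t u
  proof (cases "t : open_unit")
  case True
  then have "gm t ~: ball w et" using et(2) contour_arc_subset[OF that True] by (auto simp: C_def)
  then show ?thesis using True by (auto simp: arc_point_def dist_norm norm_minus_commute)
  qed (auto simp: arc_density_def)
  then show ?thesis using et(1) by blast
 qed
 have intw: "integrable lebesgue (%t. arc_density gm u t / (arc_point gm t - w))" if gw: "gm : set Sg" "u : L2 Sg" "w : - C" for gm u w
 proof -
  obtain et where et: "et > 0" "ALL gm:set Sg. ALL t u. arc_density gm u t = 0 \<or> et <= cmod (arc_point gm t - w)" using sep[OF gw(3)] by blast
  show ?thesis by (rule integrable_cauchy_kernel[OF pm[OF gw(1)] dm[OF gw(1,2)] dint[OF gw(1,2)] et(1)]) (use et(2) gw(1) in auto)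
 qed
 have CJhol: "CI Sg J holomorphic_on - C"
  unfolding cauchy_integral_eq[OF Sg]
 proof (intro holomorphic_intros)
  fix gm assume g: "gm : set Sg"
  show "(%z. \<integral>t. arc_density gm J t / (arc_point gm t - z) \<partial>lebesgue) holomorphic_on - C"
  proof (rule cauchy_transform_holomorphic[OF oC pm[OF g] dm[OF g J] dint[OF g J]])
  fix w assume "w : - C"
  from sep[OF this] obtain et where et: "et > 0" "ALL gm:set Sg. ALL t u. arc_density gm u t = 0 \<or> et <= cmod (arc_point gm t - w)" by blast
  then have "arc_density gm J t = 0 \<or> et <= cmod (arc_point gm t - w)" for t using g by blast
  then show "EX dl>0. AE x in lebesgue. arc_density gm J x = 0 \<or> dl <= cmod (arc_point gm x - w)" using et(1) by (intro exI[of _ et]) auto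
  qed
 qed auto
 have Phhol: "Ph holomorphic_on - C" unfolding Ph_def using CJhol hol by (intro holomorphic_intros) (auto simp: C_def)
 \<comment> \<open>The sum of the densities dominating F and C J, so that |F - C J| is at most the
   potential of G. Dropping 1/(2 pi) from C J is harmless since it is below 1.\<close>
 define G where "G = (%gm t. cmod (arc_density gm h t) + cmod (arc_density gm J t))"
 have G0: "0 <= G gm t" for gm t by (simp add: G_def)
 have Gm: "G gm : bmeas lebesgue" if "gm : set Sg" for gm
  unfolding G_def using dm[OF that h] dm[OF that J] by measurable
 have Gint: "integrable lebesgue (%t. G gm t / (1 + cmod (arc_point gm t)))" if "gm : set Sg" for gm
  unfolding G_def add_divide_distrib using dint[OF that h] dint[OF that J] by (rule Bochner_Integration.integrable_add)
 have Gout: "G gm t = 0" if "t ~: open_unit" for gm t using that by (auto simp: G_def arc_density_def)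
 have PhG: "ennreal (cmod (Ph w)) <= (\<Sum>gm\<in>set Sg. \<integral>\<^sup>+t. ennreal (G gm t / cmod (arc_point gm t - w)) \<partial>lebesgue)" if w: "w : - C" for w
 proof -
  have i: "integrable lebesgue (%t. cmod (arc_density gm u t) / cmod (arc_point gm t - w))" if "gm : set Sg" "u : L2 Sg" for gm u
  using integrable_norm[OF intw[OF that w]] by (simp add: norm_divide)
  have "cmod (CI Sg J w) <= cmod (\<Sum>gm\<in>set Sg. \<integral>t. arc_density gm J t / (arc_point gm t - w) \<partial>lebesgue)"
  proof -
  have "cmod (X / (2 * of_real pi * \<i>)) <= cmod X" for X
  proof -
  have "cmod (X / (2 * of_real pi * \<i>)) = cmod X / (2 * pi)" by (simp add: norm_divide norm_mult)
  also have "... <= cmod X / 1" using pi_gt3 by (intro divide_left_mono) auto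
  finally show ?thesis by simp
  qed
  then show ?thesis unfolding cauchy_integral_eq[OF Sg] .
  qed
  also have "... <= (\<Sum>gm\<in>set Sg. cmod (\<integral>t. arc_density gm J t / (arc_point gm t - w) \<partial>lebesgue))" by (rule norm_sum)
  also have "... <= (\<Sum>gm\<in>set Sg. \<integral>t. cmod (arc_density gm J t) / cmod (arc_point gm t - w) \<partial>lebesgue)"
  using integral_norm_bound[of lebesgue "%t. arc_density gm J t / (arc_point gm t - w)" for gm] by (intro sum_mono) (simp add: norm_divide)
  finally have "cmod (Ph w) <= (\<Sum>gm\<in>set Sg. \<integral>t. cmod (arc_density gm h t) / cmod (arc_point gm t - w) \<partial>lebesgue) + (\<Sum>gm\<in>set Sg. \<integral>t. cmod (arc_density gm J t) / cmod (arc_point gm t - w) \<partial>lebesgue)"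
  unfolding Ph_def using norm_triangle_ineq4[of "F w" "CI Sg J w"] Fh[of w] w by (simp add: C_def)
  also have "... = (\<Sum>gm\<in>set Sg. \<integral>t. G gm t / cmod (arc_point gm t - w) \<partial>lebesgue)"
  unfolding sum.distrib[symmetric] G_def add_divide_distrib
  by (intro sum.cong refl Bochner_Integration.integral_add[symmetric] i h J) auto
  finally have "ennreal (cmod (Ph w)) <= ennreal (\<Sum>gm\<in>set Sg. \<integral>t. G gm t / cmod (arc_point gm t - w) \<partial>lebesgue)" by (rule ennreal_leI)
  also have "... = (\<Sum>gm\<in>set Sg. ennreal (\<integral>t. G gm t / cmod (arc_point gm t - w) \<partial>lebesgue))"
  by (rule sum_ennreal[symmetric]) (intro Bochner_Integration.integral_nonneg divide_nonneg_nonneg G0 norm_ge_zero)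
  also have "... = (\<Sum>gm\<in>set Sg. \<integral>\<^sup>+t. ennreal (G gm t / cmod (arc_point gm t - w)) \<partial>lebesgue)"
  proof (intro sum.cong refl nn_integral_eq_integral[symmetric])
  show "integrable lebesgue (%t. G gm t / cmod (arc_point gm t - w))" if "gm : set Sg" for gm
  unfolding G_def add_divide_distrib by (intro Bochner_Integration.integrable_add i that h J)
  qed (use G0 in auto)
  finally show ?thesis .
 qed
 have Neg: "negligible {(y,x). Complex x y : C}" unfolding C_def by (rule negligible_contour_set[OF Sg])
 have "EX rh>0. EX Tt. Tt holomorphic_on ball w rh & (ALL z:ball w rh - C. Tt z = Ph z)" if w: "w : C - K" for w
 proof -
  obtain gm t where gt: "gm : set Sg" "t : open_unit" "w = gm t" using w K0 by (auto simp: K_def)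
  obtain rh M where "rh > 0" "ALL z:ball w rh - contour_set Sg. cmod (F z) <= M" using bd[of w] w by (auto simp: K_def C_def)
  then show ?thesis using local_extension[OF Sg hol gt(1,2) _ _ J nt, of rh M] gt(3) unfolding C_def Ph_def by blast
 qed
 from holomorphic_glue[OF cC _ K Phhol this] dense
 obtain Ph1 where Ph1: "Ph1 holomorphic_on - K" "!!z. z : - C ==> Ph1 z = Ph z" unfolding C_def by blast
 \<comment> \<open>To remove an exceptional point e, mean values are taken on squares about u n of
   half side |u n - e|/2; these avoid all of K. Multiplied by |u n - e|, the regularised kernel is
   bounded and tends to 0 at all points other than e, and each arc passes through e for at most one
   parameter.\<close>
 have rem: "((%z. (z - e) * Ph1 z) \<longlongrightarrow> 0) (at e)" if e: "e : K" for e
  unfolding tendsto_at_iff_sequentially o_def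
 proof (intro allI impI)
  fix u :: "nat => complex" assume u: "ALL i. u i : UNIV - {e}" "u \<longlonglongrightarrow> e"
  obtain r where r: "r > 0" "ALL x:K. x ~= e --> r <= dist e x" using finite_set_avoid[OF K(1), of e] by blast
  define dl where "dl = (%n. cmod (u n - e))"
  have dl0: "dl n > 0" for n using u(1) by (simp add: dl_def)
  have dllim: "dl \<longlonglongrightarrow> 0" unfolding dl_def using tendsto_norm_zero[OF LIM_zero[OF u(2)]] .
  \<comment> \<open>Set to 0 while \<open>dl n > 1\<close>, so that one integrable majorant works
    for all n; eventually the other branch applies.\<close>
  define kq where "kq = (%gm n t. if dl n <= 1 then 432 * (dl n / max (dl n / 2) (cmod (arc_point gm t - u n))) else 0)"
  have kqm: "kq gm n : bmeas lebesgue" if "gm : set Sg" for gm n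
  unfolding kq_def using pm[OF that] by measurable
  have mpos: "0 < max (dl n / 2) x" for n x using dl0[of n] by (auto simp: less_max_iff_disj)
  have kq0: "0 <= kq gm n t" for gm n t using dl0[of n] mpos[of n] by (auto simp: kq_def intro!: divide_nonneg_pos)
  \<comment> \<open>For |q - e| < 2 the quotient is at most 2 and 1 + |q| <= 3 + |e|. For |q - e| >=
    2, since dl n <= 1, the denominator is at least |q - e|/2. The factor is 864 = 2 times
    432.\<close>
  have kqb: "kq gm n t <= (864 * (3 + cmod e)) / (1 + cmod (arc_point gm t))" for gm n t
  proof (cases "dl n <= 1")
  case True
  define q where "q = arc_point gm t"
  have "dl n / max (dl n / 2) (cmod (q - u n)) <= 2 * (3 + cmod e) / (1 + cmod q)"
  proof (cases "cmod (q - e) < 2")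
  case t: True
  have "dl n / max (dl n / 2) (cmod (q - u n)) <= dl n / (dl n / 2)" using dl0[of n] mpos[of n] by (intro divide_left_mono mult_pos_pos) auto
  also have "... = 2 * 1" using dl0[of n] by simp
  also have "1 <= (3 + cmod e) / (1 + cmod q)" using t norm_triangle_ineq[of "q - e" e] by (simp add: le_divide_eq add_pos_nonneg)
  finally show ?thesis by simp
  next
  case False
  have "cmod (q - e) <= cmod (q - u n) + dl n" using norm_triangle_ineq[of "q - u n" "u n - e"] by (simp add: dl_def)
  then have l: "cmod (q - e) / 2 <= max (dl n / 2) (cmod (q - u n))" using True False by simp
  have "dl n / max (dl n / 2) (cmod (q - u n)) <= 1 / (cmod (q - e) / 2)"
  using True False l dl0[of n] by (intro frac_le) auto
  also have "... <= 2 * (3 + cmod e) / (1 + cmod q)"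
  proof -
  have "1 + cmod q <= 1 + cmod e + cmod (q - e)" using norm_triangle_ineq[of "q - e" e] by simp
  also have "... <= (3 + cmod e) * cmod (q - e)"
  using mult_right_mono[of 2 "cmod (q - e)" "1 + cmod e"] mult_left_mono[of 1 "cmod (q - e)" "1 + cmod e"] False by (simp add: algebra_simps add_nonneg_nonneg)
  finally have l: "1 + cmod q <= (3 + cmod e) * cmod (q - e)" .
  have D: "0 < cmod (q - e)" and Y: "0 < 1 + cmod q" using False norm_ge_zero[of q] by linarith+
  have "2 * (1 + cmod q) / cmod (q - e) <= 2 * (3 + cmod e)"
  by (subst pos_divide_le_eq[OF D], subst mult.assoc, rule mult_left_mono[OF l]) simp
  then have "1 / (cmod (q - e) / 2) * (1 + cmod q) <= 2 * (3 + cmod e)" by simp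
  then show ?thesis by (subst pos_le_divide_eq[OF Y])
  qed
  finally show ?thesis .
  qed
  then have "432 * (dl n / max (dl n / 2) (cmod (q - u n))) <= 432 * (2 * (3 + cmod e) / (1 + cmod q))" by (rule mult_left_mono) simp
  also have "... = 864 * (3 + cmod e) / (1 + cmod q)" by simp
  finally show ?thesis using True by (simp only: kq_def q_def if_True)
  qed (simp add: kq_def add_nonneg_nonneg)
  have ev1: "eventually (%n. dl n < min 1 (r/2)) sequentially"
  using order_tendstoD(2)[OF dllim, of "min 1 (r/2)"] r(1) by simp
  have lim: "(%n. \<integral>t. G gm t * kq gm n t \<partial>lebesgue) \<longlonglongrightarrow> 0" if ga: "gm : set Sg" for gm
  proof (rule integral_kernel_tendsto_0[OF Gint[OF ga] Gm[OF ga] kqm[OF ga] G0 kq0 kqb])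
  have "EX s. ALL t:open_unit. gm t = e --> t = s"
  proof (cases "EX t0:open_unit. gm t0 = e")
  case True
  then obtain t0 where t0: "t0 : open_unit" "gm t0 = e" by blast
  have "t = t0" if "t : open_unit" "gm t = e" for t
  using is_contour_arcs(2)[OF Sg ga ga that(1) t0(1)] that(2) t0(2) by simp
  then show ?thesis by blast
  qed blast
  then obtain s where s: "!!t. t : open_unit ==> gm t = e ==> t = s" by blast
  have "AE t in lborel. t ~= s" by (rule AE_lborel_singleton)
  then have "AE t in lebesgue. t ~= s" by (rule AE_completion)
  then show "AE t in lebesgue. G gm t = 0 \<or> (%n. kq gm n t) \<longlonglongrightarrow> 0"
  proof eventually_elim
  case (elim t)
  show ?case
  proof (cases "t : open_unit")
  case True
  have "gm t ~= e" using s[OF True] elim by blast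
  then have ne: "arc_point gm t ~= e" using True by (simp only: arc_point_def if_True not_False_eq_True)
  have "(%n. 432 * (dl n / max (dl n / 2) (cmod (arc_point gm t - u n)))) \<longlonglongrightarrow> 432 * (0 / max (0/2) (cmod (arc_point gm t - e)))"
  by (rule tendsto_mult[OF tendsto_const tendsto_divide[OF dllim tendsto_max[OF tendsto_divide[OF dllim tendsto_const] tendsto_norm[OF tendsto_diff[OF tendsto_const u(2)]]]]]) (use ne in simp_all)
  then have "(%n. 432 * (dl n / max (dl n / 2) (cmod (arc_point gm t - u n)))) \<longlonglongrightarrow> 0" by simp
  moreover have "eventually (%n. 432 * (dl n / max (dl n / 2) (cmod (arc_point gm t - u n))) = kq gm n t) sequentially"
  using ev1 by (rule eventually_mono) (simp add: kq_def)
  ultimately have "(%n. kq gm n t) \<longlonglongrightarrow> 0" by (rule Lim_transform_eventually)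
  then show ?thesis by (rule disjI2)
  next
  case False
  then show ?thesis by (intro disjI1 Gout)
  qed
  qed
  qed
  have "(%n. \<Sum>gm\<in>set Sg. \<integral>t. G gm t * kq gm n t \<partial>lebesgue) \<longlonglongrightarrow> 0"
  using tendsto_sum[of "set Sg" "%gm n. \<integral>t. G gm t * kq gm n t \<partial>lebesgue" "%_. 0", OF lim] by simp
  moreover have "eventually (%n. norm ((u n - e) * Ph1 (u n)) <= (\<Sum>gm\<in>set Sg. \<integral>t. G gm t * kq gm n t \<partial>lebesgue)) sequentially"
  using ev1
  proof eventually_elim
  case (elim n)
  let ?S = "ball (u n) (dl n)"
  have S: "?S <= - K"
  proof
  fix x assume x: "x : ?S"
  show "x : - K"
  proof
  assume xK: "x : K"
  have dx: "dist (u n) x < dl n" using x by simp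
  then have "x ~= e" by (auto simp: dl_def dist_norm)
  then have "r <= dist e x" using r(2) xK by blast
  also have "... <= dist (u n) e + dist (u n) x" by (metis dist_commute dist_triangle)
  also have "... < 2 * dl n" using dx by (simp add: dl_def dist_norm)
  finally show False using elim by simp
  qed
  qed
  have sq: "u n + Complex x y : ?S" if "\<bar>x\<bar> <= dl n / 2" "\<bar>y\<bar> <= dl n / 2" for x y
  proof -
  have "x^2 <= (dl n / 2)^2" "y^2 <= (dl n / 2)^2" using that dl0[of n] by (auto intro: abs_le_square_iff[THEN iffD1])
  moreover have "0 < (dl n)^2" "(dl n / 2)^2 = (dl n)^2 / 4" using dl0[of n] by (simp_all add: power_divide)
  ultimately have "x^2 + y^2 < (dl n)^2" by linarith
  then have "cmod (Complex x y) < dl n" using dl0[of n] by (simp add: cmod_def real_less_lsqrt)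
  then show ?thesis by (simp add: dist_norm)
  qed
  have "norm (Ph1 (u n)) <= (\<Sum>gm\<in>set Sg. \<integral>t. G gm t * (432 / max (dl n / 2) (cmod (arc_point gm t - u n))) \<partial>lebesgue)"
  proof (rule mean_value_arcs[OF convex_ball open_ball holomorphic_on_subset[OF Ph1(1) S] sq _ Sg Gm G0 Gint Neg])
  show "0 < dl n / 2" using dl0 by simp
  show "ennreal (cmod (Ph1 w)) <= (\<Sum>gm\<in>set Sg. \<integral>\<^sup>+t. ennreal (G gm t / cmod (arc_point gm t - w)) \<partial>lebesgue)" if "w : ?S - C" for w
  using PhG[of w] Ph1(2)[of w] that by simp
  qed auto
  then have "norm ((u n - e) * Ph1 (u n)) <= dl n * (\<Sum>gm\<in>set Sg. \<integral>t. G gm t * (432 / max (dl n / 2) (cmod (arc_point gm t - u n))) \<partial>lebesgue)"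
  unfolding norm_mult dl_def by (rule mult_left_mono) simp
  also have "... = (\<Sum>gm\<in>set Sg. \<integral>t. dl n * (G gm t * (432 / max (dl n / 2) (cmod (arc_point gm t - u n)))) \<partial>lebesgue)"
  unfolding sum_distrib_left by (simp only: integral_mult_right_zero)
  also have "... = (\<Sum>gm\<in>set Sg. \<integral>t. G gm t * kq gm n t \<partial>lebesgue)"
  proof (intro sum.cong refl Bochner_Integration.integral_cong)
  fix gm t
  have "kq gm n t = 432 * (dl n / max (dl n / 2) (cmod (arc_point gm t - u n)))" using elim by (simp add: kq_def)
  then show "dl n * (G gm t * (432 / max (dl n / 2) (cmod (arc_point gm t - u n)))) = G gm t * kq gm n t" by simp
  qed
  finally show ?case .
  qed
  ultimately show "(%n. (u n - e) * Ph1 (u n)) \<longlonglongrightarrow> 0" by (rule Lim_null_comparison[rotated])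
 qed
 \<comment> \<open>By \<open>rem\<close> the remaining singularities are removable. Gluing once
   more, now with no exceptional points, gives an entire function.\<close>
 have "EX rh>0. EX Tt. Tt holomorphic_on ball w rh & (ALL z:ball w rh - C. Tt z = Ph z)" if w: "w : C - {}" for w
 proof (cases "w : K")
  case False
  have "open (- K)" using K(1) by (simp add: finite_imp_closed open_Compl)
  then obtain rh where "rh > 0" "ball w rh <= - K" using False by (auto elim: openE)
  then show ?thesis using Ph1 by (intro exI[of _ rh] conjI exI[of _ Ph1]) (auto elim: holomorphic_on_subset)
 next
  case True
  obtain r where r: "r > 0" "ALL x:K. x ~= w --> r <= dist w x" using finite_set_avoid[OF K(1), of w] by blast
  have "ball w r - {w} <= - K" using r(2) by fastforce
  then have "Ph1 holomorphic_on ball w r - {w}" by (rule holomorphic_on_subset[OF Ph1(1)])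
  from holomorphic_on_extend_lim[OF this] rem[OF True] r(1)
  obtain g where g: "g holomorphic_on ball w r" "ALL z:ball w r - {w}. g z = Ph1 z" by auto
  have "g z = Ph z" if "z : ball w r - C" for z
  proof -
  have "z ~= w" using that w by blast
  then show ?thesis using g(2) Ph1(2)[of z] that by simp
  qed
  then show ?thesis using r(1) g(1) by blast
 qed
 from holomorphic_glue[OF cC _ finite.emptyI empty_subsetI Phhol this] dense
 obtain Ph2 where "Ph2 holomorphic_on - {}" "!!z. z : - C ==> Ph2 z = Ph z" unfolding C_def by blast
 then have Ph2: "Ph2 holomorphic_on UNIV" "!!z. z : - C ==> Ph2 z = Ph z" by (simp_all add: Compl_empty_eq)
 \<comment> \<open>A Liouville argument: on squares of half side n + 1 about z the regularised
   kernel is at most 432/(n+1), so the mean values force the entire function to vanish at z.\<close>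
 define kq where "kq = (%gm n t. 432 / max (real (Suc n)) (cmod (arc_point gm t - z)))"
 have le: "norm (Ph2 z) <= (\<Sum>gm\<in>set Sg. \<integral>t. G gm t * kq gm n t \<partial>lebesgue)" for n
  unfolding kq_def
 proof (rule mean_value_arcs[OF convex_UNIV open_UNIV Ph2(1) UNIV_I _ Sg Gm G0 Gint Neg])
  show "ennreal (cmod (Ph2 w)) <= (\<Sum>gm\<in>set Sg. \<integral>\<^sup>+t. ennreal (G gm t / cmod (arc_point gm t - w)) \<partial>lebesgue)" if "w : UNIV - C" for w
  using PhG[of w] Ph2(2)[of w] that by simp
 qed auto
 have "(%n. \<integral>t. G gm t * kq gm n t \<partial>lebesgue) \<longlonglongrightarrow> 0" if ga: "gm : set Sg" for gm
 proof (rule integral_kernel_tendsto_0[OF Gint[OF ga] Gm[OF ga] _ G0])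
  show "kq gm n : bmeas lebesgue" for n unfolding kq_def using pm[OF ga] by measurable
  show "0 <= kq gm n t" for n t by (auto simp: kq_def intro!: divide_nonneg_nonneg simp: le_max_iff_disj)
  show "kq gm n t <= (432 * (2 + cmod z)) / (1 + cmod (arc_point gm t))" for n t
  proof -
  define q where "q = arc_point gm t"
  let ?m = "max (real (Suc n)) (cmod (q - z))"
  have m: "1 <= ?m" "cmod (q - z) <= ?m" by (auto simp: le_max_iff_disj)
  have "1 + cmod q <= (1 + cmod z) * 1 + cmod (q - z)" using norm_triangle_ineq[of "q - z" z] by simp
  also have "... <= (1 + cmod z) * ?m + ?m" using m by (intro add_mono mult_left_mono) (auto intro: add_nonneg_nonneg)
  finally have "1 + cmod q <= (2 + cmod z) * ?m" by (simp add: algebra_simps)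
  then have "432 / ?m <= (432 * (2 + cmod z)) / (1 + cmod q)" using m(1) by (simp add: field_simps add_pos_nonneg)
  then show ?thesis by (simp add: kq_def q_def)
  qed
  show "AE t in lebesgue. G gm t = 0 \<or> (%n. kq gm n t) \<longlonglongrightarrow> 0"
  proof (intro AE_I2 disjI2)
  fix t
  have 1: "(%n. 432 / real (Suc n)) \<longlonglongrightarrow> 0" using LIMSEQ_Suc[OF lim_const_over_n[of "432::real"]] by simp
  show "(%n. kq gm n t) \<longlonglongrightarrow> 0"
  proof (rule tendsto_sandwich[OF _ _ tendsto_const 1])
  show "\<forall>\<^sub>F n in sequentially. 0 <= kq gm n t" by (auto simp: kq_def intro!: always_eventually divide_nonneg_nonneg simp: le_max_iff_disj)
  show "\<forall>\<^sub>F n in sequentially. kq gm n t <= 432 / real (Suc n)"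
  by (intro always_eventually allI, unfold kq_def, intro divide_left_mono mult_pos_pos) (auto simp: less_max_iff_disj)
  qed
  qed
 qed
 then have "(%n. \<Sum>gm\<in>set Sg. \<integral>t. G gm t * kq gm n t \<partial>lebesgue) \<longlonglongrightarrow> (\<Sum>gm\<in>set Sg. 0)"
  by (rule tendsto_sum)
 then have "norm (Ph2 z) <= (\<Sum>gm\<in>set Sg. 0)" by (rule LIMSEQ_le_const) (use le in auto)
 then have "Ph z = 0" using Ph2(2)[of z] z by (simp add: C_def)
 then show ?thesis by (simp add: Ph_def)
qed

section \<open>Functionals vanishing on indicators of arcs\<close>

lemma L2_indicator:
 fixes A :: "'a set" and c :: complex
 assumes "A : sets M" "emeasure M A < \<infinity>"
 shows "(%x. indicator A x * c) : Lp M 2" "Lp_norm M 2 (%x. indicator A x * c) <= sqrt (measure M A) * cmod c"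
proof -
 have m: "(%x. indicator A x * c) : bmeas M" using assms(1) by measurable
 have "(\<integral>\<^sup>+x. ennreal (norm (indicator A x * c) powr 2) \<partial>M) = (\<integral>\<^sup>+x. ennreal ((cmod c)^2) * indicator A x \<partial>M)"
  by (intro nn_integral_cong) (auto split: split_indicator)
 also have "... = ennreal ((cmod c)^2) * ennreal (measure M A)"
  using assms by (simp add: nn_integral_cmult_indicator emeasure_eq_ennreal_measure)
 also have "... = ennreal ((sqrt (measure M A) * cmod c) powr 2)"
  by (simp add: ennreal_mult[symmetric] power_mult_distrib mult.commute)
 finally show "(%x. indicator A x * c) : Lp M 2" "Lp_norm M 2 (%x. indicator A x * c) <= sqrt (measure M A) * cmod c"
  using Lp_norm_leI[OF m, of 2 "sqrt (measure M A) * cmod c"] by auto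
qed

text \<open>An arc through infinity has infinite length, so its indicator need not be in L2. On a
  compact parameter interval inside the open arc the speed is bounded, and the indicator is
  admissible.\<close>

lemma emeasure_compact_arc_finite:
 assumes Sg: "is_contour Sg" and g: "gm : set Sg" and ab: "0 < a" "b < 1"
 shows "gm ` {a..b} : sets (arclength Sg)" "emeasure (arclength Sg) (gm ` {a..b}) < \<infinity>"
proof -
 note sm = is_contour_arcs(1)[OF Sg g]
 have sub: "{a..b} <= open_unit" using ab by auto
 show A: "gm ` {a..b} : sets (arclength Sg)" by (rule arc_image_sets[OF Sg g _ sub]) auto
 have "continuous_on {a..b} (arc_speed gm)" by (intro continuous_intros continuous_on_subset[OF smooth_arc_continuous(2)[OF sm] sub])
 from compact_imp_bounded[OF compact_continuous_image[OF this compact_Icc]]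
 obtain B where "ALL w:arc_speed gm ` {a..b}. norm w <= B" unfolding bounded_iff by blast
 then have B: "arc_speed gm t <= B" if "t : {a..b}" for t using that by force
 have "emeasure (arclength Sg) (gm ` {a..b}) = (\<integral>\<^sup>+z. indicator (gm ` {a..b}) z \<partial>arclength Sg)" using A by simp
 also have "... = (\<Sum>dl\<in>set Sg. \<integral>\<^sup>+t. indicator (gm ` {a..b}) (dl t) * ennreal (arc_speed dl t) * indicator open_unit t \<partial>lebesgue)"
  by (rule nn_integral_arclength[OF Sg]) (use A in simp)
 also have "... <= (\<Sum>dl\<in>set Sg. \<integral>\<^sup>+t. ennreal (max 0 B) * indicator {a..b} t \<partial>lebesgue)"
 proof (intro sum_mono nn_integral_mono)
  fix dl t assume de: "dl : set Sg"
  show "indicator (gm ` {a..b}) (dl t) * ennreal (arc_speed dl t) * indicator open_unit t <= ennreal (max 0 B) * indicator {a..b} t"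
  proof (cases "t : open_unit & dl t : gm ` {a..b}")
  case True
  then obtain s where s: "s : {a..b}" "dl t = gm s" by auto
  then have "dl = gm & t = s" using True sub by (intro is_contour_arcs(2)[OF Sg de g]) auto
  then show ?thesis using s B[of s] True by (auto intro!: ennreal_leI simp: le_max_iff_disj)
  next
  case False
  then show ?thesis by (auto split: split_indicator)
  qed
 qed
 also have "... = (\<Sum>dl\<in>set Sg. ennreal (max 0 B) * emeasure lborel {a..b})" by (simp add: nn_integral_cmult_indicator)
 also have "... < \<infinity>" by (auto simp: emeasure_lborel_Icc_eq ennreal_mult_less_top ennreal_of_nat_eq_real_of_nat)
 finally show "emeasure (arclength Sg) (gm ` {a..b}) < \<infinity>" .
qed

text \<open>Intended for the difference of the two sides of the jump formula at a fixed point off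
  the contours. The functional acts on functions rather than on classes; that it respects equality
  almost everywhere follows from the bound.\<close>

locale L2_functional =
 fixes Sg :: contour and La :: "(complex => complex) => complex" and K :: real
 assumes Sg: "is_contour Sg"
  and add: "!!f g. f : L2 Sg ==> g : L2 Sg ==> La (%x. f x + g x) = La f + La g"
  and scale: "!!f c. f : L2 Sg ==> La (%x. c * f x) = c * La f"
  and bounded: "!!f. f : L2 Sg ==> cmod (La f) <= K * N2 Sg f"
  and arcs: "!!gm a b. gm : set Sg ==> 0 < a ==> a < b ==> b < 1 ==> La (indicator (gm ` {a..b})) = 0"
begin

abbreviation (input) "M \<equiv> arclength Sg"

lemma diff: "f : Lp M 2 ==> g : Lp M 2 ==> La (%x. f x - g x) = La f - La g"
 using add[of f "%x. (-1) * g x"] scale[of g "-1"] Lp_scale(1)[of g M 2 "-1"] by simp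

lemma limit:
 assumes f: "f : Lp M 2" and fn: "!!n::nat. fn n : Lp M 2" "!!n. La (fn n) = 0" and lim: "(%n. Lp_norm M 2 (%x. f x - fn n x)) \<longlonglongrightarrow> 0"
 shows "La f = 0"
proof -
 have "cmod (La f) <= K * Lp_norm M 2 (%x. f x - fn n x)" for n
  using bounded[OF Lp_diff(1)[OF f fn(1)], of n] diff[OF f fn(1), of n] fn(2)[of n] by simp
 moreover have "(%n. K * Lp_norm M 2 (%x. f x - fn n x)) \<longlonglongrightarrow> K * 0" by (intro tendsto_intros lim)
 ultimately have "cmod (La f) <= K * 0" by (intro LIMSEQ_le_const) auto
 then show ?thesis by simp
qed

lemma null:
 assumes f: "f : Lp M 2" and ae: "AE x in M. f x = 0" shows "La f = 0"
proof -
 have "Lp_norm M 2 f <= 0"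
 proof (rule Lp_norm_leI(2)[OF Lp_measurable[OF f]])
  have "(\<integral>\<^sup>+x. ennreal (norm (f x) powr 2) \<partial>M) = (\<integral>\<^sup>+x. 0 \<partial>M)"
  by (rule nn_integral_cong_AE) (use ae in \<open>eventually_elim, simp\<close>)
  then show "(\<integral>\<^sup>+x. ennreal (norm (f x) powr 2) \<partial>M) <= ennreal (0 powr 2)" by simp
 qed auto
 then have "Lp_norm M 2 f = 0" using Lp_norm_nonneg[of M 2 f] by linarith
 then show ?thesis using bounded[OF f] by simp
qed

lemma cong:
 assumes "f : Lp M 2" "g : Lp M 2" "AE x in M. f x = g x" shows "La f = La g"
proof -
 have "AE x in M. f x - g x = 0" using assms(3) by eventually_elim simp
 then show ?thesis using null[OF Lp_diff(1)[OF assms(1,2)]] diff[OF assms(1,2)] by simp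
qed

lemma indicator_L2:
 assumes "A : sets M" "emeasure M A < \<infinity>" shows "(indicator A :: complex => complex) : Lp M 2" "Lp_norm M 2 (indicator A :: complex => complex) <= sqrt (measure M A)"
 using L2_indicator[OF assms, of 1] by (simp_all add: mult.right_neutral)

text \<open>A pi-lambda induction over closed intervals. An intersection that is not a proper
  interval contains at most one point and is null; complements are differences of indicators inside
  the compact arc; a disjoint union is an L2 limit because the measure of the remainder decreases to
  0, the arc having finite length.\<close>

lemma borel_part:
 assumes g: "gm : set Sg" and ab: "0 < a" "a < b" "b < 1" and B: "B : sets borel"
 shows "La (indicator (gm ` ({a..b} Int B))) = 0"
proof -
 have sub: "{a..b} Int X <= open_unit" for X using ab by auto
 note S = emeasure_compact_arc_finite[OF Sg g ab(1,3)]
 have sets: "gm ` ({a..b} Int X) : sets M" if "X : sets borel" for X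
  by (rule arc_image_sets[OF Sg g _ sub]) (use that in auto)
 have fin: "emeasure M (gm ` ({a..b} Int X)) < \<infinity>" if "X : sets borel" for X
  by (rule order.strict_trans1[OF _ S(2)]) (intro emeasure_mono S; auto)
 have L2: "(indicator (gm ` ({a..b} Int X)) :: complex => complex) : Lp M 2"
  "Lp_norm M 2 (indicator (gm ` ({a..b} Int X)) :: complex => complex) <= sqrt (measure M (gm ` ({a..b} Int X)))" if "X : sets borel" for X
  using indicator_L2[OF sets[OF that] fin[OF that]] by simp_all
 have inj: "inj_on gm open_unit" by (rule smooth_arc_continuous(3)[OF is_contour_arcs(1)[OF Sg g]])
 have img: "gm t : gm ` ({a..b} Int X) \<longleftrightarrow> t : {a..b} Int X" if "t : open_unit" for t X
  by (rule inj_on_image_mem_iff[OF inj that sub])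
 have "B : sigma_sets UNIV (range (%(a, b). {a..b::real}))"
  using B unfolding borel_eq_atLeastAtMost by simp
 then show ?thesis
 proof (rule sigma_sets_induct_disjoint[rotated 2])
  show "Int_stable (range (%(a, b). {a..b::real}))" by (auto simp: Int_stable_def)
  show "range (%(a, b). {a..b::real}) <= Pow UNIV" by simp
 next
  fix A :: "real set" assume "A : range (%(a, b). {a..b})"
  then obtain u v where A: "A = {u..v}" by auto
  have I: "{a..b} Int A = {max a u..min b v}" unfolding A by auto
  show "La (indicator (gm ` ({a..b} Int A))) = 0"
  proof (cases "max a u < min b v")
  case True
  then show ?thesis unfolding I using ab by (intro arcs g) auto
  next
  case False
  have "AE x in M. x ~: gm ` ({a..b} Int A)"
  unfolding AE_arclength_iff[OF Sg]
  proof
  fix dl assume de: "dl : set Sg"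
  have "AE t in lborel. t ~= max a u" by (rule AE_lborel_singleton)
  then have "AE t in lebesgue. t ~= max a u" by (rule AE_completion)
  then show "AE t in lebesgue. t : open_unit --> dl t ~: gm ` ({a..b} Int A)"
  proof eventually_elim
  case (elim t)
  show ?case
  proof (intro impI notI)
  assume t: "t : open_unit" "dl t : gm ` ({a..b} Int A)"
  then obtain s where s: "s : {a..b} Int A" "dl t = gm s" by auto
  then have "t = s" using is_contour_arcs(2)[OF Sg de g t(1)] sub[of A] by blast
  then show False using s(1) elim False unfolding I by auto
  qed
  qed
  qed
  then have "AE x in M. indicator (gm ` ({a..b} Int A)) x = (0::complex)" by eventually_elim simp
  then show ?thesis by (intro null L2(1)) (auto simp: A)
  qed
 next
  show "La (indicator (gm ` ({a..b} Int {}))) = 0" by (intro null L2(1)) auto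
 next
  fix A assume A: "A : sigma_sets UNIV (range (%(a, b). {a..b::real}))" and 0: "La (indicator (gm ` ({a..b} Int A))) = 0"
  have Ab: "A : sets borel" using A unfolding borel_eq_atLeastAtMost by simp
  have "indicator (gm ` ({a..b} Int (UNIV - A))) x = (indicator (gm ` ({a..b} Int UNIV)) x - indicator (gm ` ({a..b} Int A)) x :: complex)" for x
  proof (cases "x : gm ` {a..b}")
  case True
  then obtain t where t: "t : {a..b}" "x = gm t" by auto
  then have "t : open_unit" using ab by auto
  then show ?thesis using img t by (simp add: indicator_def)
  next
  case False
  then have "x ~: gm ` ({a..b} Int X)" for X by auto
  then show ?thesis using False by (simp add: indicator_def)
  qed
  then have "indicator (gm ` ({a..b} Int (UNIV - A))) = (%x. indicator (gm ` ({a..b} Int UNIV)) x - indicator (gm ` ({a..b} Int A)) x :: complex)" by blast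
  moreover have "La (indicator (gm ` ({a..b} Int UNIV))) = 0" using arcs[OF g ab] by simp
  ultimately show "La (indicator (gm ` ({a..b} Int (UNIV - A)))) = 0"
  using diff[OF L2(1)[of UNIV] L2(1)[OF Ab]] 0 by (simp only:) simp
 next
  fix A :: "nat => real set" assume dis: "disjoint_family A" and A: "range A <= sigma_sets UNIV (range (%(a, b). {a..b::real}))"
  and 0: "!!i. La (indicator (gm ` ({a..b} Int A i))) = 0"
  have Ab: "A i : sets borel" for i using A unfolding borel_eq_atLeastAtMost by auto
  have part: "La (indicator (gm ` ({a..b} Int (\<Union>i<n. A i)))) = 0" for n
  proof (induction n)
  case 0
  show ?case by (intro null L2(1)) auto
  next
  case (Suc n)
  have "indicator (gm ` ({a..b} Int (\<Union>i<Suc n. A i))) x = (indicator (gm ` ({a..b} Int (\<Union>i<n. A i))) x + indicator (gm ` ({a..b} Int A n)) x :: complex)" for x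
  proof (cases "x : gm ` {a..b}")
  case True
  then obtain t where t: "t : {a..b}" "x = gm t" by auto
  then have "t : open_unit" using ab by auto
  moreover have "t ~: A n" if "t : A i" "i < n" for i
  proof -
  have "A i Int A n = {}" using dis that(2) by (simp add: disjoint_family_on_def)
  then show ?thesis using that(1) by blast
  qed
  ultimately show ?thesis using img t by (auto simp: indicator_def less_Suc_eq)
  next
  case False
  then have "x ~: gm ` ({a..b} Int X)" for X by auto
  then show ?thesis using False by (simp add: indicator_def)
  qed
  then have "indicator (gm ` ({a..b} Int (\<Union>i<Suc n. A i))) = (%x. indicator (gm ` ({a..b} Int (\<Union>i<n. A i))) x + indicator (gm ` ({a..b} Int A n)) x :: complex)" by blast
  then show ?case using add[OF L2(1) L2(1)[OF Ab], of "\<Union>i<n. A i" n] Suc.IH 0[of n] Ab by simp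
  qed
  have Un: "(\<Union>i. A i) : sets borel" using Ab by auto
  define R where "R = (%n. gm ` ({a..b} Int ((\<Union>i. A i) - (\<Union>i<n. A i))))"
  have Rb: "(\<Union>i. A i) - (\<Union>i<n. A i) : sets borel" for n using Ab by auto
  show "La (indicator (gm ` ({a..b} Int (\<Union>i. A i)))) = 0"
  proof (rule limit[OF L2(1)[OF Un] L2(1) part])
  have "(%x. indicator (gm ` ({a..b} Int (\<Union>i. A i))) x - indicator (gm ` ({a..b} Int (\<Union>i<n. A i))) x :: complex) = indicator (R n)" for n
  proof
  fix x
  show "indicator (gm ` ({a..b} Int (\<Union>i. A i))) x - indicator (gm ` ({a..b} Int (\<Union>i<n. A i))) x = (indicator (R n) x :: complex)"
  proof (cases "x : gm ` {a..b}")
  case True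
  then obtain t where t: "t : {a..b}" "x = gm t" by auto
  then have "t : open_unit" using ab by auto
  then show ?thesis using img t unfolding R_def by (auto simp: indicator_def)
  next
  case False
  then have "x ~: gm ` ({a..b} Int X)" for X by auto
  then show ?thesis using False unfolding R_def by (simp add: indicator_def)
  qed
  qed
  moreover have "(%n. Lp_norm M 2 (indicator (R n) :: complex => complex)) \<longlonglongrightarrow> 0"
  proof (rule tendsto_sandwich[OF _ _ tendsto_const])
  show "\<forall>\<^sub>F n in sequentially. Lp_norm M 2 (indicator (R n) :: complex => complex) <= sqrt (measure M (R n))"
  unfolding R_def by (rule always_eventually, rule allI, rule L2(2)[OF Rb])
  have "(%n. measure M (R n)) \<longlonglongrightarrow> measure M (\<Inter>n. R n)"
  proof (rule Lim_measure_decseq)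
  show "range R <= sets M" unfolding R_def using sets[OF Rb] by auto
  show "decseq R" unfolding R_def decseq_def by (auto intro!: image_mono)
  show "emeasure M (R i) ~= \<infinity>" for i unfolding R_def using fin[OF Rb, of i] by simp
  qed
  moreover have "(\<Inter>n. R n) = {}"
  proof -
  have "x ~: (\<Inter>n. R n)" for x
  proof
  assume x: "x : (\<Inter>n. R n)"
  then have "x : R 0" by blast
  then have "x : gm ` ({a..b} Int (\<Union>i. A i))" by (simp add: R_def)
  then obtain t where t: "t : {a..b}" "t : (\<Union>i. A i)" "x = gm t" by blast
  then obtain i where i: "t : A i" by auto
  have to: "t : open_unit" using t(1) ab by auto
  have "x : R (Suc i)" using x by blast
  then have "gm t : gm ` ({a..b} Int ((\<Union>i. A i) - (\<Union>j<Suc i. A j)))" unfolding R_def t(3) .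
  then have "t : {a..b} Int ((\<Union>i. A i) - (\<Union>j<Suc i. A j))" by (rule img[OF to, THEN iffD1])
  then show False using i by auto
  qed
  then show ?thesis by blast
  qed
  ultimately have "(%n. measure M (R n)) \<longlonglongrightarrow> 0" by simp
  then show "(%n. sqrt (measure M (R n))) \<longlonglongrightarrow> 0" using tendsto_real_sqrt[of "%n. measure M (R n)" 0] by simp
  qed simp
  ultimately show "(%n. Lp_norm M 2 (%x. indicator (gm ` ({a..b} Int (\<Union>i. A i))) x - indicator (gm ` ({a..b} Int (\<Union>i<n. A i))) x :: complex)) \<longlonglongrightarrow> 0"
  by simp
  qed (use Ab in auto)
 qed
qed

text \<open>A set measurable for the completed arc length differs on the arc from the image of a
  Borel parameter set by a null set, which the functional ignores.\<close>

lemma measurable_part: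
 assumes g: "gm : set Sg" and ab: "0 < a" "a < b" "b < 1" and A: "A : sets M"
 shows "A Int gm ` {a..b} : sets M" "emeasure M (A Int gm ` {a..b}) < \<infinity>" "La (indicator (A Int gm ` {a..b})) = 0"
proof -
 note S = emeasure_compact_arc_finite[OF Sg g ab(1,3)]
 show s: "A Int gm ` {a..b} : sets M" using A S by auto
 show f: "emeasure M (A Int gm ` {a..b}) < \<infinity>" by (rule order.strict_trans1[OF _ S(2)]) (intro emeasure_mono S; auto)
 have "gm -` A Int space (lebesgue_on open_unit) : sets (lebesgue_on open_unit)" by (rule measurable_sets[OF measurable_arc[OF Sg g] A])
 then have "gm -` A Int open_unit : sets lebesgue" by (simp add: sets_restrict_space_iff)
 then obtain B N N' where B: "gm -` A Int open_unit = B Un N" "N <= N'" "N' : null_sets lborel" "B : sets lborel"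
  by (auto elim: sets_completionE)
 have "AE t in lborel. t ~: N" using AE_not_in[OF B(3)] by eventually_elim (use B(2) in auto)
 then have nt: "AE t in lebesgue. t ~: N" by (rule AE_completion)
 have sub: "{a..b} Int B <= open_unit" using ab by auto
 have Bb: "B : sets borel" using B(4) by simp
 have sB: "gm ` ({a..b} Int B) : sets M" by (rule arc_image_sets[OF Sg g _ sub]) (use Bb in auto)
 have fB: "emeasure M (gm ` ({a..b} Int B)) < \<infinity>" by (rule order.strict_trans1[OF _ S(2)]) (intro emeasure_mono S; auto)
 have ae: "AE x in M. (indicator (A Int gm ` {a..b}) x :: complex) = indicator (gm ` ({a..b} Int B)) x"
  unfolding AE_arclength_iff[OF Sg]
 proof
  fix dl assume de: "dl : set Sg"
  show "AE t in lebesgue. t : open_unit --> (indicator (A Int gm ` {a..b}) (dl t) :: complex) = indicator (gm ` ({a..b} Int B)) (dl t)"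
  using nt
  proof eventually_elim
  case (elim t)
  show ?case
  proof
  assume t: "t : open_unit"
  have "dl t : A Int gm ` {a..b} \<longleftrightarrow> dl t : gm ` ({a..b} Int B)"
  proof (cases "dl t : gm ` {a..b}")
  case True
  then obtain s where s: "s : {a..b}" "dl t = gm s" by auto
  then have so: "s : open_unit" using ab by auto
  have ts: "t = s" using is_contour_arcs(2)[OF Sg de g t so s(2)] by simp
  have "gm s : gm ` ({a..b} Int B) \<longleftrightarrow> s : {a..b} Int B"
  by (rule inj_on_image_mem_iff[OF smooth_arc_continuous(3)[OF is_contour_arcs(1)[OF Sg g]] so sub])
  moreover have "gm s : A \<longleftrightarrow> s : B" using B(1) so elim ts by blast
  ultimately show ?thesis using s by auto
  qed auto
  then show "(indicator (A Int gm ` {a..b}) (dl t) :: complex) = indicator (gm ` ({a..b} Int B)) (dl t)" by (simp add: indicator_def)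
  qed
  qed
 qed
 show "La (indicator (A Int gm ` {a..b})) = 0"
  using cong[OF indicator_L2(1)[OF s f] indicator_L2(1)[OF sB fB] ae] borel_part[OF g ab Bb] by simp
qed

lemma sum_zero:
 assumes "finite I" "!!i. i : I ==> f i : Lp M 2" "!!i. i : I ==> La (f i) = 0"
 shows "(%x. \<Sum>i\<in>I. f i x) : Lp M 2 & La (%x. \<Sum>i\<in>I. f i x) = 0"
 using assms
proof (induction I rule: finite_induct)
 case empty
 show ?case using null[OF Lp_zero(1)] Lp_zero(1)[of 2 M] by simp
next
 case (insert i I)
 then have IH: "(%x. \<Sum>i\<in>I. f i x) : Lp M 2" "La (%x. \<Sum>i\<in>I. f i x) = 0" by auto
 have "(%x. f i x + (\<Sum>i\<in>I. f i x)) : Lp M 2" by (rule Lp_add(1)) (use insert IH in auto)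
 moreover have "La (%x. f i x + (\<Sum>i\<in>I. f i x)) = 0" using add[OF _ IH(1), of "f i"] insert IH(2) by simp
 ultimately show ?case using insert by simp
qed

text \<open>Simple functions approximating h are cut down to compact subarcs that exhaust the open
  arcs. Each is a finite combination of the indicators already treated, and dominated convergence
  gives convergence in L2.\<close>

theorem vanishes:
 assumes h: "h : Lp M 2" shows "La h = 0"
proof -
 note [measurable] = Lp_measurable[OF h]
 obtain F where F: "!!i. simple_function M (F i)" "!!x. (%i. F i x) \<longlonglongrightarrow> h x" "!!i x. cmod (F i x) <= 2 * cmod (h x)"
  using borel_measurable_implies_sequence_metric[OF Lp_measurable[OF h], of 0] by (auto simp: dist_norm)
 have Fm[measurable]: "F i : bmeas M" for i by (rule borel_measurable_simple_function[OF F(1)])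
 \<comment> \<open>The offset 3 makes \<open>a n < 1 - a n\<close> hold already for n = 0.\<close>
 define a where "a = (%n::nat. 1 / (real n + 3))"
 have a: "0 < a n" "a n < 1 - a n" "1 - a n < 1" for n by (auto simp: a_def field_simps)
 define k where "k = (%n x. \<Sum>gm\<in>set Sg. indicator (gm ` {a n..1 - a n}) x * F n x)"
 have kL: "k n : Lp M 2 & La (k n) = 0" for n
  unfolding k_def
 proof (rule sum_zero)
  fix gm assume g: "gm : set Sg"
  have fin: "finite (F n ` space M)" using F(1) by (simp add: simple_function_def)
  have pre: "F n -` {y} : sets M" if "y : F n ` space M" for y
  using F(1)[of n] that by (auto simp: simple_function_def)
  have eq: "(%x. indicator (gm ` {a n..1 - a n}) x * F n x) = (%x. \<Sum>y\<in>F n ` space M. y * indicator (F n -` {y} Int gm ` {a n..1 - a n}) x)"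
  proof
  fix x
  have "(\<Sum>y\<in>F n ` space M. y * indicator (F n -` {y} Int gm ` {a n..1 - a n}) x) = (\<Sum>y\<in>F n ` space M. if y = F n x then indicator (gm ` {a n..1 - a n}) x * F n x else 0)"
  by (intro sum.cong) (auto simp: indicator_def)
  also have "... = indicator (gm ` {a n..1 - a n}) x * F n x" using fin by (subst sum.delta) auto
  finally show "indicator (gm ` {a n..1 - a n}) x * F n x = (\<Sum>y\<in>F n ` space M. y * indicator (F n -` {y} Int gm ` {a n..1 - a n}) x)" by simp
  qed
  have "(%x. \<Sum>y\<in>F n ` space M. y * indicator (F n -` {y} Int gm ` {a n..1 - a n}) x) : Lp M 2 &
  La (%x. \<Sum>y\<in>F n ` space M. y * indicator (F n -` {y} Int gm ` {a n..1 - a n}) x) = 0"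
  proof (rule sum_zero[OF fin])
  fix y assume y: "y : F n ` space M"
  note mp = measurable_part[OF g a pre[OF y]]
  show "(%x. y * indicator (F n -` {y} Int gm ` {a n..1 - a n}) x) : Lp M 2"
  by (rule Lp_scale(1)[OF indicator_L2(1)[OF mp(1,2)]]) simp
  show "La (%x. y * indicator (F n -` {y} Int gm ` {a n..1 - a n}) x) = 0"
  using scale[OF indicator_L2(1)[OF mp(1,2)], of y] mp(3) by simp
  qed
  then show "(%x. indicator (gm ` {a n..1 - a n}) x * F n x) : Lp M 2" "La (%x. indicator (gm ` {a n..1 - a n}) x * F n x) = 0"
  unfolding eq by auto
 qed simp
 have kv: "k n (gm t) = (if t : {a n..1 - a n} then F n (gm t) else 0)" if g: "gm : set Sg" and t: "t : open_unit" for n gm t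
 proof -
  have sub: "{a n..1 - a n} <= open_unit" using a[of n] by auto
  have "gm t : dl ` {a n..1 - a n} \<longleftrightarrow> dl = gm & t : {a n..1 - a n}" if "dl : set Sg" for dl
  proof
  assume "gm t : dl ` {a n..1 - a n}"
  then obtain s where s: "s : {a n..1 - a n}" "gm t = dl s" by auto
  then have "gm = dl & t = s" using sub by (intro is_contour_arcs(2)[OF Sg g that t]) auto
  then show "dl = gm & t : {a n..1 - a n}" using s by auto
  qed auto
  then have "k n (gm t) = (\<Sum>dl\<in>set Sg. if dl = gm then (if t : {a n..1 - a n} then F n (gm t) else 0) else 0)"
  unfolding k_def by (intro sum.cong) (auto simp: indicator_def)
  also have "... = (if t : {a n..1 - a n} then F n (gm t) else 0)" using g by (subst sum.delta) auto
  finally show ?thesis .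
 qed
 have alim: "a \<longlonglongrightarrow> 0" unfolding a_def using LIMSEQ_ignore_initial_segment[OF lim_const_over_n[of "1::real"], of 3] by simp
 have klim: "AE x in M. (%n. k n x) \<longlonglongrightarrow> h x" and kb: "AE x in M. ALL n. cmod (k n x) <= 2 * cmod (h x)"
 proof -
  have *: "(%n. k n (gm t)) \<longlonglongrightarrow> h (gm t) & (ALL n. cmod (k n (gm t)) <= 2 * cmod (h (gm t)))" if "gm : set Sg" "t : open_unit" for gm t
  proof
  have "eventually (%n. a n < min t (1 - t)) sequentially" using order_tendstoD(2)[OF alim, of "min t (1 - t)"] that(2) by simp
  then have "eventually (%n. F n (gm t) = k n (gm t)) sequentially" by eventually_elim (use kv[OF that] in auto)
  then show "(%n. k n (gm t)) \<longlonglongrightarrow> h (gm t)" by (rule Lim_transform_eventually[OF F(2)])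
  show "ALL n. cmod (k n (gm t)) <= 2 * cmod (h (gm t))" using kv[OF that] F(3) by auto
  qed
  show "AE x in M. (%n. k n x) \<longlonglongrightarrow> h x" unfolding AE_arclength_iff[OF Sg] using * by (intro ballI AE_I2) blast
  show "AE x in M. ALL n. cmod (k n x) <= 2 * cmod (h x)" unfolding AE_arclength_iff[OF Sg] using * by (intro ballI AE_I2) blast
 qed
 show ?thesis
 proof (rule limit[OF h])
  show "k n : Lp M 2" "La (k n) = 0" for n using kL by auto
  have km[measurable]: "k n : bmeas M" for n using kL[of n] Lp_measurable by blast
  have hint: "integrable M (%x. (cmod (h x))^2)" using h by (simp add: Lp_def)
  have "(%n. \<integral>x. (cmod (h x - k n x))^2 \<partial>M) \<longlonglongrightarrow> (\<integral>x. 0 \<partial>M)"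
  \<comment> \<open>The approximants are bounded by 2|h|, so the difference is at most 3|h|, with
    square 9|h|^2.\<close>
  proof (rule integral_dominated_convergence[where w = "%x. 9 * (cmod (h x))^2"])
  show "integrable M (%x. 9 * (cmod (h x))^2)" using hint by simp
  show "AE x in M. (%n. (cmod (h x - k n x))^2) \<longlonglongrightarrow> 0"
  using klim
  proof eventually_elim
  case (elim x)
  have "(%n. (cmod (h x - k n x))^2) \<longlonglongrightarrow> (cmod (h x - h x))^2" by (intro tendsto_intros elim)
  then show ?case by simp
  qed
  show "AE x in M. norm ((cmod (h x - k n x))^2) <= 9 * (cmod (h x))^2" for n
  using kb
  proof eventually_elim
  case (elim x)
  have "cmod (h x - k n x) <= cmod (h x) + cmod (k n x)" by (rule norm_triangle_ineq4)
  also have "... <= 3 * cmod (h x)" using elim[rule_format, of n] by linarith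
  finally have "(cmod (h x - k n x))^2 <= (3 * cmod (h x))^2" by (intro power_mono) auto
  then show ?case by (simp add: power_mult_distrib)
  qed
  qed measurable
  then have "(%n. sqrt (\<integral>x. (cmod (h x - k n x))^2 \<partial>M)) \<longlonglongrightarrow> sqrt 0" by (intro tendsto_real_sqrt) simp
  moreover have "Lp_norm M 2 (%x. h x - k n x) = sqrt (\<integral>x. (cmod (h x - k n x))^2 \<partial>M)" for n
  by (simp add: Lp_norm_def powr_half_sqrt integral_nonneg_AE)
  ultimately show "(%n. Lp_norm M 2 (%x. h x - k n x)) \<longlonglongrightarrow> 0" by simp
 qed
qed

end

section \<open>Non-tangential boundary values\<close>

lemma arclength_measurable_AE:
 fixes f g :: "complex => 'a::topological_space"
 assumes "f : bmeas (arclength Sg)" "AE x in arclength Sg. f x = g x"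
 shows "g : bmeas (arclength Sg)"
proof (rule measurableI)
 fix A :: "'a set" assume "A : sets borel"
 then have "f -` A Int space (arclength Sg) : sets (arclength Sg)" by (rule measurable_sets[OF assms(1)])
 moreover have "AE x in arclength Sg. x : f -` A \<longleftrightarrow> x : g -` A" using assms(2) by eventually_elim simp
 ultimately show "g -` A Int space (arclength Sg) : sets (arclength Sg)"
  using completion.in_sets_AE[of "f -` A" "g -` A" "arclength_borel Sg"] unfolding arclength_eq by simp
qed simp

lemma has_nt_limit_arc_iff:
 assumes "is_contour Sg" "gm : set Sg" "t : open_unit"
 shows "has_nt_limit Sg sx f (gm t) l \<longleftrightarrow> (ALL a>0. (f \<longlongrightarrow> l) (at (gm t) within sector sx a (gm t) (vel gm t)))"
proof
 assume "has_nt_limit Sg sx f (gm t) l"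
 then obtain dl s where ds: "dl : set Sg" "s : open_unit" "dl s = gm t"
  "ALL a>0. (f \<longlongrightarrow> l) (at (gm t) within sector sx a (gm t) (vel dl s))"
  unfolding has_nt_limit_def by blast
 have "dl = gm & s = t" by (rule is_contour_arcs(2)[OF assms(1) ds(1) assms(2) ds(2) assms(3) ds(3)])
 then show "ALL a>0. (f \<longlongrightarrow> l) (at (gm t) within sector sx a (gm t) (vel gm t))" using ds(4) by simp
next
 assume "ALL a>0. (f \<longlongrightarrow> l) (at (gm t) within sector sx a (gm t) (vel gm t))"
 then show "has_nt_limit Sg sx f (gm t) l" using assms(2,3) unfolding has_nt_limit_def by blast
qed

lemma has_nt_limitE:
 assumes "has_nt_limit Sg sx f s l"
 obtains gm t where "gm : set Sg" "t : open_unit" "s = gm t"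
 using assms unfolding has_nt_limit_def by blast

lemma has_nt_limit_normal:
 assumes "is_contour Sg" "gm : set Sg" "t : open_unit" "sx = 1 \<or> sx = -1" "has_nt_limit Sg sx f (gm t) l"
 shows "((%ep. f (gm t + vel gm t * (of_real sx * \<i> * of_real ep))) \<longlongrightarrow> l) (at_right 0)"
proof (rule has_nt_limit_vertical[OF assms(1-3,5,4)])
 show *: "vel gm t ~= 0" by (rule smooth_arc_deriv(2)[OF is_contour_arcs(1)[OF assms(1,2)] assms(3)])
 then show "cmod (vel gm t / vel gm t - 1) <= 1/4" by simp
qed

text \<open>Two non-tangential limits agree because both are limits along the normal, where the
  filter is nontrivial. This justifies the definite description in \<open>nt_value\<close>.\<close>

lemma nt_value_eq:
 assumes Sg: "is_contour Sg" and sx: "sx = 1 \<or> sx = -1" and l: "has_nt_limit Sg sx f s l"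
 shows "nt_value Sg sx f s = l"
 unfolding nt_value_def
proof (rule the_equality)
 show "has_nt_limit Sg sx f s l" by (rule l)
 fix m assume m: "has_nt_limit Sg sx f s m"
 obtain gm t where g: "gm : set Sg" "t : open_unit" "s = gm t" using has_nt_limitE[OF l] .
 show "m = l"
  by (rule tendsto_unique[OF _ has_nt_limit_normal[OF Sg g(1,2) sx m[unfolded g(3)]] has_nt_limit_normal[OF Sg g(1,2) sx l[unfolded g(3)]]]) simp
qed

lemma has_nt_limit_subcontour:
 assumes "is_contour Sg" "is_contour Sg0" "set Sg0 <= set Sg" "gm : set Sg0" "t : open_unit"
 shows "has_nt_limit Sg sx f (gm t) = has_nt_limit Sg0 sx f (gm t)"
 using has_nt_limit_arc_iff[OF assms(1) subsetD[OF assms(3,4)] assms(5), of sx f] has_nt_limit_arc_iff[OF assms(2,4,5), of sx f] by (intro ext) simp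

lemma nt_value_subcontour:
 assumes "is_contour Sg" "is_contour Sg0" "set Sg0 <= set Sg" "gm : set Sg0" "t : open_unit"
 shows "nt_value Sg sx f (gm t) = nt_value Sg0 sx f (gm t)"
 unfolding nt_value_def has_nt_limit_subcontour[OF assms] ..

lemma has_nt_limit_isCont:
 assumes "is_contour Sg" "gm : set Sg" "t : open_unit" "isCont f (gm t)"
 shows "has_nt_limit Sg sx f (gm t) (f (gm t))"
 unfolding has_nt_limit_arc_iff[OF assms(1-3)] using assms(4) by (auto simp: isCont_def intro: tendsto_within_subset)

text \<open>Stated for an arbitrary operation H so that sums, products, matrix products, scalar
  multiples and constants are all instances.\<close>

lemma has_nt_limit_combine:
 assumes Sg: "is_contour Sg" and f: "has_nt_limit Sg sx f s l" and g: "has_nt_limit Sg sx g s m"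
  and H: "!!F. (f \<longlongrightarrow> l) F ==> (g \<longlongrightarrow> m) F ==> ((%z. H (f z) (g z)) \<longlongrightarrow> H l m) F"
 shows "has_nt_limit Sg sx (%z. H (f z) (g z)) s (H l m)"
proof -
 obtain gm t where e: "gm : set Sg" "t : open_unit" "s = gm t" using has_nt_limitE[OF f] .
 show ?thesis using f g unfolding e(3) has_nt_limit_arc_iff[OF Sg e(1,2)] by (intro allI impI H) auto
qed

lemma has_nt_limit_matrix:
 fixes F :: "complex => complex^'k^'k"
 assumes Sg: "is_contour Sg"
 shows "has_nt_limit Sg sx F s L \<longleftrightarrow> (ALL i j. has_nt_limit Sg sx (%z. F z $ i $ j) s (L $ i $ j))"
proof (cases "EX gm:set Sg. EX t:open_unit. s = gm t")
 case True
 then obtain gm t where g: "gm : set Sg" "t : open_unit" "s = gm t" by blast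
 have "(F \<longlongrightarrow> L) X \<longleftrightarrow> (ALL i j. ((%z. F z $ i $ j) \<longlongrightarrow> L $ i $ j) X)" for X
 proof
  assume "(F \<longlongrightarrow> L) X"
  then show "ALL i j. ((%z. F z $ i $ j) \<longlongrightarrow> L $ i $ j) X" using tendsto_vec_nth[OF tendsto_vec_nth] by blast
 next
  assume *: "ALL i j. ((%z. F z $ i $ j) \<longlongrightarrow> L $ i $ j) X"
  show "(F \<longlongrightarrow> L) X" by (rule vec_tendstoI, rule vec_tendstoI) (use * in blast)
 qed
 then show ?thesis unfolding g(3) has_nt_limit_arc_iff[OF Sg g(1,2)] by (simp only:) blast
next
 case False
 then have "\<not> has_nt_limit Sg sx F s L" using has_nt_limitE[of Sg sx F s L] by blast
 moreover have "\<not> has_nt_limit Sg sx (%z. F z $ i $ j) s (L $ i $ j)" for i j using False has_nt_limitE[of Sg sx "%z. F z $ i $ j" s "L $ i $ j"] by blast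
 ultimately show ?thesis by simp
qed

text \<open>Completeness places the two ends of the normal in the two open regions, hence off the
  contour near the base point. This lets identities known only off the contour pass to boundary
  values.\<close>

lemma complete_contour_normal:
 assumes "complete_contour Sg" "gm : set Sg" "t : open_unit" "sx = 1 \<or> sx = -1"
 shows "eventually (%ep. gm t + vel gm t * (of_real sx * \<i> * of_real ep) ~: contour_set Sg) (at_right 0)"
proof -
 obtain P M where U: "P Un M = - contour_set Sg"
  and P: "\<forall>\<^sub>F ep in at_right 0. gm t + of_real ep * \<i> * vel gm t : P"
  and M: "\<forall>\<^sub>F ep in at_right 0. gm t - of_real ep * \<i> * vel gm t : M"
  using assms(1,2,3) unfolding complete_contour_def by blast
 have "x ~: contour_set Sg" if "x : P \<or> x : M" for x using U that by blast
 then have PM: "\<forall>\<^sub>F ep in at_right 0. gm t + of_real ep * \<i> * vel gm t ~: contour_set Sg"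
  "\<forall>\<^sub>F ep in at_right 0. gm t - of_real ep * \<i> * vel gm t ~: contour_set Sg"
  using eventually_mono[OF P, of "%ep. gm t + of_real ep * \<i> * vel gm t ~: contour_set Sg"]
  eventually_mono[OF M, of "%ep. gm t - of_real ep * \<i> * vel gm t ~: contour_set Sg"] by simp_all
 show ?thesis using assms(4)
 proof
  assume "sx = 1" then show ?thesis using PM(1) by (simp add: mult_ac)
 next
  assume "sx = -1" then show ?thesis using PM(2) by (simp add: mult_ac)
 qed
qed

lemma nt_limit_unique_off:
 assumes Sg: "is_contour Sg" "complete_contour Sg" and sx: "sx = 1 \<or> sx = -1"
  and f: "has_nt_limit Sg sx f s l" and g: "has_nt_limit Sg sx g s m" and eq: "!!z. z ~: contour_set Sg ==> f z = g z"
 shows "l = m"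
proof -
 obtain gm t where e: "gm : set Sg" "t : open_unit" "s = gm t" using has_nt_limitE[OF f] .
 show ?thesis
 proof (rule tendsto_unique[OF _ has_nt_limit_normal[OF Sg(1) e(1,2) sx f[unfolded e(3)]]])
  show "((%ep. f (gm t + vel gm t * (of_real sx * \<i> * of_real ep))) \<longlongrightarrow> m) (at_right 0)"
  by (rule Lim_transform_eventually[OF has_nt_limit_normal[OF Sg(1) e(1,2) sx g[unfolded e(3)]]])
  (use complete_contour_normal[OF Sg(2) e(1,2) sx] in eventually_elim, simp add: eq)
 qed simp
qed

lemma nt_limit_bound:
 fixes f :: "complex => 'a::real_normed_vector"
 assumes Sg: "is_contour Sg" "complete_contour Sg" and sx: "sx = 1 \<or> sx = -1"
  and f: "has_nt_limit Sg sx f s l" and B: "!!z. z ~: contour_set Sg ==> norm (f z) <= B"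
 shows "norm l <= B"
proof -
 obtain gm t where e: "gm : set Sg" "t : open_unit" "s = gm t" using has_nt_limitE[OF f] .
 show ?thesis
  by (rule tendsto_upperbound[OF tendsto_norm[OF has_nt_limit_normal[OF Sg(1) e(1,2) sx f[unfolded e(3)]]]])
  (use complete_contour_normal[OF Sg(2) e(1,2) sx] in \<open>eventually_elim, simp add: B\<close>, simp)
qed

text \<open>The boundary value is, almost everywhere, the limit of r along the normal at the heights
  1/(n+1). Extension of r by 0 to the contour makes these functions Borel in the parameter, and
  completeness of the measure absorbs the exceptional null set.\<close>

lemma nt_value_measurable:
 fixes r :: "complex => complex"
 assumes Sg: "is_contour Sg" "complete_contour Sg" and sx: "sx = 1 \<or> sx = -1"
  and r: "continuous_on (- contour_set Sg) r" and nt: "AE s in arclength Sg. EX l. has_nt_limit Sg sx r s l"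
 shows "nt_value Sg sx r : bmeas (arclength Sg)"
proof (rule borel_measurable_arclengthI[OF Sg(1)])
 fix gm assume g: "gm : set Sg"
 note sm = is_contour_arcs(1)[OF Sg(1) g]
 define r0 where "r0 = (%z. indicator (- contour_set Sg) z *\<^sub>R r z)"
 have [measurable]: "r0 : bmeas borel" unfolding r0_def
  by (rule borel_measurable_continuous_on_indicator[OF _ r]) (simp add: closed_contour_set)
 define q where "q = (%n t. (if t : open_unit then gm t else 0) + (if t : open_unit then vel gm t else 0) * (of_real sx * \<i> * of_real (1 / real (Suc n))))"
 note [measurable] = smooth_arc_measurable(3,4)[OF sm]
 have q[measurable]: "q n : bmeas borel" for n unfolding q_def by measurable
 have lm: "(%t. lim (%n. r0 (q n t))) : bmeas borel" by measurable
 have lm1: "(%t. if t : open_unit then lim (%n. r0 (q n t)) else 0) : bmeas borel" by (intro measurable_If lm) auto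
 have lm2: "(%t. if t : open_unit then lim (%n. r0 (q n t)) else 0) : bmeas lebesgue"
  by (rule measurable_completion) (use lm1 in simp)
 have "AE t in lebesgue. t : open_unit --> (EX l. has_nt_limit Sg sx r (gm t) l)" using nt g unfolding AE_arclength_iff[OF Sg(1)] by blast
 then have "AE t in lebesgue. (if t : open_unit then lim (%n. r0 (q n t)) else 0) = (if t : open_unit then nt_value Sg sx r (gm t) else 0)"
 proof eventually_elim
  case (elim t)
  show ?case
  proof (cases "t : open_unit")
  case True
  then obtain l where l: "has_nt_limit Sg sx r (gm t) l" using elim by blast
  let ?v = "%ep. gm t + vel gm t * (of_real sx * \<i> * of_real ep)"
  have "((%ep. r0 (?v ep)) \<longlongrightarrow> l) (at_right 0)"
  by (rule Lim_transform_eventually[OF has_nt_limit_normal[OF Sg(1) g True sx l]])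
  (use complete_contour_normal[OF Sg(2) g True sx] in eventually_elim, simp add: r0_def)
  moreover have "filterlim (%n. 1 / real (Suc n)) (at_right 0) sequentially"
  unfolding filterlim_at using LIMSEQ_Suc[OF lim_const_over_n[of "1::real"]] by (simp add: eventually_sequentially)
  ultimately have "(%n. r0 (?v (1 / real (Suc n)))) \<longlonglongrightarrow> l" by (rule filterlim_compose)
  moreover have "?v (1 / real (Suc n)) = q n t" for n using True by (simp add: q_def)
  ultimately have "(%n. r0 (q n t)) \<longlonglongrightarrow> l" by simp
  then have "lim (%n. r0 (q n t)) = l" by (rule limI)
  then show ?thesis using True nt_value_eq[OF Sg(1) sx l] by simp
  next
  case False
  then show ?thesis by (simp only: if_False)
  qed
 qed
 then have "(%t. if t : open_unit then nt_value Sg sx r (gm t) else 0) : bmeas lebesgue"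
  by (rule borel_measurable_AE[OF lm2])
 then show "(%t. nt_value Sg sx r (gm t)) : bmeas (lebesgue_on open_unit)"
  by (subst (asm) borel_measurable_if) auto
qed

section \<open>Evaluation of a Cauchy integral off the contour, as a bounded linear functional on
  L2\<close>

lemma cauchy_kernel_bound:
 assumes Sg: "is_contour Sg" and z: "z ~: contour_set Sg" and g: "gm : set Sg"
 shows "EX K>=0. ALL h:L2 Sg. integrable lebesgue (%t. arc_density gm h t / (arc_point gm t - z)) &
  cmod (\<integral>t. arc_density gm h t / (arc_point gm t - z) \<partial>lebesgue) <= K * N2 Sg h"
proof -
 have "open (- contour_set Sg)" by (simp add: closed_contour_set open_Compl)
 then obtain dl where dl: "dl > 0" "ball z dl <= - contour_set Sg" using z by (auto elim: openE)
 have far: "dl <= cmod (arc_point gm t - z)" if "t : open_unit" for t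
 proof -
  have "gm t ~: ball z dl" using dl(2) contour_arc_subset[OF g that] by blast
  then show ?thesis using that by (simp add: arc_point_def dist_norm norm_minus_commute)
 qed
 obtain C where C: "C >= 0" "!!h. h : L2 Sg ==> integrable lebesgue (%t. norm (arc_density gm h t) / (1 + cmod (arc_point gm t)))"
  "!!h. h : L2 Sg ==> (\<integral>t. norm (arc_density gm h t) / (1 + cmod (arc_point gm t)) \<partial>lebesgue) <= C * N2 Sg h"
  using arc_density_bound[OF Sg g] by blast
 define D where "D = 1 + (1 + cmod z) / dl"
 have D: "D >= 0" using dl(1) by (simp add: D_def add_nonneg_nonneg)
 show ?thesis
 proof (intro exI[of _ "D * C"] conjI ballI)
  fix h :: "complex => complex" assume h: "h : L2 Sg"
  have pm: "arc_point gm : bmeas lebesgue" by (rule measurable_completion) (use arc_point_measurable[OF is_contour_arcs(1)[OF Sg g]] in simp)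
  have dm: "arc_density gm h : bmeas lebesgue" by (rule arc_density_measurable[OF Sg g Lp_measurable[OF h]])
  show int: "integrable lebesgue (%t. arc_density gm h t / (arc_point gm t - z))"
  by (rule integrable_cauchy_kernel[OF pm dm C(2)[OF h] dl(1)]) (rule AE_I2, use far in \<open>auto simp: arc_density_def\<close>)
  have le: "cmod (arc_density gm h t / (arc_point gm t - z)) <= D * (norm (arc_density gm h t) / (1 + cmod (arc_point gm t)))" for t
  proof (cases "t : open_unit")
  case True
  have "1 / cmod (arc_point gm t - z) <= D / (1 + cmod (arc_point gm t))" unfolding D_def by (rule inverse_dist_le[OF dl(1) far[OF True]])
  then have "cmod (arc_density gm h t) * (1 / cmod (arc_point gm t - z)) <= cmod (arc_density gm h t) * (D / (1 + cmod (arc_point gm t)))" by (rule mult_left_mono) simp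
  then show ?thesis by (simp add: norm_divide mult.commute)
  next
  case False
  then have "arc_density gm h t = 0" by (simp only: arc_density_def if_False)
  then show ?thesis by simp
  qed
  have "cmod (\<integral>t. arc_density gm h t / (arc_point gm t - z) \<partial>lebesgue) <= (\<integral>t. D * (norm (arc_density gm h t) / (1 + cmod (arc_point gm t))) \<partial>lebesgue)"
  by (rule Bochner_Integration.integral_norm_bound_integral[OF int integrable_mult_right[OF C(2)[OF h]]]) (rule le)
  also have "... = D * (\<integral>t. norm (arc_density gm h t) / (1 + cmod (arc_point gm t)) \<partial>lebesgue)" by (rule integral_mult_right_zero)
  also have "... <= D * (C * N2 Sg h)" by (rule mult_left_mono[OF C(3)[OF h] D])
  finally show "cmod (\<integral>t. arc_density gm h t / (arc_point gm t - z) \<partial>lebesgue) <= D * C * N2 Sg h" by (simp add: mult_ac)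
 qed (use D C(1) in simp)
qed

lemma cauchy_integral_bound:
 assumes Sg: "is_contour Sg" and z: "z ~: contour_set Sg"
 shows "EX K>=0. ALL h:L2 Sg. cmod (CI Sg h z) <= K * N2 Sg h"
proof -
 obtain K where K: "!!gm. gm : set Sg ==> K gm >= 0"
  "!!gm h. gm : set Sg ==> h : L2 Sg ==> cmod (\<integral>t. arc_density gm h t / (arc_point gm t - z) \<partial>lebesgue) <= K gm * N2 Sg h"
  using cauchy_kernel_bound[OF Sg z] by metis
 show ?thesis
 proof (intro exI[of _ "(\<Sum>gm\<in>set Sg. K gm) / (2 * pi)"] conjI ballI)
  show "0 <= (\<Sum>gm\<in>set Sg. K gm) / (2 * pi)" by (intro divide_nonneg_nonneg sum_nonneg K(1)) auto
  fix h :: "complex => complex" assume h: "h : L2 Sg"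
  have "cmod (\<Sum>gm\<in>set Sg. \<integral>t. arc_density gm h t / (arc_point gm t - z) \<partial>lebesgue) <= (\<Sum>gm\<in>set Sg. K gm * N2 Sg h)"
  by (rule sum_norm_le) (rule K(2)[OF _ h])
  then have "cmod (\<Sum>gm\<in>set Sg. \<integral>t. arc_density gm h t / (arc_point gm t - z) \<partial>lebesgue) / (2 * pi) <= (\<Sum>gm\<in>set Sg. K gm) * N2 Sg h / (2 * pi)"
  by (intro divide_right_mono) (simp_all add: sum_distrib_right)
  then show "cmod (CI Sg h z) <= (\<Sum>gm\<in>set Sg. K gm) / (2 * pi) * N2 Sg h"
  unfolding cauchy_integral_eq[OF Sg] norm_divide by (simp add: norm_mult)
 qed
qed

lemma cauchy_integral_add:
 assumes Sg: "is_contour Sg" and z: "z ~: contour_set Sg" and f: "f : L2 Sg" and g: "g : L2 Sg"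
 shows "CI Sg (%s. f s + g s) z = CI Sg f z + CI Sg g z"
proof -
 have i: "integrable lebesgue (%t. arc_density gm h t / (arc_point gm t - z))" if "gm : set Sg" "h : L2 Sg" for gm h
  using cauchy_kernel_bound[OF Sg z that(1)] that(2) by blast
 have e: "arc_density gm (%s. f s + g s) t / (arc_point gm t - z) = arc_density gm f t / (arc_point gm t - z) + arc_density gm g t / (arc_point gm t - z)" for gm t
  by (simp add: arc_density_def distrib_right add_divide_distrib)
 have "(\<Sum>gm\<in>set Sg. \<integral>t. arc_density gm (%s. f s + g s) t / (arc_point gm t - z) \<partial>lebesgue) = (\<Sum>gm\<in>set Sg. (\<integral>t. arc_density gm f t / (arc_point gm t - z) \<partial>lebesgue) + (\<integral>t. arc_density gm g t / (arc_point gm t - z) \<partial>lebesgue))"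
  unfolding e by (intro sum.cong refl Bochner_Integration.integral_add i f g)
 then show ?thesis unfolding cauchy_integral_eq[OF Sg] by (simp add: sum.distrib add_divide_distrib)
qed

lemma cauchy_integral_scale:
 assumes Sg: "is_contour Sg"
 shows "CI Sg (%s. c * f s) z = c * CI Sg f z"
proof -
 have e: "arc_density gm (%s. c * f s) t / (arc_point gm t - z) = c * (arc_density gm f t / (arc_point gm t - z))" for gm t
  by (simp add: arc_density_def)
 show ?thesis unfolding cauchy_integral_eq[OF Sg] e
  by (simp only: Bochner_Integration.integral_mult_right_zero sum_distrib_left[symmetric]) (rule times_divide_eq_right[symmetric])
qed

text \<open>The difference of the two densities has L2 norm 0, so the bounded functional vanishes on
  it.\<close>

lemma cauchy_integral_cong_AE:
 assumes Sg: "is_contour Sg" and z: "z ~: contour_set Sg" and f: "f : L2 Sg" and g: "g : L2 Sg"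
  and eq: "AE s in arclength Sg. f s = g s"
 shows "CI Sg f z = CI Sg g z"
proof -
 obtain K where K: "ALL h:L2 Sg. cmod (CI Sg h z) <= K * N2 Sg h"
  using cauchy_integral_bound[OF Sg z] by blast
 have g': "(%s. (-1) * g s) : L2 Sg" by (rule Lp_scale(1)[OF g]) simp
 have fg: "(%s. f s + (-1) * g s) : L2 Sg" by (rule Lp_add(1)[OF f g']) simp
 have "AE s in arclength Sg. 0 = f s + (-1) * g s" using eq by eventually_elim simp
 from Lp_cong_AE(2)[OF Lp_zero(1)[of 2] Lp_measurable[OF fg] _ this]
 have "N2 Sg (%s. f s + (-1) * g s) = 0" using Lp_zero(2)[of 2 "arclength Sg", where 'b=complex] Lp_norm_nonneg[of "arclength Sg" 2 "%s. f s + (-1) * g s"]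
  by (intro order.antisym) simp_all
 then have "CI Sg (%s. f s + (-1) * g s) z = 0" using K fg by fastforce
 then show ?thesis using cauchy_integral_add[OF Sg z f g'] cauchy_integral_scale[OF Sg, of "-1" g z] by simp
qed

lemma cauchy_integral_holomorphic:
 assumes Sg: "is_contour Sg" and h: "h : L2 Sg"
 shows "CI Sg h holomorphic_on - contour_set Sg"
proof -
 have op: "open (- contour_set Sg)" by (simp add: closed_contour_set open_Compl)
 have "(%z. \<integral>t. arc_density gm h t / (arc_point gm t - z) \<partial>lebesgue) holomorphic_on - contour_set Sg" if g: "gm : set Sg" for gm
 proof (rule cauchy_transform_holomorphic[OF op])
  show "arc_point gm : bmeas lebesgue" by (rule measurable_completion) (use arc_point_measurable[OF is_contour_arcs(1)[OF Sg g]] in simp)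
  show "arc_density gm h : bmeas lebesgue" by (rule arc_density_measurable[OF Sg g Lp_measurable[OF h]])
  show "integrable lebesgue (%t. norm (arc_density gm h t) / (1 + cmod (arc_point gm t)))" using arc_density_bound[OF Sg g] h by blast
  fix z assume "z : - contour_set Sg"
  then obtain dl where dl: "dl > 0" "ball z dl <= - contour_set Sg" using op by (auto elim: openE)
  have "arc_density gm h t = 0 \<or> dl <= cmod (arc_point gm t - z)" for t
  proof (cases "t : open_unit")
  case True
  have "gm t ~: ball z dl" using dl(2) contour_arc_subset[OF g True] by blast
  then show ?thesis using True by (simp add: arc_point_def dist_norm norm_minus_commute)
  next
  case False
  then show ?thesis by (simp only: arc_density_def if_False simp_thms)
  qed
  then show "EX dl>0. AE t in lebesgue. arc_density gm h t = 0 \<or> dl <= cmod (arc_point gm t - z)" using dl(1) by blast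
 qed
 then have "(%z. (\<Sum>gm\<in>set Sg. \<integral>t. arc_density gm h t / (arc_point gm t - z) \<partial>lebesgue) / (2 * of_real pi * \<i>)) holomorphic_on - contour_set Sg"
  by (intro holomorphic_intros) auto
 then show ?thesis unfolding cauchy_integral_eq[OF Sg, abs_def] .
qed

section \<open>Cauchy integrals of indicators of arcs\<close>

lemma local_boundI:
 fixes f :: "'a => real"
 assumes "(0::real) < rh" "!!z. z : A rh ==> f z <= M"
 shows "EX rh>0. EX M. ALL z:A rh. f z <= M"
 using assms by blast

lemma norm_add3_le:
 fixes x :: "'a::real_normed_vector"
 assumes "x = a + (b + c)" "norm b <= B" "norm a <= A" "norm c <= C" shows "norm x <= A + B + C"
 unfolding assms(1) using assms(2-4) norm_triangle_ineq[of a "b + c"] norm_triangle_ineq[of b c] by linarith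

text \<open>The easy case: w has positive distance dl from the compact subarc, and points within
  dl/2 of w keep distance dl/2.\<close>

lemma arc_cauchy_locally_bounded:
 assumes sm: "smooth_arc gm" and S: "compact S" "S <= open_unit" and w: "w ~: gm ` S"
 shows "EX rh>0. EX M. ALL z:ball w rh. cmod (LINT t:S|lebesgue. vel gm t / (gm t - z)) <= M"
proof -
 have c: "continuous_on S gm" "continuous_on S (%t. vel gm t)"
  using smooth_arc_continuous[OF sm] S(2) by (auto intro: continuous_on_subset)
 have "compact (gm ` S)" by (rule compact_continuous_image[OF c(1) S(1)])
 then have "open (- (gm ` S))" by (simp add: compact_imp_closed open_Compl)
 then obtain dl where dl: "dl > 0" "ball w dl <= - (gm ` S)" using w by (auto elim: openE)
 have "compact ((%t. vel gm t) ` S)" by (rule compact_continuous_image[OF c(2) S(1)])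
 then have "bounded ((%t. vel gm t) ` S)" by (rule compact_imp_bounded)
 then obtain B where B0: "ALL x:(%t. vel gm t) ` S. cmod x <= B" unfolding bounded_iff by blast
 have B: "cmod (vel gm t) <= B" if "t : S" for t using bspec[OF B0 imageI[OF that]] .
 have Sl: "S : lmeasurable" by (rule lmeasurable_compact[OF S(1)])
 show ?thesis
 proof (rule local_boundI[where rh = "dl/2" and M = "measure lebesgue S * (B / (dl/2))"])
  show "dl/2 > 0" using dl(1) by simp
  fix z assume z: "z : ball w (dl/2)"
  have le: "cmod (vel gm t / (gm t - z)) <= B / (dl/2)" if t: "t : S" for t
  proof -
  have "gm t ~: ball w dl" using dl(2) t by blast
  then have "dl <= dist w (gm t)" by simp
  also have "... <= dist w z + dist z (gm t)" by (rule dist_triangle)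
  finally have "dl/2 <= dist z (gm t)" using z by simp
  then have "dl/2 <= cmod (gm t - z)" by (simp add: dist_norm norm_minus_commute)
  then show ?thesis unfolding norm_divide using B[OF t] dl(1) by (intro frac_le order.trans[OF norm_ge_zero B[OF t]]) auto
  qed
  have "cmod (LINT t:S|lebesgue. vel gm t / (gm t - z)) <= (\<integral>t. indicator S t * (B / (dl/2)) \<partial>lebesgue)"
  proof (cases "set_integrable lebesgue S (%t. vel gm t / (gm t - z))")
  case True
  have i2: "integrable lebesgue (%t. indicator S t * (B / (dl/2)))"
  using Sl by (intro integrable_mult_left integrable_real_indicator) (auto simp: fmeasurable_def)
  show ?thesis unfolding set_lebesgue_integral_def
  by (rule Bochner_Integration.integral_norm_bound_integral[OF True[unfolded set_integrable_def] i2])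
  (use le in \<open>auto simp: indicator_def\<close>)
  next
  \<comment> \<open>A non-integrable function has integral 0 by convention, and the bound is
    nonnegative.\<close>
  case False
  have "0 <= B / (dl/2)" if "t : S" for t using order.trans[OF norm_ge_zero B[OF that]] dl(1) by simp
  then have "0 <= (\<integral>t. indicator S t * (B / (dl/2)) \<partial>lebesgue)" by (intro integral_nonneg_AE AE_I2) (auto simp: indicator_def)
  then show ?thesis using False unfolding set_lebesgue_integral_def set_integrable_def by (simp add: not_integrable_integral_eq)
  qed
  also have "... = measure lebesgue S * (B / (dl/2))" by simp
  finally show "cmod (LINT t:S|lebesgue. vel gm t / (gm t - z)) <= measure lebesgue S * (B / (dl/2))" .
 qed
qed

lemma set_integral_translate:
 fixes f :: "real => complex"
 assumes f: "continuous_on {a..b} f"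
 shows "(LINT t:{a..b}|lebesgue. f t) = (LINT s:{a-c..b-c}|lebesgue. f (c + s))"
proof -
 have m: "(%t. indicator {a..b} t *\<^sub>R f t) : bmeas lborel"
  using borel_measurable_continuous_on_indicator[OF _ f] by simp
 have e: "indicator {a..b} (c + 1 * s) *\<^sub>R f (c + 1 * s) = indicator {a-c..b-c} s *\<^sub>R f (c + s)" for s
  by (auto simp: indicator_def)
 have m2: "(%s. indicator {a-c..b-c} s *\<^sub>R f (c + s)) : bmeas lborel"
  unfolding e[symmetric] by (rule measurable_compose[OF _ m]) simp
 have "(\<integral>t. indicator {a..b} t *\<^sub>R f t \<partial>lborel) = \<bar>1\<bar> *\<^sub>R (\<integral>s. indicator {a..b} (c + 1 * s) *\<^sub>R f (c + 1 * s) \<partial>lborel)"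
  by (rule lborel_integral_real_affine) simp
 then show ?thesis unfolding set_lebesgue_integral_def integral_completion[OF m] integral_completion[OF m2] e by simp
qed

lemma cauchy_integral_arc_indicator:
 assumes Sg: "is_contour Sg" and g: "gm : set Sg" and ab: "0 < a" "b < 1"
 shows "CI Sg (indicator (gm ` {a..b})) z = (LINT t:{a..b}|lebesgue. vel gm t / (gm t - z)) / (2 * of_real pi * \<i>)"
proof -
 have sub: "{a..b} <= open_unit" using ab by auto
 have 0: "arc_density dl (indicator (gm ` {a..b})) t / (arc_point dl t - z) = (if dl = gm then indicator {a..b} t *\<^sub>R (vel gm t / (gm t - z)) else 0)"
  if d: "dl : set Sg" for dl t
 proof (cases "t : open_unit")
  case True
  have i: "(dl t : gm ` {a..b}) = (dl = gm & t : {a..b})"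
  proof
  assume "dl t : gm ` {a..b}"
  then obtain s where s: "s : {a..b}" "dl t = gm s" by blast
  then show "dl = gm & t : {a..b}" using is_contour_arcs(2)[OF Sg d g True _ s(2)] sub by blast
  qed blast
  then show ?thesis using True by (simp add: arc_density_def arc_point_def indicator_def del: image_eqI)
 next
  case False
  then have "t ~: {a..b}" "arc_density dl (indicator (gm ` {a..b})) t = 0" using sub by (blast, simp only: arc_density_def if_False)
  then show ?thesis by (simp add: indicator_def)
 qed
 have "(\<Sum>dl\<in>set Sg. \<integral>t. arc_density dl (indicator (gm ` {a..b})) t / (arc_point dl t - z) \<partial>lebesgue)
  = (\<Sum>dl\<in>set Sg. if dl = gm then (LINT t:{a..b}|lebesgue. vel gm t / (gm t - z)) else 0)"
  by (intro sum.cong refl) (simp add: 0 set_lebesgue_integral_def)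
 also have "... = (LINT t:{a..b}|lebesgue. vel gm t / (gm t - z))" using g by simp
 finally show ?thesis unfolding cauchy_integral_eq[OF Sg] by simp
qed

text \<open>For w inside the subarc, the parameter interval is split around t0: the middle piece is
  a difference of logarithms, bounded on both sides of the arc, and the two outer pieces stay away
  from w. At \<open>gm a\<close> and \<open>gm b\<close> this fails, since no middle piece surrounds
  them.\<close>

lemma cauchy_integral_arc_locally_bounded:
 assumes Sg: "is_contour Sg" and g: "gm : set Sg" and ab: "0 < a" "a < b" "b < 1" and w: "w ~= gm a" "w ~= gm b"
 shows "EX rh>0. EX M. ALL z:ball w rh - contour_set Sg. cmod (CI Sg (indicator (gm ` {a..b})) z) <= M"
proof -
 note sm = is_contour_arcs(1)[OF Sg g]
 have sub: "{a..b} <= open_unit" using ab by auto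
 define k where "k = (%z t. vel gm t / (gm t - z))"
 have *: "EX rh>0. EX M. ALL z:ball w rh - contour_set Sg. cmod (LINT t:{a..b}|lebesgue. k z t) <= M"
 proof (cases "w : gm ` {a..b}")
  case False
  from arc_cauchy_locally_bounded[OF sm compact_Icc sub False] show ?thesis unfolding k_def by blast
 next
  case True
  then obtain t0 where t0: "t0 : {a..b}" "w = gm t0" by blast
  then have t0': "a < t0" "t0 < b" "t0 : open_unit" using w ab by (auto simp: less_le)
  define tu where "tu = vel gm t0"
  have tu: "tu ~= 0" unfolding tu_def by (rule smooth_arc_deriv(2)[OF sm t0'(3)])
  obtain d0 where d0: "0 < d0" "!!d. 0 < d ==> d <= d0 ==> {t0-d..t0+d} <= {0<..<1} &
  (ALL s:{-d..d}. cmod (vel gm (t0 + s) / tu - 1) <= 1/4) &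
  flat_arc (%s. (gm (t0 + s) - gm t0) / tu) (%s. vel gm (t0 + s) / tu) d"
  using smooth_arc_flat[OF sm t0'(3)] unfolding tu_def by blast
  define d where "d = min d0 (min (t0 - a) (b - t0))"
  have dd: "0 < d" "d <= d0" "d <= t0 - a" "d <= b - t0" using d0(1) t0' by (auto simp: d_def)
  have dsub: "{t0-d..t0+d} <= open_unit" using d0(2)[OF dd(1,2)] by blast
  interpret flat_arc "%s. (gm (t0 + s) - gm t0) / tu" "%s. vel gm (t0 + s) / tu" d using d0(2)[OF dd(1,2)] by blast
  note d = dd
  obtain C where C: "!!z. z : ball 0 (d/4) - (%s. (gm (t0 + s) - gm t0) / tu) ` {-d..d} ==>
  cmod (LINT t:{-d/2..d/2}|lebesgue. (vel gm (t0 + t) / tu) / ((gm (t0 + t) - gm t0) / tu - z)) <= C"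
  using bounded_log_integral by blast
  define S1 where "S1 = {a..t0-d/2}"
  define S2 where "S2 = {t0+d/2..b}"
  have S: "S1 <= open_unit" "S2 <= open_unit" "compact S1" "compact S2" "w ~: gm ` S1" "w ~: gm ` S2"
  proof -
  show s: "S1 <= open_unit" "S2 <= open_unit" using sub t0' d by (auto simp: S1_def S2_def)
  show "compact S1" "compact S2" by (auto simp: S1_def S2_def)
  have "t = t0" if "t : open_unit" "w = gm t" for t using is_contour_arcs(2)[OF Sg g g that(1) t0'(3)] that(2) t0(2) by simp
  moreover have "t0 ~: S1" "t0 ~: S2" using d(1) by (auto simp: S1_def S2_def)
  ultimately show "w ~: gm ` S1" "w ~: gm ` S2" using s by blast+
  qed
  obtain rh1 M1 where M1: "rh1 > 0" "!!z. z : ball w rh1 ==> cmod (LINT t:S1|lebesgue. k z t) <= M1"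
  using arc_cauchy_locally_bounded[OF sm S(3,1,5)] unfolding k_def by blast
  obtain rh2 M2 where M2: "rh2 > 0" "!!z. z : ball w rh2 ==> cmod (LINT t:S2|lebesgue. k z t) <= M2"
  using arc_cauchy_locally_bounded[OF sm S(4,2,6)] unfolding k_def by blast
  \<comment> \<open>The first radius is the disc of radius d/4 in flat coordinates, scaled back by
    |tu|.\<close>
  define rh where "rh = min (cmod tu * (d/4)) (min rh1 rh2)"
  show ?thesis
  proof (rule local_boundI[where rh = rh and M = "M1 + C + M2"])
  show "0 < rh" using tu d(1) M1(1) M2(1) by (simp add: rh_def)
  fix z assume z: "z : ball w rh - contour_set Sg"
  have ne: "gm t ~= z" if "t : {a..b}" for t using z contour_arc_subset[OF g] sub that by blast
  have kc: "continuous_on {x..y} (k z)" if xy: "{x..y} <= {a..b}" for x y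
  unfolding k_def
  proof (intro continuous_intros ballI)
  have "{x..y} <= open_unit" using xy sub by (rule order.trans)
  then show "continuous_on {x..y} (%t. vel gm t)" "continuous_on {x..y} gm"
  by (rule continuous_on_subset[OF smooth_arc_continuous(2)[OF sm]], rule continuous_on_subset[OF smooth_arc_continuous(1)[OF sm]])
  fix t assume "t : {x..y}"
  then have "t : {a..b}" using xy by (rule subsetD[rotated])
  then show "gm t - z ~= 0" using ne[of t] by simp
  qed
  have si: "set_integrable lebesgue {x..y} (k z)" if "{x..y} <= {a..b}" for x y
  proof -
  have "set_integrable lborel {x..y} (k z)" by (rule borel_integrable_atLeastAtMost'[OF kc[OF that]])
  then show ?thesis unfolding set_integrable_def by (simp add: integrable_completion)
  qed
  have split: "(LINT t:{x..v}|lebesgue. k z t) = (LINT t:{x..y}|lebesgue. k z t) + (LINT t:{y..v}|lebesgue. k z t)" if "a <= x" "x <= y" "y <= v" "v <= b" for x y v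
  proof -
  have "AE t in lborel. t ~= y" by (rule AE_lborel_singleton)
  then have ae: "AE t in lebesgue. t ~= y" by (rule AE_completion)
  have u: "{x..v} = {x..y} Un {y..v}" using that by auto
  show ?thesis unfolding u
  by (rule set_integral_Un_AE) (use ae that in \<open>auto intro!: si elim: eventually_mono\<close>)
  qed
  have h: "a <= t0 - d/2" "t0 - d/2 <= b" "t0 - d/2 <= t0 + d/2" "t0 + d/2 <= b" using d by linarith+
  have "(LINT t:{a..b}|lebesgue. k z t) = (LINT t:S1|lebesgue. k z t) + ((LINT t:{t0-d/2..t0+d/2}|lebesgue. k z t) + (LINT t:S2|lebesgue. k z t))"
  unfolding S1_def S2_def using split[of a "t0-d/2" b, OF order.refl h(1) h(2) order.refl] split[of "t0-d/2" "t0+d/2" b, OF h(1) h(3) h(4) order.refl] by simp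
  moreover have "cmod (LINT t:{t0-d/2..t0+d/2}|lebesgue. k z t) <= C"
  proof -
  have "(LINT t:{t0-d/2..t0+d/2}|lebesgue. k z t) = (LINT s:{t0-d/2-t0..t0+d/2-t0}|lebesgue. k z (t0 + s))"
  by (rule set_integral_translate[OF kc]) (use d in auto)
  also have "... = (LINT s:{-d/2..d/2}|lebesgue. (vel gm (t0 + s) / tu) / ((gm (t0 + s) - gm t0) / tu - (z - w) / tu))"
  proof -
  have "(vel gm (t0 + s) / tu) / ((gm (t0 + s) - gm t0) / tu - (z - w) / tu) = k z (t0 + s)" for s
  proof -
  have "(gm (t0 + s) - gm t0) / tu - (z - w) / tu = (gm (t0 + s) - z) / tu" by (simp add: t0(2) diff_divide_distrib)
  then show ?thesis using tu by (simp add: k_def)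
  qed
  then show ?thesis by simp
  qed
  also have "cmod ... <= C"
  proof (rule C, rule DiffI)
  have "cmod (z - w) < cmod tu * (d/4)" using z by (simp add: rh_def dist_norm norm_minus_commute)
  then show "(z - w) / tu : ball 0 (d/4)" using tu by (simp add: norm_divide field_simps)
  show "(z - w) / tu ~: (%s. (gm (t0 + s) - gm t0) / tu) ` {-d..d}"
  proof
  assume "(z - w) / tu : (%s. (gm (t0 + s) - gm t0) / tu) ` {-d..d}"
  then obtain s where s: "s : {-d..d}" "(z - w) / tu = (gm (t0 + s) - gm t0) / tu" by blast
  then have "z = gm (t0 + s)" using tu t0(2) by simp
  then show False using ne[of "t0 + s"] s(1) d by simp
  qed
  qed
  finally show ?thesis .
  qed
  moreover have "cmod (LINT t:S1|lebesgue. k z t) <= M1" "cmod (LINT t:S2|lebesgue. k z t) <= M2" using M1(2)[of z] M2(2)[of z] z by (auto simp: rh_def)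
  ultimately show "cmod (LINT t:{a..b}|lebesgue. k z t) <= M1 + C + M2" by (rule norm_add3_le)
  qed
 qed
 then obtain rh M where M: "rh > 0" "!!z. z : ball w rh - contour_set Sg ==> cmod (LINT t:{a..b}|lebesgue. k z t) <= M" by blast
 show ?thesis
 proof (rule local_boundI[where rh = rh and M = "M / (2 * pi)", OF M(1)])
  fix z assume "z : ball w rh - contour_set Sg"
  from M(2)[OF this] have "cmod (LINT t:{a..b}|lebesgue. k z t) / (2 * pi) <= M / (2 * pi)" by (rule divide_right_mono) simp
  then show "cmod (CI Sg (indicator (gm ` {a..b})) z) <= M / (2 * pi)"
  unfolding cauchy_integral_arc_indicator[OF Sg g ab(1,3)] norm_divide k_def by (simp add: norm_mult)
 qed
qed

section \<open>The jump of a product\<close>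

lemma complete_contour_dense:
 assumes "complete_contour Sg" shows "contour_set Sg <= closure (- contour_set Sg)"
proof -
 obtain P M where PM: "P Un M = - contour_set Sg" "frontier P = contour_set Sg" using assms unfolding complete_contour_def by blast
 have "contour_set Sg <= closure P" using PM(2) by (auto simp: frontier_def)
 also have "... <= closure (- contour_set Sg)" using PM(1) by (intro closure_mono) blast
 finally show ?thesis .
qed

locale contour_pair =
 fixes GG GG' :: contour
 assumes cG: "cauchy_contour GG" and cG': "cauchy_contour GG'" and cS: "cauchy_contour (GG @ GG')"
  and kG: "complete_contour GG" and kS: "complete_contour (GG @ GG')"
  and sep: "EX d>0. ALL x:contour_set GG. ALL y:contour_set GG'. d <= dist x y"
  and across: "cauchy_bounded_across GG GG'" and across': "cauchy_bounded_across GG' GG"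
begin

abbreviation "Sg \<equiv> GG @ GG'"

section \<open>Two contours at positive distance and their union\<close>

lemma contours: "is_contour GG" "is_contour GG'" "is_contour Sg"
 using cG cG' cS by (simp_all add: cauchy_contour_def)

lemma contour_set_append: "contour_set Sg = contour_set GG Un contour_set GG'"
 by (simp add: contour_set_def image_Un Union_Un_distrib)

lemma contour_disjoint: "z : contour_set GG ==> z ~: contour_set GG'"
 using sep by fastforce

lemma AE_append: "(AE z in arclength Sg. P z) \<longleftrightarrow> (AE z in arclength GG. P z) & (AE z in arclength GG'. P z)"
 unfolding AE_arclength_iff[OF contours(1)] AE_arclength_iff[OF contours(2)] AE_arclength_iff[OF contours(3)] by auto

lemma measurable_append: "f : bmeas (arclength Sg) \<longleftrightarrow> f : bmeas (arclength GG) & f : bmeas (arclength GG')"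
proof
 assume f: "f : bmeas (arclength Sg)"
 have "(%t. f (gm t)) : bmeas (lebesgue_on open_unit)" if "gm : set Sg" for gm
  by (rule measurable_compose[OF measurable_arc[OF contours(3) that] f])
 then show "f : bmeas (arclength GG) & f : bmeas (arclength GG')"
  by (intro conjI borel_measurable_arclengthI contours) auto
next
 assume f: "f : bmeas (arclength GG) & f : bmeas (arclength GG')"
 show "f : bmeas (arclength Sg)"
 proof (rule borel_measurable_arclengthI[OF contours(3)])
  fix gm assume "gm : set Sg"
  then show "(%t. f (gm t)) : bmeas (lebesgue_on open_unit)"
  using measurable_compose[OF measurable_arc[OF contours(1)], of gm f] measurable_compose[OF measurable_arc[OF contours(2)], of gm f] f by auto
 qed
qed

lemma nn_integral_append:
 assumes f: "f : bmeas (arclength Sg)"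
 shows "(\<integral>\<^sup>+z. f z \<partial>arclength Sg) = (\<integral>\<^sup>+z. f z \<partial>arclength GG) + (\<integral>\<^sup>+z. f z \<partial>arclength GG')"
proof -
 have "set GG Int set GG' = {}" using is_contour_arcs(3)[OF contours(3)] by simp
 then show ?thesis using f unfolding nn_integral_arclength[OF contours(3) f]
  by (simp add: measurable_append nn_integral_arclength[OF contours(1)] nn_integral_arclength[OF contours(2)] sum.union_disjoint)
qed

lemma L2_append:
 fixes f :: "complex => complex"
 assumes f: "f : L2 GG" "N2 GG f <= A" and f': "f : Lp (arclength GG') 2" "Lp_norm (arclength GG') 2 f <= B"
 shows "f : L2 Sg" "N2 Sg f <= A + B"
proof -
 have AB: "0 <= A" "0 <= B" using f(2) f'(2) Lp_norm_nonneg order.trans by blast+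
 have m: "f : bmeas (arclength Sg)" using f f' by (simp add: measurable_append Lp_measurable)
 have m2: "(%z. ennreal (norm (f z) powr 2)) : bmeas (arclength Sg)" using m by measurable
 have "(\<integral>\<^sup>+z. ennreal (norm (f z) powr 2) \<partial>arclength Sg) = ennreal (N2 GG f powr 2) + ennreal (Lp_norm (arclength GG') 2 f powr 2)"
  unfolding nn_integral_append[OF m2] Lp_norm_powr[OF f(1) zero_less_numeral] Lp_norm_powr[OF f'(1) zero_less_numeral] ..
 also have "... <= ennreal (A powr 2) + ennreal (B powr 2)" using f(2) f'(2) by (intro add_mono ennreal_leI powr_mono2) auto
 also have "... = ennreal (A^2 + B^2)" using AB by (simp add: ennreal_plus[symmetric] del: ennreal_plus)
 also have "... <= ennreal ((A + B) powr 2)" using AB by (intro ennreal_leI) (simp add: power2_sum)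
 finally show "f : L2 Sg" "N2 Sg f <= A + B" using Lp_norm_leI[OF m, of 2 "A + B"] AB by simp_all
qed

lemma has_nt_limit_append: "gm : set GG ==> t : open_unit ==> has_nt_limit Sg sx f (gm t) = has_nt_limit GG sx f (gm t)"
 by (rule has_nt_limit_subcontour[OF contours(3,1)]) auto

lemma AE_on_arcs: "AE z in arclength GG. EX gm:set GG. EX t:open_unit. z = gm t" "AE z in arclength GG'. EX gm:set GG'. EX t:open_unit. z = gm t"
 unfolding AE_arclength_iff[OF contours(1)] AE_arclength_iff[OF contours(2)] by (intro ballI AE_I2, blast)+

lemma isCont_across:
 assumes h: "h : L2 GG" and g: "gm : set GG'" "t : open_unit"
 shows "isCont (CI GG h) (gm t)"
proof -
 have "gm t : contour_set GG'" by (rule contour_arc_subset[OF g])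
 then have "gm t : - contour_set GG" using contour_disjoint by blast
 moreover have "open (- contour_set GG)" by (simp add: closed_contour_set open_Compl)
 ultimately show ?thesis
  using holomorphic_on_imp_continuous_on[OF cauchy_integral_holomorphic[OF contours(1) h]] by (simp add: continuous_on_eq_continuous_at)
qed

lemma isCont_across':
 assumes h: "h : Lp (arclength GG') 2" and g: "gm : set GG" "t : open_unit"
 shows "isCont (CI GG' h) (gm t)"
proof -
 have "gm t : contour_set GG" by (rule contour_arc_subset[OF g])
 then have "gm t : - contour_set GG'" using contour_disjoint by blast
 moreover have "open (- contour_set GG')" by (simp add: closed_contour_set open_Compl)
 ultimately show ?thesis
  using holomorphic_on_imp_continuous_on[OF cauchy_integral_holomorphic[OF contours(2) h]] by (simp add: continuous_on_eq_continuous_at)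
qed

text \<open>On the first contour these are the standing facts. On the second contour the Cauchy
  integral over the first is analytic, hence continuous, so both boundary values equal its value
  there.\<close>

lemma has_nt_limit_cauchy:
 assumes h: "h : L2 GG" and sx: "sx = 1 \<or> sx = -1"
 shows "AE s in arclength GG. has_nt_limit Sg sx (CI GG h) s (nt_value GG sx (CI GG h) s)"
  and "AE s in arclength GG. has_nt_limit GG sx (CI GG h) s (nt_value GG sx (CI GG h) s)"
  and "AE s in arclength GG'. has_nt_limit Sg sx (CI GG h) s (CI GG h s)"
proof -
 have s': "sx : {1,-1}" using sx by simp
 have ex: "AE s in arclength GG. EX l. has_nt_limit GG sx (CI GG h) s l"
 proof -
  have *: "ALL p>=1. ALL h:Lp (arclength GG) p. ALL sx:{1, -1}. AE z in arclength GG. EX l. has_nt_limit GG sx (CI GG h) z l"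
  using cG unfolding cauchy_contour_def by blast
  have "(1::real) <= 2" by simp
  from *[rule_format, OF this h s'] show ?thesis .
 qed
 show 2: "AE s in arclength GG. has_nt_limit GG sx (CI GG h) s (nt_value GG sx (CI GG h) s)"
  using ex
 proof eventually_elim
  case (elim s)
  then obtain l where "has_nt_limit GG sx (CI GG h) s l" by blast
  then show ?case using nt_value_eq[OF contours(1) sx] by metis
 qed
 show "AE s in arclength GG. has_nt_limit Sg sx (CI GG h) s (nt_value GG sx (CI GG h) s)"
  using 2 AE_on_arcs(1) by eventually_elim (auto simp: has_nt_limit_append)
 show "AE s in arclength GG'. has_nt_limit Sg sx (CI GG h) s (CI GG h s)"
  using AE_on_arcs(2)
 proof eventually_elim
  case (elim s)
  then obtain gm t where g: "gm : set GG'" "t : open_unit" "s = gm t" by blast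
  have "gm : set Sg" using g(1) by simp
  from has_nt_limit_isCont[where f = "CI GG h" and gm = gm and t = t, OF contours(3) this g(2) isCont_across[OF h g(1,2)]]
  show ?case unfolding g(3) .
 qed
qed

lemma C_bounded:
 assumes q: "1 < q" and sx: "sx = 1 \<or> sx = -1"
 shows "EX K>=0. ALL h:Lp (arclength GG) q. nt_value GG sx (CI GG h) : Lp (arclength GG) q &
  Lp_norm (arclength GG) q (nt_value GG sx (CI GG h)) <= K * Lp_norm (arclength GG) q h"
proof -
 have s': "sx : {1,-1}" using sx by simp
 have *: "ALL p>1. ALL sx:{1, -1}. EX K. ALL h:Lp (arclength GG) p.
  nt_value GG sx (CI GG h) : Lp (arclength GG) p &
  Lp_norm (arclength GG) p (nt_value GG sx (CI GG h)) <= K * Lp_norm (arclength GG) p h"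
  using cG unfolding cauchy_contour_def by blast
 from *[rule_format, OF q s'] obtain K where K: "ALL h:Lp (arclength GG) q. nt_value GG sx (CI GG h) : Lp (arclength GG) q &
  Lp_norm (arclength GG) q (nt_value GG sx (CI GG h)) <= K * Lp_norm (arclength GG) q h" ..
 have "K * Lp_norm (arclength GG) q h <= max 0 K * Lp_norm (arclength GG) q h" for h :: "complex => complex" by (intro mult_right_mono) auto
 then show ?thesis using K by (intro exI[of _ "max 0 K"]) (auto intro: order.trans)
qed

lemma across_bounded:
 assumes q: "1 < q"
 shows "EX K>=0. ALL h:Lp (arclength GG) q. CI GG h : Lp (arclength GG') q &
  Lp_norm (arclength GG') q (CI GG h) <= K * Lp_norm (arclength GG) q h"
proof -
 from across q obtain K where K: "ALL h:Lp (arclength GG) q. CI GG h : Lp (arclength GG') q &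
  Lp_norm (arclength GG') q (CI GG h) <= K * Lp_norm (arclength GG) q h" unfolding cauchy_bounded_across_def by blast
 have "K * Lp_norm (arclength GG) q h <= max 0 K * Lp_norm (arclength GG) q h" for h :: "complex => complex" by (intro mult_right_mono) auto
 then show ?thesis using K by (intro exI[of _ "max 0 K"]) (auto intro: order.trans)
qed

lemma across_bounded':
 assumes q: "1 < q"
 shows "EX K>=0. ALL h:Lp (arclength GG') q. CI GG' h : Lp (arclength GG) q & (AE s in arclength GG. cmod (CI GG' h s) <= K * Lp_norm (arclength GG') q h) &
  Lp_norm (arclength GG) q (CI GG' h) <= K * Lp_norm (arclength GG') q h"
proof -
 from across' q obtain K where K: "ALL h:Lp (arclength GG') q. CI GG' h : Lp (arclength GG) q & CI GG' h : Linf (arclength GG) &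
  Lp_norm (arclength GG) q (CI GG' h) <= K * Lp_norm (arclength GG') q h &
  Linf_norm (arclength GG) (CI GG' h) <= K * Lp_norm (arclength GG') q h" unfolding cauchy_bounded_across_def by blast
 have le: "K * Lp_norm (arclength GG') q h <= max 0 K * Lp_norm (arclength GG') q h" for h :: "complex => complex" by (intro mult_right_mono) auto
 show ?thesis
 proof (intro exI[of _ "max 0 K"] conjI ballI)
  fix h :: "complex => complex" assume h: "h : Lp (arclength GG') q"
  note Kh = bspec[OF K h]
  show "CI GG' h : Lp (arclength GG) q" using Kh by blast
  show "Lp_norm (arclength GG) q (CI GG' h) <= max 0 K * Lp_norm (arclength GG') q h" using Kh le[of h] by linarith
  have "CI GG' h : Linf (arclength GG)" using Kh by blast
  from Linf_bound[OF this] show "AE s in arclength GG. cmod (CI GG' h s) <= max 0 K * Lp_norm (arclength GG') q h"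
  by (rule eventually_mono) (use Kh le[of h] in linarith)
 qed simp
qed

lemma nt_value_cauchy:
 assumes h: "h : L2 GG" and sx: "sx = 1 \<or> sx = -1"
 shows "AE s in arclength GG. nt_value Sg sx (CI GG h) s = nt_value GG sx (CI GG h) s"
  and "AE s in arclength GG'. nt_value Sg sx (CI GG h) s = CI GG h s"
  and "AE s in arclength Sg. has_nt_limit Sg sx (CI GG h) s (nt_value Sg sx (CI GG h) s)"
proof -
 show 1: "AE s in arclength GG. nt_value Sg sx (CI GG h) s = nt_value GG sx (CI GG h) s"
  using has_nt_limit_cauchy(1)[OF h sx] by (rule eventually_mono) (rule nt_value_eq[OF contours(3) sx])
 show 2: "AE s in arclength GG'. nt_value Sg sx (CI GG h) s = CI GG h s"
  using has_nt_limit_cauchy(3)[OF h sx] by (rule eventually_mono) (rule nt_value_eq[OF contours(3) sx])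
 show "AE s in arclength Sg. has_nt_limit Sg sx (CI GG h) s (nt_value Sg sx (CI GG h) s)"
  unfolding AE_append
 proof
  show "AE s in arclength GG. has_nt_limit Sg sx (CI GG h) s (nt_value Sg sx (CI GG h) s)"
  using has_nt_limit_cauchy(1)[OF h sx] 1 by eventually_elim simp
  show "AE s in arclength GG'. has_nt_limit Sg sx (CI GG h) s (nt_value Sg sx (CI GG h) s)"
  using has_nt_limit_cauchy(3)[OF h sx] 2 by eventually_elim simp
 qed
qed

text \<open>The jump, left minus right, of the product of \<open>CI GG h\<close> and r across the
  union of the contours. On GG' the first factor does not jump, so this is its value times the jump
  of r, up to a null set.\<close>

definition boundary_jump :: "(complex => complex) => (complex => complex) => complex => complex" where
 "boundary_jump r h s = nt_value Sg 1 (CI GG h) s * nt_value Sg 1 r s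
  - nt_value Sg (-1) (CI GG h) s * nt_value Sg (-1) r s"

section \<open>The product formula for a bounded analytic factor\<close>

context
 fixes r :: "complex => complex" and B :: real
 assumes r: "r holomorphic_on - contour_set Sg" and B: "!!z. z ~: contour_set Sg ==> cmod (r z) <= B"
begin

lemma B_nonneg: "0 <= B"
proof -
 have "- contour_set Sg ~= {}" using complete_contour_dense[OF kS] by auto
 then obtain z where "z ~: contour_set Sg" by blast
 from B[OF this] show ?thesis using norm_ge_zero order.trans by blast
qed

lemma boundary_values_r:
 assumes sx: "sx = 1 \<or> sx = -1"
 shows "AE s in arclength Sg. has_nt_limit Sg sx r s (nt_value Sg sx r s)" "AE s in arclength Sg. cmod (nt_value Sg sx r s) <= B"
  "nt_value Sg sx r : bmeas (arclength Sg)"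
proof -
 have s': "sx : {1,-1}" using sx by simp
 have *: "ALL f. f holomorphic_on - contour_set Sg & bounded (f ` (- contour_set Sg)) -->
  (ALL sx:{1, -1}. AE z in arclength Sg. EX l. has_nt_limit Sg sx f z l)" using cS unfolding cauchy_contour_def by blast
 have "bounded (r ` (- contour_set Sg))" unfolding bounded_iff using B by auto
 with *[rule_format, of r, OF conjI s'] r have ex: "AE s in arclength Sg. EX l. has_nt_limit Sg sx r s l" by blast
 show 1: "AE s in arclength Sg. has_nt_limit Sg sx r s (nt_value Sg sx r s)" using ex
 proof eventually_elim
  case (elim s)
  then obtain l where "has_nt_limit Sg sx r s l" by blast
  then show ?case using nt_value_eq[OF contours(3) sx] by metis
 qed
 show "AE s in arclength Sg. cmod (nt_value Sg sx r s) <= B"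
  using 1 by (rule eventually_mono) (rule nt_limit_bound[OF contours(3) kS sx _ B])
 show "nt_value Sg sx r : bmeas (arclength Sg)"
  by (rule nt_value_measurable[OF contours(3) kS sx holomorphic_on_imp_continuous_on[OF r] ex])
qed

text \<open>On the first contour the bound comes from the Cauchy operators, on the second from the
  boundedness across the contours; B is the bound for the boundary values of r in both cases. A
  bound linear in the norm of h is needed for the density argument.\<close>

lemma nt_value_cauchy_mult_bounded:
 assumes sx: "sx = 1 \<or> sx = -1"
 shows "EX K>=0. ALL h:L2 GG. (%s. nt_value Sg sx (CI GG h) s * nt_value Sg sx r s) : L2 Sg &
  N2 Sg (%s. nt_value Sg sx (CI GG h) s * nt_value Sg sx r s) <= K * N2 GG h"
proof -
 have two: "(1::real) < 2" "(0::real) < 2" by simp_all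
 obtain K where K: "K >= 0" "ALL h:L2 GG. nt_value GG sx (CI GG h) : L2 GG &
  N2 GG (nt_value GG sx (CI GG h)) <= K * N2 GG h"
  using C_bounded[OF two(1) sx] by blast
 obtain K' where K': "K' >= 0" "ALL h:L2 GG. CI GG h : Lp (arclength GG') 2 &
  Lp_norm (arclength GG') 2 (CI GG h) <= K' * N2 GG h" using across_bounded[OF two(1)] by blast
 show ?thesis
 proof (intro exI[of _ "B * K + B * K'"] conjI ballI)
  show "0 <= B * K + B * K'" using B_nonneg K(1) K'(1) by simp
  fix h :: "complex => complex" assume h: "h : L2 GG"
  let ?f = "%s. nt_value Sg sx (CI GG h) s * nt_value Sg sx r s"
  note Kh = bspec[OF K(2) h] and Kh' = bspec[OF K'(2) h]
  have rm: "nt_value Sg sx r : bmeas (arclength GG)" "nt_value Sg sx r : bmeas (arclength GG')"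
  using boundary_values_r(3)[OF sx] by (simp_all add: measurable_append)
  have rB: "AE s in arclength GG. cmod (nt_value Sg sx r s) <= B" "AE s in arclength GG'. cmod (nt_value Sg sx r s) <= B"
  using boundary_values_r(2)[OF sx] by (simp_all add: AE_append)
  have e1: "AE s in arclength GG. nt_value GG sx (CI GG h) s = nt_value Sg sx (CI GG h) s"
  using nt_value_cauchy(1)[OF h sx] by eventually_elim simp
  have m1: "?f : bmeas (arclength GG)"
  by (rule borel_measurable_times[OF arclength_measurable_AE[OF _ e1] rm(1)]) (use Kh Lp_measurable in blast)
  have e2: "AE s in arclength GG'. CI GG h s = nt_value Sg sx (CI GG h) s"
  using nt_value_cauchy(2)[OF h sx] by eventually_elim simp
  have m2: "?f : bmeas (arclength GG')"
  by (rule borel_measurable_times[OF arclength_measurable_AE[OF _ e2] rm(2)]) (use Kh' Lp_measurable in blast)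
  have le1: "AE s in arclength GG. cmod (?f s) <= B * cmod (nt_value GG sx (CI GG h) s)"
  using e1 rB(1)
  proof eventually_elim
  case (elim s)
  have "cmod (nt_value Sg sx (CI GG h) s) * cmod (nt_value Sg sx r s) <= cmod (nt_value Sg sx (CI GG h) s) * B"
  by (rule mult_left_mono[OF elim(2)]) simp
  then show ?case unfolding elim(1) norm_mult by (simp only: mult.commute)
  qed
  have le2: "AE s in arclength GG'. cmod (?f s) <= B * cmod (CI GG h s)"
  using e2 rB(2)
  proof eventually_elim
  case (elim s)
  have "cmod (nt_value Sg sx (CI GG h) s) * cmod (nt_value Sg sx r s) <= cmod (nt_value Sg sx (CI GG h) s) * B"
  by (rule mult_left_mono[OF elim(2)]) simp
  then show ?case unfolding elim(1) norm_mult by (simp only: mult.commute)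
  qed
  have a: "?f : L2 GG" "N2 GG ?f <= B * (K * N2 GG h)"
  using Lp_mono[OF conjunct1[OF Kh] m1 two(2) B_nonneg le1] mult_left_mono[OF conjunct2[OF Kh] B_nonneg] by auto
  have b: "?f : Lp (arclength GG') 2" "Lp_norm (arclength GG') 2 ?f <= B * (K' * N2 GG h)"
  using Lp_mono[OF conjunct1[OF Kh'] m2 two(2) B_nonneg le2] mult_left_mono[OF conjunct2[OF Kh'] B_nonneg] by auto
  show "?f : L2 Sg" by (rule L2_append(1)[OF a b])
  show "N2 Sg ?f <= (B * K + B * K') * N2 GG h" using L2_append(2)[OF a b] by (simp add: algebra_simps)
 qed
qed

lemma boundary_jump_bounded:
 "EX K>=0. ALL h:L2 GG. boundary_jump r h : L2 Sg & N2 Sg (boundary_jump r h) <= K * N2 GG h"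
proof -
 obtain K1 where K1: "K1 >= 0" "ALL h:L2 GG. (%s. nt_value Sg 1 (CI GG h) s * nt_value Sg 1 r s) : L2 Sg &
  N2 Sg (%s. nt_value Sg 1 (CI GG h) s * nt_value Sg 1 r s) <= K1 * N2 GG h"
  using nt_value_cauchy_mult_bounded[of 1] by auto
 obtain K2 where K2: "K2 >= 0" "ALL h:L2 GG. (%s. nt_value Sg (-1) (CI GG h) s * nt_value Sg (-1) r s) : L2 Sg &
  N2 Sg (%s. nt_value Sg (-1) (CI GG h) s * nt_value Sg (-1) r s) <= K2 * N2 GG h"
  using nt_value_cauchy_mult_bounded[of "-1"] by auto
 show ?thesis
 proof (intro exI[of _ "2 * (K1 + K2)"] conjI ballI)
  show "0 <= 2 * (K1 + K2)" using K1(1) K2(1) by simp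
  fix h :: "complex => complex" assume h: "h : L2 GG"
  note a = bspec[OF K1(2) h] and b = bspec[OF K2(2) h]
  have e: "boundary_jump r h = (%s. nt_value Sg 1 (CI GG h) s * nt_value Sg 1 r s - nt_value Sg (-1) (CI GG h) s * nt_value Sg (-1) r s)"
  by (rule ext) (rule boundary_jump_def)
  show "boundary_jump r h : L2 Sg" unfolding e by (rule Lp_diff(1)[OF conjunct1[OF a] conjunct1[OF b]]) simp
  have "N2 Sg (boundary_jump r h) <= 2 * (N2 Sg (%s. nt_value Sg 1 (CI GG h) s * nt_value Sg 1 r s) + N2 Sg (%s. nt_value Sg (-1) (CI GG h) s * nt_value Sg (-1) r s))"
  unfolding e by (rule Lp_diff(2)[OF conjunct1[OF a] conjunct1[OF b]]) simp
  also have "... <= 2 * (K1 * N2 GG h + K2 * N2 GG h)" using a b by (intro mult_left_mono add_mono) auto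
  finally show "N2 Sg (boundary_jump r h) <= 2 * (K1 + K2) * N2 GG h" by (simp add: algebra_simps)
 qed
qed

text \<open>Additivity of Cauchy integrals is available only off the contour, where the integrals
  converge, and is carried to boundary values by \<open>nt_limit_unique_off\<close>.\<close>

lemma nt_value_cauchy_linear:
 assumes f: "f : L2 GG" and g: "g : L2 GG" and sx: "sx = 1 \<or> sx = -1"
 shows "AE s in arclength Sg. nt_value Sg sx (CI GG (%s. f s + g s)) s = nt_value Sg sx (CI GG f) s + nt_value Sg sx (CI GG g) s"
proof -
 have fg: "(%s. f s + g s) : L2 GG" by (rule Lp_add(1)[OF f g]) simp
 show ?thesis using nt_value_cauchy(3)[OF f sx] nt_value_cauchy(3)[OF g sx] nt_value_cauchy(3)[OF fg sx]
 proof eventually_elim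
  case (elim s)
  show ?case
  proof (rule nt_limit_unique_off[OF contours(3) kS sx elim(3) has_nt_limit_combine[OF contours(3) elim(1,2) tendsto_add]])
  fix z assume "z ~: contour_set Sg"
  then have "z ~: contour_set GG" by (simp add: contour_set_append)
  then show "CI GG (%s. f s + g s) z = CI GG f z + CI GG g z"
  by (rule cauchy_integral_add[OF contours(1) _ f g])
  qed
 qed
qed

lemma nt_value_cauchy_scale:
 assumes f: "f : L2 GG" and sx: "sx = 1 \<or> sx = -1"
 shows "AE s in arclength Sg. nt_value Sg sx (CI GG (%s. c * f s)) s = c * nt_value Sg sx (CI GG f) s"
 using nt_value_cauchy(3)[OF f sx]
proof eventually_elim
 case (elim s)
 have "has_nt_limit Sg sx (%z. c * CI GG f z) s (c * nt_value Sg sx (CI GG f) s)"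
  by (rule has_nt_limit_combine[OF contours(3) elim elim, of "%x y. c * x"]) (rule tendsto_mult_left)
 moreover have "(%z. c * CI GG f z) = CI GG (%s. c * f s)" by (rule ext) (rule cauchy_integral_scale[OF contours(1), symmetric])
 ultimately show ?case using nt_value_eq[OF contours(3) sx] by simp
qed

text \<open>Here \<open>cauchy_integral_of_jump\<close> applies: m is locally bounded except at the
  two end points of the subarc, so m r is too, and r analytic off the union makes m r analytic
  there.\<close>

lemma jump_formula_indicator:
 assumes g: "gm : set GG" and ab: "0 < a" "a < b" "b < 1" and z: "z ~: contour_set Sg"
 shows "CI GG (indicator (gm ` {a..b})) z * r z = CI Sg (boundary_jump r (indicator (gm ` {a..b}))) z"
proof -
 let ?h = "indicator (gm ` {a..b}) :: complex => complex"
 let ?m = "CI GG ?h"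
 have S: "gm ` {a..b} : sets (arclength GG)" "emeasure (arclength GG) (gm ` {a..b}) < \<infinity>" by (rule emeasure_compact_arc_finite[OF contours(1) g ab(1,3)])+
 have S': "gm ` {a..b} : sets (arclength Sg)" "emeasure (arclength Sg) (gm ` {a..b}) < \<infinity>"
  using emeasure_compact_arc_finite[OF contours(3) _ ab(1,3), of gm] g by simp_all
 have h: "?h : L2 GG" using L2_indicator(1)[OF S, of 1] by simp
 have sub: "contour_set GG <= contour_set Sg" by (simp add: contour_set_append)
 show ?thesis
 proof (rule cauchy_integral_of_jump[where E = "{gm a, gm b}" and h = "%s. indicator (gm ` {a..b}) s * complex_of_real B" and F = "%z. ?m z * r z",
  OF contours(3) complete_contour_dense[OF kS] _ _ _ _ _ _ _ z])
  have "?m holomorphic_on - contour_set Sg" by (rule holomorphic_on_subset[OF cauchy_integral_holomorphic[OF contours(1) h]]) (use sub in blast)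
  then show "(%z. ?m z * r z) holomorphic_on - contour_set Sg" by (intro holomorphic_on_mult r)
  show "boundary_jump r ?h : L2 Sg" using boundary_jump_bounded h by blast
  show "(%s. indicator (gm ` {a..b}) s * complex_of_real B) : L2 Sg" by (rule L2_indicator(1)[OF S'])
  fix w assume "w : contour_set Sg - {gm a, gm b}"
  then obtain rh M where M: "rh > 0" "!!z. z : ball w rh - contour_set GG ==> cmod (?m z) <= M"
  using cauchy_integral_arc_locally_bounded[OF contours(1) g ab, of w] by blast
  have "cmod (?m z * r z) <= M * B" if "z : ball w rh - contour_set Sg" for z
  proof -
  have "cmod (?m z) <= M" "cmod (r z) <= B" using M(2)[of z] B[of z] that sub by blast+
  then show ?thesis unfolding norm_mult by (intro mult_mono order.trans[OF norm_ge_zero]) auto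
  qed
  then show "EX rh>0. EX M. ALL z:ball w rh - contour_set Sg. cmod (?m z * r z) <= M" using M(1) by blast
 next
  have one: "(1::real) = 1 \<or> (1::real) = -1" "(-1::real) = 1 \<or> (-1::real) = -1" by simp_all
  show "AE s in arclength Sg. EX lp lm. has_nt_limit Sg 1 (%z. ?m z * r z) s lp & has_nt_limit Sg (-1) (%z. ?m z * r z) s lm & boundary_jump r ?h s = lp - lm"
  using nt_value_cauchy(3)[OF h one(1)] nt_value_cauchy(3)[OF h one(2)] boundary_values_r(1)[OF one(1)] boundary_values_r(1)[OF one(2)]
  proof eventually_elim
  case (elim s)
  show ?case
  using has_nt_limit_combine[OF contours(3) elim(1,3), of "(*)", OF tendsto_mult] has_nt_limit_combine[OF contours(3) elim(2,4), of "(*)", OF tendsto_mult]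
  boundary_jump_def[of r ?h s] by blast
  qed
 next
  \<comment> \<open>Domination by a potential: B times the indicator serves as density, because |r|
    <= B and the factor 1/(2 pi) may be dropped. Arcs of GG' contribute nonnegative terms
    only.\<close>
  fix z assume z: "z ~: contour_set Sg"
  let ?I = "%dl. \<integral>t. cmod (arc_density dl (%s. indicator (gm ` {a..b}) s * complex_of_real B) t) / cmod (arc_point dl t - z) \<partial>lebesgue"
  have "cmod (\<Sum>dl\<in>set GG. \<integral>t. arc_density dl ?h t / (arc_point dl t - z) \<partial>lebesgue) * B <= (\<Sum>dl\<in>set GG. ?I dl)"
  proof -
  have "cmod (\<integral>t. arc_density dl ?h t / (arc_point dl t - z) \<partial>lebesgue) * B <= ?I dl" for dl
  proof -
  have "cmod (\<integral>t. arc_density dl ?h t / (arc_point dl t - z) \<partial>lebesgue) <= (\<integral>t. cmod (arc_density dl ?h t / (arc_point dl t - z)) \<partial>lebesgue)" by (rule integral_norm_bound)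
  then have "cmod (\<integral>t. arc_density dl ?h t / (arc_point dl t - z) \<partial>lebesgue) * B <= (\<integral>t. cmod (arc_density dl ?h t / (arc_point dl t - z)) \<partial>lebesgue) * B"
  by (rule mult_right_mono) (rule B_nonneg)
  also have "... = (\<integral>t. cmod (arc_density dl ?h t / (arc_point dl t - z)) * B \<partial>lebesgue)" by (rule Bochner_Integration.integral_mult_left_zero[symmetric])
  also have "... = ?I dl" using B_nonneg
  by (intro Bochner_Integration.integral_cong refl) (simp add: arc_density_def norm_mult norm_divide)
  finally show ?thesis .
  qed
  then have "(\<Sum>dl\<in>set GG. cmod (\<integral>t. arc_density dl ?h t / (arc_point dl t - z) \<partial>lebesgue) * B) <= (\<Sum>dl\<in>set GG. ?I dl)" by (rule sum_mono)
  moreover have "cmod (\<Sum>dl\<in>set GG. \<integral>t. arc_density dl ?h t / (arc_point dl t - z) \<partial>lebesgue) * B <= (\<Sum>dl\<in>set GG. cmod (\<integral>t. arc_density dl ?h t / (arc_point dl t - z) \<partial>lebesgue)) * B"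
  by (intro mult_right_mono norm_sum B_nonneg)
  ultimately show ?thesis by (simp add: sum_distrib_right)
  qed
  also have "(\<Sum>dl\<in>set GG. ?I dl) <= (\<Sum>dl\<in>set Sg. ?I dl)" by (rule sum_mono2) (auto intro!: integral_nonneg_AE)
  finally have 1: "cmod (\<Sum>dl\<in>set GG. \<integral>t. arc_density dl ?h t / (arc_point dl t - z) \<partial>lebesgue) * B <= (\<Sum>dl\<in>set Sg. ?I dl)" .
  let ?X = "cmod (\<Sum>dl\<in>set GG. \<integral>t. arc_density dl ?h t / (arc_point dl t - z) \<partial>lebesgue)"
  have "cmod (?m z) = ?X / (2 * pi)" unfolding cauchy_integral_eq[OF contours(1)] norm_divide by (simp add: norm_mult)
  also have "... <= ?X / 1" by (rule divide_left_mono) (use pi_gt3 in auto)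
  finally have "cmod (?m z) <= ?X" by simp
  then have "cmod (?m z * r z) <= ?X * B" unfolding norm_mult by (intro mult_mono B z) auto
  with 1 show "cmod (?m z * r z) <= (\<Sum>dl\<in>set Sg. ?I dl)" by linarith
 qed simp
qed

text \<open>For fixed z both sides are linear in h and bounded by its L2 norm, and they agree on
  indicators of compact subarcs; \<open>vanishes\<close> for their difference gives the
  rest.\<close>

theorem jump_formula:
 assumes h: "h : L2 GG" and z: "z ~: contour_set Sg"
 shows "boundary_jump r h : L2 Sg" "CI GG h z * r z = CI Sg (boundary_jump r h) z"
proof -
 have zG: "z ~: contour_set GG" using z by (simp add: contour_set_append)
 obtain K1 where K1: "K1 >= 0" "ALL h:L2 GG. cmod (CI GG h z) <= K1 * N2 GG h" using cauchy_integral_bound[OF contours(1) zG] by blast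
 obtain K2 where K2: "K2 >= 0" "ALL h:L2 Sg. cmod (CI Sg h z) <= K2 * N2 Sg h" using cauchy_integral_bound[OF contours(3) z] by blast
 obtain K where K: "K >= 0" "ALL h:L2 GG. boundary_jump r h : L2 Sg & N2 Sg (boundary_jump r h) <= K * N2 GG h"
  using boundary_jump_bounded by blast
 have J: "boundary_jump r f : L2 Sg" "N2 Sg (boundary_jump r f) <= K * N2 GG f" if "f : L2 GG" for f
  using bspec[OF K(2) that] by simp_all
 show "boundary_jump r h : L2 Sg" by (rule J[OF h])
 have one: "(1::real) = 1 \<or> (1::real) = -1" "(-1::real) = 1 \<or> (-1::real) = -1" by simp_all
 define La where "La = (%f. CI GG f z * r z - CI Sg (boundary_jump r f) z)"
 interpret L2_functional GG La "K1 * cmod (r z) + K2 * K"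
 proof
  show "is_contour GG" by (rule contours)
 next
  fix f g :: "complex => complex" assume f: "f : L2 GG" and g: "g : L2 GG"
  have fg: "(%x. f x + g x) : L2 GG" by (rule Lp_add(1)[OF f g]) simp
  have "AE s in arclength Sg. boundary_jump r (%x. f x + g x) s = boundary_jump r f s + boundary_jump r g s"
  using nt_value_cauchy_linear[OF f g one(1)] nt_value_cauchy_linear[OF f g one(2)]
  proof eventually_elim
  case (elim s)
  show ?case unfolding boundary_jump_def elim by (simp add: algebra_simps)
  qed
  from cauchy_integral_cong_AE[OF contours(3) z J(1)[OF fg] Lp_add(1)[OF J(1)[OF f] J(1)[OF g]] this]
  have "CI Sg (boundary_jump r (%x. f x + g x)) z = CI Sg (boundary_jump r f) z + CI Sg (boundary_jump r g) z"
  using cauchy_integral_add[OF contours(3) z J(1)[OF f] J(1)[OF g]] by simp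
  then show "La (%x. f x + g x) = La f + La g" unfolding La_def cauchy_integral_add[OF contours(1) zG f g] by (simp add: algebra_simps)
 next
  fix f :: "complex => complex" and c assume f: "f : L2 GG"
  have cf: "(%x. c * f x) : L2 GG" by (rule Lp_scale(1)[OF f]) simp
  have "AE s in arclength Sg. boundary_jump r (%x. c * f x) s = c * boundary_jump r f s"
  using nt_value_cauchy_scale[OF f one(1), where c = c] nt_value_cauchy_scale[OF f one(2), where c = c]
  proof eventually_elim
  case (elim s)
  show ?case unfolding boundary_jump_def elim by (simp add: algebra_simps)
  qed
  from cauchy_integral_cong_AE[OF contours(3) z J(1)[OF cf] Lp_scale(1)[OF J(1)[OF f]] this]
  have "CI Sg (boundary_jump r (%x. c * f x)) z = c * CI Sg (boundary_jump r f) z"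
  unfolding cauchy_integral_scale[OF contours(3)] by simp
  then show "La (%x. c * f x) = c * La f" unfolding La_def cauchy_integral_scale[OF contours(1)] by (simp add: algebra_simps)
 next
  fix f :: "complex => complex" assume f: "f : L2 GG"
  have "cmod (La f) <= cmod (CI GG f z) * cmod (r z) + cmod (CI Sg (boundary_jump r f) z)"
  unfolding La_def norm_mult[symmetric] by (rule norm_triangle_ineq4)
  also have "... <= K1 * N2 GG f * cmod (r z) + K2 * (K * N2 GG f)"
  using bspec[OF K1(2) f] order.trans[OF bspec[OF K2(2) J(1)[OF f]] mult_left_mono[OF J(2)[OF f] K2(1)]]
  by (intro add_mono mult_right_mono) auto
  finally show "cmod (La f) <= (K1 * cmod (r z) + K2 * K) * N2 GG f" by (simp add: algebra_simps)
 next
  fix gm and a b :: real assume "gm : set GG" "0 < a" "a < b" "b < 1"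
  then show "La (indicator (gm ` {a..b})) = 0" unfolding La_def using jump_formula_indicator z by simp
 qed
 show "CI GG h z * r z = CI Sg (boundary_jump r h) z" using vanishes[OF h] by (simp add: La_def)
qed

end

end

section \<open>Matrix-valued functions\<close>

lemma norm_scale_vec: "norm (c *s (x::complex^'k)) = norm c * norm x"
 unfolding norm_vec_def by (simp add: norm_mult L2_set_right_distrib)

text \<open>The norm is the Frobenius norm. A row of the product is a combination of rows of B, so
  Cauchy-Schwarz bounds it by the row of A times the norm of B; summing squares over the rows gives
  the claim.\<close>

lemma norm_matrix_mult:
 fixes A B :: "complex^'k^'k"
 shows "norm (A ** B) <= norm A * norm B"
proof -
 have row: "norm ((A ** B) $ i) <= norm (A $ i) * norm B" for i
 proof -
  have "(A ** B) $ i = (\<Sum>l\<in>UNIV. A $ i $ l *s B $ l)" by (simp add: vec_eq_iff matrix_matrix_mult_def sum_component)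
  then have "norm ((A ** B) $ i) <= (\<Sum>l\<in>UNIV. norm (A $ i $ l *s B $ l))" by (simp add: norm_sum)
  also have "... = (\<Sum>l\<in>UNIV. \<bar>norm (A $ i $ l)\<bar> * \<bar>norm (B $ l)\<bar>)" by (simp add: norm_scale_vec)
  also have "... <= L2_set (%l. norm (A $ i $ l)) UNIV * L2_set (%l. norm (B $ l)) UNIV" by (rule L2_set_mult_ineq)
  finally show ?thesis unfolding norm_vec_def[of "A $ i"] norm_vec_def[of B] .
 qed
 have "norm (A ** B) = L2_set (%i. norm ((A ** B) $ i)) UNIV" by (rule norm_vec_def)
 also have "... <= L2_set (%i. norm (A $ i) * norm B) UNIV" by (rule L2_set_mono) (auto intro: row)
 also have "... = L2_set (%i. norm (A $ i)) UNIV * norm B" by (rule L2_set_left_distrib[symmetric]) simp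
 also have "... = norm A * norm B" by (simp only: norm_vec_def[of A])
 finally show ?thesis .
qed

lemma matrix_mult_distribs:
 fixes A B C :: "complex^'k^'k"
 shows "A ** (B - C) = A ** B - A ** C" "(A - B) ** C = A ** C - B ** C" "A ** (B + C) = A ** B + A ** C" "(A + B) ** C = A ** C + B ** C"
 by (simp_all add: vec_eq_iff matrix_matrix_mult_def sum_subtractf sum.distrib algebra_simps)

lemma matrix_mult_scaleR: "(c *\<^sub>R A) ** B = c *\<^sub>R (A ** (B::complex^'k^'k))"
 by (simp add: vec_eq_iff matrix_matrix_mult_def scaleR_sum_right)

lemma norm_entry_le: "norm ((A::complex^'k^'k) $ i $ j) <= norm A"
 by (rule order.trans[OF Finite_Cartesian_Product.norm_nth_le Finite_Cartesian_Product.norm_nth_le])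

lemma norm_matrix_le_sum: "norm (A::complex^'k^'k) <= (\<Sum>x\<in>UNIV. norm (A $ fst x $ snd x))"
proof -
 have "norm A <= (\<Sum>i\<in>UNIV. norm (A $ i))" unfolding norm_vec_def[of A] by (rule L2_set_le_sum) simp
 also have "... <= (\<Sum>i\<in>UNIV. \<Sum>j\<in>UNIV. norm (A $ i $ j))"
 proof (rule sum_mono)
  show "norm (A $ i) <= (\<Sum>j\<in>UNIV. norm (A $ i $ j))" for i unfolding norm_vec_def[of "A $ i"] by (rule L2_set_le_sum) simp
 qed
 also have "... = (\<Sum>x\<in>UNIV \<times> UNIV. norm (A $ fst x $ snd x))" by (simp add: sum.cartesian_product case_prod_beta)
 finally show ?thesis by simp
qed

lemma tendsto_matrix_mult:
 fixes A B :: "complex^'k^'k"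
 assumes "(f \<longlongrightarrow> A) F" "(g \<longlongrightarrow> B) F" shows "((%z. f z ** g z) \<longlongrightarrow> A ** B) F"
 unfolding matrix_matrix_mult_def
 by (rule vec_tendstoI, rule vec_tendstoI, simp only: vec_lambda_beta, rule tendsto_sum, rule tendsto_mult)
  (rule tendsto_vec_nth[OF tendsto_vec_nth] assms)+

lemma borel_measurable_matrix:
 fixes f :: "'a => complex^'k^'k"
 assumes "!!i j. (%x. f x $ i $ j) : bmeas M" shows "f : bmeas M"
proof (subst borel_measurable_euclidean_space, rule ballI)
 fix b :: "complex^'k^'k" assume "b : Basis"
 then obtain i u where u: "b = axis i u" "u : Basis" by (auto simp: Basis_vec_def)
 then obtain j w where w: "u = axis j w" by (auto simp: Basis_vec_def)
 show "(%x. f x \<bullet> b) : bmeas M" unfolding u w inner_axis by (intro borel_measurable_inner assms) simp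
qed

lemma borel_measurable_entry:
 fixes f :: "'a => complex^'k^'k"
 assumes "f : bmeas M" shows "(%x. f x $ i $ j) : bmeas M"
 by (rule measurable_compose[OF assms borel_measurable_continuous_onI]) (intro continuous_intros)

lemma borel_measurable_matrix_mult:
 fixes f g :: "'a => complex^'k^'k"
 assumes "f : bmeas M" "g : bmeas M" shows "(%x. f x ** g x) : bmeas M"
 by (rule borel_measurable_matrix) (simp add: matrix_matrix_mult_def borel_measurable_sum borel_measurable_times borel_measurable_entry assms)

section \<open>Matrix-valued Lp functions\<close>

lemma Lp_entry:
 fixes f :: "'a => complex^'k^'k"
 assumes "f : Lp M q" "q > 0"
 shows "(%x. f x $ i $ j) : Lp M q" "Lp_norm M q (%x. f x $ i $ j) <= Lp_norm M q f"
 using Lp_mono[OF assms(1) borel_measurable_entry[OF Lp_measurable[OF assms(1)]] assms(2), of 1 i j] norm_entry_le by auto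

text \<open>K is chosen before the functions, and depends on the index set only through its size:
  each summand costs a factor 2 from \<open>Lp_add\<close>.\<close>

lemma Lp_sum_bound:
 assumes "finite I" and q: "q >= 1"
 shows "EX K>=0. \<forall>(g :: 'i => 'a => real) C. 0 <= C & (ALL i:I. g i : Lp M q & Lp_norm M q (g i) <= C) -->
  (%x. \<Sum>i\<in>I. g i x) : Lp M q & Lp_norm M q (%x. \<Sum>i\<in>I. g i x) <= K * C"
 using assms(1)
proof induction
 case empty
 show ?case using Lp_zero[of q M, where 'b = real] q by (intro exI[of _ 0]) simp
next
 case (insert a I)
 then obtain K where K: "K >= 0" "!!(g :: 'i => 'a => real) C. 0 <= C & (ALL i:I. g i : Lp M q & Lp_norm M q (g i) <= C) ==>
  (%x. \<Sum>i\<in>I. g i x) : Lp M q & Lp_norm M q (%x. \<Sum>i\<in>I. g i x) <= K * C" by blast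
 show ?case
 proof (intro exI[of _ "2 * (1 + K)"] conjI allI impI)
  show "0 <= 2 * (1 + K)" using K(1) by simp
  fix g :: "'i => 'a => real" and C
  assume g: "0 <= C & (ALL i:insert a I. g i : Lp M q & Lp_norm M q (g i) <= C)"
  then have 1: "(%x. \<Sum>i\<in>I. g i x) : Lp M q & Lp_norm M q (%x. \<Sum>i\<in>I. g i x) <= K * C" by (intro K(2)) blast
  have 2: "g a : Lp M q" "Lp_norm M q (g a) <= C" using g by blast+
  have e: "(\<Sum>i\<in>insert a I. g i x) = g a x + (\<Sum>i\<in>I. g i x)" for x using insert(1,2) by simp
  show "(%x. \<Sum>i\<in>insert a I. g i x) : Lp M q" unfolding e by (rule Lp_add(1)[OF 2(1) conjunct1[OF 1] q])
  have "Lp_norm M q (%x. \<Sum>i\<in>insert a I. g i x) <= 2 * (Lp_norm M q (g a) + Lp_norm M q (%x. \<Sum>i\<in>I. g i x))"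
  unfolding e by (rule Lp_add(2)[OF 2(1) conjunct1[OF 1] q])
  also have "... <= 2 * (C + K * C)" using conjunct2[OF 1] 2(2) by simp
  finally show "Lp_norm M q (%x. \<Sum>i\<in>insert a I. g i x) <= 2 * (1 + K) * C" by (simp add: algebra_simps)
 qed
qed

lemma Lp_matrix:
 assumes q: "q >= 1"
 shows "EX K>=0. \<forall>(f :: 'a => complex^'k^'k) C. 0 <= C & (ALL i j. (%x. f x $ i $ j) : Lp M q & Lp_norm M q (%x. f x $ i $ j) <= C) -->
  f : Lp M q & Lp_norm M q f <= K * C"
proof -
 have q0: "q > 0" using q by simp
 obtain K where K: "K >= 0" "\<forall>(g :: 'k \<times> 'k => 'a => real) C. 0 <= C & (ALL i:UNIV. g i : Lp M q & Lp_norm M q (g i) <= C) -->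
  (%x. \<Sum>i\<in>UNIV. g i x) : Lp M q & Lp_norm M q (%x. \<Sum>i\<in>UNIV. g i x) <= K * C"
  using Lp_sum_bound[of "UNIV :: ('k \<times> 'k) set" q M, OF finite_class.finite_UNIV q] by blast
 show ?thesis
 proof (intro exI[of _ K] conjI allI impI K(1))
  fix f :: "'a => complex^'k^'k" and C
  assume f: "0 <= C & (ALL i j. (%x. f x $ i $ j) : Lp M q & Lp_norm M q (%x. f x $ i $ j) <= C)"
  have 1: "(%x. norm (f x $ i $ j)) : Lp M q" "Lp_norm M q (%x. norm (f x $ i $ j)) <= C" for i j
  proof -
  have f': "(%x. f x $ i $ j) : Lp M q" "Lp_norm M q (%x. f x $ i $ j) <= C" using f by blast+
  have m: "(%x. norm (f x $ i $ j)) : bmeas M" using Lp_measurable[OF f'(1)] by measurable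
  show "(%x. norm (f x $ i $ j)) : Lp M q" "Lp_norm M q (%x. norm (f x $ i $ j)) <= C"
  using Lp_mono[OF f'(1) m q0, of 1] f'(2) by auto
  qed
  define G where "G = (%x. \<Sum>y\<in>UNIV. norm (f x $ fst y $ snd y))"
  have G: "G : Lp M q & Lp_norm M q G <= K * C" unfolding G_def
  by (rule K(2)[rule_format]) (use f 1 in simp)
  have fm: "f : bmeas M" by (rule borel_measurable_matrix) (use f Lp_measurable in blast)
  have "AE x in M. norm (f x) <= 1 * norm (G x)"
  proof (rule AE_I2)
  fix x
  have "norm (f x) <= G x" unfolding G_def by (rule norm_matrix_le_sum)
  then show "norm (f x) <= 1 * norm (G x)" by simp
  qed
  from Lp_mono[OF conjunct1[OF G] fm q0 zero_le_one this] G
  show "f : Lp M q" "Lp_norm M q f <= K * C" by auto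
 qed
qed

lemma Lp_mult_bounded:
 fixes f b :: "'a => complex^'k^'k"
 assumes f: "f : Lp M q" "q > 0" and b: "b : bmeas M" "AE x in M. norm (b x) <= B" "0 <= B"
 shows "(%x. f x ** b x) : Lp M q" "Lp_norm M q (%x. f x ** b x) <= B * Lp_norm M q f"
proof -
 have "AE x in M. norm (f x ** b x) <= B * norm (f x)" using b(2)
 proof eventually_elim
  case (elim x)
  have "norm (f x ** b x) <= norm (f x) * norm (b x)" by (rule norm_matrix_mult)
  also have "... <= norm (f x) * B" by (rule mult_left_mono[OF elim]) simp
  finally show ?case by (simp add: mult.commute)
 qed
 from Lp_mono[OF f(1) borel_measurable_matrix_mult[OF Lp_measurable[OF f(1)] b(1)] f(2) b(3) this]
 show "(%x. f x ** b x) : Lp M q" "Lp_norm M q (%x. f x ** b x) <= B * Lp_norm M q f" .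
qed

lemma Lp_scaleR:
 fixes f :: "'a => 'b::{real_normed_vector, second_countable_topology}"
 assumes "f : Lp M q" "q > 0"
 shows "(%x. c *\<^sub>R f x) : Lp M q" "Lp_norm M q (%x. c *\<^sub>R f x) <= \<bar>c\<bar> * Lp_norm M q f"
proof -
 have m: "(%x. c *\<^sub>R f x) : bmeas M" using Lp_measurable[OF assms(1)] by measurable
 show "(%x. c *\<^sub>R f x) : Lp M q" "Lp_norm M q (%x. c *\<^sub>R f x) <= \<bar>c\<bar> * Lp_norm M q f"
  using Lp_mono[OF assms(1) m assms(2), of "\<bar>c\<bar>"] by auto
qed

text \<open>The bound in \<open>L2_product\<close> is not homogeneous in f and is stated for norm at
  most 1. Membership for arbitrary f follows after division by N, the maximum of 1 and the norm of
  f.\<close>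

lemma L2_mult:
 fixes f b :: "'a => complex^'k^'k"
 assumes f: "f : Lp M p" and p: "2 < p" and b: "b : Lp M 2" "AE x in M. norm (b x) <= B" "0 <= B"
 shows "(%x. f x ** b x) : Lp M 2" "Lp_norm M p f <= 1 ==> Lp_norm M 2 (%x. f x ** b x) <= Lp_norm M 2 b + B"
proof -
 have p0: "p > 0" using p by simp
 have m: "(%x. u x ** b x) : bmeas M" if "u : Lp M p" for u :: "'a => complex^'k^'k"
  by (rule borel_measurable_matrix_mult[OF Lp_measurable[OF that] Lp_measurable[OF b(1)]])
 note L = L2_product[OF _ p _ b m AE_I2[OF norm_matrix_mult]]
 define N where "N = max 1 (Lp_norm M p f)"
 have N: "N >= 1" "Lp_norm M p f <= N" by (auto simp: N_def)
 note u = Lp_scaleR[OF f p0, of "1 / N"]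
 have "\<bar>1 / N\<bar> * Lp_norm M p f <= 1" using N by simp
 then have u2: "Lp_norm M p (%x. (1 / N) *\<^sub>R f x) <= 1" using u(2) by linarith
 have "(%x. N *\<^sub>R ((1 / N) *\<^sub>R f x ** b x)) : Lp M 2"
  by (rule Lp_scaleR(1)[OF L(1)[OF u(1) u2 u(1)]]) simp
 moreover have "N *\<^sub>R ((1 / N) *\<^sub>R f x ** b x) = f x ** b x" for x using N(1) by (simp add: matrix_mult_scaleR)
 ultimately show "(%x. f x ** b x) : Lp M 2" by simp
 show "Lp_norm M 2 (%x. f x ** b x) <= Lp_norm M 2 b + B" if "Lp_norm M p f <= 1" by (rule L(2)[OF f that f])
qed

section \<open>A priori bounds from operator norms of inverses\<close>

lemma Lp_inverse_spec:
 assumes "Lp_bijective M q T" "F : Lp M q"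
 shows "Lp_inverse M q T F : Lp M q" "AE x in M. T (Lp_inverse M q T F) x = F x"
proof -
 have "EX h. h : Lp M q & (AE x in M. T h x = F x)" using assms unfolding Lp_bijective_def by blast
 from someI_ex[OF this] show "Lp_inverse M q T F : Lp M q" "AE x in M. T (Lp_inverse M q T F) x = F x" unfolding Lp_inverse_def by auto
qed

text \<open>The inverse is a choice, determined only up to null sets and not literally linear, so
  its operator norm controls the unit ball only. The image T h is normalised, inverted and rescaled,
  and injectivity identifies the result with h. If T h has norm 0, homogeneity with c = 0 and
  injectivity give h = 0 almost everywhere.\<close>

lemma Lp_inverse_bound:
 fixes T :: "('a => 'b::{real_normed_vector, second_countable_topology}) => 'a => 'b"
 assumes bij: "Lp_bijective M q T" and q: "q > 0"
  and hom: "!!h c. h : Lp M q ==> AE x in M. T (%x. c *\<^sub>R h x) x = c *\<^sub>R T h x"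
  and A: "Lp_opnorm M q (Lp_inverse M q T) <= ennreal A" "0 <= A" and h: "h : Lp M q"
 shows "Lp_norm M q h <= A * Lp_norm M q (T h)"
proof -
 have inj: "AE x in M. u x = u' x" if "u : Lp M q" "u' : Lp M q" "AE x in M. T u x = T u' x" for u u'
  using bij that unfolding Lp_bijective_def by blast
 have Th: "T h : Lp M q" using bij h unfolding Lp_bijective_def by blast
 let ?N = "Lp_norm M q (T h)"
 show ?thesis
 proof (cases "?N = 0")
  case True
  have "AE x in M. T h x = 0" by (rule Lp_norm_eq_0[OF Th q True])
  with hom[OF h, of 0] have "AE x in M. T h x = T (%x. 0 *\<^sub>R h x) x" by eventually_elim simp
  from inj[OF h Lp_scaleR(1)[OF h q] this] have "AE x in M. 0 = h x" by eventually_elim simp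
  from Lp_cong_AE(2)[OF Lp_zero(1)[OF q] Lp_measurable[OF h] q this] show ?thesis using True Lp_zero(2)[OF q, of M, where 'b = 'b] by simp
 next
  case False
  then have N: "?N > 0" using Lp_norm_nonneg[of M q "T h"] by linarith
  define F where "F = (%x. (1 / ?N) *\<^sub>R T h x)"
  have F: "F : Lp M q" unfolding F_def by (rule Lp_scaleR(1)[OF Th q])
  have F1: "Lp_norm M q F <= 1" using Lp_scaleR(2)[OF Th q, of "1 / ?N"] N by (simp add: F_def)
  define u where "u = Lp_inverse M q T F"
  have u: "u : Lp M q" "AE x in M. T u x = F x" unfolding u_def by (rule Lp_inverse_spec[OF bij F])+
  have "ennreal (Lp_norm M q u) <= Lp_opnorm M q (Lp_inverse M q T)"
  unfolding Lp_opnorm_def u_def by (rule SUP_upper) (use F F1 in simp)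
  then have uA: "Lp_norm M q u <= A" using A by (metis ennreal_le_iff order.trans)
  have "AE x in M. T (%x. ?N *\<^sub>R u x) x = T h x" using hom[OF u(1), of ?N] u(2)
  proof eventually_elim
  case (elim x)
  then show ?case using N by (simp add: F_def)
  qed
  from inj[OF Lp_scaleR(1)[OF u(1) q] h this]
  have "Lp_norm M q h <= Lp_norm M q (%x. ?N *\<^sub>R u x)" by (rule Lp_cong_AE(2)[OF Lp_scaleR(1)[OF u(1) q] Lp_measurable[OF h] q])
  also have "... <= ?N * Lp_norm M q u" using Lp_scaleR(2)[OF u(1) q, of ?N] N by simp
  also have "... <= ?N * A" using uA N by (intro mult_left_mono) auto
  finally show ?thesis by (simp add: mult.commute)
 qed
qed

lemma matrix_inverse_of_right:
 fixes A B :: "complex^'k^'k"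
 assumes "A ** B = mat 1" shows "B ** A = mat 1" "matrix_inv A = B"
proof -
 show BA: "B ** A = mat 1" using assms by (simp add: matrix_left_right_inverse)
 have "A ** matrix_inv A = mat 1 & matrix_inv A ** A = mat 1"
  unfolding matrix_inv_def by (rule someI[of _ B]) (simp add: assms BA)
 then have "matrix_inv A ** A = mat 1" by blast
 then have "matrix_inv A = matrix_inv A ** (A ** B)" "matrix_inv A ** A ** B = B" by (simp_all add: assms)
 then show "matrix_inv A = B" by (simp add: matrix_mul_assoc)
qed

section \<open>Matrix Cauchy operators on the two contours\<close>

context contour_pair
begin

abbreviation C_mat :: "real => (complex => complex^'k^'k) => complex => complex^'k^'k" where
 "C_mat sx h \<equiv> nt_value GG sx (cauchy_mat GG h)"

lemma cauchy_mat_entry [simp]: "cauchy_mat GG h z $ i $ j = CI GG (%s. h s $ i $ j) z"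
 by (simp add: cauchy_mat_def)

lemma C_mat_limit:
 fixes h :: "complex => complex^'k^'k"
 assumes h: "h : Lp (arclength GG) q" and q: "1 <= q" and sx: "sx = 1 \<or> sx = -1"
 shows "AE s in arclength GG. has_nt_limit GG sx (cauchy_mat GG h) s (C_mat sx h s)"
  and "AE s in arclength GG. ALL i j. C_mat sx h s $ i $ j = nt_value GG sx (CI GG (%s. h s $ i $ j)) s"
proof -
 have s': "sx : {1,-1}" using sx by simp
 have q0: "q > 0" using q by simp
 have *: "ALL p>=1. ALL h:Lp (arclength GG) p. ALL sx:{1, -1}. AE z in arclength GG. EX l. has_nt_limit GG sx (CI GG h) z l"
  using cG unfolding cauchy_contour_def by blast
 have "AE s in arclength GG. EX l. has_nt_limit GG sx (CI GG (%s. h s $ i $ j)) s l" for i j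
  by (rule *[rule_format, OF q Lp_entry(1)[OF h q0] s'])
 then have ex: "AE s in arclength GG. ALL i j. EX l. has_nt_limit GG sx (CI GG (%s. h s $ i $ j)) s l"
  by (intro eventually_all_finite)
 have "AE s in arclength GG. has_nt_limit GG sx (cauchy_mat GG h) s (C_mat sx h s) & (ALL i j. C_mat sx h s $ i $ j = nt_value GG sx (CI GG (%s. h s $ i $ j)) s)"
  using ex
 proof eventually_elim
  case (elim s)
  have e: "has_nt_limit GG sx (CI GG (%s. h s $ i $ j)) s (nt_value GG sx (CI GG (%s. h s $ i $ j)) s)" for i j
  proof -
  obtain l where l: "has_nt_limit GG sx (CI GG (%s. h s $ i $ j)) s l" using elim by blast
  show ?thesis using nt_value_eq[OF contours(1) sx l] l by simp
  qed
  define L where "L = (\<chi> i j. nt_value GG sx (CI GG (%s. h s $ i $ j)) s)"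
  have "has_nt_limit GG sx (cauchy_mat GG h) s L"
  unfolding has_nt_limit_matrix[OF contours(1)] cauchy_mat_entry using e by (simp add: L_def)
  moreover from nt_value_eq[OF contours(1) sx this] have "C_mat sx h s = L" .
  ultimately show ?case by (simp add: L_def)
 qed
 then show "AE s in arclength GG. has_nt_limit GG sx (cauchy_mat GG h) s (C_mat sx h s)"
  and "AE s in arclength GG. ALL i j. C_mat sx h s $ i $ j = nt_value GG sx (CI GG (%s. h s $ i $ j)) s"
  by (auto elim: eventually_mono)
qed

lemma C_mat_bounded:
 assumes q: "1 < q" and sx: "sx = 1 \<or> sx = -1"
 shows "EX K>=0. ALL h::complex => complex^'k^'k. h : Lp (arclength GG) q --> C_mat sx h : Lp (arclength GG) q & Lp_norm (arclength GG) q (C_mat sx h) <= K * Lp_norm (arclength GG) q h"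
proof -
 have q1: "1 <= q" "0 < q" using q by simp_all
 obtain K where K: "K >= 0" "ALL h:Lp (arclength GG) q. nt_value GG sx (CI GG h) : Lp (arclength GG) q &
  Lp_norm (arclength GG) q (nt_value GG sx (CI GG h)) <= K * Lp_norm (arclength GG) q h" using C_bounded[OF q sx] by blast
 obtain K' where K': "K' >= 0" "\<forall>(f :: complex => complex^'k^'k) C. 0 <= C & (ALL i j. (%x. f x $ i $ j) : Lp (arclength GG) q & Lp_norm (arclength GG) q (%x. f x $ i $ j) <= C) -->
  f : Lp (arclength GG) q & Lp_norm (arclength GG) q f <= K' * C" using Lp_matrix[OF q1(1)] by blast
 show ?thesis
 proof (intro exI[of _ "K' * K"] conjI[of "0 <= K' * K"] allI impI)
  show "0 <= K' * K" using K(1) K'(1) by simp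
  fix h :: "complex => complex^'k^'k" assume h: "h : Lp (arclength GG) q"
  have "(%x. C_mat sx h x $ i $ j) : Lp (arclength GG) q & Lp_norm (arclength GG) q (%x. C_mat sx h x $ i $ j) <= K * Lp_norm (arclength GG) q h" for i j
  proof -
  note e = Lp_entry[OF h q1(2), of i j]
  note Ke = bspec[OF K(2) e(1)]
  have ae: "AE s in arclength GG. nt_value GG sx (CI GG (%s. h s $ i $ j)) s = C_mat sx h s $ i $ j"
  using C_mat_limit(2)[OF h q1(1) sx] by eventually_elim simp
  note c = Lp_cong_AE[OF conjunct1[OF Ke] arclength_measurable_AE[OF Lp_measurable[OF conjunct1[OF Ke]] ae] q1(2) ae]
  show ?thesis using c Ke mult_left_mono[OF e(2) K(1)] by linarith
  qed
  with K'(2)[rule_format, of "K * Lp_norm (arclength GG) q h" "C_mat sx h"] K(1)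
  show "C_mat sx h : Lp (arclength GG) q & Lp_norm (arclength GG) q (C_mat sx h) <= K' * K * Lp_norm (arclength GG) q h" by (simp add: mult.assoc)
 qed
qed

text \<open>The third function is required to be the sum only almost everywhere, so the lemma also
  expresses that the operators respect equality almost everywhere.\<close>

lemma C_mat_add:
 fixes h1 h2 h3 :: "complex => complex^'k^'k"
 assumes h: "h1 : L2 GG" "h2 : L2 GG" "h3 : L2 GG" and eq: "AE s in arclength GG. h3 s = h1 s + h2 s"
  and sx: "sx = 1 \<or> sx = -1"
 shows "AE s in arclength GG. C_mat sx h3 s = C_mat sx h1 s + C_mat sx h2 s"
proof -
 have two: "(1::real) <= 2" "(0::real) < 2" by simp_all
 have off: "cauchy_mat GG h3 z = cauchy_mat GG h1 z + cauchy_mat GG h2 z" if z: "z ~: contour_set GG" for z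
 proof -
  have "CI GG (%s. h3 s $ i $ j) z = CI GG (%s. h1 s $ i $ j) z + CI GG (%s. h2 s $ i $ j) z" for i j
  proof -
  note e = Lp_entry(1)[OF h(1) two(2), of i j] Lp_entry(1)[OF h(2) two(2), of i j] Lp_entry(1)[OF h(3) two(2), of i j]
  have "AE s in arclength GG. h3 s $ i $ j = h1 s $ i $ j + h2 s $ i $ j" using eq by eventually_elim simp
  from cauchy_integral_cong_AE[OF contours(1) z e(3) Lp_add(1)[OF e(1,2) two(1)] this] cauchy_integral_add[OF contours(1) z e(1,2)]
  show ?thesis by simp
  qed
  then show ?thesis by (simp add: vec_eq_iff)
 qed
 show ?thesis using C_mat_limit(1)[OF h(1) two(1) sx] C_mat_limit(1)[OF h(2) two(1) sx] C_mat_limit(1)[OF h(3) two(1) sx]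
 proof eventually_elim
  case (elim s)
  show ?case by (rule nt_limit_unique_off[OF contours(1) kG sx elim(3) has_nt_limit_combine[OF contours(1) elim(1,2) tendsto_add] off])
 qed
qed

lemma C_mat_scaleR:
 fixes h :: "complex => complex^'k^'k"
 assumes h: "h : Lp (arclength GG) q" and q: "1 <= q" and sx: "sx = 1 \<or> sx = -1"
 shows "AE s in arclength GG. C_mat sx (%s. c *\<^sub>R h s) s = c *\<^sub>R C_mat sx h s"
 using C_mat_limit(1)[OF h q sx]
proof eventually_elim
 case (elim s)
 have "has_nt_limit GG sx (%z. c *\<^sub>R cauchy_mat GG h z) s (c *\<^sub>R C_mat sx h s)"
  by (rule has_nt_limit_combine[OF contours(1) elim elim, of "%x y. c *\<^sub>R x"]) (rule tendsto_scaleR[OF tendsto_const])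
 moreover have "(%z. c *\<^sub>R cauchy_mat GG h z) = cauchy_mat GG (%s. c *\<^sub>R h s)"
  using cauchy_integral_scale[OF contours(1), of "complex_of_real c"] by (simp add: fun_eq_iff vec_eq_iff scaleR_conv_of_real[where 'a = complex])
 ultimately show ?case using nt_value_eq[OF contours(1) sx] by simp
qed

lemma C_mat_jump:
 fixes h :: "complex => complex^'k^'k"
 assumes h: "h : L2 GG"
 shows "AE s in arclength GG. C_mat 1 h s = C_mat (-1) h s + h s"
proof -
 have two: "(1::real) <= 2" "(0::real) < 2" by simp_all
 have *: "ALL p>=1. ALL h:Lp (arclength GG) p. AE z in arclength GG.
  nt_value GG 1 (CI GG h) z - nt_value GG (-1) (CI GG h) z = h z" using cG unfolding cauchy_contour_def by blast
 have "AE s in arclength GG. nt_value GG 1 (CI GG (%s. h s $ i $ j)) s - nt_value GG (-1) (CI GG (%s. h s $ i $ j)) s = h s $ i $ j" for i j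
  by (rule *[rule_format, OF two(1) Lp_entry(1)[OF h two(2)]])
 then have "AE s in arclength GG. ALL i j. nt_value GG 1 (CI GG (%s. h s $ i $ j)) s - nt_value GG (-1) (CI GG (%s. h s $ i $ j)) s = h s $ i $ j"
  by (intro eventually_all_finite)
 with C_mat_limit(2)[OF h two(1), of 1, OF disjI1[OF refl]] C_mat_limit(2)[OF h two(1), of "-1", OF disjI2[OF refl]]
 show ?thesis
 proof eventually_elim
  case (elim s)
  then show ?case by (simp add: vec_eq_iff diff_eq_eq add.commute)
 qed
qed

lemma across_mat_bounded:
 "EX K>=0. ALL h::complex => complex^'k^'k. h : L2 GG --> cauchy_mat GG h : Lp (arclength GG') 2 & Lp_norm (arclength GG') 2 (cauchy_mat GG h) <= K * N2 GG h"
proof -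
 have two: "(1::real) <= 2" "(0::real) < 2" "(1::real) < 2" by simp_all
 obtain K where K: "K >= 0" "ALL h:L2 GG. CI GG h : Lp (arclength GG') 2 &
  Lp_norm (arclength GG') 2 (CI GG h) <= K * N2 GG h" using across_bounded[OF two(3)] by blast
 obtain K' where K': "K' >= 0" "\<forall>(f :: complex => complex^'k^'k) C. 0 <= C & (ALL i j. (%x. f x $ i $ j) : Lp (arclength GG') 2 & Lp_norm (arclength GG') 2 (%x. f x $ i $ j) <= C) -->
  f : Lp (arclength GG') 2 & Lp_norm (arclength GG') 2 f <= K' * C" using Lp_matrix[OF two(1)] by blast
 show ?thesis
 proof (intro exI[of _ "K' * K"] conjI[of "0 <= K' * K"] allI impI)
  show "0 <= K' * K" using K(1) K'(1) by simp
  fix h :: "complex => complex^'k^'k" assume h: "h : L2 GG"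
  have "(%x. cauchy_mat GG h x $ i $ j) : Lp (arclength GG') 2 & Lp_norm (arclength GG') 2 (%x. cauchy_mat GG h x $ i $ j) <= K * N2 GG h" for i j
  using bspec[OF K(2) Lp_entry(1)[OF h two(2), of i j]] mult_left_mono[OF Lp_entry(2)[OF h two(2), of i j] K(1)] by simp
  with K'(2)[rule_format, of "K * N2 GG h" "cauchy_mat GG h"] K(1)
  show "cauchy_mat GG h : Lp (arclength GG') 2 & Lp_norm (arclength GG') 2 (cauchy_mat GG h) <= K' * K * N2 GG h" by (simp add: mult.assoc)
 qed
qed

text \<open>Both the L2 and the L-infinity norm on the first contour are bounded by the L2 norm on
  the second, entry by entry; \<open>Lp_Int_Linf\<close> then yields Lp with the same bound.\<close>

lemma across_mat_bounded':
 assumes p: "2 < p"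
 shows "EX K>=0. ALL h::complex => complex^'k^'k. h : Lp (arclength GG') 2 --> cauchy_mat GG' h : L2 GG & cauchy_mat GG' h : Lp (arclength GG) p &
  Lp_norm (arclength GG) p (cauchy_mat GG' h) <= K * Lp_norm (arclength GG') 2 h"
proof -
 have two: "(1::real) <= 2" "(0::real) < 2" "(1::real) < 2" and p1: "1 <= p" using p by simp_all
 obtain K where K: "K >= 0" "ALL h:Lp (arclength GG') 2. CI GG' h : L2 GG & (AE s in arclength GG. cmod (CI GG' h s) <= K * Lp_norm (arclength GG') 2 h) &
  N2 GG (CI GG' h) <= K * Lp_norm (arclength GG') 2 h" using across_bounded'[OF two(3)] by blast
 obtain K2 where K2: "K2 >= 0" "\<forall>(f :: complex => complex^'k^'k) C. 0 <= C & (ALL i j. (%x. f x $ i $ j) : L2 GG & N2 GG (%x. f x $ i $ j) <= C) -->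
  f : L2 GG & N2 GG f <= K2 * C" using Lp_matrix[OF two(1)] by blast
 obtain K' where K': "K' >= 0" "\<forall>(f :: complex => complex^'k^'k) C. 0 <= C & (ALL i j. (%x. f x $ i $ j) : Lp (arclength GG) p & Lp_norm (arclength GG) p (%x. f x $ i $ j) <= C) -->
  f : Lp (arclength GG) p & Lp_norm (arclength GG) p f <= K' * C" using Lp_matrix[OF p1] by blast
 show ?thesis
 proof (intro exI[of _ "K' * K"] conjI[of "0 <= K' * K"] allI impI)
  show "0 <= K' * K" using K(1) K'(1) by simp
  fix h :: "complex => complex^'k^'k" assume h: "h : Lp (arclength GG') 2"
  define C where "C = K * Lp_norm (arclength GG') 2 h"
  have C: "0 <= C" using K(1) by (simp add: C_def)
  have e: "(%x. cauchy_mat GG' h x $ i $ j) = CI GG' (%s. h s $ i $ j)" for i j by (simp add: cauchy_mat_def fun_eq_iff)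
  have 1: "(%x. cauchy_mat GG' h x $ i $ j) : L2 GG & N2 GG (%x. cauchy_mat GG' h x $ i $ j) <= C"
  "(%x. cauchy_mat GG' h x $ i $ j) : Lp (arclength GG) p & Lp_norm (arclength GG) p (%x. cauchy_mat GG' h x $ i $ j) <= C" for i j
  proof -
  note B = bspec[OF K(2) Lp_entry(1)[OF h two(2), of i j]]
  have le: "K * Lp_norm (arclength GG') 2 (%s. h s $ i $ j) <= C" unfolding C_def by (rule mult_left_mono[OF Lp_entry(2)[OF h two(2)] K(1)])
  have B2: "CI GG' (%s. h s $ i $ j) : L2 GG" "N2 GG (CI GG' (%s. h s $ i $ j)) <= C"
  using B le by auto
  have B1: "AE s in arclength GG. cmod (CI GG' (%s. h s $ i $ j) s) <= C"
  by (rule eventually_mono[OF conjunct1[OF conjunct2[OF B]]]) (use le in linarith)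
  show "(%x. cauchy_mat GG' h x $ i $ j) : L2 GG & N2 GG (%x. cauchy_mat GG' h x $ i $ j) <= C"
  "(%x. cauchy_mat GG' h x $ i $ j) : Lp (arclength GG) p & Lp_norm (arclength GG) p (%x. cauchy_mat GG' h x $ i $ j) <= C"
  unfolding e using B2 Lp_Int_Linf[OF B2(1) B1 B2(2) C p] by auto
  qed
  have "cauchy_mat GG' h : L2 GG" using K2(2)[rule_format, of C "cauchy_mat GG' h"] C 1(1) by blast
  moreover have "cauchy_mat GG' h : Lp (arclength GG) p & Lp_norm (arclength GG) p (cauchy_mat GG' h) <= K' * C" using K'(2)[rule_format, of C "cauchy_mat GG' h"] C 1(2) by blast
  ultimately show "cauchy_mat GG' h : L2 GG & cauchy_mat GG' h : Lp (arclength GG) p & Lp_norm (arclength GG) p (cauchy_mat GG' h) <= K' * K * Lp_norm (arclength GG') 2 h"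
  by (simp add: C_def mult.assoc)
 qed
qed

lemma boundary_values_matrix:
 fixes Q :: "complex => complex^'k^'k"
 assumes Q: "!!i j. (%z. Q z $ i $ j) holomorphic_on - contour_set Sg" and B: "!!z. z ~: contour_set Sg ==> norm (Q z) <= B" and sx: "sx = 1 \<or> sx = -1"
 shows "AE s in arclength Sg. has_nt_limit Sg sx Q s (nt_value Sg sx Q s)"
  "AE s in arclength Sg. ALL i j. nt_value Sg sx Q s $ i $ j = nt_value Sg sx (%z. Q z $ i $ j) s"
  "AE s in arclength Sg. norm (nt_value Sg sx Q s) <= B" "nt_value Sg sx Q : bmeas (arclength Sg)"
proof -
 have eB: "cmod (Q z $ i $ j) <= B" if "z ~: contour_set Sg" for z i j using order.trans[OF norm_entry_le B[OF that]] .
 note bv = boundary_values_r[OF Q eB sx]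
 have "AE s in arclength Sg. ALL i j. has_nt_limit Sg sx (%z. Q z $ i $ j) s (nt_value Sg sx (%z. Q z $ i $ j) s)"
  by (intro eventually_all_finite bv(1))
 then have both: "AE s in arclength Sg. has_nt_limit Sg sx Q s (nt_value Sg sx Q s) & (ALL i j. nt_value Sg sx Q s $ i $ j = nt_value Sg sx (%z. Q z $ i $ j) s)"
 proof eventually_elim
  case (elim s)
  define L where "L = (\<chi> i j. nt_value Sg sx (%z. Q z $ i $ j) s)"
  have "has_nt_limit Sg sx Q s L" unfolding has_nt_limit_matrix[OF contours(3)] using elim by (simp add: L_def)
  moreover from nt_value_eq[OF contours(3) sx this] have "nt_value Sg sx Q s = L" .
  ultimately show ?case by (simp add: L_def)
 qed
 show 1: "AE s in arclength Sg. has_nt_limit Sg sx Q s (nt_value Sg sx Q s)" by (rule eventually_mono[OF both]) blast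
 show 2: "AE s in arclength Sg. ALL i j. nt_value Sg sx Q s $ i $ j = nt_value Sg sx (%z. Q z $ i $ j) s" by (rule eventually_mono[OF both]) blast
 show "AE s in arclength Sg. norm (nt_value Sg sx Q s) <= B"
  by (rule eventually_mono[OF 1]) (rule nt_limit_bound[OF contours(3) kS sx _ B])
 show "nt_value Sg sx Q : bmeas (arclength Sg)"
 proof (rule borel_measurable_matrix)
  fix i j
  have bv3: "nt_value Sg sx (%z. Q z $ i $ j) : bmeas (arclength Sg)" by (rule bv(3))
  have "AE s in arclength Sg. nt_value Sg sx (%z. Q z $ i $ j) s = nt_value Sg sx Q s $ i $ j" using 2 by eventually_elim simp
  then show "(%s. nt_value Sg sx Q s $ i $ j) : bmeas (arclength Sg)"
  by (rule arclength_measurable_AE[where f = "nt_value Sg sx (%z. Q z $ i $ j)" and g = "%s. nt_value Sg sx Q s $ i $ j", OF bv3])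
 qed
qed

end

section \<open>Transfer of the resolvent\<close>

lemma cauchy_integral_append: "CI (GG @ GG') h z = CI GG h z + CI GG' h z"
 by (simp add: cauchy_integral_def add_divide_distrib)

lemma cauchy_integral_sum:
 assumes Sg: "is_contour Sg" and z: "z ~: contour_set Sg" and I: "finite I" and h: "!!i. i : I ==> h i : L2 Sg"
 shows "(%s. \<Sum>i\<in>I. h i s) : L2 Sg & CI Sg (%s. \<Sum>i\<in>I. h i s) z = (\<Sum>i\<in>I. CI Sg (h i) z)"
 using I h
proof (induction I)
 case empty
 then show ?case using Lp_zero(1)[of 2 "arclength Sg", where 'b = complex] by (simp add: cauchy_integral_def set_lebesgue_integral_def)
next
 case (insert a I)
 have IH: "(%s. \<Sum>i\<in>I. h i s) : L2 Sg" "CI Sg (%s. \<Sum>i\<in>I. h i s) z = (\<Sum>i\<in>I. CI Sg (h i) z)"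
  using insert by auto
 have a: "h a : L2 Sg" using insert by blast
 have e: "(%s. \<Sum>i\<in>insert a I. h i s) = (%s. h a s + (\<Sum>i\<in>I. h i s))" using insert(1,2) by simp
 have "(%s. h a s + (\<Sum>i\<in>I. h i s)) : L2 Sg" by (rule Lp_add(1)[OF a IH(1)]) simp
 then show ?case unfolding e using cauchy_integral_add[OF Sg z a IH(1)] IH(2) insert(1,2) by simp
qed

text \<open>One constant K >= 1 stands for all operator bounds that depend only on the contours, p
  and the matrix size. S is the inverse of R with bounds rhR and rhS; V and W bound the deviations
  of the jump matrices from the identity.\<close>

locale jump_relation = contour_pair +
 fixes v w R S :: "complex => complex^'k^'k" and V W rhR rhS K p :: real
 assumes p: "2 < p" and K: "1 <= K"
  and K1: "!!h::complex => complex^'k^'k. h : L2 GG ==> C_mat (-1) h : L2 GG & N2 GG (C_mat (-1) h) <= K * N2 GG h"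
  and K2: "!!h::complex => complex^'k^'k. h : Lp (arclength GG) p ==> C_mat (-1) h : Lp (arclength GG) p & Lp_norm (arclength GG) p (C_mat (-1) h) <= K * Lp_norm (arclength GG) p h"
  and K3: "!!h::complex => complex^'k^'k. h : L2 GG ==> cauchy_mat GG h : Lp (arclength GG') 2 & Lp_norm (arclength GG') 2 (cauchy_mat GG h) <= K * N2 GG h"
  and K4: "!!h::complex => complex^'k^'k. h : Lp (arclength GG') 2 ==> cauchy_mat GG' h : L2 GG & cauchy_mat GG' h : Lp (arclength GG) p &
  Lp_norm (arclength GG) p (cauchy_mat GG' h) <= K * Lp_norm (arclength GG') 2 h"
  and Rh: "!!i j. (%z. R z $ i $ j) holomorphic_on - contour_set (GG @ GG')" and RB: "!!z. z ~: contour_set (GG @ GG') ==> norm (R z) <= rhR"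
  and Sh: "!!i j. (%z. S z $ i $ j) holomorphic_on - contour_set (GG @ GG')" and SB: "!!z. z ~: contour_set (GG @ GG') ==> norm (S z) <= rhS"
  and rh: "0 <= rhR" "0 <= rhS"
  and RS: "!!z. z ~: contour_set (GG @ GG') ==> R z ** S z = mat 1"
  and VB: "AE s in arclength GG. norm (v s - mat 1) <= V" "0 <= V" and WB: "AE s in arclength GG. norm (w s - mat 1) <= W" "0 <= W"
  and vL: "(%s. v s - mat 1) : L2 GG" and wL: "(%s. w s - mat 1) : L2 GG"
  and vw: "AE s in arclength GG. v s = matrix_inv (nt_value (GG @ GG') (-1) R s) ** w s ** nt_value (GG @ GG') 1 R s"
  and ex: "resolvent_exists GG w 2" "resolvent_exists GG w p" "resolvent_exists GG v 2"
begin

abbreviation "M \<equiv> arclength GG"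
abbreviation "M' \<equiv> arclength GG'"
abbreviation (input) "resolvent_op u \<equiv> (%h z. h z - C_op GG u h z)"

lemma exps: "(1::real) <= 2" "(0::real) < 2" "1 <= p" "0 < p" and signs: "(1::real) = 1 \<or> (1::real) = -1" "(-1::real) = 1 \<or> (-1::real) = -1"
 using p by simp_all

lemma C_op_eq: "C_op GG u h s = C_mat (-1) (%s. h s ** (u s - mat 1)) s"
 by (simp add: C_op_def)

lemma RS_boundary:
 assumes sx: "sx = 1 \<or> sx = -1"
 shows "AE s in arclength Sg. nt_value Sg sx R s ** nt_value Sg sx S s = mat 1"
proof -
 have 1: "AE s in arclength Sg. has_nt_limit Sg sx R s (nt_value Sg sx R s)" by (rule boundary_values_matrix(1)[OF Rh RB sx])
 have 2: "AE s in arclength Sg. has_nt_limit Sg sx S s (nt_value Sg sx S s)" by (rule boundary_values_matrix(1)[OF Sh SB sx])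
 show ?thesis using 1 2
 proof eventually_elim
  case (elim s)
  have c: "has_nt_limit Sg sx (%_. mat 1 :: complex^'k^'k) s (mat 1)"
  by (rule has_nt_limit_combine[OF contours(3) elim(1,1), of "%_ _. mat 1"]) (rule tendsto_const)
  show ?case by (rule nt_limit_unique_off[OF contours(3) kS sx has_nt_limit_combine[OF contours(3) elim, of "(**)", OF tendsto_matrix_mult] c RS])
 qed
qed

text \<open>The jump across the union of the matrix product of \<open>cauchy_mat GG ph\<close> and
  S, put together entry by entry from the scalar jumps.\<close>

definition jump_mat :: "(complex => complex^'k^'k) => complex => complex^'k^'k" where
 "jump_mat ph s = (\<chi> i j. \<Sum>l\<in>UNIV. boundary_jump (%z. S z $ l $ j) (%s. ph s $ i $ l) s)"

context
 fixes ph :: "complex => complex^'k^'k" assumes ph: "ph : L2 GG"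
begin

lemma jump_formula_entry:
 assumes z: "z ~: contour_set Sg"
 shows "boundary_jump (%z. S z $ l $ j) (%s. ph s $ i $ l) : L2 Sg"
  "CI GG (%s. ph s $ i $ l) z * S z $ l $ j = CI Sg (boundary_jump (%z. S z $ l $ j) (%s. ph s $ i $ l)) z"
proof -
 have B: "cmod (S z $ l $ j) <= rhS" if "z ~: contour_set Sg" for z using order.trans[OF norm_entry_le SB[OF that]] .
 show "boundary_jump (%z. S z $ l $ j) (%s. ph s $ i $ l) : L2 Sg"
  by (rule jump_formula(1)[OF Sh B Lp_entry(1)[OF ph exps(2)] z])
 show "CI GG (%s. ph s $ i $ l) z * S z $ l $ j = CI Sg (boundary_jump (%z. S z $ l $ j) (%s. ph s $ i $ l)) z"
  by (rule jump_formula(2)[OF Sh B Lp_entry(1)[OF ph exps(2)] z])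
qed

lemma jump_mat_off:
 assumes z: "z ~: contour_set Sg"
 shows "(%s. jump_mat ph s $ i $ j) : L2 Sg" "cauchy_mat GG ph z ** S z = cauchy_mat GG (jump_mat ph) z + cauchy_mat GG' (jump_mat ph) z"
proof -
 have e: "(%s. jump_mat ph s $ i $ j) = (%s. \<Sum>l\<in>UNIV. boundary_jump (%z. S z $ l $ j) (%s. ph s $ i $ l) s)" for i j by (simp add: jump_mat_def)
 have s: "(%s. \<Sum>l\<in>UNIV. boundary_jump (%z. S z $ l $ j) (%s. ph s $ i $ l) s) : L2 Sg &
  CI Sg (%s. \<Sum>l\<in>UNIV. boundary_jump (%z. S z $ l $ j) (%s. ph s $ i $ l) s) z = (\<Sum>l\<in>UNIV. CI Sg (boundary_jump (%z. S z $ l $ j) (%s. ph s $ i $ l)) z)" for i j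
  by (rule cauchy_integral_sum[OF contours(3) z finite_class.finite_UNIV]) (rule jump_formula_entry(1)[OF z])
 show "(%s. jump_mat ph s $ i $ j) : L2 Sg" unfolding e using s by blast
 have "(cauchy_mat GG ph z ** S z) $ i $ j = CI Sg (%s. jump_mat ph s $ i $ j) z" for i j
  unfolding e using conjunct2[OF s, of j i, symmetric] by (simp add: matrix_matrix_mult_def jump_formula_entry(2)[OF z])
 then show "cauchy_mat GG ph z ** S z = cauchy_mat GG (jump_mat ph) z + cauchy_mat GG' (jump_mat ph) z"
  by (simp add: vec_eq_iff cauchy_integral_append) (simp add: cauchy_mat_def)
qed

lemma jump_mat_measurable: "jump_mat ph : bmeas M" "jump_mat ph : bmeas M'"
 and jump_mat_L2: "jump_mat ph : Lp M 2"
proof -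
 have "- contour_set Sg ~= {}" using complete_contour_dense[OF kS] by auto
 then obtain z where z: "z ~: contour_set Sg" by blast
 have L: "(%s. jump_mat ph s $ i $ j) : L2 Sg" for i j by (rule jump_mat_off(1)[OF z])
 have m: "(%s. jump_mat ph s $ i $ j) : bmeas (arclength Sg)" for i j by (rule Lp_measurable[OF L])
 show 1: "jump_mat ph : bmeas M" "jump_mat ph : bmeas M'"
  using m by (auto intro!: borel_measurable_matrix simp: measurable_append)
 have "(%s. jump_mat ph s $ i $ j) : Lp M 2" for i j
 proof -
  have m2: "(%z. ennreal (norm (jump_mat ph z $ i $ j) powr 2)) : bmeas (arclength Sg)" using m[of i j] by measurable
  have "(\<integral>\<^sup>+z. ennreal (norm (jump_mat ph z $ i $ j) powr 2) \<partial>arclength Sg) < \<infinity>" using L[of i j] by (simp add: Lp_iff)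
  then have "(\<integral>\<^sup>+z. ennreal (norm (jump_mat ph z $ i $ j) powr 2) \<partial>M) < \<infinity>" unfolding nn_integral_append[OF m2] by (simp add: ennreal_add_eq_top less_top)
  then show ?thesis using m[of i j] unfolding Lp_iff measurable_append by blast
 qed
 then have "ALL i j. (%s. jump_mat ph s $ i $ j) : Lp M 2 & Lp_norm M 2 (%s. jump_mat ph s $ i $ j) <= (\<Sum>x\<in>UNIV. Lp_norm M 2 (%s. jump_mat ph s $ fst x $ snd x))"
  using member_le_sum[of "(i, j)" UNIV "%x. Lp_norm M 2 (%s. jump_mat ph s $ fst x $ snd x)" for i j] by simp
 moreover obtain C where "\<forall>(f :: complex => complex^'k^'k) D. 0 <= D & (ALL i j. (%x. f x $ i $ j) : Lp M 2 & Lp_norm M 2 (%x. f x $ i $ j) <= D) -->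
  f : Lp M 2 & Lp_norm M 2 f <= C * D" using Lp_matrix[OF exps(1), of M, where 'k = 'k] by blast
 moreover have "0 <= (\<Sum>x\<in>UNIV. Lp_norm M 2 (%s. jump_mat ph s $ fst x $ snd x))" by (rule sum_nonneg) simp
 ultimately show "jump_mat ph : Lp M 2" by blast
qed

lemma S_bounds:
 assumes sx: "sx = 1 \<or> sx = -1"
 shows "AE s in M. norm (nt_value Sg sx S s) <= rhS" "AE s in M'. norm (nt_value Sg sx S s) <= rhS" "nt_value Sg sx S : bmeas M"
proof -
 have "AE s in arclength Sg. norm (nt_value Sg sx S s) <= rhS" by (rule boundary_values_matrix(3)[OF Sh SB sx])
 then show "AE s in M. norm (nt_value Sg sx S s) <= rhS" "AE s in M'. norm (nt_value Sg sx S s) <= rhS" by (simp_all add: AE_append)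
 have "nt_value Sg sx S : bmeas (arclength Sg)" by (rule boundary_values_matrix(4)[OF Sh SB sx])
 then show "nt_value Sg sx S : bmeas M" by (simp add: measurable_append)
qed

lemma S_entries:
 assumes sx: "sx = 1 \<or> sx = -1"
 shows "AE s in M. ALL i j. nt_value Sg sx S s $ i $ j = nt_value Sg sx (%z. S z $ i $ j) s" "AE s in M'. ALL i j. nt_value Sg sx S s $ i $ j = nt_value Sg sx (%z. S z $ i $ j) s"
proof -
 have "AE s in arclength Sg. ALL i j. nt_value Sg sx S s $ i $ j = nt_value Sg sx (%z. S z $ i $ j) s" by (rule boundary_values_matrix(2)[OF Sh SB sx])
 then show "AE s in M. ALL i j. nt_value Sg sx S s $ i $ j = nt_value Sg sx (%z. S z $ i $ j) s" "AE s in M'. ALL i j. nt_value Sg sx S s $ i $ j = nt_value Sg sx (%z. S z $ i $ j) s"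
  by (simp_all add: AE_append)
qed

lemma jump_mat_on:
 "AE s in M. jump_mat ph s = C_mat 1 ph s ** nt_value Sg 1 S s - C_mat (-1) ph s ** nt_value Sg (-1) S s"
proof -
 have a: "AE s in M. ALL i j. nt_value Sg sx (CI GG (%s. ph s $ i $ j)) s = C_mat sx ph s $ i $ j" if sx: "sx = 1 \<or> sx = -1" for sx
 proof -
  have "AE s in M. ALL i j. nt_value Sg sx (CI GG (%s. ph s $ i $ j)) s = nt_value GG sx (CI GG (%s. ph s $ i $ j)) s"
  by (intro eventually_all_finite nt_value_cauchy(1)[OF Lp_entry(1)[OF ph exps(2)] sx])
  with C_mat_limit(2)[OF ph exps(1) sx] show ?thesis by eventually_elim simp
 qed
 show ?thesis using a[OF signs(1)] a[OF signs(2)] S_entries(1)[OF signs(1)] S_entries(1)[OF signs(2)]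
 proof eventually_elim
  case (elim s)
  then show ?case by (simp add: vec_eq_iff jump_mat_def boundary_jump_def matrix_matrix_mult_def sum_subtractf)
 qed
qed

text \<open>On the second contour the Cauchy integral of ph is continuous, so the jump is this
  integral times the difference of the boundary values of S, whence the factor 2 rhS.\<close>

lemma jump_mat_across: "jump_mat ph : Lp M' 2" "Lp_norm M' 2 (jump_mat ph) <= 2 * rhS * (K * Lp_norm M 2 ph)"
proof -
 have a: "AE s in M'. ALL i j. nt_value Sg sx (CI GG (%s. ph s $ i $ j)) s = CI GG (%s. ph s $ i $ j) s" if sx: "sx = 1 \<or> sx = -1" for sx
  by (intro eventually_all_finite nt_value_cauchy(2)[OF Lp_entry(1)[OF ph exps(2)] sx])
 have "AE s in M'. norm (jump_mat ph s) <= 2 * rhS * norm (cauchy_mat GG ph s)"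
  using a[OF signs(1)] a[OF signs(2)] S_entries(2)[OF signs(1)] S_entries(2)[OF signs(2)] S_bounds(2)[OF signs(1)] S_bounds(2)[OF signs(2)]
 proof eventually_elim
  case (elim s)
  have "jump_mat ph s = cauchy_mat GG ph s ** nt_value Sg 1 S s - cauchy_mat GG ph s ** nt_value Sg (-1) S s"
  using elim(1-4) by (simp add: vec_eq_iff jump_mat_def boundary_jump_def matrix_matrix_mult_def sum_subtractf)
  also have "norm ... <= norm (cauchy_mat GG ph s ** nt_value Sg 1 S s) + norm (cauchy_mat GG ph s ** nt_value Sg (-1) S s)" by (rule norm_triangle_ineq4)
  also have "... <= norm (cauchy_mat GG ph s) * rhS + norm (cauchy_mat GG ph s) * rhS"
  using elim(5,6) by (intro add_mono order.trans[OF norm_matrix_mult] mult_left_mono) auto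
  finally show ?case by (simp add: algebra_simps)
 qed
 from Lp_mono[OF conjunct1[OF K3[OF ph]] jump_mat_measurable(2) exps(2) _ this] rh(2)
 have 1: "jump_mat ph : Lp M' 2" "Lp_norm M' 2 (jump_mat ph) <= 2 * rhS * Lp_norm M' 2 (cauchy_mat GG ph)" by simp_all
 show "jump_mat ph : Lp M' 2" by (rule 1)
 have "2 * rhS * Lp_norm M' 2 (cauchy_mat GG ph) <= 2 * rhS * (K * Lp_norm M 2 ph)" using K3[OF ph] rh(2) by (intro mult_left_mono) auto
 with 1 show "Lp_norm M' 2 (jump_mat ph) <= 2 * rhS * (K * Lp_norm M 2 ph)" by linarith
qed

text \<open>The off-contour identity is taken to the right side of the first contour. The Cauchy
  integral over the union splits into the part over GG, which gives C-, and the part over GG', which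
  is continuous there.\<close>

lemma C_mat_mult:
 "AE s in M. C_mat (-1) ph s ** nt_value Sg (-1) S s = C_mat (-1) (jump_mat ph) s + cauchy_mat GG' (jump_mat ph) s"
proof -
 have S: "AE s in M. has_nt_limit Sg (-1) S s (nt_value Sg (-1) S s)"
 proof -
  have "AE s in arclength Sg. has_nt_limit Sg (-1) S s (nt_value Sg (-1) S s)" by (rule boundary_values_matrix(1)[OF Sh SB signs(2)])
  then show ?thesis by (simp add: AE_append)
 qed
 show ?thesis using C_mat_limit(1)[OF ph exps(1) signs(2)] C_mat_limit(1)[OF jump_mat_L2 exps(1) signs(2)] S AE_on_arcs(1)
 proof eventually_elim
  case (elim s)
  then obtain gm t where g: "gm : set GG" "t : open_unit" "s = gm t" by blast
  have gS: "gm : set Sg" using g(1) by simp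
  have 1: "has_nt_limit Sg (-1) (cauchy_mat GG ph) s (C_mat (-1) ph s)" "has_nt_limit Sg (-1) (cauchy_mat GG (jump_mat ph)) s (C_mat (-1) (jump_mat ph) s)"
  using elim(1,2) unfolding g(3) has_nt_limit_append[OF g(1,2)] .
  have 2: "has_nt_limit Sg (-1) (cauchy_mat GG' (jump_mat ph)) s (cauchy_mat GG' (jump_mat ph) s)"
  unfolding has_nt_limit_matrix[OF contours(3)]
  proof (intro allI)
  fix i j
  have e: "(%z. cauchy_mat GG' (jump_mat ph) z $ i $ j) = CI GG' (%s. jump_mat ph s $ i $ j)" by (simp add: cauchy_mat_def fun_eq_iff)
  have "isCont (CI GG' (%s. jump_mat ph s $ i $ j)) (gm t)"
  by (rule isCont_across'[OF Lp_entry(1)[OF jump_mat_across(1) exps(2)] g(1,2)])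
  from has_nt_limit_isCont[where f = "CI GG' (%s. jump_mat ph s $ i $ j)" and gm = gm and t = t and sx = "-1", OF contours(3) gS g(2) this]
  show "has_nt_limit Sg (-1) (%z. cauchy_mat GG' (jump_mat ph) z $ i $ j) s (cauchy_mat GG' (jump_mat ph) s $ i $ j)"
  unfolding e g(3) by (simp add: cauchy_mat_def)
  qed
  show ?case
  by (rule nt_limit_unique_off[OF contours(3) kS signs(2) has_nt_limit_combine[OF contours(3) 1(1) elim(3), of "(**)", OF tendsto_matrix_mult]
  has_nt_limit_combine[OF contours(3) 1(2) 2, of "(+)", OF tendsto_add] jump_mat_off(2)])
 qed
qed

end

section \<open>From L2 solvability to Lp solvability\<close>

lemma resolvent_op_inj2:
 assumes "resolvent_exists GG u 2" "h : Lp M 2" "h' : Lp M 2" "AE s in M. resolvent_op u h s = resolvent_op u h' s"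
 shows "AE s in M. h s = h' s"
 using assms unfolding resolvent_exists_def Lp_bijective_def by blast

text \<open>The function h is built without any norm bound on the resolvents, because their operator
  norms might be infinite; the a priori constants Av and Bw are therefore quantified inside the
  conclusion. The nested bound follows the construction outward: L2 norms of f(v-1), g and ph, then
  the Cauchy integral over GG', the right-hand side r, and finally N, g and h in Lp.\<close>

lemma key_construction:
 assumes f: "f : Lp M p"
 obtains h where "h : Lp M p" "AE s in M. resolvent_op v h s = f s"
  "ALL Av Bw. 0 <= Av --> (ALL h:Lp M 2. Lp_norm M 2 h <= Av * Lp_norm M 2 (resolvent_op v h)) -->
  0 <= Bw --> (ALL h:Lp M p. Lp_norm M p h <= Bw * Lp_norm M p (resolvent_op w h)) --> Lp_norm M p f <= 1 -->
  Lp_norm M p h <= 2 * (1 + rhR * (Bw * (2 * (K * (rhS * V) + K * (2 * rhS * (K * (2 * ((Lp_norm M 2 (%s. v s - mat 1) + V) + V * (Av * (K * (Lp_norm M 2 (%s. v s - mat 1) + V)))))))))))"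
proof -
 let ?b = "%s. v s - mat 1"
 let ?c = "%s. w s - mat 1"
 let ?Sp = "nt_value Sg 1 S" and ?Sm = "nt_value Sg (-1) S" and ?Rp = "nt_value Sg 1 R" and ?Rm = "nt_value Sg (-1) R"
 note bm = Lp_measurable[OF vL] and cm = Lp_measurable[OF wL]
 have z1: "0 <= K" using K by simp
 have Sb: "AE s in M. norm (?Sp s) <= rhS" "AE s in M. norm (?Sm s) <= rhS" "?Sp : bmeas M" "?Sm : bmeas M"
  using S_bounds(1,3)[OF Lp_zero(1)[OF exps(2)] signs(1)] S_bounds(1,3)[OF Lp_zero(1)[OF exps(2)] signs(2)] by auto
 have Rb: "AE s in M. norm (?Rm s) <= rhR" "?Rm : bmeas M"
 proof -
  have "AE s in arclength Sg. norm (?Rm s) <= rhR" by (rule boundary_values_matrix(3)[OF Rh RB signs(2)])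
  then show "AE s in M. norm (?Rm s) <= rhR" by (simp add: AE_append)
  have "?Rm : bmeas (arclength Sg)" by (rule boundary_values_matrix(4)[OF Rh RB signs(2)])
  then show "?Rm : bmeas M" by (simp add: measurable_append)
 qed
 have RS1: "AE s in M. ?Rp s ** ?Sp s = mat 1" "AE s in M. ?Rm s ** ?Sm s = mat 1"
  using RS_boundary[OF signs(1)] RS_boundary[OF signs(2)] by (simp_all add: AE_append)
 define fb where "fb = (%s. f s ** ?b s)"
 have fb2: "fb : Lp M 2" unfolding fb_def by (rule L2_mult(1)[OF f p vL VB])
 have fbp: "fb : Lp M p" "Lp_norm M p fb <= V * Lp_norm M p f" unfolding fb_def by (rule Lp_mult_bounded[OF f exps(4) bm VB])+
 define F where "F = C_mat (-1) fb"
 have F: "F : Lp M 2" unfolding F_def using K1[OF fb2] by blast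
 define g where "g = Lp_inverse M 2 (resolvent_op v) F"
 have g: "g : Lp M 2" "AE s in M. resolvent_op v g s = F s" unfolding g_def
  using Lp_inverse_spec[OF ex(3)[unfolded resolvent_exists_def] F] by auto
 define gb where "gb = (%s. g s ** ?b s)"
 have gb: "gb : Lp M 2" "Lp_norm M 2 gb <= V * Lp_norm M 2 g" unfolding gb_def by (rule Lp_mult_bounded[OF g(1) exps(2) bm VB])+
 define ph where "ph = (%s. (f s + g s) ** ?b s)"
 have pheq: "ph = (%s. fb s + gb s)" unfolding ph_def fb_def gb_def by (rule ext) (rule matrix_mult_distribs(4))
 have ph2: "ph : Lp M 2" "Lp_norm M 2 ph <= 2 * (Lp_norm M 2 fb + Lp_norm M 2 gb)" unfolding pheq by (rule Lp_add[OF fb2 gb(1) exps(1)])+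
 have "AE s in M. C_mat (-1) ph s = C_mat (-1) fb s + C_mat (-1) gb s"
  by (rule C_mat_add[OF fb2 gb(1) ph2(1) _ signs(2)]) (simp add: pheq)
 then have geq: "AE s in M. C_mat (-1) ph s = g s" using g(2)
 proof eventually_elim
  case (elim s)
  have "C_op GG v g s = C_mat (-1) gb s" unfolding C_op_eq gb_def ..
  then show ?case using elim by (simp add: F_def algebra_simps)
 qed
 define J where "J = jump_mat ph"
 have J2: "J : Lp M 2" unfolding J_def by (rule jump_mat_L2[OF ph2(1)])
 define N where "N = (%s. g s ** ?Sm s)"
 have N2: "N : Lp M 2" unfolding N_def by (rule Lp_mult_bounded(1)[OF g(1) exps(2) Sb(4,2) rh(2)])
 define Nw where "Nw = (%s. N s ** ?c s)"
 have Nw2: "Nw : Lp M 2" unfolding Nw_def by (rule Lp_mult_bounded(1)[OF N2 exps(2) cm WB])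
 define fs where "fs = (%s. fb s ** ?Sp s)"
 have fs2: "fs : Lp M 2" unfolding fs_def by (rule Lp_mult_bounded(1)[OF fb2 exps(2) Sb(3,1) rh(2)])
 have fsp: "fs : Lp M p" "Lp_norm M p fs <= rhS * Lp_norm M p fb" unfolding fs_def by (rule Lp_mult_bounded[OF fbp(1) exps(4) Sb(3,1) rh(2)])+
 \<comment> \<open>With m- = g and m+ = g + ph = g v + f(v-1), the jump is g v S+ + f(v-1) S+ - g
   S-. The jump relation gives v S+ = S- w R+ S+ = S- w, so the first and last terms combine to N (w
   - 1).\<close>
 have Jeq: "AE s in M. J s = Nw s + fs s"
  using jump_mat_on[OF ph2(1)] geq C_mat_jump[OF ph2(1)] RS1 vw
 proof eventually_elim
  case (elim s)
  have m: "matrix_inv (?Rm s) = ?Sm s" by (rule matrix_inverse_of_right(2)[OF elim(5)])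
  have "g s + ph s = g s ** v s + fb s"
  unfolding pheq gb_def by (simp add: matrix_mult_distribs)
  then have "J s = (g s ** v s) ** ?Sp s + fb s ** ?Sp s - g s ** ?Sm s"
  unfolding J_def elim(1) elim(3) elim(2) by (simp add: matrix_mult_distribs)
  also have "(g s ** v s) ** ?Sp s = g s ** ?Sm s ** w s ** (?Rp s ** ?Sp s)"
  unfolding elim(6) m by (simp only: matrix_mul_assoc)
  also have "... = N s ** w s" unfolding elim(4) N_def by simp
  finally show ?case unfolding Nw_def fs_def N_def[symmetric] by (simp add: matrix_mult_distribs N_def[symmetric] fun_cong[OF N_def, symmetric])
 qed
 define k where "k = cauchy_mat GG' J"
 have k: "k : Lp M 2" "k : Lp M p" "Lp_norm M p k <= K * Lp_norm M' 2 J"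
  using K4[OF jump_mat_across(1)[OF ph2(1)]] unfolding k_def J_def by auto
 define r where "r = (%s. C_mat (-1) fs s + k s)"
 have r2: "r : Lp M 2" unfolding r_def using K1[OF fs2] by (intro Lp_add(1) k exps) auto
 have rp: "r : Lp M p" "Lp_norm M p r <= 2 * (Lp_norm M p (C_mat (-1) fs) + Lp_norm M p k)"
  unfolding r_def using Lp_add[OF conjunct1[OF K2[OF fsp(1)]] k(2) exps(3)] by auto
 \<comment> \<open>\<open>C_mat_mult\<close> reads N = C- J + k; inserting J = N(w-1) + f(v-1) S+
   moves the first term to the left as C_w N.\<close>
 have TN: "AE s in M. resolvent_op w N s = r s"
  using C_mat_add[OF Nw2 fs2 J2 Jeq signs(2)] C_mat_mult[OF ph2(1)] geq
 proof eventually_elim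
  case (elim s)
  have "C_op GG w N s = C_mat (-1) Nw s" unfolding C_op_eq Nw_def ..
  moreover have "N s = C_mat (-1) J s + k s" using elim(2) unfolding elim(3) N_def J_def k_def .
  ultimately show ?case using elim(1) by (simp add: r_def)
 qed
 define N' where "N' = Lp_inverse M p (resolvent_op w) r"
 have N': "N' : Lp M p" "AE s in M. resolvent_op w N' s = r s" unfolding N'_def
  using Lp_inverse_spec[OF ex(2)[unfolded resolvent_exists_def] rp(1)] by auto
 define Nw' where "Nw' = (%s. N' s ** ?c s)"
 have Nw'2: "Nw' : Lp M 2" unfolding Nw'_def by (rule L2_mult(1)[OF N'(1) p wL WB])
 \<comment> \<open>The equation is read as N' = r + C-(N'(w-1)). The product N'(w-1) is in L2, since
   N' is in Lp and w - 1 is bounded and in L2; so N' inherits L2 from its equation.\<close>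
 have N'2: "N' : Lp M 2"
 proof (rule Lp_cong_AE(1)[OF Lp_add(1)[OF r2 conjunct1[OF K1[OF Nw'2]] exps(1)] Lp_measurable[OF N'(1)] exps(2)])
  show "AE s in M. r s + C_mat (-1) Nw' s = N' s" using N'(2) by eventually_elim (simp add: C_op_eq Nw'_def algebra_simps)
 qed
 have "AE s in M. resolvent_op w N' s = resolvent_op w N s" using N'(2) TN by eventually_elim simp
 then have NN': "AE s in M. N' s = N s" by (rule resolvent_op_inj2[OF ex(1) N'2 N2])
 have Np: "N : Lp M p" "Lp_norm M p N <= Lp_norm M p N'" by (rule Lp_cong_AE[OF N'(1) Lp_measurable[OF N2] exps(4) NN'])+
 have "AE s in M. N s ** ?Rm s = g s" using RS1(2)
 proof eventually_elim
  case (elim s)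
  have "N s ** ?Rm s = g s ** (?Sm s ** ?Rm s)" unfolding N_def by (simp only: matrix_mul_assoc)
  then show ?case unfolding matrix_inverse_of_right(1)[OF elim] by simp
 qed
 note gp' = Lp_cong_AE[OF Lp_mult_bounded(1)[OF Np(1) exps(4) Rb(2,1) rh(1)] Lp_measurable[OF g(1)] exps(4) this]
 have gp: "g : Lp M p" "Lp_norm M p g <= rhR * Lp_norm M p N"
  using gp' Lp_mult_bounded(2)[OF Np(1) exps(4) Rb(2,1) rh(1)] by auto
 define h where "h = (%s. f s + g s)"
 have h: "h : Lp M p" "Lp_norm M p h <= 2 * (Lp_norm M p f + Lp_norm M p g)" unfolding h_def by (rule Lp_add[OF f gp(1) exps(3)])+
 show ?thesis
 proof (rule that[OF h(1)])
  show "AE s in M. resolvent_op v h s = f s" using geq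
  proof eventually_elim
  case (elim s)
  have "C_op GG v h s = C_mat (-1) ph s" unfolding C_op_eq ph_def h_def ..
  then show ?case using elim by (simp add: h_def)
  qed
  show "ALL Av Bw. 0 <= Av --> (ALL h:Lp M 2. Lp_norm M 2 h <= Av * Lp_norm M 2 (resolvent_op v h)) -->
  0 <= Bw --> (ALL h:Lp M p. Lp_norm M p h <= Bw * Lp_norm M p (resolvent_op w h)) --> Lp_norm M p f <= 1 -->
  Lp_norm M p h <= 2 * (1 + rhR * (Bw * (2 * (K * (rhS * V) + K * (2 * rhS * (K * (2 * ((Lp_norm M 2 (%s. v s - mat 1) + V) + V * (Av * (K * (Lp_norm M 2 (%s. v s - mat 1) + V)))))))))))"
  proof (intro allI impI)
  fix Av Bw :: real
  assume A': "0 <= Av" "ALL h:Lp M 2. Lp_norm M 2 h <= Av * Lp_norm M 2 (resolvent_op v h)"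
  and B': "0 <= Bw" "ALL h:Lp M p. Lp_norm M p h <= Bw * Lp_norm M p (resolvent_op w h)" and f1: "Lp_norm M p f <= 1"
  note A = A'(1) bspec[OF A'(2)] and B = B'(1) bspec[OF B'(2)]
  \<comment> \<open>The bound from \<open>L2_mult\<close> for f(v-1) when f has Lp norm at most 1;
    the remaining L2 quantities are multiples of it.\<close>
  let ?n = "Lp_norm M 2 ?b + V"
  have n1: "Lp_norm M 2 fb <= ?n" unfolding fb_def by (rule L2_mult(2)[OF f p vL VB f1])
  have "Lp_norm M 2 (resolvent_op v g) <= Lp_norm M 2 F"
  proof (rule Lp_cong_AE(2)[OF F _ exps(2)])
  show "AE s in M. F s = resolvent_op v g s" using g(2) by eventually_elim simp
  have "resolvent_op v g : Lp M 2" using ex(3) g(1) unfolding resolvent_exists_def Lp_bijective_def by blast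
  then show "resolvent_op v g : bmeas M" by (rule Lp_measurable)
  qed
  also have "... <= K * Lp_norm M 2 fb" unfolding F_def using K1[OF fb2] by blast
  also have "... <= K * ?n" by (rule mult_left_mono[OF n1 z1])
  finally have "Av * Lp_norm M 2 (resolvent_op v g) <= Av * (K * ?n)" by (rule mult_left_mono[OF _ A(1)])
  then have n2: "Lp_norm M 2 g <= Av * (K * ?n)" using A(2)[OF g(1)] by linarith
  have n3: "Lp_norm M 2 ph <= 2 * (?n + V * (Av * (K * ?n)))" (is "_ <= ?Ph")
  using ph2(2) n1 gb(2) mult_left_mono[OF n2 VB(2)] by argo
  have "2 * rhS * (K * Lp_norm M 2 ph) <= 2 * rhS * (K * ?Ph)" using n3 z1 rh(2) by (intro mult_left_mono) auto
  then have "Lp_norm M' 2 J <= 2 * rhS * (K * ?Ph)" using jump_mat_across(2)[OF ph2(1)] unfolding J_def by linarith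
  then have n4: "Lp_norm M p k <= K * (2 * rhS * (K * ?Ph))" using k(3) mult_left_mono[OF _ z1] order.trans by blast
  have "Lp_norm M p fb <= V" using fbp(2) mult_left_mono[OF f1 VB(2)] by simp
  then have "Lp_norm M p fs <= rhS * V" using fsp(2) mult_left_mono[OF _ rh(2)] order.trans by blast
  then have n5: "Lp_norm M p (C_mat (-1) fs) <= K * (rhS * V)" using K2[OF fsp(1)] mult_left_mono[OF _ z1] order.trans by blast
  have n6: "Lp_norm M p r <= 2 * (K * (rhS * V) + K * (2 * rhS * (K * ?Ph)))" (is "_ <= ?r") using rp(2) n4 n5 by argo
  have "Lp_norm M p (resolvent_op w N') <= Lp_norm M p r"
  proof (rule Lp_cong_AE(2)[OF rp(1) _ exps(4)])
  show "AE s in M. r s = resolvent_op w N' s" using N'(2) by eventually_elim simp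
  have "resolvent_op w N' : Lp M p" using ex(2) N'(1) unfolding resolvent_exists_def Lp_bijective_def by blast
  then show "resolvent_op w N' : bmeas M" by (rule Lp_measurable)
  qed
  then have "Bw * Lp_norm M p (resolvent_op w N') <= Bw * ?r" using n6 by (intro mult_left_mono[OF _ B(1)]) linarith
  then have "Lp_norm M p N <= Bw * ?r" using B(2)[OF N'(1)] Np(2) by linarith
  from mult_left_mono[OF this rh(1)] have "Lp_norm M p g <= rhR * (Bw * ?r)" using gp(2) by linarith
  then show "Lp_norm M p h <= 2 * (1 + rhR * (Bw * ?r))" using h(2) f1 by argo
  qed
 qed
qed

text \<open>A difference d in Lp with (1 - C_v) d = 0 equals C-(d(v-1)), and d(v-1) is in L2. Hence
  d is in L2 and vanishes by injectivity there.\<close>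

lemma resolvent_op_inj:
 assumes h: "h : Lp M p" and h': "h' : Lp M p" and eq: "AE s in M. resolvent_op v h s = resolvent_op v h' s"
 shows "AE s in M. h s = h' s"
proof -
 let ?b = "%s. v s - mat 1"
 define d where "d = (%s. h s - h' s)"
 have d: "d : Lp M p" unfolding d_def by (rule Lp_diff(1)[OF h h' exps(3)])
 have b: "(%s. u s ** ?b s) : Lp M 2" if "u : Lp M p" for u :: "complex => complex^'k^'k" by (rule L2_mult(1)[OF that p vL VB])
 have "AE s in M. C_mat (-1) (%s. h s ** ?b s) s = C_mat (-1) (%s. h' s ** ?b s) s + C_mat (-1) (%s. d s ** ?b s) s"
  by (rule C_mat_add[OF b[OF h'] b[OF d] b[OF h] _ signs(2)]) (simp add: d_def matrix_mult_distribs)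
 with eq have dC: "AE s in M. C_mat (-1) (%s. d s ** ?b s) s = d s"
 proof eventually_elim
  case (elim s)
  then show ?case unfolding C_op_eq by (simp add: d_def algebra_simps)
 qed
 have d2: "d : Lp M 2" by (rule Lp_cong_AE(1)[OF conjunct1[OF K1[OF b[OF d]]] Lp_measurable[OF d] exps(2) dC])
 have z: "(%_. 0 :: complex^'k^'k) : Lp M 2" by (rule Lp_zero(1)[OF exps(2)])
 have zb: "(%s. (0 :: complex^'k^'k) ** ?b s) = (%_. 0)" by (simp add: fun_eq_iff vec_eq_iff matrix_matrix_mult_def)
 have "Lp_norm M 2 (C_mat (-1) (%_. 0 :: complex^'k^'k)) = 0"
  using K1[OF z] Lp_zero(2)[OF exps(2), of M, where 'b = "complex^'k^'k"] Lp_norm_nonneg[of M 2 "C_mat (-1) (%_. 0 :: complex^'k^'k)"] by simp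
 from Lp_norm_eq_0[OF conjunct1[OF K1[OF z]] exps(2) this] dC
 have "AE s in M. resolvent_op v d s = resolvent_op v (%_. 0) s"
  by eventually_elim (simp add: C_op_eq zb)
 from resolvent_op_inj2[OF ex(3) d2 z this] show ?thesis by eventually_elim (simp add: d_def)
qed

theorem resolvent_transfer:
 shows "resolvent_exists GG v p"
  and "!!Av Bw. 0 <= Av ==> (!!h. h : Lp M 2 ==> Lp_norm M 2 h <= Av * Lp_norm M 2 (resolvent_op v h)) ==>
  0 <= Bw ==> (!!h. h : Lp M p ==> Lp_norm M p h <= Bw * Lp_norm M p (resolvent_op w h)) ==>
  resolvent_norm GG v p <= ennreal (2 * (1 + rhR * (Bw * (2 * (K * (rhS * V) + K * (2 * rhS * (K * (2 * ((Lp_norm M 2 (%s. v s - mat 1) + V) + V * (Av * (K * (Lp_norm M 2 (%s. v s - mat 1) + V))))))))))))"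
proof -
 show ex': "resolvent_exists GG v p"
  unfolding resolvent_exists_def Lp_bijective_def
 proof (intro conjI ballI impI)
  fix h :: "complex => complex^'k^'k" assume h: "h : Lp M p"
  have "(%s. h s ** (v s - mat 1)) : Lp M p" by (rule Lp_mult_bounded(1)[OF h exps(4) Lp_measurable[OF vL] VB])
  from Lp_diff(1)[OF h conjunct1[OF K2[OF this]] exps(3)] show "resolvent_op v h : Lp M p" unfolding C_op_eq .
 next
  fix h h' :: "complex => complex^'k^'k" assume "h : Lp M p" "h' : Lp M p" "AE s in M. resolvent_op v h s = resolvent_op v h' s"
  then show "AE s in M. h s = h' s" by (rule resolvent_op_inj)
 next
  fix f :: "complex => complex^'k^'k" assume "f : Lp M p"
  then show "EX h:Lp M p. AE s in M. resolvent_op v h s = f s" by (rule key_construction) blast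
 qed
 fix Av Bw :: real
 assume A: "0 <= Av" "!!h. h : Lp M 2 ==> Lp_norm M 2 h <= Av * Lp_norm M 2 (resolvent_op v h)"
  and B: "0 <= Bw" "!!h. h : Lp M p ==> Lp_norm M p h <= Bw * Lp_norm M p (resolvent_op w h)"
 show "resolvent_norm GG v p <= ennreal (2 * (1 + rhR * (Bw * (2 * (K * (rhS * V) + K * (2 * rhS * (K * (2 * ((Lp_norm M 2 (%s. v s - mat 1) + V) + V * (Av * (K * (Lp_norm M 2 (%s. v s - mat 1) + V))))))))))))"
  unfolding resolvent_norm_def Lp_opnorm_def
 proof (rule SUP_least, rule ennreal_leI)
  fix f :: "complex => complex^'k^'k" assume f: "f : {f : Lp M p. Lp_norm M p f <= 1}"
  then have f': "f : Lp M p" "Lp_norm M p f <= 1" by auto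
  obtain h where h: "h : Lp M p" "AE s in M. resolvent_op v h s = f s" and hb:
  "ALL Av Bw. 0 <= Av --> (ALL h:Lp M 2. Lp_norm M 2 h <= Av * Lp_norm M 2 (resolvent_op v h)) -->
  0 <= Bw --> (ALL h:Lp M p. Lp_norm M p h <= Bw * Lp_norm M p (resolvent_op w h)) --> Lp_norm M p f <= 1 -->
  Lp_norm M p h <= 2 * (1 + rhR * (Bw * (2 * (K * (rhS * V) + K * (2 * rhS * (K * (2 * ((Lp_norm M 2 (%s. v s - mat 1) + V) + V * (Av * (K * (Lp_norm M 2 (%s. v s - mat 1) + V)))))))))))"
  by (rule key_construction[OF f'(1)])
  have h3: "Lp_norm M p h <= 2 * (1 + rhR * (Bw * (2 * (K * (rhS * V) + K * (2 * rhS * (K * (2 * ((Lp_norm M 2 (%s. v s - mat 1) + V) + V * (Av * (K * (Lp_norm M 2 (%s. v s - mat 1) + V)))))))))))"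
  using hb A B f'(2) by simp
  note h0 = Lp_inverse_spec[OF ex'[unfolded resolvent_exists_def] f'(1)]
  \<comment> \<open>The operator norm refers to the function selected by \<open>Lp_inverse\<close>;
    injectivity in Lp shows that it equals the constructed h almost everywhere, so the bound carries
    over.\<close>
  have "AE s in M. resolvent_op v h s = resolvent_op v (Lp_inverse M p (resolvent_op v) f) s" using h(2) h0(2) by eventually_elim simp
  from Lp_cong_AE(2)[OF h(1) Lp_measurable[OF h0(1)] exps(4) resolvent_op_inj[OF h(1) h0(1) this]] h3
  show "Lp_norm M p (Lp_inverse M p (resolvent_op v) f) <= 2 * (1 + rhR * (Bw * (2 * (K * (rhS * V) + K * (2 * rhS * (K * (2 * ((Lp_norm M 2 (%s. v s - mat 1) + V) + V * (Av * (K * (Lp_norm M 2 (%s. v s - mat 1) + V)))))))))))"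
  by linarith
 qed
qed

end

section \<open>The estimate\<close>

text \<open>Converts the bound of the construction into a product of the prescribed factors. The
  constant D is such that D times a resolvent norm times the jump size is at least 1; factors
  missing in a term are supplied by such quantities, each D being charged to the constant.\<close>

lemma resolvent_bound_arith:
 fixes K E D V0 W0 V rhR rhS Av Aw Bw nv nw :: real
 assumes K: "1 <= K" and E: "1 <= E" and D: "D = 4 * K * E" and V0: "1 <= V0" and W0: "1 <= W0" and V: "0 <= V" "V <= E * V0"
  and X: "1 <= rhR * rhS" and nn: "0 <= nv" "0 <= nw" "0 <= Av" "0 <= Aw" "0 <= Bw"
  and Av: "1 <= D * (Av * V0)" and Aw: "1 <= D * (Aw * W0)" and Bw: "1 <= D * (Bw * W0)"
 shows "2 * (1 + rhR * (Bw * (2 * (K * (rhS * V) + K * (2 * rhS * (K * (2 * ((nv + V) + V * (Av * (K * (nv + V)))))))))))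
  <= 2 * (D^2 + (2 * K * E * D + 16 * K^2 * E * D)) * D^2 * rhR * rhS * Bw * Aw * Av^2 * V0 ^ 3 * W0^2 * (1 + nw)^2 * (1 + nv)^2"
proof -
 define a where "a = Av * V0"
 define X where "X = rhR * rhS"
 define Y where "Y = X * Bw * (V0 * (1 + nv) * a)"
 define Z where "Z = 2 * K * E * D + 16 * K^2 * E * D"
 have KE: "1 <= K * E" using mult_mono[OF K E] K by simp
 have D1: "1 <= D" "K * E <= D" using KE unfolding D by linarith+
 have a0: "0 <= a" "1 <= D * a" using nn V0 Av by (auto simp: a_def)
 have X1: "1 <= X" using X by (simp add: X_def)
 have Z0: "0 <= Z" using K E D1 unfolding Z_def by (intro add_nonneg_nonneg mult_nonneg_nonneg) auto
 have U1: "1 <= V0 * (1 + nv)" using mult_mono[OF V0, of 1 "1 + nv"] nn V0 by simp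
 have Y0: "0 <= Y" unfolding Y_def using X1 nn V0 a0 by (intro mult_nonneg_nonneg) auto
 have v1: "V <= E * (V0 * (1 + nv))"
 proof -
  have "V0 * 1 <= V0 * (1 + nv)" using nn V0 by (intro mult_left_mono) auto
  then have "E * V0 <= E * (V0 * (1 + nv))" using E by (intro mult_left_mono) auto
  then show ?thesis using V by linarith
 qed
 have n1: "nv + V <= E * (V0 * (1 + nv))"
 proof -
  have "1 * 1 <= E * V0" using E V0 by (intro mult_mono) auto
  then have "nv * 1 <= nv * (E * V0)" using nn by (intro mult_left_mono) auto
  then show ?thesis using V by (simp add: algebra_simps)
 qed
 have g1: "1 + K * (V * Av) <= 2 * D * a"
 proof -
  have "V * Av <= E * V0 * Av" using V nn by (intro mult_right_mono) auto
  then have "K * (V * Av) <= K * (E * V0 * Av)" using K by (intro mult_left_mono) auto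
  also have "... = K * E * a" by (simp add: a_def)
  also have "... <= D * a" using D1 a0 by (intro mult_right_mono) auto
  finally show ?thesis using a0 by linarith
 qed
 have t1: "V <= E * D * (V0 * (1 + nv) * a)"
 proof -
  have "E * (V0 * (1 + nv)) * 1 <= E * (V0 * (1 + nv)) * (D * a)" using E V0 nn a0 by (intro mult_left_mono mult_nonneg_nonneg) auto
  with v1 show ?thesis by (simp add: mult_ac)
 qed
 have t2: "(nv + V) * (1 + K * (V * Av)) <= 2 * E * D * (V0 * (1 + nv) * a)"
 proof -
  have "(nv + V) * (1 + K * (V * Av)) <= (E * (V0 * (1 + nv))) * (2 * D * a)"
  using n1 g1 E U1 K V nn by (intro mult_mono) auto
  then show ?thesis by (simp add: mult_ac)
 qed
 have "2 * (K * (rhS * V) + K * (2 * rhS * (K * (2 * ((nv + V) + V * (Av * (K * (nv + V)))))))) = rhS * (2 * K * V + 8 * K^2 * ((nv + V) * (1 + K * (V * Av))))"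
  by (simp add: algebra_simps power2_eq_square)
 then have "rhR * (Bw * (2 * (K * (rhS * V) + K * (2 * rhS * (K * (2 * ((nv + V) + V * (Av * (K * (nv + V))))))))))
  = X * Bw * (2 * K * V + 8 * K^2 * ((nv + V) * (1 + K * (V * Av))))" by (simp add: X_def)
 also have "... <= X * Bw * (2 * K * (E * D * (V0 * (1 + nv) * a)) + 8 * K^2 * (2 * E * D * (V0 * (1 + nv) * a)))"
  using X1 nn K t1 t2 by (intro mult_left_mono add_mono mult_nonneg_nonneg) auto
 also have "... = Z * Y" by (simp add: Z_def Y_def algebra_simps)
 finally have 1: "rhR * (Bw * (2 * (K * (rhS * V) + K * (2 * rhS * (K * (2 * ((nv + V) + V * (Av * (K * (nv + V)))))))))) <= Z * Y" .
 \<comment> \<open>Absorbs the summand 1, which stems from h = f + g: two of these quantities, for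
   Bw and Av, cost D^2.\<close>
 have "1 * (1 * (1 * 1)) <= X * ((D * (Bw * W0)) * ((V0 * (1 + nv)) * (D * a)))"
  using X1 Bw U1 a0 by (intro mult_mono) auto
 then have 2: "1 <= D^2 * (W0 * Y)" by (simp add: Y_def power2_eq_square mult_ac)
 have "1 * Y <= W0 * Y" using W0 Y0 by (intro mult_right_mono) auto
 then have "Z * Y <= Z * (W0 * Y)" using Z0 by (intro mult_left_mono) auto
 with 1 2 have 3: "1 + rhR * (Bw * (2 * (K * (rhS * V) + K * (2 * rhS * (K * (2 * ((nv + V) + V * (Av * (K * (nv + V)))))))))) <= (D^2 + Z) * (W0 * Y)"
  unfolding distrib_right by linarith
 have WY: "0 <= W0 * Y" using W0 Y0 by simp
 \<comment> \<open>Supplies the remaining factors: Aw and one W0, a second Av with the third V0, the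
   second 1 + nv, and (1 + nw)^2, again at the cost of D^2.\<close>
 have "1 * (1 * (1 * 1)) <= (D * (Aw * W0)) * ((D * a) * ((1 + nv) * (1 + nw)^2))"
  using Aw a0 nn by (intro mult_mono one_le_power) auto
 from mult_left_mono[OF this WY] have "W0 * Y <= W0 * Y * ((D * (Aw * W0)) * ((D * a) * ((1 + nv) * (1 + nw)^2)))" by simp
 also have "... = D^2 * rhR * rhS * Bw * Aw * Av^2 * V0 ^ 3 * W0^2 * (1 + nw)^2 * (1 + nv)^2"
  by (simp add: Y_def X_def a_def power2_eq_square power3_eq_cube mult_ac)
 finally have 4: "W0 * Y <= D^2 * rhR * rhS * Bw * Aw * Av^2 * V0 ^ 3 * W0^2 * (1 + nw)^2 * (1 + nv)^2" .
 have "(D^2 + Z) * (W0 * Y) <= (D^2 + Z) * (D^2 * rhR * rhS * Bw * Aw * Av^2 * V0 ^ 3 * W0^2 * (1 + nw)^2 * (1 + nv)^2)"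
  using Z0 by (intro mult_left_mono[OF 4]) auto
 from mult_left_mono[OF order.trans[OF 3 this], of 2] show ?thesis unfolding Z_def[symmetric] by (simp only: mult.assoc)
qed

section \<open>Lower bounds for the factors of the constant\<close>

lemma matrix_inv_inverse:
 fixes A :: "complex^'k^'k"
 assumes "invertible A" shows "A ** matrix_inv A = mat 1"
proof -
 have "A ** matrix_inv A = mat 1 & matrix_inv A ** A = mat 1"
  using assms unfolding matrix_inv_def invertible_def by (rule someI_ex)
 then show ?thesis by blast
qed

lemma norm_mat_1_ge: "1 <= norm (mat 1 :: complex^'k^'k)"
 using norm_entry_le[of "mat 1 :: complex^'k^'k" undefined undefined] by (simp add: mat_def)

text \<open>The set where the norm exceeds the essential supremum is open by continuity and null by
  definition, hence empty. So the essential norm bounds the function at every point, in particular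
  on approach to the contour.\<close>

lemma bounded_analytic_le_Linf_norm:
 fixes Q :: "complex => complex^'k^'k"
 assumes D: "open D" and Q: "bounded_analytic_on Q D" and z: "z : D"
 shows "norm (Q z) <= Linf_norm (lebesgue_on D) Q"
proof -
 have Dl: "D : sets lebesgue" using D by simp
 have c: "continuous_on D (%z. Q z $ i $ j)" for i j using Q unfolding bounded_analytic_on_def by (blast intro: holomorphic_on_imp_continuous_on)
 have "continuous_on D (%z. \<chi> i j. Q z $ i $ j)" by (intro continuous_on_vec_lambda c)
 then have cQ: "continuous_on D Q" by (simp add: vec_nth_inverse)
 have "Q : bmeas (lebesgue_on D)"
  by (rule borel_measurable_matrix) (rule continuous_imp_measurable_on_sets_lebesgue[OF c Dl])
 moreover obtain B where "ALL x:Q ` D. norm x <= B" using Q unfolding bounded_analytic_on_def bounded_iff by blast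
 then have "AE x in lebesgue_on D. norm (Q x) <= B" by (intro AE_I2) simp
 ultimately have "Q : Linf (lebesgue_on D)" unfolding Linf_def by blast
 from Linf_bound[OF this] have "AE x in lebesgue. x : D --> norm (Q x) <= Linf_norm (lebesgue_on D) Q"
  using Dl by (simp add: AE_restrict_space_iff)
 then obtain N where N: "negligible N" "{x. \<not> (x : D --> norm (Q x) <= Linf_norm (lebesgue_on D) Q)} <= N"
  unfolding eventually_ae_filter_negligible by blast
 define U where "U = D Int Q -` {y. Linf_norm (lebesgue_on D) Q < norm y}"
 have "open {y :: complex^'k^'k. Linf_norm (lebesgue_on D) Q < norm y}" by (intro open_Collect_less continuous_intros)
 from continuous_open_preimage[OF cQ D this] have U: "open U" unfolding U_def .
 have "U <= N" using N(2) unfolding U_def by (auto simp: not_le)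
 then have "negligible U" by (rule negligible_subset[OF N(1)])
 then have "U = {}" using open_not_negligible[OF U] by blast
 then show ?thesis using z unfolding U_def by (auto simp: not_less)
qed

context contour_pair
begin

text \<open>A test function for lower bounds of operator norms: the identity matrix on a compact
  subarc, which has finite and positive length once the contour is not null.\<close>

lemma nonzero_Lp:
 assumes ne: "\<not> (AE z in arclength GG. False)" and q: "0 < q"
 obtains h :: "complex => complex^'k^'k" where "h : Lp (arclength GG) q" "0 < Lp_norm (arclength GG) q h"
proof -
 obtain gm where g: "gm : set GG" using ne unfolding AE_arclength_iff[OF contours(1)] by blast
 define A where "A = gm ` {1/4..3/4::real}"
 have A: "A : sets (arclength GG)" "emeasure (arclength GG) A < \<infinity>" unfolding A_def by (rule emeasure_compact_arc_finite[OF contours(1) g]; simp)+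
 define h where "h = (%z. indicator A z *\<^sub>R (mat 1 :: complex^'k^'k))"
 have hm: "h : bmeas (arclength GG)" unfolding h_def using A(1) by measurable
 have "(\<integral>\<^sup>+x. ennreal (norm (h x) powr q) \<partial>arclength GG) = (\<integral>\<^sup>+x. ennreal (norm (mat 1 :: complex^'k^'k) powr q) * indicator A x \<partial>arclength GG)"
  using q by (intro nn_integral_cong) (auto simp: h_def split: split_indicator)
 also have "... = ennreal (norm (mat 1 :: complex^'k^'k) powr q) * emeasure (arclength GG) A" using A by (simp add: nn_integral_cmult_indicator)
 also have "... < \<infinity>" using A(2) by (simp add: ennreal_mult_less_top)
 finally have h: "h : Lp (arclength GG) q" using hm by (simp add: Lp_iff)
 moreover have "Lp_norm (arclength GG) q h ~= 0"
 proof
  assume "Lp_norm (arclength GG) q h = 0"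
  from Lp_norm_eq_0[OF h q this] have "AE z in arclength GG. z ~: A"
  proof eventually_elim
  case (elim z)
  have "(mat 1 :: complex^'k^'k) ~= 0" using norm_mat_1_ge[where 'k = 'k] by auto
  then show ?case using elim by (auto simp: h_def)
  qed
  then have "AE t in lebesgue. t : open_unit --> gm t ~: A" unfolding AE_arclength_iff[OF contours(1)] using g by blast
  then obtain N where N: "negligible N" "{t. \<not> (t : open_unit --> gm t ~: A)} <= N" unfolding eventually_ae_filter_negligible by blast
  have "{1/4<..<3/4::real} <= N" using N(2) by (auto simp: A_def)
  then have "negligible {1/4<..<3/4::real}" by (rule negligible_subset[OF N(1)])
  then show False using open_not_negligible[of "{1/4<..<3/4::real}"] by auto
 qed
 ultimately show ?thesis using that[of h] Lp_norm_nonneg[of "arclength GG" q h] by linarith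
qed

text \<open>The second claim bounds the resolvent norm from below: a nonzero h satisfies |h| <= A
  |(1 - C_u) h| <= A 2(1 + K U) |h| in norm, the 2 coming from \<open>Lp_diff\<close>. It also shows
  that the norm cannot be 0.\<close>

lemma resolvent_norm_bounds:
 fixes u :: "complex => complex^'k^'k"
 assumes q: "1 < q" and u: "(%s. u s - mat 1) : bmeas (arclength GG)" "AE s in arclength GG. norm (u s - mat 1) <= U" "0 <= U"
  and K: "!!h::complex => complex^'k^'k. h : Lp (arclength GG) q ==> C_mat (-1) h : Lp (arclength GG) q & Lp_norm (arclength GG) q (C_mat (-1) h) <= K * Lp_norm (arclength GG) q h" "0 <= K"
  and ex: "resolvent_exists GG u q" and ne: "\<not> (AE z in arclength GG. False)" and A: "resolvent_norm GG u q <= ennreal A" "0 <= A"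
 shows "!!h. h : Lp (arclength GG) q ==> Lp_norm (arclength GG) q h <= A * Lp_norm (arclength GG) q (%z. h z - C_op GG u h z)"
  and "1 <= A * (2 * (1 + K * U))"
proof -
 have q': "0 < q" "1 <= q" and sg: "(-1::real) = 1 \<or> (-1::real) = -1" using q by simp_all
 have b: "(%s. h s ** (u s - mat 1)) : Lp (arclength GG) q" "Lp_norm (arclength GG) q (%s. h s ** (u s - mat 1)) <= U * Lp_norm (arclength GG) q h"
  if "h : Lp (arclength GG) q" for h :: "complex => complex^'k^'k" by (rule Lp_mult_bounded[OF that q'(1) u])+
 show 1: "Lp_norm (arclength GG) q h <= A * Lp_norm (arclength GG) q (%z. h z - C_op GG u h z)" if h: "h : Lp (arclength GG) q" for h
 proof (rule Lp_inverse_bound[OF ex[unfolded resolvent_exists_def] q'(1) _ A(1)[unfolded resolvent_norm_def] A(2) h])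
  fix h :: "complex => complex^'k^'k" and c :: real assume h: "h : Lp (arclength GG) q"
  show "AE x in arclength GG. c *\<^sub>R h x - C_op GG u (%x. c *\<^sub>R h x) x = c *\<^sub>R (h x - C_op GG u h x)"
  using C_mat_scaleR[OF b(1)[OF h] q'(2) sg, of c] by eventually_elim (simp add: C_op_def matrix_mult_scaleR scaleR_diff_right)
 qed
 obtain h :: "complex => complex^'k^'k" where h: "h : Lp (arclength GG) q" "0 < Lp_norm (arclength GG) q h" using nonzero_Lp[OF ne q'(1)] .
 let ?n = "Lp_norm (arclength GG) q h"
 note C = K(1)[OF b(1)[OF h(1)]]
 have "Lp_norm (arclength GG) q (%z. h z - C_op GG u h z) <= 2 * (?n + Lp_norm (arclength GG) q (C_mat (-1) (%s. h s ** (u s - mat 1))))"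
  unfolding C_op_def by (rule Lp_diff(2)[OF h(1) conjunct1[OF C] q'(2)])
 also have "... <= 2 * (?n + K * (U * ?n))" using conjunct2[OF C] mult_left_mono[OF b(2)[OF h(1)] K(2)] by argo
 finally have "A * Lp_norm (arclength GG) q (%z. h z - C_op GG u h z) <= A * (2 * (?n + K * (U * ?n)))" by (rule mult_left_mono[OF _ A(2)])
 with 1[OF h(1)] have "1 * ?n <= (A * (2 * (1 + K * U))) * ?n" by (simp add: algebra_simps)
 then show "1 <= A * (2 * (1 + K * U))" using h(2) by (rule mult_right_le_imp_le)
qed

end

lemma jump_size_bounds:
 assumes "jump_matrix GG v"
 shows "AE z in arclength GG. norm (v z) <= jump_size GG v" "AE z in arclength GG. norm (matrix_inv (v z)) <= jump_size GG v" "0 <= jump_size GG v"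
proof -
 have L: "v : Linf (arclength GG)" "(%z. matrix_inv (v z)) : Linf (arclength GG)" using assms by (auto simp: jump_matrix_def)
 show "AE z in arclength GG. norm (v z) <= jump_size GG v" using Linf_bound[OF L(1)] by eventually_elim (simp add: jump_size_def)
 show "AE z in arclength GG. norm (matrix_inv (v z)) <= jump_size GG v" using Linf_bound[OF L(2)] by eventually_elim (simp add: jump_size_def)
 have "0 <= Linf_norm (arclength GG) v" using L(1) by (intro Linf_norm_nonneg) (simp add: Linf_def)
 then show "0 <= jump_size GG v" by (simp add: jump_size_def)
qed

text \<open>At almost every point the identity, of Frobenius norm at least 1, is the product of the
  jump matrix and its inverse, so both cannot have norm below 1. On a null contour there is no such
  point.\<close>

lemma jump_size_ge_1:
 assumes v: "jump_matrix GG v" and ne: "\<not> (AE z in arclength GG. False)"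
 shows "1 <= jump_size GG v"
proof (rule ccontr)
 assume n: "\<not> 1 <= jump_size GG v"
 have "AE z in arclength GG. invertible (v z)" using v by (simp add: jump_matrix_def)
 with jump_size_bounds(1,2)[OF v] have "AE z in arclength GG. False"
 proof eventually_elim
  case (elim z)
  have "1 <= norm (v z ** matrix_inv (v z))" unfolding matrix_inv_inverse[OF elim(3)] by (rule norm_mat_1_ge)
  also have "... <= norm (v z) * norm (matrix_inv (v z))" by (rule norm_matrix_mult)
  also have "... <= jump_size GG v * jump_size GG v" using elim(1,2) jump_size_bounds(3)[OF v] by (intro mult_mono) auto
  also have "... <= 1 * jump_size GG v" using n jump_size_bounds(3)[OF v] by (intro mult_right_mono) auto
  finally show ?case using n by simp
 qed
 with ne show False by blast
qed

lemma resolvent_lower_bound_arith: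
 fixes K E A V V0 :: real
 assumes "1 <= K" "1 <= E" "0 <= A" "V <= E * V0" "1 <= V0" "1 <= A * (2 * (1 + K * V))"
 shows "1 <= 4 * K * E * (A * V0)"
proof -
 define x where "x = K * (E * V0)"
 have "1 * (1 * 1) <= K * (E * V0)" using assms by (intro mult_mono) auto
 then have 1: "1 <= x" by (simp add: x_def)
 have "K * V <= x" unfolding x_def using assms by (intro mult_left_mono) auto
 with 1 have "2 * (1 + K * V) <= 4 * x" by argo
 then have "2 * (1 + K * V) <= 4 * (K * (E * V0))" by (simp only: x_def)
 then have "A * (2 * (1 + K * V)) <= A * (4 * (K * (E * V0)))" using assms(3) by (rule mult_left_mono)
 with assms(6) show ?thesis by (simp add: mult_ac)
qed

text \<open>In extended reals 0 times infinity is 0, so an infinite resolvent norm makes the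
  right-hand side infinite only when the other factors are nonzero.\<close>

lemma ennreal_product_eq_top:
 fixes a b c d e f g x y z :: ennreal
 assumes "a ~= 0" "b ~= 0" "c ~= 0" "d ~= 0" "e ~= 0" "f ~= 0" "g ~= 0" "x ~= 0" "y ~= 0" "z ~= 0" "x = top \<or> y = top \<or> z = top"
 shows "a * b * c * x * y * z^2 * d * e * f * g = top"
 using assms by (auto simp: ennreal_mult_eq_top_iff power2_eq_square)

section \<open>Assembly of the estimate\<close>

context contour_pair
begin

text \<open>E = 1 + |I| gives |v - I| <= E times the jump size once the latter is at least 1. D = 4
  K E then comes from 2(1 + K E x) <= 4 K E x for x >= 1, the form in which a resolvent norm is
  bounded below.\<close>

lemma resolvent_estimate:
 fixes v w R :: "complex => complex^'k^'k" and K p :: real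
 defines "E \<equiv> 1 + norm (mat 1 :: complex^'k^'k)"
 defines "D \<equiv> 4 * K * E"
 assumes p: "2 < p" and K: "1 <= K"
  and K1: "!!h::complex => complex^'k^'k. h : L2 GG ==> C_mat (-1) h : L2 GG & N2 GG (C_mat (-1) h) <= K * N2 GG h"
  and K2: "!!h::complex => complex^'k^'k. h : Lp (arclength GG) p ==> C_mat (-1) h : Lp (arclength GG) p & Lp_norm (arclength GG) p (C_mat (-1) h) <= K * Lp_norm (arclength GG) p h"
  and K3: "!!h::complex => complex^'k^'k. h : L2 GG ==> cauchy_mat GG h : Lp (arclength GG') 2 & Lp_norm (arclength GG') 2 (cauchy_mat GG h) <= K * N2 GG h"
  and K4: "!!h::complex => complex^'k^'k. h : Lp (arclength GG') 2 ==> cauchy_mat GG' h : L2 GG & cauchy_mat GG' h : Lp (arclength GG) p &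
  Lp_norm (arclength GG) p (cauchy_mat GG' h) <= K * Lp_norm (arclength GG') 2 h"
  and R: "bounded_analytic_on R (- contour_set Sg)" and Ri: "ALL z:- contour_set Sg. invertible (R z)"
  and S: "bounded_analytic_on (%z. matrix_inv (R z)) (- contour_set Sg)"
  and v: "jump_matrix GG v" and w: "jump_matrix GG w"
  and vw: "AE z in arclength GG. v z = matrix_inv (nt_value Sg (-1) R z) ** w z ** nt_value Sg 1 R z"
  and vL: "(%z. v z - mat 1) : L2 GG" and wL: "(%z. w z - mat 1) : L2 GG"
  and ex: "resolvent_exists GG w 2" "resolvent_exists GG w p" "resolvent_exists GG v 2"
 shows "resolvent_exists GG v p"
  "resolvent_norm GG v p <=
  ennreal (2 * (D^2 + (2 * K * E * D + 16 * K^2 * E * D)) * D^2)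
  * ennreal (Linf_norm (lebesgue_on (- contour_set Sg)) R)
  * ennreal (Linf_norm (lebesgue_on (- contour_set Sg)) (%z. matrix_inv (R z)))
  * resolvent_norm GG w p * resolvent_norm GG w 2 * (resolvent_norm GG v 2)^2
  * ennreal (jump_size GG v ^ 3) * ennreal (jump_size GG w ^ 2)
  * ennreal ((1 + N2 GG (%z. w z - mat 1))^2)
  * ennreal ((1 + N2 GG (%z. v z - mat 1))^2)" (is "_ <= ?rhs")
proof -
 define rhR where "rhR = Linf_norm (lebesgue_on (- contour_set Sg)) R"
 define rhS where "rhS = Linf_norm (lebesgue_on (- contour_set Sg)) (%z. matrix_inv (R z))"
 define V0 where "V0 = jump_size GG v"
 define W0 where "W0 = jump_size GG w"
 define V where "V = V0 + norm (mat 1 :: complex^'k^'k)"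
 define W where "W = W0 + norm (mat 1 :: complex^'k^'k)"
 have op: "open (- contour_set Sg)" by (rule open_Compl[OF closed_contour_set])
 have RB: "norm (R z) <= rhR" if "z ~: contour_set Sg" for z unfolding rhR_def using bounded_analytic_le_Linf_norm[OF op R, of z] that by simp
 have SB: "norm (matrix_inv (R z)) <= rhS" if "z ~: contour_set Sg" for z unfolding rhS_def using bounded_analytic_le_Linf_norm[OF op S, of z] that by simp
 have RS: "R z ** matrix_inv (R z) = mat 1" if "z ~: contour_set Sg" for z using Ri that by (simp add: matrix_inv_inverse)
 have "- contour_set Sg ~= {}" using complete_contour_dense[OF kS] by auto
 then obtain z0 where z0: "z0 ~: contour_set Sg" by blast
 have rh: "0 <= rhR" "0 <= rhS" using order.trans[OF norm_ge_zero RB[OF z0]] order.trans[OF norm_ge_zero SB[OF z0]] by simp_all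
 have X: "1 <= rhR * rhS"
 proof -
  have "1 <= norm (R z0 ** matrix_inv (R z0))" unfolding RS[OF z0] by (rule norm_mat_1_ge)
  also have "... <= norm (R z0) * norm (matrix_inv (R z0))" by (rule norm_matrix_mult)
  also have "... <= rhR * rhS" by (rule mult_mono[OF RB[OF z0] SB[OF z0] rh(1)]) simp
  finally show ?thesis .
 qed
 have Rh: "(%z. R z $ i $ j) holomorphic_on - contour_set Sg" and Sh: "(%z. matrix_inv (R z) $ i $ j) holomorphic_on - contour_set Sg" for i j
  using R S by (simp_all add: bounded_analytic_on_def)
 have V: "AE s in arclength GG. norm (v s - mat 1) <= V" "0 <= V"
 proof -
  show "AE s in arclength GG. norm (v s - mat 1) <= V" using jump_size_bounds(1)[OF v]
  proof eventually_elim
  case (elim s)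
  then show ?case unfolding V_def V0_def using norm_triangle_ineq4[of "v s" "mat 1"] by linarith
  qed
  show "0 <= V" using jump_size_bounds(3)[OF v] by (simp add: V_def V0_def)
 qed
 have W: "AE s in arclength GG. norm (w s - mat 1) <= W" "0 <= W"
 proof -
  show "AE s in arclength GG. norm (w s - mat 1) <= W" using jump_size_bounds(1)[OF w]
  proof eventually_elim
  case (elim s)
  then show ?case unfolding W_def W0_def using norm_triangle_ineq4[of "w s" "mat 1"] by linarith
  qed
  show "0 <= W" using jump_size_bounds(3)[OF w] by (simp add: W_def W0_def)
 qed
 have jr: "jump_relation GG GG' v w R (%z. matrix_inv (R z)) V W rhR rhS K p"
  by unfold_locales ((rule p K K1 K2 K3 K4 Rh Sh RB SB rh RS V W vL wL vw ex); assumption)+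
 show "resolvent_exists GG v p" by (rule jump_relation.resolvent_transfer(1)[OF jr])
 show "resolvent_norm GG v p <= ?rhs"
 proof (cases "AE z in arclength GG. False")
  case True
  \<comment> \<open>If the contour is null, all Lp norms are 0, and so is the resolvent norm. This
    case is separate because the lower bounds of the factors fail here.\<close>
  have 0: "Lp_norm (arclength GG) p f = 0" for f :: "complex => complex^'k^'k"
  proof -
  have "(\<integral>x. norm (f x) powr p \<partial>arclength GG) = 0" by (rule integral_eq_zero_AE) (use True in eventually_elim, simp)
  then show ?thesis by (simp add: Lp_norm_def)
  qed
  have "resolvent_norm GG v p <= 0" unfolding resolvent_norm_def Lp_opnorm_def by (rule SUP_least) (simp add: 0)
  then show ?thesis by simp
 next
  case ne: False
  have V1: "1 <= V0" "1 <= W0" unfolding V0_def W0_def by (rule jump_size_ge_1[OF v ne], rule jump_size_ge_1[OF w ne])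
  have E1: "1 <= E" by (simp add: E_def)
  have VE: "V <= E * V0" "W <= E * W0"
  unfolding V_def W_def E_def using mult_left_mono[OF V1(1), of "norm (mat 1 :: complex^'k^'k)"] mult_left_mono[OF V1(2), of "norm (mat 1 :: complex^'k^'k)"]
  by (simp_all add: algebra_simps)
  have K0: "0 <= K" and q: "(1::real) < 2" "1 < p" using K p by simp_all
  note vm = Lp_measurable[OF vL] and wm = Lp_measurable[OF wL]
  note v2 = resolvent_norm_bounds[OF q(1) vm V K1 K0 ex(3) ne]
  note w2 = resolvent_norm_bounds[OF q(1) wm W K1 K0 ex(1) ne]
  note wp = resolvent_norm_bounds[OF q(2) wm W K2 K0 ex(2) ne]
  \<comment> \<open>With A = 0 the lower bound of \<open>resolvent_norm_bounds\<close> would read 1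
    <= 0.\<close>
  have n0: "resolvent_norm GG v 2 ~= 0" "resolvent_norm GG w 2 ~= 0" "resolvent_norm GG w p ~= 0"
  using v2(2)[of 0] w2(2)[of 0] wp(2)[of 0] by auto
  have DK: "1 <= D" using mult_mono[OF K E1] K by (simp add: D_def)
  have c0: "0 < 2 * (D^2 + (2 * K * E * D + 16 * K^2 * E * D)) * D^2" (is "0 < ?c")
  using DK K E1 by (intro mult_pos_pos add_pos_nonneg mult_nonneg_nonneg) auto
  have rh0: "0 < rhR" "0 < rhS" using X rh by (auto simp: less_le)
  let ?nv = "N2 GG (%z. v z - mat 1)" and ?nw = "N2 GG (%z. w z - mat 1)"
  have nn: "0 < (1 + ?nw)^2" "0 < (1 + ?nv)^2"
  by (rule zero_less_power, rule add_pos_nonneg, simp, simp)+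
  have V3: "0 < V0 ^ 3" "0 < W0 ^ 2" using V1 by simp_all
  have rhs: "?rhs = ennreal ?c * ennreal rhR * ennreal rhS * resolvent_norm GG w p * resolvent_norm GG w 2 * (resolvent_norm GG v 2)^2
  * ennreal (V0 ^ 3) * ennreal (W0 ^ 2) * ennreal ((1 + ?nw)^2) * ennreal ((1 + ?nv)^2)"
  by (simp only: rhR_def rhS_def V0_def W0_def)
  have pos: "ennreal ?c ~= 0" "ennreal rhR ~= 0" "ennreal rhS ~= 0" "ennreal (V0 ^ 3) ~= 0" "ennreal (W0 ^ 2) ~= 0" "ennreal ((1 + ?nw)^2) ~= 0" "ennreal ((1 + ?nv)^2) ~= 0"
  using c0 rh0 V3 nn by (simp_all only: ennreal_eq_0_iff not_le)
  show ?thesis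
  proof (cases "resolvent_norm GG w p = \<infinity> \<or> resolvent_norm GG w 2 = \<infinity> \<or> resolvent_norm GG v 2 = \<infinity>")
  case True
  have "?rhs = top" unfolding rhs
  by (rule ennreal_product_eq_top) (use True pos n0 in simp_all)
  then show ?thesis by simp
  next
  case False
  then obtain Av Aw Bw where N: "resolvent_norm GG v 2 = ennreal Av" "0 <= Av" "resolvent_norm GG w 2 = ennreal Aw" "0 <= Aw" "resolvent_norm GG w p = ennreal Bw" "0 <= Bw"
  by (cases "resolvent_norm GG v 2"; cases "resolvent_norm GG w 2"; cases "resolvent_norm GG w p") auto
  have "resolvent_norm GG v p <= ennreal (2 * (1 + rhR * (Bw * (2 * (K * (rhS * V) + K * (2 * rhS * (K * (2 * ((?nv + V) + V * (Av * (K * (?nv + V)))))))))))) "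
  by (rule jump_relation.resolvent_transfer(2)[OF jr N(2) v2(1) N(6) wp(1)]) (simp_all add: N)
  also have "... <= ennreal (?c * rhR * rhS * Bw * Aw * Av^2 * V0 ^ 3 * W0^2 * (1 + ?nw)^2 * (1 + ?nv)^2)"
  proof (rule ennreal_leI, rule resolvent_bound_arith[OF K E1 _ V1 V(2) VE(1) X])
  show "1 <= D * (Av * V0)" unfolding D_def by (rule resolvent_lower_bound_arith[OF K E1 N(2) VE(1) V1(1)]) (rule v2(2); simp add: N)
  show "1 <= D * (Aw * W0)" unfolding D_def by (rule resolvent_lower_bound_arith[OF K E1 N(4) VE(2) V1(2)]) (rule w2(2); simp add: N)
  show "1 <= D * (Bw * W0)" unfolding D_def by (rule resolvent_lower_bound_arith[OF K E1 N(6) VE(2) V1(2)]) (rule wp(2); simp add: N)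
  qed (simp_all add: N D_def)
  also have "... = ?rhs"
  unfolding rhs unfolding N(1,3,5) ennreal_power[OF N(2)]
  using N(2,4,6) rh V1 by (simp add: ennreal_mult'')
  finally show ?thesis .
  qed
 qed
qed

end

theorem mainTheorem1:
  fixes p :: real and \<Gamma> \<Gamma>' :: contour
  assumes "2 < p"
    and "cauchy_contour \<Gamma>" "cauchy_contour \<Gamma>'" "cauchy_contour (\<Gamma> @ \<Gamma>')"
    and "complete_contour \<Gamma>" "complete_contour (\<Gamma> @ \<Gamma>')"
    and "\<exists>d>0. \<forall>x\<in>contour_set \<Gamma>. \<forall>y\<in>contour_set \<Gamma>'. d \<le> dist x y"
    and "cauchy_bounded_across \<Gamma> \<Gamma>'" "cauchy_bounded_across \<Gamma>' \<Gamma>"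
  shows "\<exists>c::real. c > 0 \<and>
    (\<forall>(v :: complex \<Rightarrow> complex^'k^'k) (w :: complex \<Rightarrow> complex^'k^'k) (R :: complex \<Rightarrow> complex^'k^'k).
       bounded_analytic_on R (- contour_set (\<Gamma> @ \<Gamma>')) \<and>
       (\<forall>z\<in>- contour_set (\<Gamma> @ \<Gamma>'). invertible (R z)) \<and>
       bounded_analytic_on (\<lambda>z. matrix_inv (R z)) (- contour_set (\<Gamma> @ \<Gamma>')) \<and>
       jump_matrix \<Gamma> v \<and> jump_matrix \<Gamma> w \<and>
       (AE z in arclength \<Gamma>.
          v z = matrix_inv (nt_value (\<Gamma> @ \<Gamma>') (-1) R z) ** w z ** nt_value (\<Gamma> @ \<Gamma>') 1 R z) \<and>
       (\<lambda>z. v z - mat 1) \<in> Lp (arclength \<Gamma>) 2 \<and>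
       (\<lambda>z. w z - mat 1) \<in> Lp (arclength \<Gamma>) 2 \<and>
       resolvent_exists \<Gamma> w 2 \<and> resolvent_exists \<Gamma> w p \<and> resolvent_exists \<Gamma> v 2
       \<longrightarrow>
       resolvent_exists \<Gamma> v p \<and>
       resolvent_norm \<Gamma> v p \<le>
         ennreal c
         * ennreal (Linf_norm (lebesgue_on (- contour_set (\<Gamma> @ \<Gamma>'))) R)
         * ennreal (Linf_norm (lebesgue_on (- contour_set (\<Gamma> @ \<Gamma>'))) (\<lambda>z. matrix_inv (R z)))
         * resolvent_norm \<Gamma> w p * resolvent_norm \<Gamma> w 2 * (resolvent_norm \<Gamma> v 2)\<^sup>2
         * ennreal (jump_size \<Gamma> v ^ 3) * ennreal (jump_size \<Gamma> w ^ 2)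
         * ennreal ((1 + Lp_norm (arclength \<Gamma>) 2 (\<lambda>z. w z - mat 1))\<^sup>2)
         * ennreal ((1 + Lp_norm (arclength \<Gamma>) 2 (\<lambda>z. v z - mat 1))\<^sup>2))"
proof -
 interpret contour_pair \<Gamma> \<Gamma>' by unfold_locales (rule assms)+
 have q: "(1::real) < 2" "1 < p" and sg: "(-1::real) = 1 \<or> (-1::real) = -1" using \<open>2 < p\<close> by simp_all
 obtain Ka where Ka: "Ka >= 0" "ALL h::complex => complex^'k^'k. h : Lp (arclength \<Gamma>) 2 --> C_mat (-1) h : Lp (arclength \<Gamma>) 2 & Lp_norm (arclength \<Gamma>) 2 (C_mat (-1) h) <= Ka * Lp_norm (arclength \<Gamma>) 2 h"
  using C_mat_bounded[OF q(1) sg, where 'k = 'k] by blast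
 obtain Kb where Kb: "Kb >= 0" "ALL h::complex => complex^'k^'k. h : Lp (arclength \<Gamma>) p --> C_mat (-1) h : Lp (arclength \<Gamma>) p & Lp_norm (arclength \<Gamma>) p (C_mat (-1) h) <= Kb * Lp_norm (arclength \<Gamma>) p h"
  using C_mat_bounded[OF q(2) sg, where 'k = 'k] by blast
 obtain Kc where Kc: "Kc >= 0" "ALL h::complex => complex^'k^'k. h : Lp (arclength \<Gamma>) 2 --> cauchy_mat \<Gamma> h : Lp (arclength \<Gamma>') 2 & Lp_norm (arclength \<Gamma>') 2 (cauchy_mat \<Gamma> h) <= Kc * Lp_norm (arclength \<Gamma>) 2 h"
  using across_mat_bounded[where 'k = 'k] by blast
 obtain Kd where Kd: "Kd >= 0" "ALL h::complex => complex^'k^'k. h : Lp (arclength \<Gamma>') 2 --> cauchy_mat \<Gamma>' h : Lp (arclength \<Gamma>) 2 & cauchy_mat \<Gamma>' h : Lp (arclength \<Gamma>) p &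
  Lp_norm (arclength \<Gamma>) p (cauchy_mat \<Gamma>' h) <= Kd * Lp_norm (arclength \<Gamma>') 2 h"
  using across_mat_bounded'[OF \<open>2 < p\<close>, where 'k = 'k] by blast
 \<comment> \<open>A common bound for the four operators, with 1 added to have K >= 1. It is fixed
   before the jump matrices and R, so the constant c depends only on p, the matrix size and the
   contours.\<close>
 define K where "K = 1 + Ka + Kb + Kc + Kd"
 have K: "1 <= K" "Ka <= K" "Kb <= K" "Kc <= K" "Kd <= K" using Ka(1) Kb(1) Kc(1) Kd(1) by (simp_all add: K_def)
 have le: "x <= K * y" if "x <= L * y" "L <= K" "0 <= y" for x y L :: real using mult_right_mono[OF that(2,3)] that(1) by linarith
 have K': "C_mat (-1) h : Lp (arclength \<Gamma>) 2 & Lp_norm (arclength \<Gamma>) 2 (C_mat (-1) h) <= K * Lp_norm (arclength \<Gamma>) 2 h"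
  "cauchy_mat \<Gamma> h : Lp (arclength \<Gamma>') 2 & Lp_norm (arclength \<Gamma>') 2 (cauchy_mat \<Gamma> h) <= K * Lp_norm (arclength \<Gamma>) 2 h"
  if "h : Lp (arclength \<Gamma>) 2" for h :: "complex => complex^'k^'k"
  using Ka(2)[rule_format, OF that] Kc(2)[rule_format, OF that] le[OF _ K(2) Lp_norm_nonneg] le[OF _ K(4) Lp_norm_nonneg] by auto
 have Kp: "C_mat (-1) h : Lp (arclength \<Gamma>) p & Lp_norm (arclength \<Gamma>) p (C_mat (-1) h) <= K * Lp_norm (arclength \<Gamma>) p h"
  if "h : Lp (arclength \<Gamma>) p" for h :: "complex => complex^'k^'k"
  using Kb(2)[rule_format, OF that] le[OF _ K(3) Lp_norm_nonneg] by auto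
 have Kx: "cauchy_mat \<Gamma>' h : Lp (arclength \<Gamma>) 2 & cauchy_mat \<Gamma>' h : Lp (arclength \<Gamma>) p & Lp_norm (arclength \<Gamma>) p (cauchy_mat \<Gamma>' h) <= K * Lp_norm (arclength \<Gamma>') 2 h"
  if "h : Lp (arclength \<Gamma>') 2" for h :: "complex => complex^'k^'k"
  using Kd(2)[rule_format, OF that] le[OF _ K(5) Lp_norm_nonneg] by auto
 define E where "E = 1 + norm (mat 1 :: complex^'k^'k)"
 define D where "D = 4 * K * E"
 define c where "c = 2 * (D^2 + (2 * K * E * D + 16 * K^2 * E * D)) * D^2"
 have E1: "1 <= E" by (simp add: E_def)
 have D1: "1 <= D" using mult_mono[OF K(1) E1] K(1) by (simp add: D_def)
 have c: "c > 0" unfolding c_def using D1 K(1) E1 by (intro mult_pos_pos add_pos_nonneg mult_nonneg_nonneg) auto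
 show ?thesis
 proof (rule exI[of _ c], rule conjI[OF c], intro allI impI)
  fix v w R :: "complex => complex^'k^'k"
  assume H: "
  bounded_analytic_on R (- contour_set (\<Gamma> @ \<Gamma>')) &
  (ALL z:- contour_set (\<Gamma> @ \<Gamma>'). invertible (R z)) &
  bounded_analytic_on (%z. matrix_inv (R z)) (- contour_set (\<Gamma> @ \<Gamma>')) &
  jump_matrix \<Gamma> v & jump_matrix \<Gamma> w &
  (AE z in arclength \<Gamma>.
  v z = matrix_inv (nt_value (\<Gamma> @ \<Gamma>') (-1) R z) ** w z ** nt_value (\<Gamma> @ \<Gamma>') 1 R z) &
  (%z. v z - mat 1) : Lp (arclength \<Gamma>) 2 &
  (%z. w z - mat 1) : Lp (arclength \<Gamma>) 2 &
  resolvent_exists \<Gamma> w 2 & resolvent_exists \<Gamma> w p & resolvent_exists \<Gamma> v 2"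
  then have R: "bounded_analytic_on R (- contour_set Sg)" and Ri: "ALL z:- contour_set Sg. invertible (R z)"
  and S: "bounded_analytic_on (%z. matrix_inv (R z)) (- contour_set Sg)" and v: "jump_matrix \<Gamma> v" and w: "jump_matrix \<Gamma> w"
  and vw: "AE z in arclength \<Gamma>. v z = matrix_inv (nt_value Sg (-1) R z) ** w z ** nt_value Sg 1 R z"
  and vL: "(%z. v z - mat 1) : Lp (arclength \<Gamma>) 2" and wL: "(%z. w z - mat 1) : Lp (arclength \<Gamma>) 2"
  and ex: "resolvent_exists \<Gamma> w 2" "resolvent_exists \<Gamma> w p" "resolvent_exists \<Gamma> v 2" by blast+
  note est = resolvent_estimate[OF \<open>2 < p\<close> K(1) K'(1) Kp K'(2) Kx R Ri S v w vw vL wL ex, folded E_def, folded D_def, folded c_def]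
  show "resolvent_exists \<Gamma> v p &
  resolvent_norm \<Gamma> v p <=
  ennreal c
  * ennreal (Linf_norm (lebesgue_on (- contour_set (\<Gamma> @ \<Gamma>'))) R)
  * ennreal (Linf_norm (lebesgue_on (- contour_set (\<Gamma> @ \<Gamma>'))) (%z. matrix_inv (R z)))
  * resolvent_norm \<Gamma> w p * resolvent_norm \<Gamma> w 2 * (resolvent_norm \<Gamma> v 2)^2
  * ennreal (jump_size \<Gamma> v ^ 3) * ennreal (jump_size \<Gamma> w ^ 2)
  * ennreal ((1 + Lp_norm (arclength \<Gamma>) 2 (%z. w z - mat 1))^2)
  * ennreal ((1 + Lp_norm (arclength \<Gamma>) 2 (%z. v z - mat 1))^2)"
  by (rule conjI[OF est])
 qed
qed

end
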